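(* Let $K$ be a field, $u_1,\dots,u_\ell\in K$, and suppose that the degenerate cyclotomic Hecke algebra $H_{\ell,n}(\mathbf u)$ over $K$ is semisimple. Let $\lambda\in\mathscr P_n$ and $\mathfrak s,\mathfrak t\in\mathrm{Std}(\lambda)$. Then $\mathrm g_{\mathfrak s\mathfrak t}=a_{\mathfrak s\mathfrak t}\,\mathrm f_{\mathfrak s\mathfrak t}$ with $a_{\mathfrak s\mathfrak t}\in K^\times$ given by $$a_{\mathfrak s\mathfrak t}=(-1)^{-\ell(d(\mathfrak s'))-\ell(d(\mathfrak t'))}\,\frac{r_{\mathfrak t_\lambda}\,r'_{\mathfrak t^{\lambda'}}}{r_{\mathfrak s}\,r_{\mathfrak t}}=(-1)^{\ell(d(\mathfrak s'))+\ell(d(\mathfrak t'))}\,\frac{r'_{\mathfrak s'}\,r'_{\mathfrak t'}}{r_{\mathfrak t_\lambda}\,r'_{\mathfrak t^{\lambda'}}}.$$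
   Context: **Combinatorics.** $\ell,n\ge 1$ are integers. A multipartition of $n$ is an $\ell$-tuple $\lambda=(\lambda^{(1)},\dots,\lambda^{(\ell)})$ of partitions whose sizes sum to $n$; $\mathscr P_n$ is the set of these. Its diagram is $[\lambda]=\{(i,j,c):1\le c\le \ell,\ 1\le j\le \lambda^{(c)}_i\}$. A $\lambda$-tableau is a bijection $\mathfrak t:[\lambda]\to\{1,\dots,n\}$, written $\mathfrak t=(\mathfrak t^{(1)},\dots,\mathfrak t^{(\ell)})$; it is standard if in every component entries increase along rows and down columns; $\mathrm{Std}(\lambda)$ is the set of standard $\lambda$-tableaux. Conjugates: $\lambda'=(\lambda^{(\ell)\prime},\dots,\lambda^{(1)\prime})$ and $\mathfrak t'=(\mathfrak t^{(\ell)\prime},\dots,\mathfrak t^{(1)\prime})\in\mathrm{Std}(\lambda')$, where on single components the prime is transposition. Dominance: $\lambda\unrhd\mu$ if $\sum_{t<s}|\lambda^{(t)}|+\sum_{j\le i}\lambda^{(s)}_j\ge\sum_{t<s}|\mu^{(t)}|+\sum_{j\le i}\mu^{(s)}_j$ for all $1\le s\le \ell$, $i\ge 1$; for standard tableaux $\mathfrak s\unrhd\mathfrak t$ if for every $k$ the shape of the subtableau of $\mathfrak s$ with entries $1,\dots,k$ dominates that of $\mathfrak t$; $\rhd$ means $\unrhd$ and $\ne$. $\mathfrak t^\lambda$ is the standard $\lambda$-tableau with $1,\dots,n$ entered in order along the rows of component 1, then the rows of component 2, etc.; $\mathfrak t_\lambda:=(\mathfrak t^{\lambda'})'$. $\mathfrak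 S_n$ acts from the right on tableaux by permuting entries (permutations are composed left to right); $s_i=(i,i+1)$; $\ell(w)$ is the length of $w\in\mathfrak S_n$; $d(\mathfrak t),d'(\mathfrak t)\in\mathfrak S_n$ are defined by $\mathfrak t^\lambda d(\mathfrak t)=\mathfrak t$ and $\mathfrak t_\lambda d'(\mathfrak t)=\mathfrak t$. $\mathfrak S_\lambda$ is the standard Young subgroup of $\lambda$ (the row stabiliser of $\mathfrak t^\lambda$). **Algebra.** $H_{\ell,n}(\mathbf u)$, $\mathbf u=(u_1,\dots,u_\ell)$, is the unital associative $K$-algebra with generators $s_1,\dots,s_{n-1},L_1,\dots,L_n$ and relations $(L_1-u_1)\cdots(L_1-u_\ell)=0$; $s_i^2=1$; $s_is_j=s_js_i$ for $|i-j|>1$; $s_is_{i+1}s_i=s_{i+1}s_is_{i+1}$; $L_iL_k=L_kL_i$; $s_iL_l=L_ls_i$ for $l\ne i,i+1$; $L_{i+1}=s_iL_is_i+s_i$ for $1\le i<n$. Elements of $\mathfrak S_n$ are viewed in $H_{\ell,n}(\mathbf u)$ through the $s_i$. Semisimplicity is equivalent to $n!\prod_{1\le i<j\le\ell,\,|d|<n}(d\cdot 1_K+u_i-u_j)\ne 0$ in $K$, and it implies that for any standard tableaux $\mathfrak s\ne\mathfrak t$ of shapes in $\mathscr P_n$ there is $k$ with $c_{\mathfrak s}(k)\ne c_{\mathfrak t}(k)$, where $c_{\mathfrak t}(k)=j-i+u_c$ if $k$ is in row $i$, column $j$ of $\mathfrak t^{(c)}$. Let $C(k)=\{c_{\mathfrak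 t}(k):\mathfrak t\in\mathrm{Std}(\lambda),\lambda\in\mathscr P_n\}$. **Bases.** For $\mathfrak s,\mathfrak t\in\mathrm{Std}(\lambda)$: $$\mathrm m_{\mathfrak s\mathfrak t}=d(\mathfrak s)^{-1}\Big(\sum_{w\in\mathfrak S_\lambda}w\Big)\Big(\prod_{s=2}^{\ell}\prod_{k=1}^{|\lambda^{(1)}|+\cdots+|\lambda^{(s-1)}|}(L_k-u_s)\Big)d(\mathfrak t),$$ $$\mathrm n_{\mathfrak t_\lambda\mathfrak t_\lambda}=(-1)^{\mathbf n(\lambda)}\Big(\sum_{w\in\mathfrak S_{\lambda'}}(-1)^{\ell(w)}w\Big)\Big(\prod_{s=2}^{\ell}\ \prod_{k=1}^{|\lambda^{(\ell)}|+|\lambda^{(\ell-1)}|+\cdots+|\lambda^{(\ell-s+2)}|}(L_k-u_{\ell-s+1})\Big),\qquad \mathbf n(\lambda)=\sum_{i=1}^\ell(i-1)|\lambda^{(i)}|,$$ $$\mathrm n_{\mathfrak s\mathfrak t}=(-1)^{\ell(d'(\mathfrak s))+\ell(d'(\mathfrak t))}d'(\mathfrak s)^{-1}\,\mathrm n_{\mathfrak t_\lambda\mathfrak t_\lambda}\,d'(\mathfrak t).$$ Put $\mathrm F_{\mathfrak t}=\prod_{k=1}^n\prod_{c\in C(k),\,c\ne c_{\mathfrak t}(k)}\frac{L_k-c}{c_{\mathfrak t}(k)-c}$, $\ \mathrm f_{\mathfrak s\mathfrak t}=\mathrm F_{\mathfrak s}\mathrm m_{\mathfrak s\mathfrak t}\mathrm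 F_{\mathfrak t}$ (seminormal basis) and $\mathrm g_{\mathfrak s\mathfrak t}=\mathrm F_{\mathfrak s}\mathrm n_{\mathfrak s\mathfrak t}\mathrm F_{\mathfrak t}$ (dual seminormal basis). **$r$-coefficients.** The scalars $r_{\mathfrak t}\in K^\times$ are uniquely determined by: (a) $r_{\mathfrak t^\lambda}=\Big(\prod_{c=1}^\ell\prod_{i\ge1}\lambda^{(c)}_i!\Big)\prod_{1\le s<t\le\ell}\prod_{(i,j):\,1\le j\le\lambda^{(s)}_i}(j-i+u_s-u_t)$; (b) if $\mathfrak s=\mathfrak t(i,i+1)\rhd\mathfrak t$ then $\frac{r_{\mathfrak t}}{r_{\mathfrak s}}=\frac{(c_{\mathfrak s}(i)-c_{\mathfrak t}(i)+1)(c_{\mathfrak s}(i)-c_{\mathfrak t}(i)-1)}{(c_{\mathfrak s}(i)-c_{\mathfrak t}(i))^2}$. These formulas exhibit $r_{\mathfrak t}$ as the value at $(u_1,\dots,u_\ell)$ of a rational function $r_{\mathfrak t}(\hat u_1,\dots,\hat u_\ell)$ in indeterminates; $r'_{\mathfrak t}\in K^\times$ is the value at $(u_1,\dots,u_\ell)$ of the rational function obtained from it by the substitution $\hat u_j\mapsto-\hat u_{\ell-j+1}$. *)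

theory Defs
  imports
    "HOL-Algebra.QuotRing"
    "HOL-Combinatorics.Permutations"
    "HOL-Library.Poly_Mapping"
begin

section \<open>Semisimple rings\<close>

definition left_ideal :: "'a set \<Rightarrow> ('a, 'b) ring_scheme \<Rightarrow> bool" where
  "left_ideal I R \<longleftrightarrow>
     additive_subgroup I R \<and> (\<forall>a\<in>carrier R. \<forall>x\<in>I. a \<otimes>\<^bsub>R\<^esub> x \<in> I)"

text \<open>The left regular module is semisimple: each of its submodules is a direct summand.\<close>

definition semisimple_ring :: "('a, 'b) ring_scheme \<Rightarrow> bool" where
  "semisimple_ring R \<longleftrightarrow>
     (\<forall>I. left_ideal I R \<longrightarrow>
        (\<exists>J. left_ideal J R \<and> I \<inter> J = {\<zero>\<^bsub>R\<^esub>} \<and> I <+>\<^bsub>R\<^esub> J = carrier R))"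


section \<open>Multipartitions and tableaux\<close>

text \<open>
  All indices start at 1. A multipartition is the function sending \<open>c\<close> and \<open>i\<close> to the
  length of row \<open>i\<close> of component \<open>c\<close>, with value 0 outside the meaningful indices,
  so that equality of functions is equality of multipartitions.
\<close>

type_synonym mpart = "nat \<Rightarrow> nat \<Rightarrow> nat"

definition comp_size :: "mpart \<Rightarrow> nat \<Rightarrow> nat" where
  "comp_size lam c = (\<Sum>i | lam c i \<noteq> 0. lam c i)"

definition multipartition :: "nat \<Rightarrow> nat \<Rightarrow> mpart \<Rightarrow> bool" where
  "multipartition l n lam \<longleftrightarrow>
     (\<forall>c i. lam c i \<noteq> 0 \<longrightarrow> 1 \<le> c \<and> c \<le> l \<and> 1 \<le> i) \<and>
     (\<forall>c. finite {i. lam c i \<noteq> 0}) \<and>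
     (\<forall>c. \<forall>i\<ge>1. lam c (Suc i) \<le> lam c i) \<and>
     (\<Sum>c=1..l. comp_size lam c) = n"

type_synonym node = "nat \<times> nat \<times> nat" \<comment> \<open>row, column, component\<close>

definition diagram :: "mpart \<Rightarrow> node set" where
  "diagram lam = {(i, j, c). 1 \<le> j \<and> j \<le> lam c i}"

text \<open>A tableau takes the value 0 off its diagram, so it determines its shape.\<close>

type_synonym tableau = "node \<Rightarrow> nat"

definition tableaux :: "nat \<Rightarrow> mpart \<Rightarrow> tableau set" where
  "tableaux n lam =
     {t. bij_betw t (diagram lam) {1..n} \<and> (\<forall>x. x \<notin> diagram lam \<longrightarrow> t x = 0)}"

definition Std :: "nat \<Rightarrow> mpart \<Rightarrow> tableau set" where
  "Std n lam = {t \<in> tableaux n lam.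
     (\<forall>i j j' c. (i, j, c) \<in> diagram lam \<longrightarrow> (i, j', c) \<in> diagram lam \<longrightarrow> j < j' \<longrightarrow>
        t (i, j, c) < t (i, j', c)) \<and>
     (\<forall>i i' j c. (i, j, c) \<in> diagram lam \<longrightarrow> (i', j, c) \<in> diagram lam \<longrightarrow> i < i' \<longrightarrow>
        t (i, j, c) < t (i', j, c))}"

definition conj_mpart :: "nat \<Rightarrow> mpart \<Rightarrow> mpart" where
  "conj_mpart l lam = (\<lambda>c j.
     if 1 \<le> c \<and> c \<le> l \<and> 1 \<le> j then card {i. 1 \<le> i \<and> j \<le> lam (l + 1 - c) i} else 0)"

definition conj_tab :: "nat \<Rightarrow> tableau \<Rightarrow> tableau" where
  "conj_tab l t = (\<lambda>(i, j, c). if 1 \<le> c \<and> c \<le> l then t (j, i, l + 1 - c) else 0)"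

definition dominates :: "nat \<Rightarrow> mpart \<Rightarrow> mpart \<Rightarrow> bool" where
  "dominates l lam mu \<longleftrightarrow>
     (\<forall>s\<in>{1..l}. \<forall>i\<ge>1.
        (\<Sum>c\<in>{1..<s}. comp_size lam c) + (\<Sum>j=1..i. lam s j)
          \<ge> (\<Sum>c\<in>{1..<s}. comp_size mu c) + (\<Sum>j=1..i. mu s j))"

text \<open>The shape of the subtableau with entries \<open>1, \<dots>, k\<close>, given by its row lengths.\<close>

definition shape_upto :: "tableau \<Rightarrow> nat \<Rightarrow> mpart" where
  "shape_upto t k = (\<lambda>c i. card {j. 1 \<le> t (i, j, c) \<and> t (i, j, c) \<le> k})"

definition tab_dominates :: "nat \<Rightarrow> tableau \<Rightarrow> tableau \<Rightarrow> bool" where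
  "tab_dominates l s t \<longleftrightarrow> (\<forall>k. dominates l (shape_upto s k) (shape_upto t k))"

definition tab_sdominates :: "nat \<Rightarrow> tableau \<Rightarrow> tableau \<Rightarrow> bool" where
  "tab_sdominates l s t \<longleftrightarrow> tab_dominates l s t \<and> s \<noteq> t"

definition tab_upper :: "mpart \<Rightarrow> tableau" where \<comment> \<open>\<open>t\<close> with superscript \<open>\<lambda>\<close>\<close>
  "tab_upper lam = (\<lambda>(i, j, c).
     if (i, j, c) \<in> diagram lam
     then (\<Sum>c'\<in>{1..<c}. comp_size lam c') + (\<Sum>i'\<in>{1..<i}. lam c i') + j
     else 0)"

definition tab_lower :: "nat \<Rightarrow> mpart \<Rightarrow> tableau" where \<comment> \<open>\<open>t\<close> with subscript \<open>\<lambda>\<close>\<close>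
  "tab_lower l lam = conj_tab l (tab_upper (conj_mpart l lam))"

definition content :: "(nat \<Rightarrow> 'k::field) \<Rightarrow> tableau \<Rightarrow> nat \<Rightarrow> 'k" where
  "content u t k = (case (THE x. t x = k) of (i, j, c) \<Rightarrow> of_nat j - of_nat i + u c)"

definition contents :: "nat \<Rightarrow> nat \<Rightarrow> (nat \<Rightarrow> 'k::field) \<Rightarrow> nat \<Rightarrow> 'k set" where
  "contents l n u k = {content u t k | t lam. multipartition l n lam \<and> t \<in> Std n lam}"


section \<open>The symmetric group\<close>

text \<open>
  Permutations of \<open>{1..n}\<close> are functions \<open>w\<close> with \<open>w permutes {1..n}\<close>. They act from the
  right and compose left to right: the product \<open>v w\<close> is the function \<open>w \<circ> v\<close>, and the
  tableau \<open>t w\<close> is \<open>w \<circ> t\<close> (which is again 0 off the diagram, as \<open>w\<close> fixes 0).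
\<close>

definition word_perm :: "nat list \<Rightarrow> nat \<Rightarrow> nat" where \<comment> \<open>left-to-right product of the \<open>s\<^sub>i\<close>\<close>
  "word_perm is = fold (\<lambda>i v. transpose i (i + 1) \<circ> v) is id"

definition perm_length :: "nat \<Rightarrow> (nat \<Rightarrow> nat) \<Rightarrow> nat" where
  "perm_length n w =
     (LEAST k. \<exists>is. length is = k \<and> set is \<subseteq> {1..<n} \<and> word_perm is = w)"

definition d_perm :: "nat \<Rightarrow> mpart \<Rightarrow> tableau \<Rightarrow> nat \<Rightarrow> nat" where
  "d_perm n lam t = (THE w. w permutes {1..n} \<and> w \<circ> tab_upper lam = t)"

definition d'_perm :: "nat \<Rightarrow> nat \<Rightarrow> mpart \<Rightarrow> tableau \<Rightarrow> nat \<Rightarrow> nat" where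
  "d'_perm l n lam t = (THE w. w permutes {1..n} \<and> w \<circ> tab_lower l lam = t)"

definition young :: "nat \<Rightarrow> mpart \<Rightarrow> (nat \<Rightarrow> nat) set" where
  "young n lam = {w. w permutes {1..n} \<and>
     (\<forall>(i, j, c)\<in>diagram lam. \<exists>j'. (i, j', c) \<in> diagram lam \<and>
        w (tab_upper lam (i, j, c)) = tab_upper lam (i, j', c))}"


section \<open>The degenerate cyclotomic Hecke algebra\<close>

text \<open>
  Noncommutative polynomials are finitely supported functions from words to \<open>K\<close>; words
  form a monoid under concatenation, written additively to fit the convolution product
  of \<^type>\<open>poly_mapping\<close>.
\<close>

datatype gen = SGen nat | LGen nat

datatype word = Word (letters: "gen list")

instantiation word :: monoid_add
begin

definition zero_word :: word where "0 = Word []"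

definition plus_word :: "word \<Rightarrow> word \<Rightarrow> word" where
  "v + w = Word (letters v @ letters w)"

instance
  by standard (simp_all add: zero_word_def plus_word_def)

end

type_synonym 'k ncpoly = "word \<Rightarrow>\<^sub>0 'k"

definition scal :: "'k::field \<Rightarrow> 'k ncpoly" where
  "scal a = Poly_Mapping.single 0 a"

definition sg :: "nat \<Rightarrow> 'k::field ncpoly" where
  "sg i = Poly_Mapping.single (Word [SGen i]) 1"

definition Lg :: "nat \<Rightarrow> 'k::field ncpoly" where
  "Lg k = Poly_Mapping.single (Word [LGen k]) 1"

definition gens :: "nat \<Rightarrow> gen set" where
  "gens n = SGen ` {1..<n} \<union> LGen ` {1..n}"

definition free_algebra :: "nat \<Rightarrow> 'k::field ncpoly ring" where
  "free_algebra n =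
     \<lparr>carrier = {x. \<forall>w\<in>Poly_Mapping.keys x. set (letters w) \<subseteq> gens n},
      monoid.mult = (*), one = 1, zero = 0, add = (+)\<rparr>"

lemma ring_free_algebra: "ring (free_algebra n :: 'k::field ncpoly ring)"
proof -
  have mult: "a \<in> gens n"
    if "\<forall>w\<in>Poly_Mapping.keys x. set (letters w) \<subseteq> gens n"
      "\<forall>w\<in>Poly_Mapping.keys y. set (letters w) \<subseteq> gens n"
      "w \<in> Poly_Mapping.keys (x * y)" "a \<in> set (letters w)" for x y :: "'k ncpoly" and w a
    using that keys_mult[of x y] by (fastforce simp: plus_word_def)
  have inverse: "\<exists>y. (\<forall>w\<in>Poly_Mapping.keys y. set (letters w) \<subseteq> gens n) \<and> x + y = 0"
    if "\<forall>w\<in>Poly_Mapping.keys x. set (letters w) \<subseteq> gens n" for x :: "'k ncpoly"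
    using that by (intro exI[of _ "- x"]) (auto simp: in_keys_iff)
  show ?thesis
    unfolding free_algebra_def
    by (intro ringI abelian_groupI monoidI)
       (auto simp: algebra_simps zero_word_def intro: mult inverse dest: subsetD[OF keys_add])
qed

text \<open>Elements of the free algebra that become 0; here \<open>x = y\<close> is encoded as \<open>x - y\<close>.\<close>

definition relators :: "nat \<Rightarrow> nat \<Rightarrow> (nat \<Rightarrow> 'k::field) \<Rightarrow> 'k ncpoly set" where
  "relators l n u =
     {\<Prod>j\<leftarrow>[1..<Suc l]. (Lg 1 - scal (u j))} \<union>
     {sg i * sg i - 1 | i. 1 \<le> i \<and> i < n} \<union>
     {sg i * sg j - sg j * sg i | i j.
        1 \<le> i \<and> i < n \<and> 1 \<le> j \<and> j < n \<and> \<bar>int i - int j\<bar> > 1} \<union>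
     {sg i * sg (i + 1) * sg i - sg (i + 1) * sg i * sg (i + 1) | i. 1 \<le> i \<and> i + 1 < n} \<union>
     {Lg i * Lg k - Lg k * Lg i | i k. 1 \<le> i \<and> i \<le> n \<and> 1 \<le> k \<and> k \<le> n} \<union>
     {sg i * Lg k - Lg k * sg i | i k.
        1 \<le> i \<and> i < n \<and> 1 \<le> k \<and> k \<le> n \<and> k \<noteq> i \<and> k \<noteq> i + 1} \<union>
     {Lg (i + 1) - (sg i * Lg i * sg i + sg i) | i. 1 \<le> i \<and> i < n}"

definition hecke_ideal :: "nat \<Rightarrow> nat \<Rightarrow> (nat \<Rightarrow> 'k::field) \<Rightarrow> 'k ncpoly set" where
  "hecke_ideal l n u = genideal (free_algebra n) (relators l n u)"

definition hecke :: "nat \<Rightarrow> nat \<Rightarrow> (nat \<Rightarrow> 'k::field) \<Rightarrow> 'k ncpoly set ring" where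
  "hecke l n u = free_algebra n Quot hecke_ideal l n u"

lemma relators_carrier: "n \<ge> 1 \<Longrightarrow> relators l n u \<subseteq> carrier (free_algebra n)"
proof -
  assume n: "n \<ge> 1"
  interpret ring "free_algebra n :: 'a ncpoly ring" by (rule ring_free_algebra)
  let ?C = "carrier (free_algebra n) :: 'a ncpoly set"
  have add: "x + y \<in> ?C" if "x \<in> ?C" "y \<in> ?C" for x y
    using a_closed[OF that] by (simp add: free_algebra_def)
  have mult: "x * y \<in> ?C" if "x \<in> ?C" "y \<in> ?C" for x y
    using m_closed[OF that] by (simp add: free_algebra_def)
  have uminus: "- x \<in> ?C" if "x \<in> ?C" for x
    using that by (simp add: free_algebra_def in_keys_iff)
  have diff: "x - y \<in> ?C" if "x \<in> ?C" "y \<in> ?C" for x y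
    using add[OF that(1) uminus[OF that(2)]] by simp
  have one: "1 \<in> ?C" using one_closed by (simp add: free_algebra_def)
  have scal: "scal a \<in> ?C" for a
    by (simp add: free_algebra_def scal_def zero_word_def)
  have s: "sg i \<in> ?C" if "1 \<le> i" "i < n" for i
    using that by (simp add: free_algebra_def sg_def gens_def)
  have L: "Lg k \<in> ?C" if "1 \<le> k" "k \<le> n" for k
    using that by (simp add: free_algebra_def Lg_def gens_def)
  have prod: "(\<Prod>j\<leftarrow>js. (Lg 1 - scal (u j))) \<in> ?C" for js
    using n by (induction js) (auto intro!: one mult diff L scal)
  show ?thesis
    unfolding relators_def using prod
    by (auto intro!: add mult diff one s L)
qed

lemma ring_hecke: "n \<ge> 1 \<Longrightarrow> ring (hecke l n u)"
  unfolding hecke_def hecke_ideal_def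
  by (intro ideal.quotient_is_ring ring.genideal_ideal ring_free_algebra relators_carrier)

definition proj :: "nat \<Rightarrow> nat \<Rightarrow> (nat \<Rightarrow> 'k::field) \<Rightarrow> 'k ncpoly \<Rightarrow> 'k ncpoly set" where
  "proj l n u x = hecke_ideal l n u +>\<^bsub>free_algebra n\<^esub> x"

definition hecke_smult ::
  "nat \<Rightarrow> nat \<Rightarrow> (nat \<Rightarrow> 'k::field) \<Rightarrow> 'k \<Rightarrow> 'k ncpoly set \<Rightarrow> 'k ncpoly set" where
  "hecke_smult l n u a h = proj l n u (scal a) \<otimes>\<^bsub>hecke l n u\<^esub> h"


section \<open>Seminormal bases\<close>

text \<open>
  Elements of the Hecke algebra are first written down as noncommutative polynomials and
  then projected. The choices made in the representatives (an expression of \<open>w\<close> as a product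
  of the \<open>s\<^sub>i\<close>, the order of factors involving only the \<open>L\<^sub>k\<close>) do not affect the projection.
\<close>

definition perm_elt :: "nat \<Rightarrow> (nat \<Rightarrow> nat) \<Rightarrow> 'k::field ncpoly" where
  "perm_elt n w =
     (\<Prod>i\<leftarrow>(SOME is. set is \<subseteq> {1..<n} \<and> word_perm is = w). sg i)"

definition set_prod :: "('a \<Rightarrow> 'b::monoid_mult) \<Rightarrow> 'a set \<Rightarrow> 'b" where
  "set_prod f A = (\<Prod>x\<leftarrow>(SOME xs. distinct xs \<and> set xs = A). f x)"

definition m_elt :: "nat \<Rightarrow> nat \<Rightarrow> (nat \<Rightarrow> 'k::field) \<Rightarrow> mpart \<Rightarrow> tableau \<Rightarrow> tableau \<Rightarrow> 'k ncpoly" where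
  "m_elt l n u lam s t =
     perm_elt n (inv_into UNIV (d_perm n lam s)) *
     (\<Sum>w\<in>young n lam. perm_elt n w) *
     (\<Prod>r\<leftarrow>[2..<Suc l]. \<Prod>k\<leftarrow>[1..<Suc (\<Sum>c\<in>{1..<r}. comp_size lam c)]. (Lg k - scal (u r))) *
     perm_elt n (d_perm n lam t)"

definition n_low :: "nat \<Rightarrow> nat \<Rightarrow> (nat \<Rightarrow> 'k::field) \<Rightarrow> mpart \<Rightarrow> 'k ncpoly" where
  "n_low l n u lam =
     (- 1) ^ (\<Sum>i=1..l. (i - 1) * comp_size lam i) *
     (\<Sum>w\<in>young n (conj_mpart l lam). (- 1) ^ perm_length n w * perm_elt n w) *
     (\<Prod>r\<leftarrow>[2..<Suc l]. \<Prod>k\<leftarrow>[1..<Suc (\<Sum>c\<in>{l + 2 - r..l}. comp_size lam c)].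
        (Lg k - scal (u (l + 1 - r))))"

definition n_elt :: "nat \<Rightarrow> nat \<Rightarrow> (nat \<Rightarrow> 'k::field) \<Rightarrow> mpart \<Rightarrow> tableau \<Rightarrow> tableau \<Rightarrow> 'k ncpoly" where
  "n_elt l n u lam s t =
     (- 1) ^ (perm_length n (d'_perm l n lam s) + perm_length n (d'_perm l n lam t)) *
     perm_elt n (inv_into UNIV (d'_perm l n lam s)) * n_low l n u lam * perm_elt n (d'_perm l n lam t)"

definition F_elt :: "nat \<Rightarrow> nat \<Rightarrow> (nat \<Rightarrow> 'k::field) \<Rightarrow> tableau \<Rightarrow> 'k ncpoly" where
  "F_elt l n u t =
     (\<Prod>k\<leftarrow>[1..<Suc n].
        set_prod (\<lambda>c. scal (1 / (content u t k - c)) * (Lg k - scal c))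
          (contents l n u k - {content u t k}))"

definition f_basis ::
  "nat \<Rightarrow> nat \<Rightarrow> (nat \<Rightarrow> 'k::field) \<Rightarrow> mpart \<Rightarrow> tableau \<Rightarrow> tableau \<Rightarrow> 'k ncpoly set" where
  "f_basis l n u lam s t = proj l n u (F_elt l n u s * m_elt l n u lam s t * F_elt l n u t)"

definition g_basis ::
  "nat \<Rightarrow> nat \<Rightarrow> (nat \<Rightarrow> 'k::field) \<Rightarrow> mpart \<Rightarrow> tableau \<Rightarrow> tableau \<Rightarrow> 'k ncpoly set" where
  "g_basis l n u lam s t = proj l n u (F_elt l n u s * n_elt l n u lam s t * F_elt l n u t)"


section \<open>The coefficients r\<close>

definition is_r_family :: "nat \<Rightarrow> nat \<Rightarrow> (nat \<Rightarrow> 'k::field) \<Rightarrow> (tableau \<Rightarrow> 'k) \<Rightarrow> bool" where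
  "is_r_family l n u r \<longleftrightarrow>
     (\<forall>lam. multipartition l n lam \<longrightarrow> (\<forall>t\<in>Std n lam. r t \<noteq> 0)) \<and>
     (\<forall>lam. multipartition l n lam \<longrightarrow>
        r (tab_upper lam) =
          (\<Prod>c=1..l. \<Prod>i | lam c i \<noteq> 0. of_nat (fact (lam c i))) *
          (\<Prod>a=1..l. \<Prod>b\<in>{a<..l}. \<Prod>(i, j)\<in>{(i, j). (i, j, a) \<in> diagram lam}.
             (of_nat j - of_nat i + u a - u b))) \<and>
     (\<forall>lam. multipartition l n lam \<longrightarrow>
        (\<forall>s\<in>Std n lam. \<forall>t\<in>Std n lam. \<forall>i\<in>{1..<n}.
           s = transpose i (i + 1) \<circ> t \<and> tab_sdominates l s t \<longrightarrow>
           r t / r s =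
             (content u s i - content u t i + 1) * (content u s i - content u t i - 1) /
             (content u s i - content u t i)\<^sup>2))"

text \<open>The family is unique on standard tableaux, and only its values there are used.\<close>

definition r_coeff :: "nat \<Rightarrow> nat \<Rightarrow> (nat \<Rightarrow> 'k::field) \<Rightarrow> tableau \<Rightarrow> 'k" where
  "r_coeff l n u = (SOME r. is_r_family l n u r)"

text \<open>
  Substituting \<open>-u\<^sub>l\<^sub>+\<^sub>1\<^sub>-\<^sub>j\<close> for the \<open>j\<close>-th indeterminate in the rational function and then
  evaluating at \<open>u\<close> is the same as evaluating it at the parameters \<open>-u\<^sub>l\<^sub>+\<^sub>1\<^sub>-\<^sub>j\<close>. In the
  semisimple case no denominator vanishes there: the content differences occurring for
  \<open>-u\<^sub>l\<^sub>+\<^sub>1\<^sub>-\<^sub>j\<close> have the form \<open>d + u\<^sub>a - u\<^sub>b\<close> just as for \<open>u\<close>.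
\<close>

definition r'_coeff :: "nat \<Rightarrow> nat \<Rightarrow> (nat \<Rightarrow> 'k::field) \<Rightarrow> tableau \<Rightarrow> 'k" where
  "r'_coeff l n u = r_coeff l n (\<lambda>j. - u (l + 1 - j))"

end

theory Submission
  imports Defs
begin

text \<open>
  Following Okounkov and Vershik, work in any ring satisfying the Hecke relations whose parameters separate the
  contents. A simultaneous eigenvector of \<open>L\<^sub>1, \<dots>, L\<^sub>k\<^sub>-\<^sub>1\<close> whose eigenvalues are the contents along
  a path of Young diagrams is annihilated by the product of \<open>L\<^sub>k - c\<close> over the contents \<open>c\<close> of the addable
  nodes. Hence the \<open>F\<^sub>t\<close> are orthogonal idempotents with sum 1, and \<open>F\<^sub>a s\<^sub>i F\<^sub>b = 0\<close> unless
  \<open>b\<close> is \<open>a\<close> or \<open>a s\<^sub>i\<close>. In \<open>m\<^sub>s\<^sub>t\<close> only the idempotent of the initial tableau survives between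
  the two permutations, so \<open>f\<^sub>s\<^sub>t\<close> is a multiple of \<open>F\<^sub>s s F\<^sub>t\<^sub>0 t F\<^sub>t\<close> for words \<open>s\<close>, \<open>t\<close>
  leading to and from the initial tableau \<open>t\<^sub>0\<close>.

  Replacing \<open>s\<^sub>i\<close>, \<open>L\<^sub>k\<close>, \<open>u\<^sub>j\<close> by \<open>- s\<^sub>i\<close>, \<open>- L\<^sub>k\<close>, \<open>- u\<^sub>l\<^sub>+\<^sub>1\<^sub>-\<^sub>j\<close>
  preserves the relations and turns \<open>m\<close> for the conjugate tableaux into \<open>n\<close>, so \<open>g\<^sub>s\<^sub>t\<close> has the same form
  with the last tableau of the shape in place of the first one. The two are compared through the products of \<open>1 - 1 / \<rho>\<^sup>2\<close>,
  \<open>\<rho>\<close> the difference of contents, over the inversions of a tableau, which are the non-inversions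
  of its conjugate.

  Semisimplicity forces the parameters to separate contents: otherwise the Hecke algebra has a module whose
  quotient by a hyperplane does not split off.
\<close>

section \<open>Words in the symmetric group\<close>

text \<open>No basis and no dimension of the Hecke algebra is at hand, so nothing may rest on linear
  independence or on \<open>F t\<close> being nonzero: every step is an equation in a ring, and only
  scalars are inverted. The generators and their negatives are two presentations inside one ring,
  which replaces an isomorphism between two Hecke algebras.

  The constant comes from closing up loops. Let \<open>\<alpha>a * \<alpha>b\<close> be the product
  from \<open>a\<close> through the initial tableau to \<open>b\<close>, and
  \<open>\<beta>a * \<beta>b\<close> the one through the final tableau. Multiply the former by a
  loop from \<open>a\<close> to the final tableau and back, and by a similar loop at
  \<open>b\<close>. Evaluating these loops gives the scalars of the conjugates of \<open>a\<close>
  and \<open>b\<close>. Regrouping the same factors gives a single loop from the final tableau to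
  the initial one and back, hence the scalar of the final tableau, times
  \<open>\<beta>a * \<beta>b\<close>. The regrouping is exact because the word from the initial to
  the final tableau can be cut at \<open>a\<close> or \<open>b\<close>: the first half reaches no
  other tableau with as many inversions, the second half starts from no other with as few.\<close>

lemma word_perm_append: "word_perm (is @ js) = word_perm js \<circ> word_perm is"
proof -
  have "fold (\<lambda>i v. transpose i (i + 1) \<circ> v) js f = word_perm js \<circ> f" for f
    by (induction js arbitrary: f rule: rev_induct) (simp_all add: word_perm_def comp_assoc)
  then show ?thesis by (simp add: word_perm_def)
qed

lemma word_perm_Nil [simp]: "word_perm [] = id"
  by (simp add: word_perm_def)

lemma word_perm_single [simp]: "word_perm [i] = transpose i (i + 1)"
  by (simp add: word_perm_def)

lemma word_perm_Cons: "word_perm (i # is) = word_perm is \<circ> transpose i (i + 1)"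
  using word_perm_append[of "[i]" "is"] by simp

lemma word_perm_permutes: "set is \<subseteq> {1..<n} \<Longrightarrow> word_perm is permutes {1..n}"
  by (induction "is") (auto simp: word_perm_Cons permutes_id intro!: permutes_compose permutes_swap_id)

lemma word_perm_rev: "word_perm (rev is) \<circ> word_perm is = id" "word_perm is \<circ> word_perm (rev is) = id"
proof -
  have *: "word_perm (rev is) \<circ> word_perm is = id" for "is"
  proof (induction "is")
    case (Cons i "is")
    have "word_perm (rev (i # is)) \<circ> word_perm (i # is) =
        transpose i (i + 1) \<circ> (word_perm (rev is) \<circ> word_perm is) \<circ> transpose i (i + 1)"
      by (simp add: word_perm_append word_perm_Cons comp_assoc)
    then show ?case by (simp add: Cons)
  qed simp
  show "word_perm (rev is) \<circ> word_perm is = id" by (rule *)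
  show "word_perm is \<circ> word_perm (rev is) = id" using *[of "rev is"] by simp
qed

lemma inv_word_perm: "inv_into UNIV (word_perm is) = word_perm (rev is)"
  by (rule inv_unique_comp) (use word_perm_rev in auto)

lemma permutation_word_perm: "permutation (word_perm is)"
proof (induction "is")
  case (Cons i "is")
  then show ?case unfolding word_perm_Cons by (intro permutation_compose permutation_swap_id)
qed simp

lemma sign_word_perm: "sign (word_perm is) = (- 1) ^ length is"
proof (induction "is")
  case (Cons i "is")
  have "sign (word_perm (i # is)) = sign (word_perm is) * sign (transpose i (i + 1))"
    unfolding word_perm_Cons by (intro sign_compose permutation_word_perm permutation_swap_id)
  then show ?case using Cons by (simp add: sign_swap_id)
qed simp

lemma neg_one_power_word:
  assumes "word_perm is = word_perm js"
  shows "(- 1 :: 'r::ring_1) ^ length is = (- 1) ^ length js"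
proof -
  have "(- 1 :: int) ^ length is = (- 1) ^ length js"
    using assms sign_word_perm by metis
  then have "even (length is) = even (length js)"
    by (metis neg_one_even_power neg_one_odd_power one_neq_neg_one)
  then show ?thesis by (metis neg_one_even_power neg_one_odd_power)
qed

text \<open>A shortest word and the given one both compute the sign of the permutation, so signs can
  be read off from any word.\<close>

lemma perm_length_word:
  assumes "set is \<subseteq> {1..<n}" "word_perm is = w"
  shows "(- 1 :: 'r::ring_1) ^ perm_length n w = (- 1) ^ length is"
proof -
  have "\<exists>js. length js = perm_length n w \<and> set js \<subseteq> {1..<n} \<and> word_perm js = w"
    unfolding perm_length_def by (rule LeastI[of _ "length is"]) (use assms in auto)
  then show ?thesis using neg_one_power_word assms(2) by metis
qed

text \<open>The word with letters \<open>m - 1\<close>, ..., \<open>j\<close> is a cycle. For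
  \<open>j\<close> from 1 to \<open>m\<close> these cycles represent the cosets of the permutations
  fixing \<open>m\<close>, and \<open>j\<close> is recovered as the image of
  \<open>m\<close>.\<close>

lemma word_perm_desc:
  assumes "j \<le> m"
  shows "word_perm (rev [j..<m]) k = (if k = m then j else if j \<le> k \<and> k < m then k + 1 else k)"
  using assms
proof (induction m arbitrary: k)
  case (Suc m)
  show ?case
  proof (cases "j = Suc m")
    case False
    with Suc have "word_perm (rev [j..<m]) k = (if k = m then j else if j \<le> k \<and> k < m then k + 1 else k)" for k
      by auto
    with False Suc.prems show ?thesis
      by (auto simp: word_perm_Cons transpose_def)
  qed auto
qed auto

section \<open>Rewriting words with the Coxeter relations\<close>

inductive weq :: "nat \<Rightarrow> nat list \<Rightarrow> nat list \<Rightarrow> bool" for n where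
  weq_refl: "weq n xs xs"
| weq_trans: "weq n xs ys \<Longrightarrow> weq n ys zs \<Longrightarrow> weq n xs zs"
| weq_sq: "1 \<le> i \<Longrightarrow> i < n \<Longrightarrow> weq n (xs @ [i, i] @ ys) (xs @ ys)"
| weq_swap: "1 \<le> i \<Longrightarrow> i < n \<Longrightarrow> 1 \<le> j \<Longrightarrow> j < n \<Longrightarrow> \<bar>int i - int j\<bar> > 1 \<Longrightarrow>
    weq n (xs @ [i, j] @ ys) (xs @ [j, i] @ ys)"
| weq_braid: "1 \<le> i \<Longrightarrow> i + 1 < n \<Longrightarrow> weq n (xs @ [i + 1, i, i + 1] @ ys) (xs @ [i, i + 1, i] @ ys)"

lemma weq_append_right: "weq n xs ys \<Longrightarrow> weq n (xs @ zs) (ys @ zs)"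
proof (induction rule: weq.induct)
  case (weq_trans xs ys zs)
  then show ?case by (blast intro: weq.weq_trans)
next
  case (weq_sq i xs ys)
  then show ?case using weq.weq_sq[of i n xs "ys @ zs"] by simp
next
  case (weq_swap i j xs ys)
  then show ?case using weq.weq_swap[of i n j xs "ys @ zs"] by simp
next
  case (weq_braid i xs ys)
  then show ?case using weq.weq_braid[of i n xs "ys @ zs"] by simp
qed (rule weq_refl)

lemma weq_move:
  assumes "1 \<le> i" "i < n" "\<forall>k\<in>set ks. 1 \<le> k \<and> k < n \<and> \<bar>int k - int i\<bar> > 1"
  shows "weq n (xs @ ks @ i # ys) (xs @ i # ks @ ys)"
  using assms(3)
proof (induction ks arbitrary: xs)
  case Nil
  show ?case by (simp add: weq_refl)
next
  case (Cons k ks)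
  have "weq n ((xs @ [k]) @ ks @ i # ys) ((xs @ [k]) @ i # ks @ ys)"
    by (rule Cons.IH) (use Cons.prems in auto)
  moreover have "weq n (xs @ [k, i] @ ks @ ys) (xs @ [i, k] @ ks @ ys)"
    by (rule weq_swap) (use assms Cons.prems in auto)
  ultimately show ?case by (auto intro: weq_trans)
qed

text \<open>Append one letter \<open>i\<close> to a normal form. It cancels the end of the
  descending run, prolongs it, commutes past all of it, or travels through it by one braid move and
  comes out on the left as \<open>i - 1\<close>. Squares and braids are applied in one direction
  only, so \<open>weq\<close> is a rewriting relation.\<close>

lemma weq_normal_form:
  assumes "1 \<le> m" "m \<le> n" "set is \<subseteq> {1..<m}"
  shows "\<exists>js j. set js \<subseteq> {1..<m - 1} \<and> 1 \<le> j \<and> j \<le> m \<and> weq n is (js @ rev [j..<m])"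
  using assms(3)
proof (induction "is" rule: rev_induct)
  case Nil
  show ?case by (rule exI[of _ "[]"], rule exI[of _ m]) (use assms in \<open>auto intro: weq_refl\<close>)
next
  case (snoc i "is")
  then obtain js j where js: "set js \<subseteq> {1..<m - 1}" "1 \<le> j" "j \<le> m"
    and w: "weq n is (js @ rev [j..<m])" by auto
  from snoc.prems have i: "1 \<le> i" "i < m" by auto
  have w: "weq n (is @ [i]) (js @ rev [j..<m] @ [i])"
    using weq_append_right[OF w, of "[i]"] by simp
  consider "i = j" | "i + 1 = j" | "i + 1 < j" | "j < i" by linarith
  then show ?case
  proof cases
    case 1
    then have "rev [j..<m] = rev [j + 1..<m] @ [i]"
      using i by (simp add: upt_conv_Cons)
    then have "weq n (js @ rev [j..<m] @ [i]) (js @ rev [j + 1..<m])"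
      using weq_sq[of i n "js @ rev [j + 1..<m]" "[]"] i assms by simp
    with w js i 1 show ?thesis by (intro exI[of _ js] exI[of _ "j + 1"]) (auto intro: weq_trans)
  next
    case 2
    then have "rev [j..<m] @ [i] = rev [i..<m]"
      using i by (simp add: upt_conv_Cons)
    with w js i show ?thesis by (intro exI[of _ js] exI[of _ i]) auto
  next
    case 3
    have "weq n (js @ rev [j..<m] @ i # []) (js @ i # rev [j..<m] @ [])"
      by (rule weq_move) (use 3 i assms in auto)
    with w js i 3 show ?thesis
      by (intro exI[of _ "js @ [i]"] exI[of _ j]) (auto intro: weq_trans)
  next
    case 4
    \<comment> \<open>The run contains \<open>i, i - 1\<close>. The new \<open>i\<close> commutes
      left past the letters below \<open>i - 1\<close>, the braid rule turns
      \<open>i, i - 1, i\<close> into \<open>i - 1, i, i - 1\<close>, and the leading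
      \<open>i - 1\<close> commutes past the letters above \<open>i\<close>.\<close>
    have split: "rev [j..<m] = rev [i + 1..<m] @ [i, i - 1] @ rev [j..<i - 1]"
    proof -
      have "[j..<m] = [j..<i - 1] @ [i - 1..<i + 1] @ [i + 1..<m]"
        using 4 i upt_add_eq_append[of j "i - 1" "m - (i - 1)"] upt_add_eq_append[of "i - 1" "i + 1" "m - (i + 1)"]
        by simp
      moreover have "[i - 1..<i + 1] = [i - 1, i]" using 4 by (simp add: upt_rec)
      ultimately show ?thesis by simp
    qed
    have "weq n ((js @ rev [i + 1..<m] @ [i, i - 1]) @ rev [j..<i - 1] @ i # [])
        ((js @ rev [i + 1..<m] @ [i, i - 1]) @ i # rev [j..<i - 1] @ [])"
      by (rule weq_move) (use 4 i assms js in auto)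
    moreover have "weq n ((js @ rev [i + 1..<m]) @ [(i - 1) + 1, i - 1, (i - 1) + 1] @ rev [j..<i - 1])
        ((js @ rev [i + 1..<m]) @ [i - 1, (i - 1) + 1, i - 1] @ rev [j..<i - 1])"
      by (rule weq_braid) (use 4 i js assms in auto)
    moreover have "weq n (js @ rev [i + 1..<m] @ (i - 1) # [i, i - 1] @ rev [j..<i - 1])
        (js @ (i - 1) # rev [i + 1..<m] @ [i, i - 1] @ rev [j..<i - 1])"
      by (rule weq_move) (use 4 i assms js in auto)
    ultimately have "weq n (js @ rev [j..<m] @ [i]) (js @ (i - 1) # rev [j..<m])"
      using 4 by (auto simp: split intro: weq_trans)
    with w js i 4 show ?thesis
      by (intro exI[of _ "js @ [i - 1]"] exI[of _ j]) (auto intro: weq_trans)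
  qed
qed

lemma weq_word_perm: "weq n xs ys \<Longrightarrow> word_perm xs = word_perm ys"
proof (induction rule: weq.induct)
  case (weq_braid i xs ys)
  have "word_perm [i + 1, i, i + 1] = word_perm [i, i + 1, i]"
    by (auto simp: word_perm_Cons fun_eq_iff transpose_def)
  then show ?case by (simp add: word_perm_append del: append_Cons append_Nil)
next
  case (weq_swap i j xs ys)
  then have "word_perm [i, j] = word_perm [j, i]"
    by (auto simp: word_perm_Cons fun_eq_iff transpose_def)
  then show ?case by (simp add: word_perm_append del: append_Cons append_Nil)
next
  case (weq_sq i xs ys)
  have "word_perm [i, i] = id" by (simp add: word_perm_Cons)
  then show ?case by (simp add: word_perm_append del: append_Cons append_Nil)
qed simp_all

lemma weq_prod_list:
  fixes s :: "nat \<Rightarrow> 'r::monoid_mult"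
  assumes sq: "\<And>i. 1 \<le> i \<Longrightarrow> i < n \<Longrightarrow> s i * s i = 1"
    and swap: "\<And>i j. 1 \<le> i \<Longrightarrow> i < n \<Longrightarrow> 1 \<le> j \<Longrightarrow> j < n \<Longrightarrow> \<bar>int i - int j\<bar> > 1 \<Longrightarrow> s i * s j = s j * s i"
    and braid: "\<And>i. 1 \<le> i \<Longrightarrow> i + 1 < n \<Longrightarrow> s i * s (i + 1) * s i = s (i + 1) * s i * s (i + 1)"
  shows "weq n xs ys \<Longrightarrow> prod_list (map s xs) = prod_list (map s ys)"
proof (induction rule: weq.induct)
  case (weq_braid i xs ys)
  have "s (i + 1) * (s i * (s (i + 1) * z)) = s i * (s (i + 1) * (s i * z))" for z
    using arg_cong[OF braid[OF weq_braid], of "\<lambda>x. x * z"] by (simp add: mult.assoc)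
  then show ?case by simp
next
  case (weq_swap i j xs ys)
  have "s i * (s j * z) = s j * (s i * z)" for z
    using arg_cong[OF swap[OF weq_swap], of "\<lambda>x. x * z"] by (simp add: mult.assoc)
  then show ?case by simp
next
  case (weq_sq i xs ys)
  have "s i * (s i * z) = z" for z
    using arg_cong[OF sq[OF weq_sq], of "\<lambda>x. x * z"] by (simp add: mult.assoc)
  then show ?case by simp
qed simp_all

text \<open>Bring both words to normal form. The image of the top point determines the descending
  run, so the runs agree and cancel, and induction applies to what is left. Hence the image of a
  permutation does not depend on the word that \<open>SOME\<close> picks.\<close>

theorem coxeter_words:
  fixes s :: "nat \<Rightarrow> 'r::monoid_mult"
  assumes rel: "\<And>i. 1 \<le> i \<Longrightarrow> i < n \<Longrightarrow> s i * s i = 1"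
    "\<And>i j. 1 \<le> i \<Longrightarrow> i < n \<Longrightarrow> 1 \<le> j \<Longrightarrow> j < n \<Longrightarrow> \<bar>int i - int j\<bar> > 1 \<Longrightarrow> s i * s j = s j * s i"
    "\<And>i. 1 \<le> i \<Longrightarrow> i + 1 < n \<Longrightarrow> s i * s (i + 1) * s i = s (i + 1) * s i * s (i + 1)"
    and words: "set is \<subseteq> {1..<n}" "set js \<subseteq> {1..<n}" and eq: "word_perm is = word_perm js"
  shows "prod_list (map s is) = prod_list (map s js)"
proof -
  have "prod_list (map s is) = prod_list (map s js)"
    if "m \<le> n" "set is \<subseteq> {1..<m}" "set js \<subseteq> {1..<m}" "word_perm is = word_perm js" for m "is" js
    using that
  proof (induction m arbitrary: "is" js)
    case (Suc m)
    obtain is' i where i: "set is' \<subseteq> {1..<m}" "1 \<le> i" "i \<le> Suc m" "weq n is (is' @ rev [i..<Suc m])"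
      using weq_normal_form[of "Suc m" n "is"] Suc.prems by auto
    obtain js' j where j: "set js' \<subseteq> {1..<m}" "1 \<le> j" "j \<le> Suc m" "weq n js (js' @ rev [j..<Suc m])"
      using weq_normal_form[of "Suc m" n js] Suc.prems by auto
    have fix_top: "word_perm xs (Suc m) = Suc m" if "set xs \<subseteq> {1..<m}" for xs
      using word_perm_permutes[OF that] by (simp add: permutes_not_in)
    have eq: "word_perm (rev [i..<Suc m]) \<circ> word_perm is' = word_perm (rev [j..<Suc m]) \<circ> word_perm js'"
      using weq_word_perm[OF i(4)] weq_word_perm[OF j(4)] Suc.prems(4) word_perm_append by metis
    from fun_cong[OF this, of "Suc m"] fix_top[OF i(1)] fix_top[OF j(1)]
    have "i = j" using i j by (simp add: word_perm_desc del: upt_Suc)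
    with eq have "word_perm ([i..<Suc m]) \<circ> (word_perm (rev [i..<Suc m]) \<circ> word_perm is') =
        word_perm ([i..<Suc m]) \<circ> (word_perm (rev [i..<Suc m]) \<circ> word_perm js')" by simp
    then have "word_perm is' = word_perm js'"
      by (simp add: comp_assoc[symmetric] word_perm_rev del: upt_Suc)
    then have "prod_list (map s is') = prod_list (map s js')"
      using Suc.IH[OF _ i(1) j(1)] Suc.prems(1) by simp
    then show ?case
      using weq_prod_list[of n s, OF rel i(4)] weq_prod_list[of n s, OF rel j(4)] \<open>i = j\<close>
      by (simp del: upt_Suc)
  qed simp
  then show ?thesis using words eq by blast
qed

section \<open>Permutations preserving blocks\<close>

definition block_perms :: "nat \<Rightarrow> (nat \<Rightarrow> 'b) \<Rightarrow> (nat \<Rightarrow> nat) set" where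
  "block_perms m row = {w. w permutes {1..m} \<and> (\<forall>k\<in>{1..m}. row (w k) = row k)}"

text \<open>If blocks are intervals, the image \<open>j\<close> of the top point lies in one block
  with everything between, so the cycle that carries \<open>j\<close> back to the top uses
  reflections inside that block. Stripping it off leaves one point fewer. A constant labelling gives
  the whole symmetric group, the rows of the initial tableau give the Young subgroup.\<close>

lemma block_perms_words:
  assumes "\<And>a b c. 1 \<le> a \<Longrightarrow> a \<le> b \<Longrightarrow> b \<le> c \<Longrightarrow> c \<le> m \<Longrightarrow> row a = row c \<Longrightarrow> row b = row c"
    and "w \<in> block_perms m row"
  shows "\<exists>is. set is \<subseteq> {i. 1 \<le> i \<and> i < m \<and> row i = row (i + 1)} \<and> word_perm is = w"
  using assms
proof (induction m arbitrary: w)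
  case 0
  then have "w = id" by (auto simp: block_perms_def)
  then show ?case by (intro exI[of _ "[]"]) auto
next
  case (Suc m)
  define j where "j = w (Suc m)"
  have w: "w permutes {1..Suc m}" "\<And>k. 1 \<le> k \<Longrightarrow> k \<le> Suc m \<Longrightarrow> row (w k) = row k"
    using Suc.prems(2) by (auto simp: block_perms_def)
  have j: "1 \<le> j" "j \<le> Suc m" "row j = row (Suc m)"
    using permutes_in_image[OF w(1), of "Suc m"] w(2) by (auto simp: j_def)
  have row: "row b = row (Suc m)" if "j \<le> b" "b \<le> Suc m" for b
    using Suc.prems(1)[of j b "Suc m"] that j by simp
  define v where "v = word_perm [j..<Suc m] \<circ> w"
  have wv: "w = word_perm (rev [j..<Suc m]) \<circ> v"
    by (simp add: v_def comp_assoc[symmetric] word_perm_rev del: upt_Suc)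
  have perm: "word_perm [j..<Suc m] permutes {1..Suc m}"
    by (rule word_perm_permutes) (use j in auto)
  then have v: "v permutes {1..Suc m}"
    unfolding v_def by (rule permutes_compose[OF w(1)])
  have vtop: "v (Suc m) = Suc m"
  proof -
    have "word_perm (rev [j..<Suc m]) (Suc m) = j"
      using word_perm_desc[of j "Suc m" "Suc m"] j by simp
    then have "word_perm [j..<Suc m] j = Suc m"
      using fun_cong[OF word_perm_rev(2)[of "[j..<Suc m]"], of "Suc m"] by (simp del: upt_Suc)
    then show ?thesis by (simp add: v_def j_def)
  qed
  have rowp: "row (word_perm (rev [j..<Suc m]) k) = row k" if "1 \<le> k" "k \<le> Suc m" for k
    using word_perm_desc[of j "Suc m" k] j that row[of k] row[of "Suc k"] by auto
  have "v permutes {1..m}"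
  proof (rule permutes_superset[OF v])
    fix x assume "x \<in> {1..Suc m} - {1..m}"
    then have "x = Suc m" by auto
    then show "v x = x" using vtop by simp
  qed
  moreover have "row (v k) = row k" if "1 \<le> k" "k \<le> m" for k
  proof -
    have "1 \<le> v k" "v k \<le> Suc m" using permutes_in_image[OF v, of k] that by auto
    then have "row (v k) = row (w k)" using rowp[of "v k"] wv by simp
    then show ?thesis using w(2) that by simp
  qed
  ultimately have "v \<in> block_perms m row" by (auto simp: block_perms_def)
  moreover have "row b = row c" if "1 \<le> a" "a \<le> b" "b \<le> c" "c \<le> m" "row a = row c" for a b c
    using Suc.prems(1)[of a b c] that by simp
  ultimately obtain js where "set js \<subseteq> {i. 1 \<le> i \<and> i < m \<and> row i = row (i + 1)}" "word_perm js = v"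
    using Suc.IH[of v] by blast
  moreover have "set (rev [j..<Suc m]) \<subseteq> {i. 1 \<le> i \<and> i < Suc m \<and> row i = row (i + 1)}"
  proof
    fix x assume "x \<in> set (rev [j..<Suc m])"
    then have x: "j \<le> x" "x < Suc m" by auto
    then show "x \<in> {i. 1 \<le> i \<and> i < Suc m \<and> row i = row (i + 1)}"
      using row[of x] row[of "x + 1"] j by simp
  qed
  ultimately have "set (js @ rev [j..<Suc m]) \<subseteq> {i. 1 \<le> i \<and> i < Suc m \<and> row i = row (i + 1)}"
    by (auto simp del: upt_Suc)
  moreover have "word_perm (js @ rev [j..<Suc m]) = w"
    using wv \<open>word_perm js = v\<close> by (simp only: word_perm_append)
  ultimately show ?case by blast
qed

lemma permutes_words:
  assumes "w permutes {1..n}"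
  shows "\<exists>is. set is \<subseteq> {1..<n} \<and> word_perm is = w"
proof -
  have "w \<in> block_perms n (\<lambda>_. ())" using assms by (simp add: block_perms_def)
  from block_perms_words[OF _ this] obtain "is" where
    "set is \<subseteq> {i. 1 \<le> i \<and> i < n}" "word_perm is = w" by auto
  then show ?thesis by (intro exI[of _ "is"]) auto
qed

text \<open>The top point may go to any point of its block, and a transposition brings it back. For
  the rows of the initial tableau the factor of \<open>k\<close> is the column of entry
  \<open>k\<close>, which is how the order of the Young subgroup is found.\<close>

lemma card_block_perms:
  "card (block_perms m row) = (\<Prod>k\<in>{1..m}. card {j\<in>{1..k}. row j = row k})"
proof (induction m)
  case 0
  have "block_perms 0 row = {id}" by (auto simp: block_perms_def)
  then show ?case by simp
next
  case (Suc m)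
  let ?J = "{j\<in>{1..Suc m}. row j = row (Suc m)}"
  let ?f = "\<lambda>(j, v). transpose (Suc m) j \<circ> v"
  have img: "block_perms (Suc m) row = ?f ` (?J \<times> block_perms m row)"
  proof (intro equalityI subsetI)
    fix w assume "w \<in> block_perms (Suc m) row"
    then have w: "w permutes {1..Suc m}" "\<And>k. 1 \<le> k \<Longrightarrow> k \<le> Suc m \<Longrightarrow> row (w k) = row k"
      by (auto simp: block_perms_def)
    define j where "j = w (Suc m)"
    have j: "j \<in> ?J" using permutes_in_image[OF w(1), of "Suc m"] w(2)[of "Suc m"] by (auto simp: j_def)
    define v where "v = transpose (Suc m) j \<circ> w"
    have v: "v permutes {1..Suc m}"
      unfolding v_def by (rule permutes_compose[OF w(1)], rule permutes_swap_id) (use j in auto)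
    have "v permutes {1..m}"
    proof (rule permutes_superset[OF v])
      fix x assume "x \<in> {1..Suc m} - {1..m}"
      then have "x = Suc m" by auto
      then show "v x = x" by (simp add: v_def j_def)
    qed
    moreover have "row (v k) = row k" if "k \<in> {1..m}" for k
      using w(2)[of k] that j by (auto simp: v_def transpose_def)
    ultimately have "v \<in> block_perms m row" by (auto simp: block_perms_def)
    moreover have "w = ?f (j, v)" by (simp add: v_def comp_assoc[symmetric])
    ultimately show "w \<in> ?f ` (?J \<times> block_perms m row)" using j by blast
  next
    fix w assume "w \<in> ?f ` (?J \<times> block_perms m row)"
    then obtain j v where j: "j \<in> ?J" and v: "v \<in> block_perms m row" and w: "w = transpose (Suc m) j \<circ> v"
      by auto
    have vp: "v permutes {1..m}" using v by (simp add: block_perms_def)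
    then have vp': "v permutes {1..Suc m}" by (rule permutes_subset) auto
    have "w permutes {1..Suc m}"
      unfolding w by (rule permutes_compose[OF vp'], rule permutes_swap_id) (use j in auto)
    moreover have "row (w k) = row k" if k: "k \<in> {1..Suc m}" for k
    proof (cases "k = Suc m")
      case True
      then show ?thesis using j permutes_not_in[OF vp, of "Suc m"] by (simp add: w)
    next
      case False
      then have "row (v k) = row k" using v k by (auto simp: block_perms_def)
      then show ?thesis using j by (auto simp: w transpose_def)
    qed
    ultimately show "w \<in> block_perms (Suc m) row" by (auto simp: block_perms_def)
  qed
  have top: "v (Suc m) = Suc m" if "v \<in> block_perms m row" for v
    using that permutes_not_in[of v "{1..m}" "Suc m"] by (auto simp: block_perms_def)
  have "inj_on ?f (?J \<times> block_perms m row)"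
  proof (rule inj_onI, clarify)
    fix i v j w assume *: "v \<in> block_perms m row" "w \<in> block_perms m row"
      "transpose (Suc m) i \<circ> v = transpose (Suc m) j \<circ> w"
    from fun_cong[OF *(3), of "Suc m"] top[OF *(1)] top[OF *(2)] have "i = j" by simp
    with *(3) have "transpose (Suc m) i \<circ> (transpose (Suc m) i \<circ> v) = transpose (Suc m) i \<circ> (transpose (Suc m) i \<circ> w)"
      by simp
    then show "i = j \<and> v = w" using \<open>i = j\<close> by (simp add: comp_assoc[symmetric])
  qed
  then have "card (block_perms (Suc m) row) = card ?J * card (block_perms m row)"
    by (simp add: img card_image card_cartesian_product)
  then show ?case using Suc by (simp add: mult.commute)
qed

section \<open>Young diagrams and standard tableaux\<close>

declare split_paired_All [simp del] split_paired_Ex [simp del]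

abbreviation row :: "node \<Rightarrow> nat" where "row x \<equiv> fst x"
abbreviation col :: "node \<Rightarrow> nat" where "col x \<equiv> fst (snd x)"
abbreviation cmp :: "node \<Rightarrow> nat" where "cmp x \<equiv> snd (snd x)"

definition diag :: "node \<Rightarrow> int" where "diag x = int (col x) - int (row x)"

definition ct :: "(nat \<Rightarrow> 'k::field) \<Rightarrow> node \<Rightarrow> 'k" where
  "ct u x = of_int (diag x) + u (cmp x)"

definition nle :: "node \<Rightarrow> node \<Rightarrow> bool" where
  "nle x y \<longleftrightarrow> row x \<le> row y \<and> col x \<le> col y \<and> cmp x = cmp y"

definition valid_node :: "nat \<Rightarrow> node \<Rightarrow> bool" where
  "valid_node l x \<longleftrightarrow> 1 \<le> row x \<and> 1 \<le> col x \<and> 1 \<le> cmp x \<and> cmp x \<le> l"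

text \<open>A multipartition is handled as a finite down-set of nodes, so that adding and removing a
  node are set operations; \<open>young_diagram_multipartition\<close> translates back.\<close>

definition young_diagram :: "nat \<Rightarrow> node set \<Rightarrow> bool" where
  "young_diagram l D \<longleftrightarrow> finite D \<and>
     (\<forall>x\<in>D. valid_node l x \<and> (\<forall>y. valid_node l y \<longrightarrow> nle y x \<longrightarrow> y \<in> D))"

definition addable :: "nat \<Rightarrow> node set \<Rightarrow> node set" where
  "addable l D = {x. x \<notin> D \<and> young_diagram l (insert x D)}"

text \<open>The semisimplicity criterion with its product split into factors: \<open>n!\<close> and
  the shifted differences of parameters.\<close>

definition separated :: "nat \<Rightarrow> nat \<Rightarrow> (nat \<Rightarrow> 'k::field) \<Rightarrow> bool" where
  "separated l n u \<longleftrightarrow> (\<forall>m. 1 \<le> m \<and> m \<le> n \<longrightarrow> (of_nat m :: 'k) \<noteq> 0) \<and>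
     (\<forall>a\<in>{1..l}. \<forall>b\<in>{1..l}. a \<noteq> b \<longrightarrow> (\<forall>d::int. \<bar>d\<bar> < int n \<longrightarrow> of_int d + u a - u b \<noteq> 0))"

text \<open>A standard tableau read as the order in which its nodes are added: \<open>p m\<close> is
  the node of entry \<open>m\<close>. Only the values on \<open>{1..k}\<close> count, hence the
  congruence arguments later on.\<close>

definition path :: "nat \<Rightarrow> nat \<Rightarrow> (nat \<Rightarrow> node) \<Rightarrow> bool" where
  "path l k p \<longleftrightarrow> inj_on p {1..k} \<and> (\<forall>m\<le>k. young_diagram l (p ` {1..m}))"

lemma nle_refl [simp]: "nle x x" by (simp add: nle_def)

lemma young_diagramD:
  assumes "young_diagram l D" "x \<in> D"
  shows "valid_node l x" "\<And>y. valid_node l y \<Longrightarrow> nle y x \<Longrightarrow> y \<in> D"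
  using assms unfolding young_diagram_def by blast+

lemma young_diagram_finite: "young_diagram l D \<Longrightarrow> finite D"
  by (simp add: young_diagram_def)

text \<open>The first row up to the column of \<open>x\<close> and the first column down to the row
  of \<open>y\<close> lie in the diagram and share the corner. This bounds the spread of diagonals
  by the number of nodes.\<close>

lemma hook_card:
  assumes D: "young_diagram l D" and x: "x \<in> D" and y: "y \<in> D" and c: "cmp x = cmp y"
  shows "col x + row y \<le> Suc (card {z\<in>D. cmp z = cmp x})"
proof -
  let ?A = "(\<lambda>b. (1, b, cmp x)) ` {1..col x} :: node set"
    and ?B = "(\<lambda>a. (a, 1, cmp x)) ` {2..row y} :: node set"
  have vx: "valid_node l x" and vy: "valid_node l y" using young_diagramD(1)[OF D] x y by auto
  have "?A \<subseteq> {z\<in>D. cmp z = cmp x}"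
  proof
    fix z :: node assume "z \<in> ?A"
    then obtain b where b: "z = (1, b, cmp x)" "b \<in> {1..col x}" by blast
    have "z \<in> D" by (rule young_diagramD(2)[OF D x]) (use vx b in \<open>simp_all add: valid_node_def nle_def\<close>)
    then show "z \<in> {z\<in>D. cmp z = cmp x}" using b by simp
  qed
  moreover have "?B \<subseteq> {z\<in>D. cmp z = cmp x}"
  proof
    fix z :: node assume "z \<in> ?B"
    then obtain a where a: "z = (a, 1, cmp x)" "a \<in> {2..row y}" by blast
    have "z \<in> D" by (rule young_diagramD(2)[OF D y]) (use vy c a in \<open>simp_all add: valid_node_def nle_def\<close>)
    then show "z \<in> {z\<in>D. cmp z = cmp x}" using a by simp
  qed
  moreover have "finite {z\<in>D. cmp z = cmp x}" using D by (simp add: young_diagram_def)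
  ultimately have "card (?A \<union> ?B) \<le> card {z\<in>D. cmp z = cmp x}" by (intro card_mono) auto
  moreover have "card (?A \<union> ?B) = card ?A + card ?B" by (rule card_Un_disjoint) auto
  moreover have "card ?A = col x" by (simp add: card_image inj_on_def)
  moreover have "card ?B = row y - 1" by (simp add: card_image inj_on_def)
  ultimately show ?thesis using vy by (simp add: valid_node_def)
qed

lemma diag_card:
  assumes D: "young_diagram l D" and x: "x \<in> D" and y: "y \<in> D" and c: "cmp x = cmp y"
  shows "\<bar>diag x - diag y\<bar> < int (card {z\<in>D. cmp z = cmp x})"
proof -
  have v: "valid_node l x" "valid_node l y" using young_diagramD(1)[OF D] x y by auto
  show ?thesis
    using hook_card[OF D x y c] hook_card[OF D y x c[symmetric]] v
    unfolding diag_def valid_node_def c by linarith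
qed

lemma diag_card1:
  assumes D: "young_diagram l D" and x: "x \<in> D"
  shows "\<bar>diag x\<bar> < int (card {z\<in>D. cmp z = cmp x})"
proof -
  have v: "valid_node l x" using young_diagramD(1)[OF D] x by auto
  show ?thesis
    using hook_card[OF D x x] v by (simp add: diag_def valid_node_def abs_less_iff)
qed

text \<open>Each diagonal is strictly bounded by the size of its own component, and the two sizes
  add up to at most the whole; the two strict inequalities account for the 2.\<close>

lemma diag_card2:
  assumes D: "young_diagram l D" and x: "x \<in> D" and y: "y \<in> D" and c: "cmp x \<noteq> cmp y"
  shows "\<bar>diag x - diag y\<bar> + 2 \<le> int (card D)"
proof -
  have "card ({z\<in>D. cmp z = cmp x} \<union> {z\<in>D. cmp z = cmp y}) \<le> card D"
    using D by (intro card_mono) (auto simp: young_diagram_def)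
  moreover have "card ({z\<in>D. cmp z = cmp x} \<union> {z\<in>D. cmp z = cmp y}) =
      card {z\<in>D. cmp z = cmp x} + card {z\<in>D. cmp z = cmp y}"
    using D c by (intro card_Un_disjoint) (auto simp: young_diagram_def)
  ultimately show ?thesis using diag_card1[OF D x] diag_card1[OF D y] by linarith
qed

lemma separated_of_int:
  fixes u :: "nat \<Rightarrow> 'k::field"
  assumes "separated l n u" "\<bar>d\<bar> \<le> int n" "(of_int d :: 'k) = 0"
  shows "d = 0"
proof (rule ccontr)
  assume "d \<noteq> 0"
  then have m: "1 \<le> nat \<bar>d\<bar>" "nat \<bar>d\<bar> \<le> n" using assms by auto
  have "(of_int \<bar>d\<bar> :: 'k) = 0" using assms(3) by (simp add: abs_if)
  then have "(of_nat (nat \<bar>d\<bar>) :: 'k) = 0" by simp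
  then show False using assms(1) m by (auto simp: separated_def)
qed

text \<open>The bound on \<open>card D\<close> and \<open>e\<close> is the budget of the criterion:
  within a component the integer in question is at most \<open>n\<close> in absolute value, between
  components it is below \<open>n\<close>. These are the integers controlled by
  \<open>separated\<close>.\<close>

lemma content_separation:
  fixes u :: "nat \<Rightarrow> 'k::field"
  assumes S: "separated l n u" and D: "young_diagram l D" and x: "x \<in> D" and y: "y \<in> D"
    and card: "int (card D) + \<bar>e\<bar> \<le> int n + 1" and eq: "ct u x - ct u y + of_int e = 0"
  shows "cmp x = cmp y \<and> diag x - diag y + e = 0"
proof (cases "cmp x = cmp y")
  case True
  have "card {z\<in>D. cmp z = cmp x} \<le> card D"
    using D by (intro card_mono) (auto simp: young_diagram_def)
  then have "\<bar>diag x - diag y + e\<bar> \<le> int n" using diag_card[OF D x y True] card by linarith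
  moreover have "(of_int (diag x - diag y + e) :: 'k) = 0" using eq True by (simp add: ct_def)
  ultimately show ?thesis using separated_of_int[OF S] True by blast
next
  case False
  have v: "valid_node l x" "valid_node l y" using young_diagramD(1)[OF D] x y by auto
  have "\<bar>diag x - diag y + e\<bar> < int n" using diag_card2[OF D x y False] card by linarith
  moreover have "cmp x \<in> {1..l}" "cmp y \<in> {1..l}" using v by (auto simp: valid_node_def)
  ultimately have "of_int (diag x - diag y + e) + u (cmp x) - u (cmp y) \<noteq> 0"
    using S False unfolding separated_def by blast
  then show ?thesis using eq by (simp add: ct_def algebra_simps)
qed

lemma young_diagram_Un: "young_diagram l A \<Longrightarrow> young_diagram l B \<Longrightarrow> young_diagram l (A \<union> B)"
  by (auto simp: young_diagram_def)

lemma young_diagram_empty [simp]: "young_diagram l {}"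
  by (simp add: young_diagram_def)

lemma addable_nle:
  assumes "x \<in> addable l D" "y \<in> addable l D" "nle x y"
  shows "x = y"
proof -
  have "valid_node l x" using assms(1) young_diagramD(1)[of l "insert x D" x] by (simp add: addable_def)
  then have "x \<in> insert y D" using assms(2,3) young_diagramD(2)[of l "insert y D" y] by (auto simp: addable_def)
  then show ?thesis using assms(1) by (auto simp: addable_def)
qed

text \<open>Distinct addable nodes are incomparable, so within a component one lies strictly above
  and strictly to the right of the other.\<close>

lemma addable_diag:
  assumes "x \<in> addable l D" "y \<in> addable l D" "x \<noteq> y" "cmp x = cmp y"
  shows "\<bar>diag x - diag y\<bar> \<ge> 2"
proof -
  have "\<not> nle x y" "\<not> nle y x" using addable_nle[OF assms(1,2)] addable_nle[OF assms(2,1)] assms(3) by auto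
  then have "(row x < row y \<and> col y < col x) \<or> (row y < row x \<and> col x < col y)"
    using assms(4) unfolding nle_def by linarith
  then show ?thesis unfolding diag_def by linarith
qed

text \<open>Both nodes can be added at once, and \<open>content_separation\<close> applies to the
  larger diagram. With \<open>e = 0\<close> this tells addable nodes apart by content; with
  \<open>e = 1\<close> or \<open>e = - 1\<close> it excludes neighbouring contents, as
  \<open>swap_zero\<close> requires of intertwiners.\<close>

lemma addable_separation:
  fixes u :: "nat \<Rightarrow> 'k::field"
  assumes S: "separated l n u" and x: "x \<in> addable l D" and y: "y \<in> addable l D" and ne: "x \<noteq> y"
    and card: "int (card D) + 1 + \<bar>e\<bar> \<le> int n" and e: "\<bar>e\<bar> \<le> 1"
  shows "ct u x - ct u y + of_int e \<noteq> 0"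
proof
  assume eq: "ct u x - ct u y + of_int e = 0"
  let ?D = "insert x (insert y D)"
  have D: "young_diagram l ?D"
    using young_diagram_Un[of l "insert x D" "insert y D"] x y by (auto simp: addable_def insert_commute)
  have "finite D" using x by (auto simp: addable_def young_diagram_def)
  then have "card ?D \<le> card D + 2" by (simp add: card_insert_if)
  then show False
    using content_separation[OF S D _ _ _ eq] addable_diag[OF x y ne] card e by fastforce
qed

section \<open>Paths of Young diagrams and their admissible swaps\<close>

lemma pathD: "path l k p \<Longrightarrow> m \<le> k \<Longrightarrow> young_diagram l (p ` {1..m})"
  by (simp add: path_def)

lemma path_mono: "path l k p \<Longrightarrow> m \<le> k \<Longrightarrow> path l m p"
  by (auto simp: path_def intro: inj_on_subset)

lemma path_card: "path l k p \<Longrightarrow> m \<le> k \<Longrightarrow> card (p ` {1..m}) = m"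
  by (subst card_image) (auto simp: path_def intro: inj_on_subset)

lemma image_atLeastAtMost_Suc: "p ` {1..Suc k} = insert (p (Suc k)) (p ` {1..k})"
  by (simp add: atLeastAtMostSuc_conv)

lemma path_Suc: "path l (Suc k) p \<longleftrightarrow> path l k p \<and> p (Suc k) \<in> addable l (p ` {1..k})"
proof -
  have "{1..Suc k} = insert (Suc k) {1..k}" by auto
  then have "inj_on p {1..Suc k} \<longleftrightarrow> inj_on p {1..k} \<and> p (Suc k) \<notin> p ` {1..k}"
    by (simp add: inj_on_insert)
  then show ?thesis
    unfolding path_def addable_def le_Suc_eq
    by (auto simp only: image_atLeastAtMost_Suc mem_Collect_eq)
qed

lemma path_addable: "path l k p \<Longrightarrow> 1 \<le> m \<Longrightarrow> m \<le> k \<Longrightarrow> p m \<in> addable l (p ` {1..m - 1})"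
  using path_Suc[of l "m - 1" p] path_mono[of l k p m] by simp

lemma path_cong: "(\<And>m. 1 \<le> m \<Longrightarrow> m \<le> k \<Longrightarrow> p m = q m) \<Longrightarrow> path l k p = path l k q"
proof -
  assume *: "\<And>m. 1 \<le> m \<Longrightarrow> m \<le> k \<Longrightarrow> p m = q m"
  then have "inj_on p {1..k} = inj_on q {1..k}" by (intro inj_on_cong) auto
  moreover have "p ` {1..m} = q ` {1..m}" if "m \<le> k" for m using that * by (intro image_cong) auto
  ultimately show ?thesis by (auto simp: path_def)
qed

text \<open>If \<open>a\<close> is below \<open>b\<close> in the node order, a node strictly between
  them would belong to \<open>D\<close> and drag \<open>a\<close> into \<open>D\<close>. So
  \<open>b\<close> is the right or lower neighbour of \<open>a\<close>. If they are incomparable,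
  \<open>b\<close> does not wait for \<open>a\<close>.\<close>

lemma addable_two_step:
  assumes D: "young_diagram l D" and a: "a \<in> addable l D" and b: "b \<in> addable l (insert a D)"
  shows "b \<in> addable l D \<or> (nle a b \<and> \<bar>diag a - diag b\<bar> = 1)"
proof (cases "nle a b")
  case False
  have "young_diagram l (insert b D)"
    unfolding young_diagram_def
  proof (intro conjI ballI allI impI)
    show "finite (insert b D)" using D by (simp add: young_diagram_def)
    fix x assume x: "x \<in> insert b D"
    then show "valid_node l x" using young_diagramD(1)[of l "insert b (insert a D)" x] b by (auto simp: addable_def)
    fix y assume y: "valid_node l y" "nle y x"
    show "y \<in> insert b D"
    proof (cases "x = b")
      case True
      then have "y \<in> insert b (insert a D)"
        using young_diagramD(2)[of l "insert b (insert a D)" b y] b y by (auto simp: addable_def)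
      then show ?thesis using False True y by auto
    next
      case False
      then show ?thesis using young_diagramD(2)[OF D _ y] x by auto
    qed
  qed
  then show ?thesis using b by (auto simp: addable_def)
next
  case True
  have B: "young_diagram l (insert b (insert a D))" "b \<noteq> a" using b by (auto simp: addable_def)
  have va: "valid_node l a" using young_diagramD(1)[of l "insert a D" a] a by (auto simp: addable_def)
  have *: "z = b" if "valid_node l z" "nle a z" "nle z b" "z \<noteq> a" for z
  proof (rule ccontr)
    assume "z \<noteq> b"
    moreover have "z \<in> insert b (insert a D)" using young_diagramD(2)[OF B(1), of b z] that by simp
    ultimately have "z \<in> D" using that by auto
    then have "a \<in> D" using young_diagramD(2)[OF D, of z a] va that by simp
    then show False using a by (simp add: addable_def)
  qed
  have "row a < row b \<or> col a < col b" using True B(2) by (auto simp: nle_def prod_eq_iff)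
  then show ?thesis
  proof
    assume "row a < row b"
    then have "(Suc (row a), col a, cmp a) = b"
      using va True by (intro *) (auto simp: valid_node_def nle_def prod_eq_iff)
    then show ?thesis using True by (auto simp: diag_def)
  next
    assume "col a < col b"
    then have "(row a, Suc (col a), cmp a) = b"
      using va True by (intro *) (auto simp: valid_node_def nle_def prod_eq_iff)
    then show ?thesis using True by (auto simp: diag_def)
  qed
qed

abbreviation sw :: "nat \<Rightarrow> nat \<Rightarrow> nat" where "sw i \<equiv> transpose i (i + 1)"

text \<open>All three criteria express that steps \<open>i\<close> and \<open>i + 1\<close> are
  independent. The swap changes only the diagram after step \<open>i\<close>, so the question is
  whether \<open>p (i + 1)\<close> can come first, which \<open>addable_two_step\<close>
  decides.\<close>

lemma path_swap_iff:
  assumes p: "path l k p" and i: "1 \<le> i" "i < k"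
  shows "path l k (p \<circ> sw i) \<longleftrightarrow> \<not> (cmp (p i) = cmp (p (i + 1)) \<and> \<bar>diag (p i) - diag (p (i + 1))\<bar> = 1)"
    and "path l k (p \<circ> sw i) \<longleftrightarrow> \<not> nle (p i) (p (i + 1))"
    and "path l k (p \<circ> sw i) \<longleftrightarrow> p (i + 1) \<in> addable l (p ` {1..i - 1})"
proof -
  let ?D = "p ` {1..i - 1}"
  have D: "young_diagram l ?D" using pathD[OF p] i by simp
  have a: "p i \<in> addable l ?D" using path_addable[OF p, of i] i by simp
  have Di: "p ` {1..i} = insert (p i) ?D" using image_atLeastAtMost_Suc[of p "i - 1"] i by simp
  have b: "p (i + 1) \<in> addable l (insert (p i) ?D)" using path_addable[OF p, of "i + 1"] i Di by simp
  have ne: "p i \<noteq> p (i + 1)" using b by (auto simp: addable_def)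
  show *: "path l k (p \<circ> sw i) \<longleftrightarrow> p (i + 1) \<in> addable l ?D"
  proof
    assume q: "path l k (p \<circ> sw i)"
    have "(p \<circ> sw i) ` {1..i - 1} = ?D" by (intro image_cong) (auto simp: transpose_def)
    then show "p (i + 1) \<in> addable l ?D" using path_addable[OF q, of i] i by simp
  next
    assume "p (i + 1) \<in> addable l ?D"
    then have y: "young_diagram l (insert (p (i + 1)) ?D)" by (simp add: addable_def)
    have "young_diagram l ((p \<circ> sw i) ` {1..m})" if "m \<le> k" for m
    proof -
      consider "m < i" | "m = i" | "i < m" by linarith
      then show ?thesis
      proof cases
        case 1
        then have "(p \<circ> sw i) ` {1..m} = p ` {1..m}" by (intro image_cong) (auto simp: transpose_def)
        then show ?thesis using pathD[OF p that] by simp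
      next
        case 2
        have "(p \<circ> sw i) ` {1..i - 1} = ?D" by (intro image_cong) (auto simp: transpose_def)
        then have "(p \<circ> sw i) ` {1..m} = insert (p (i + 1)) ?D"
          using image_atLeastAtMost_Suc[of "p \<circ> sw i" "i - 1"] i 2 by simp
        then show ?thesis using y by simp
      next
        case 3
        then have "sw i ` {1..m} = {1..m}" using i by (intro permutes_image permutes_swap_id) auto
        then have "(p \<circ> sw i) ` {1..m} = p ` {1..m}" by (metis image_comp)
        then show ?thesis using pathD[OF p that] by simp
      qed
    qed
    moreover have "inj_on (p \<circ> sw i) {1..k}"
    proof (rule comp_inj_on)
      show "inj_on (sw i) {1..k}" by (rule inj_on_subset[OF inj_transpose]) auto
      have "sw i ` {1..k} = {1..k}" using i by (intro permutes_image permutes_swap_id) auto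
      then show "inj_on p (sw i ` {1..k})" using p by (simp add: path_def)
    qed
    ultimately show "path l k (p \<circ> sw i)" by (simp add: path_def)
  qed
  have "\<not> nle (p i) (p (i + 1))" "\<not> (cmp (p i) = cmp (p (i + 1)) \<and> \<bar>diag (p i) - diag (p (i + 1))\<bar> = 1)"
    if "p (i + 1) \<in> addable l ?D"
    using addable_nle[OF a that] addable_diag[OF a that ne] ne by auto
  moreover have "nle (p i) (p (i + 1)) \<and> cmp (p i) = cmp (p (i + 1)) \<and> \<bar>diag (p i) - diag (p (i + 1))\<bar> = 1"
    if "p (i + 1) \<notin> addable l ?D"
    using addable_two_step[OF D a b] that by (auto simp: nle_def)
  ultimately show "path l k (p \<circ> sw i) \<longleftrightarrow> \<not> (cmp (p i) = cmp (p (i + 1)) \<and> \<bar>diag (p i) - diag (p (i + 1))\<bar> = 1)"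
    and "path l k (p \<circ> sw i) \<longleftrightarrow> \<not> nle (p i) (p (i + 1))"
    using * by blast+
qed

lemma path_not_nle:
  assumes p: "path l k p" and i: "1 \<le> i" "i < j" "j \<le> k"
  shows "\<not> nle (p j) (p i)"
proof
  assume "nle (p j) (p i)"
  moreover have "p i \<in> p ` {1..i}" "young_diagram l (p ` {1..i})" using pathD[OF p, of i] i by auto
  moreover have "valid_node l (p j)" using young_diagramD(1)[OF pathD[OF p, of j], of "p j"] i by auto
  ultimately have "p j \<in> p ` {1..i}" using young_diagramD(2) by blast
  then have "j \<in> {1..i}" using p i by (auto simp: path_def dest!: inj_onD)
  then show False using i by simp
qed

section \<open>Reading order and standard tableaux\<close>

definition before :: "node \<Rightarrow> node \<Rightarrow> bool" where
  "before x y \<longleftrightarrow> cmp x < cmp y \<or> (cmp x = cmp y \<and> (row x < row y \<or> (row x = row y \<and> col x < col y)))"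

lemma before_total: "x \<noteq> y \<Longrightarrow> before x y \<or> before y x"
  by (auto simp: before_def prod_eq_iff)
lemma before_asym: "before x y \<Longrightarrow> \<not> before y x" by (auto simp: before_def)
lemma before_irrefl [simp]: "\<not> before x x" by (auto simp: before_def)
lemma before_trans: "before x y \<Longrightarrow> before y z \<Longrightarrow> before x z" by (auto simp: before_def)
lemma nle_before: "nle x y \<Longrightarrow> x \<noteq> y \<Longrightarrow> before x y" by (auto simp: nle_def before_def prod_eq_iff)

text \<open>Monotonicity is stated for the node order, which suits paths of down-sets;
  \<open>Std_iff_std_tab\<close> compares it with the conditions on rows and columns.\<close>

definition std_tab :: "nat \<Rightarrow> nat \<Rightarrow> node set \<Rightarrow> tableau \<Rightarrow> bool" where
  "std_tab l n D t \<longleftrightarrow> young_diagram l D \<and> bij_betw t D {1..n} \<and> (\<forall>x. x \<notin> D \<longrightarrow> t x = 0) \<and>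
     (\<forall>x\<in>D. \<forall>y\<in>D. nle x y \<longrightarrow> x \<noteq> y \<longrightarrow> t x < t y)"

definition pos :: "tableau \<Rightarrow> nat \<Rightarrow> node" where "pos t k = (THE x. t x = k)"

lemma content_pos: "content u t k = ct u (pos t k)"
  by (simp add: content_def pos_def ct_def diag_def split: prod.split)

lemma std_tab_unique_shape: "std_tab l n D t \<Longrightarrow> D = {x. t x \<noteq> 0}"
  by (fastforce simp: std_tab_def bij_betw_def)

lemma std_tab_pos:
  assumes t: "std_tab l n D t"
  shows "k \<in> {1..n} \<Longrightarrow> pos t k \<in> D" "k \<in> {1..n} \<Longrightarrow> t (pos t k) = k" "x \<in> D \<Longrightarrow> pos t (t x) = x"
    "x \<in> D \<Longrightarrow> t x \<in> {1..n}"
proof -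
  have bij: "bij_betw t D {1..n}" and z: "\<And>x. x \<notin> D \<Longrightarrow> t x = 0" using t by (auto simp: std_tab_def)
  have *: "pos t (t x) = x" if "x \<in> D" for x
    unfolding pos_def
  proof (rule the_equality)
    fix y assume eq: "t y = t x"
    have "t x \<in> {1..n}" using bij that by (auto simp: bij_betw_def)
    then have "y \<in> D" using z[of y] eq by fastforce
    then show "y = x" using bij eq that by (auto simp: bij_betw_def dest: inj_onD)
  qed simp
  then show "x \<in> D \<Longrightarrow> pos t (t x) = x" .
  show "x \<in> D \<Longrightarrow> t x \<in> {1..n}" using bij by (auto simp: bij_betw_def)
  assume "k \<in> {1..n}"
  then obtain x where x: "x \<in> D" "t x = k" using bij unfolding bij_betw_def by (metis imageE)
  show "pos t k \<in> D" "t (pos t k) = k" using x *[OF x(1)] by simp_all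
qed

lemma std_tab_image_pos:
  assumes t: "std_tab l n D t" and m: "m \<le> n"
  shows "pos t ` {1..m} = {x\<in>D. t x \<le> m}"
proof (intro equalityI subsetI)
  fix x assume "x \<in> {x\<in>D. t x \<le> m}"
  then show "x \<in> pos t ` {1..m}" using std_tab_pos[OF t] by (intro image_eqI[of _ _ "t x"]) auto
qed (use std_tab_pos[OF t] m in auto)

lemma std_tab_path:
  assumes t: "std_tab l n D t"
  shows "path l n (pos t)" "pos t ` {1..n} = D"
proof -
  show "pos t ` {1..n} = D" using std_tab_image_pos[OF t, of n] std_tab_pos[OF t] by auto
  show "path l n (pos t)"
    unfolding path_def
  proof (intro conjI allI impI)
    show "inj_on (pos t) {1..n}" using std_tab_pos(2)[OF t] by (metis inj_onI)
    fix m assume m: "m \<le> n"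
    have D: "young_diagram l D" using t by (simp add: std_tab_def)
    have mono: "t y \<le> t x" if "x \<in> D" "y \<in> D" "nle y x" for x y
      using t that by (cases "x = y") (auto simp: std_tab_def less_imp_le)
    show "young_diagram l (pos t ` {1..m})"
      unfolding std_tab_image_pos[OF t m] young_diagram_def
    proof (intro conjI ballI allI impI)
      show "finite {x \<in> D. t x \<le> m}" using young_diagram_finite[OF D] by simp
      fix x assume x: "x \<in> {x \<in> D. t x \<le> m}"
      then show "valid_node l x" using young_diagramD(1)[OF D] by blast
      fix y assume y: "valid_node l y" "nle y x"
      then have "y \<in> D" using young_diagramD(2)[OF D, of x y] x by blast
      then show "y \<in> {x \<in> D. t x \<le> m}" using mono[of x y] x y by simp
    qed
  qed
qed

text \<open>Together with \<open>std_tab_path\<close> this identifies standard tableaux with paths: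
  the tableau is the inverse of the path, and it increases because a later node is never below an
  earlier one.\<close>

lemma path_std_tab:
  assumes p: "path l n p"
  shows "\<exists>t. std_tab l n (p ` {1..n}) t \<and> (\<forall>k\<in>{1..n}. pos t k = p k)"
proof -
  define D where "D = p ` {1..n}"
  define t where "t x = (if x \<in> D then the_inv_into {1..n} p x else 0)" for x
  have inj: "inj_on p {1..n}" using p by (simp add: path_def)
  have tp: "t (p k) = k" if "k \<in> {1..n}" for k
    using that inj by (auto simp: t_def D_def the_inv_into_f_f)
  have "bij_betw t D {1..n}"
  proof -
    have "bij_betw (the_inv_into {1..n} p) D {1..n}"
      by (rule bij_betw_the_inv_into) (use inj in \<open>simp add: bij_betw_def D_def\<close>)
    moreover have "bij_betw (the_inv_into {1..n} p) D {1..n} = bij_betw t D {1..n}"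
      by (rule bij_betw_cong) (simp add: t_def)
    ultimately show ?thesis by blast
  qed
  moreover have "t x < t y" if xy: "x \<in> D" "y \<in> D" "nle x y" "x \<noteq> y" for x y
  proof -
    obtain a b where ab: "a \<in> {1..n}" "b \<in> {1..n}" "x = p a" "y = p b" using xy by (auto simp: D_def)
    have "\<not> b < a" using path_not_nle[OF p, of b a] ab xy by auto
    moreover have "a \<noteq> b" using ab xy by auto
    ultimately show ?thesis using ab xy tp by auto
  qed
  ultimately have t: "std_tab l n D t"
    using pathD[OF p, of n] by (auto simp: std_tab_def t_def D_def)
  moreover have "pos t k = p k" if "k \<in> {1..n}" for k
    using std_tab_pos(3)[OF t, of "p k"] tp[OF that] that by (auto simp: D_def)
  ultimately show ?thesis by (auto simp: D_def)
qed

lemma std_tab_ext: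
  assumes "std_tab l n D t" "std_tab l n E t'" "\<And>k. k \<in> {1..n} \<Longrightarrow> pos t k = pos t' k"
  shows "t = t'" "D = E"
proof -
  show "D = E" using std_tab_path(2)[OF assms(1)] std_tab_path(2)[OF assms(2)] assms(3) by auto
  show "t = t'"
  proof
    fix x show "t x = t' x"
    proof (cases "x \<in> D")
      case True
      then have "pos t' (t x) = x" using assms(3) std_tab_pos[OF assms(1)] by metis
      then show ?thesis using std_tab_pos(2)[OF assms(2)] std_tab_pos(4)[OF assms(1) True] by metis
    next
      case False
      then show ?thesis using assms \<open>D = E\<close> by (auto simp: std_tab_def)
    qed
  qed
qed

lemma sw_in: "1 \<le> i \<Longrightarrow> i < n \<Longrightarrow> k \<in> {1..n} \<Longrightarrow> sw i k \<in> {1..n}"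
  by (auto simp: transpose_def)

lemma sw_sw [simp]: "sw i \<circ> (sw i \<circ> t) = t" and sw_sw_right [simp]: "(p \<circ> sw i) \<circ> sw i = p"
  by (auto simp: fun_eq_iff)

lemma pos_sw:
  assumes t: "std_tab l n D t" and i: "1 \<le> i" "i < n" and k: "k \<in> {1..n}"
  shows "pos (sw i \<circ> t) k = pos t (sw i k)"
  unfolding pos_def
  by (rule arg_cong[of _ _ The]) (auto simp: fun_eq_iff)

text \<open>Exchanging the entries \<open>i\<close> and \<open>i + 1\<close> amounts to precomposing
  the path with the transposition, so \<open>path_swap_iff\<close> decides standardness.\<close>

lemma std_tab_sw:
  assumes t: "std_tab l n D t" and i: "1 \<le> i" "i < n"
  shows "path l n (pos t \<circ> sw i) \<Longrightarrow> std_tab l n D (sw i \<circ> t)"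
    "std_tab l n E (sw i \<circ> t) \<Longrightarrow> path l n (pos t \<circ> sw i) \<and> E = D"
proof -
  assume p: "path l n (pos t \<circ> sw i)"
  have im: "(pos t \<circ> sw i) ` {1..n} = D"
  proof -
    have "sw i ` {1..n} = {1..n}" using i by (intro permutes_image permutes_swap_id) auto
    then show ?thesis using std_tab_path(2)[OF t] by (metis image_comp)
  qed
  obtain t' where t': "std_tab l n D t'" "\<And>k. k \<in> {1..n} \<Longrightarrow> pos t' k = pos t (sw i k)"
    using path_std_tab[OF p] im by auto
  have "t' = sw i \<circ> t"
  proof
    fix x show "t' x = (sw i \<circ> t) x"
    proof (cases "x \<in> D")
      case True
      have "sw i (t' x) \<in> {1..n}" using sw_in[OF i] std_tab_pos(4)[OF t'(1) True] by blast
      moreover have "pos t (sw i (t' x)) = x"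
        using t'(2)[of "t' x"] std_tab_pos(3,4)[OF t'(1) True] by simp
      ultimately have "sw i (t' x) = t x" using std_tab_pos(2)[OF t] by metis
      then show ?thesis by (metis comp_apply transpose_involutory)
    next
      case False
      then show ?thesis using t t'(1) i by (auto simp: std_tab_def transpose_def)
    qed
  qed
  then show "std_tab l n D (sw i \<circ> t)" using t' by simp
next
  assume E: "std_tab l n E (sw i \<circ> t)"
  have eq: "pos (sw i \<circ> t) k = (pos t \<circ> sw i) k" if "1 \<le> k" "k \<le> n" for k
    using pos_sw[OF t i, of k] that by simp
  have "path l n (pos t \<circ> sw i)"
    using std_tab_path(1)[OF E] path_cong[of n "pos (sw i \<circ> t)" "pos t \<circ> sw i" l] eq by blast
  moreover have "E = D"
    using std_tab_unique_shape[OF t] std_tab_unique_shape[OF E] i by (auto simp: transpose_def)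
  ultimately show "path l n (pos t \<circ> sw i) \<and> E = D" by simp
qed

section \<open>Inversions and induction from the initial tableau\<close>

definition inversions :: "node set \<Rightarrow> tableau \<Rightarrow> (node \<times> node) set" where
  "inversions D t = {(x, y). x \<in> D \<and> y \<in> D \<and> before x y \<and> t y < t x}"

definition inv_count :: "node set \<Rightarrow> tableau \<Rightarrow> nat" where
  "inv_count D t = card (inversions D t)"

lemma finite_inversions: "finite D \<Longrightarrow> finite (inversions D t)"
  by (rule finite_subset[of _ "D \<times> D"]) (auto simp: inversions_def)

text \<open>The relative order of two entries changes only for the pair \<open>i\<close>,
  \<open>i + 1\<close>.\<close>

lemma inversions_sw:
  assumes t: "std_tab l n D t" and i: "1 \<le> i" "i < n" and b: "before (pos t i) (pos t (i + 1))"
  shows "inversions D (sw i \<circ> t) = insert (pos t i, pos t (i + 1)) (inversions D t)"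
    and "(pos t i, pos t (i + 1)) \<notin> inversions D t"
proof -
  have in_D: "pos t i \<in> D" "pos t (i + 1) \<in> D" and val: "t (pos t i) = i" "t (pos t (i + 1)) = i + 1"
    using std_tab_pos[OF t] i by auto
  have inj: "x = pos t i \<longleftrightarrow> t x = i" "x = pos t (i + 1) \<longleftrightarrow> t x = i + 1" if "x \<in> D" for x
    using val std_tab_pos(3)[OF t that] by auto
  show "(pos t i, pos t (i + 1)) \<notin> inversions D t"
    using val by (auto simp: inversions_def)
  have "(x, y) \<in> inversions D (sw i \<circ> t) \<longleftrightarrow> (x, y) \<in> insert (pos t i, pos t (i + 1)) (inversions D t)" for x y
  proof (cases "x \<in> D \<and> y \<in> D")
    case True
    then show ?thesis using inj[of x] inj[of y] b before_asym[OF b]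
      by (auto simp: inversions_def transpose_def in_D)
  qed (use in_D in \<open>auto simp: inversions_def\<close>)
  then show "inversions D (sw i \<circ> t) = insert (pos t i, pos t (i + 1)) (inversions D t)"
    by (metis subrelI subset_antisym)
qed

lemma inv_count_sw:
  assumes t: "std_tab l n D t" and i: "1 \<le> i" "i < n" and b: "before (pos t i) (pos t (i + 1))"
  shows "inv_count D (sw i \<circ> t) = Suc (inv_count D t)"
proof -
  have "finite D" using t by (simp add: std_tab_def young_diagram_def)
  then show ?thesis
    unfolding inv_count_def using inversions_sw[OF assms] finite_inversions by simp
qed

lemma inv_count_sw_le:
  assumes t: "std_tab l n D t" and s: "std_tab l n D (sw i \<circ> t)" and i: "1 \<le> i" "i < n"
  shows "inv_count D (sw i \<circ> t) \<le> Suc (inv_count D t)"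
proof (cases "before (pos t i) (pos t (i + 1))")
  case True
  then show ?thesis using inv_count_sw[OF t i] by simp
next
  case False
  have "t (pos t i) \<noteq> t (pos t (i + 1))" using std_tab_pos(2)[OF t] i by auto
  then have "pos t i \<noteq> pos t (i + 1)" by auto
  then have "before (pos (sw i \<circ> t) i) (pos (sw i \<circ> t) (i + 1))"
    using before_total[of "pos t i" "pos t (i + 1)"] False pos_sw[OF t i] i by simp
  from inv_count_sw[OF s i this] show ?thesis unfolding sw_sw by simp
qed

text \<open>Without inversions the entries follow the reading order. This pins the tableau down, so
  a shape has only one tableau without inversions.\<close>

lemma std_tab_rank:
  assumes t: "std_tab l n D t" and "inversions D t = {}" and x: "x \<in> D"
  shows "t x = card {y\<in>D. y = x \<or> before y x}"
proof -
  have no: "\<not> (before a b \<and> t b < t a)" if "a \<in> D" "b \<in> D" for a b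
    using assms(2) that unfolding inversions_def by blast
  have inj: "inj_on t D" using t by (auto simp: std_tab_def bij_betw_def)
  have le: "y = x \<or> before y x \<longleftrightarrow> t y \<le> t x" if y: "y \<in> D" for y
  proof
    assume "y = x \<or> before y x"
    then show "t y \<le> t x" using no[OF y x] by auto
  next
    assume le: "t y \<le> t x"
    show "y = x \<or> before y x"
    proof (rule ccontr)
      assume "\<not> ?thesis"
      then have "x \<noteq> y" "before x y" using before_total[of x y] by auto
      moreover have "t y \<noteq> t x" using inj x y \<open>x \<noteq> y\<close> by (auto dest: inj_onD)
      ultimately show False using no[OF x y] le by auto
    qed
  qed
  then have "{y\<in>D. y = x \<or> before y x} = {y\<in>D. t y \<le> t x}" by auto
  also have "t ` \<dots> = {1..t x}"
  proof (intro equalityI subsetI)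
    fix k assume "k \<in> {1..t x}"
    then have k: "k \<in> {1..n}" "k \<le> t x" using std_tab_pos(4)[OF t x] by auto
    then show "k \<in> t ` {y\<in>D. t y \<le> t x}"
      using std_tab_pos(1,2)[OF t k(1)] by (intro image_eqI[of _ _ "pos t k"]) auto
  next
    fix k assume "k \<in> t ` {y\<in>D. t y \<le> t x}"
    then show "k \<in> {1..t x}" using std_tab_pos(4)[OF t] by auto
  qed
  finally have "t ` {y\<in>D. y = x \<or> before y x} = {1..t x}" .
  moreover have "inj_on t {y\<in>D. y = x \<or> before y x}" by (rule inj_on_subset[OF inj]) auto
  ultimately show ?thesis using card_image by fastforce
qed

lemma std_tab_no_inversions_unique:
  assumes t: "std_tab l n D t" "inversions D t = {}" and s: "std_tab l n D s" "inversions D s = {}"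
  shows "t = s"
proof
  fix x show "t x = s x"
    using std_tab_rank[OF t] std_tab_rank[OF s] t s by (cases "x \<in> D") (auto simp: std_tab_def)
qed

text \<open>If every \<open>i + 1\<close> came after \<open>i\<close> in reading order, chaining
  these comparisons would exclude all inversions. At a descent the swap stays standard, because
  comparable nodes are in reading order.\<close>

lemma std_tab_descent:
  assumes t: "std_tab l n D t" and inv: "inversions D t \<noteq> {}"
  shows "\<exists>i. 1 \<le> i \<and> i < n \<and> before (pos t (i + 1)) (pos t i) \<and> std_tab l n D (sw i \<circ> t)"
proof -
  have "\<exists>i. 1 \<le> i \<and> i < n \<and> before (pos t (i + 1)) (pos t i)"
  proof (rule ccontr)
    assume no: "\<not> ?thesis"
    have step: "before (pos t i) (pos t (i + 1))" if "1 \<le> i" "i < n" for i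
    proof -
      have "t (pos t i) \<noteq> t (pos t (i + 1))" using std_tab_pos(2)[OF t] that by auto
      then show ?thesis using no before_total that by metis
    qed
    have mono: "before (pos t i) (pos t (i + Suc k))" if "1 \<le> i" "i + Suc k \<le> n" for i k
      using that
    proof (induction k)
      case (Suc k)
      then show ?case using step[of "i + Suc k"] before_trans by fastforce
    qed (use step in auto)
    obtain x y where xy: "x \<in> D" "y \<in> D" "before x y" "t y < t x" using inv by (auto simp: inversions_def)
    have "before (pos t (t y)) (pos t (t y + Suc (t x - t y - 1)))"
      by (rule mono) (use std_tab_pos(4)[OF t] xy in auto)
    then have "before y x" using std_tab_pos(3)[OF t] xy by simp
    then show False using xy before_asym by blast
  qed
  then obtain i where i: "1 \<le> i" "i < n" "before (pos t (i + 1)) (pos t i)" by blast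
  have "\<not> nle (pos t i) (pos t (i + 1))" using i(3) nle_before before_asym before_irrefl by metis
  then have "path l n (pos t \<circ> sw i)" using path_swap_iff(2)[OF std_tab_path(1)[OF t] i(1,2)] by simp
  then show ?thesis using std_tab_sw(1)[OF t i(1,2)] i by blast
qed

text \<open>Induction along the weak order: every standard tableau arises from \<open>t0\<close> by
  admissible swaps, each of which creates one inversion.\<close>

lemma std_tab_induct [consumes 3, case_names init step]:
  assumes t: "std_tab l n D t" and t0: "std_tab l n D t0" "inversions D t0 = {}"
    and init: "P t0"
    and step: "\<And>t i. std_tab l n D t \<Longrightarrow> std_tab l n D (sw i \<circ> t) \<Longrightarrow> 1 \<le> i \<Longrightarrow> i < n \<Longrightarrow>
      before (pos t i) (pos t (i + 1)) \<Longrightarrow> P t \<Longrightarrow> P (sw i \<circ> t)"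
  shows "P t"
  using t
proof (induction "inv_count D t" arbitrary: t rule: less_induct)
  case less
  show ?case
  proof (cases "inversions D t = {}")
    case True
    then show ?thesis using std_tab_no_inversions_unique[OF t0 less.prems] init by simp
  next
    case False
    then obtain i where i: "1 \<le> i" "i < n" "before (pos t (i + 1)) (pos t i)" "std_tab l n D (sw i \<circ> t)"
      using std_tab_descent[OF less.prems] by blast
    let ?s = "sw i \<circ> t"
    have b: "before (pos ?s i) (pos ?s (i + 1))" using i pos_sw[OF less.prems i(1,2)] by simp
    have "sw i \<circ> ?s = t" by (rule sw_sw)
    moreover from this have "inv_count D t = Suc (inv_count D ?s)" using inv_count_sw[OF i(4) i(1,2) b] by simp
    then have "P ?s" using less.hyps[OF _ i(4)] by simp
    ultimately show ?thesis using step[OF i(4) _ i(1,2) b] less.prems by simp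
  qed
qed

lemma finite_addable:
  assumes "finite D"
  shows "finite (addable l D)"
proof (rule finite_subset)
  show "addable l D \<subseteq> {..card D + 2} \<times> {..card D + 2} \<times> {..l}"
  proof
    fix x assume "x \<in> addable l D"
    then have D: "young_diagram l (insert x D)" by (simp add: addable_def)
    have "card {z \<in> insert x D. cmp z = cmp x} \<le> card (insert x D)" using assms by (intro card_mono) auto
    also have "\<dots> \<le> Suc (card D)" using assms by (simp add: card_insert_if)
    finally have "col x + row x \<le> card D + 2" using hook_card[OF D, of x x] by simp
    moreover have "cmp x \<le> l" using young_diagramD(1)[OF D, of x] by (simp add: valid_node_def)
    ultimately show "x \<in> {..card D + 2} \<times> {..card D + 2} \<times> {..l}" by (cases x) auto
  qed
qed auto

lemma young_diagram_path:
  assumes "young_diagram l D"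
  shows "\<exists>p. path l (card D) p \<and> p ` {1..card D} = D"
  using assms
proof (induction "card D" arbitrary: D)
  case 0
  then have "D = {}" by (simp add: young_diagram_def)
  then show ?case using 0 by (auto simp: path_def)
next
  case (Suc m)
  have fin: "finite D" using Suc.prems by (simp add: young_diagram_def)
  have "D \<noteq> {}" using Suc.hyps(2) by auto
  \<comment> \<open>Nothing lies above a node of maximal \<open>row + col\<close> in the node order,
    so removing it leaves a down-set.\<close>
  define f where "f x = row x + col x" for x :: node
  have "Max (f ` D) \<in> f ` D" using fin \<open>D \<noteq> {}\<close> by (intro Max_in) auto
  then obtain x where "x \<in> D" "f x = Max (f ` D)" by auto
  then have x: "x \<in> D" "\<And>y. y \<in> D \<Longrightarrow> row y + col y \<le> row x + col x"
    using fin Max_ge[of "f ` D"] by (auto simp: f_def)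
  have "young_diagram l (D - {x})"
    unfolding young_diagram_def
  proof (intro conjI ballI allI impI)
    fix z assume z: "z \<in> D - {x}"
    then show "valid_node l z" using young_diagramD(1)[OF Suc.prems] by blast
    fix y assume y: "valid_node l y" "nle y z"
    then have "y \<in> D" using young_diagramD(2)[OF Suc.prems, of z] z by blast
    moreover have "y \<noteq> x" using x(2)[of z] z y(2) by (auto simp: nle_def prod_eq_iff)
    ultimately show "y \<in> D - {x}" by simp
  qed (use fin in simp)
  moreover have c: "m = card (D - {x})" using Suc.hyps(2) fin x by simp
  ultimately obtain p where p: "path l m p" "p ` {1..m} = D - {x}" using Suc.hyps(1)[of "D - {x}"] by auto
  let ?q = "p(Suc m := x)"
  have "path l m ?q" using p(1) by (subst path_cong[of m _ p]) auto
  moreover have im: "?q ` {1..m} = D - {x}" using p(2) by auto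
  moreover have "x \<in> addable l (D - {x})"
    using x Suc.prems by (auto simp: addable_def insert_absorb)
  ultimately have "path l (Suc m) ?q" by (simp add: path_Suc)
  moreover have "?q ` {1..Suc m} = D" using im image_atLeastAtMost_Suc[of ?q m] x by auto
  ultimately show ?case using Suc.hyps(2) by metis
qed

lemma std_tab_no_inversions_exists:
  assumes t: "std_tab l n D t"
  shows "\<exists>t0. std_tab l n D t0 \<and> inversions D t0 = {}"
  using t
proof (induction "inv_count D t" arbitrary: t rule: less_induct)
  case less
  show ?case
  proof (cases "inversions D t = {}")
    case False
    then obtain i where i: "1 \<le> i" "i < n" "before (pos t (i + 1)) (pos t i)" "std_tab l n D (sw i \<circ> t)"
      using std_tab_descent[OF less.prems] by blast
    let ?s = "sw i \<circ> t"
    have "before (pos ?s i) (pos ?s (i + 1))" using i pos_sw[OF less.prems i(1,2)] by simp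
    from inv_count_sw[OF i(4) i(1,2) this] have "inv_count D ?s < inv_count D t" unfolding sw_sw by simp
    then show ?thesis using less.hyps[OF _ i(4)] by blast
  qed (use less in blast)
qed

text \<open>Both paths lead by admissible swaps to the tableau without inversions, and a swap can be
  undone. The hypothesis \<open>cong\<close> is there because passing from a path to its tableau and
  back preserves only the first \<open>m\<close> steps.\<close>

lemma path_connected:
  assumes p: "path l m p" and q: "path l m q" and im: "p ` {1..m} = q ` {1..m}"
    and P: "P p"
    and cong: "\<And>p q. (\<And>k. k \<in> {1..m} \<Longrightarrow> p k = q k) \<Longrightarrow> P p \<Longrightarrow> P q"
    and swap: "\<And>p i. path l m p \<Longrightarrow> path l m (p \<circ> sw i) \<Longrightarrow> p ` {1..m} = q ` {1..m} \<Longrightarrow> 1 \<le> i \<Longrightarrow> i < m \<Longrightarrow> P p \<Longrightarrow> P (p \<circ> sw i)"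
  shows "P q"
proof -
  let ?D = "q ` {1..m}"
  obtain t where t: "std_tab l m ?D t" "\<And>k. k \<in> {1..m} \<Longrightarrow> pos t k = p k"
    using path_std_tab[OF p] im by auto
  obtain t' where t': "std_tab l m ?D t'" "\<And>k. k \<in> {1..m} \<Longrightarrow> pos t' k = q k"
    using path_std_tab[OF q] by auto
  obtain t0 where t0: "std_tab l m ?D t0" "inversions ?D t0 = {}"
    using std_tab_no_inversions_exists[OF t(1)] by blast
  have adj: "P (pos (sw i \<circ> s)) \<longleftrightarrow> P (pos s)"
    if s: "std_tab l m ?D s" "std_tab l m ?D (sw i \<circ> s)" and i: "1 \<le> i" "i < m" for s i
  proof -
    have ps: "path l m (pos s)" and pss: "path l m (pos s \<circ> sw i)" and img: "pos s ` {1..m} = ?D"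
      using std_tab_path[OF s(1)] std_tab_sw(2)[OF s(1) i s(2)] by auto
    have eq: "pos (sw i \<circ> s) k = (pos s \<circ> sw i) k" if "k \<in> {1..m}" for k using pos_sw[OF s(1) i that] by simp
    have img': "(pos s \<circ> sw i) ` {1..m} = ?D"
      using eq std_tab_path(2)[OF s(2)] by (metis image_cong)
    have "P (pos s) \<Longrightarrow> P (pos s \<circ> sw i)" using swap[OF ps pss img i] .
    moreover have "P (pos s \<circ> sw i) \<Longrightarrow> P (pos s)"
      using swap[OF pss _ img' i] ps unfolding sw_sw_right by blast
    ultimately show ?thesis using cong[of "pos (sw i \<circ> s)" "pos s \<circ> sw i"] cong[of "pos s \<circ> sw i" "pos (sw i \<circ> s)"] eq
      by metis
  qed
  have all: "P (pos s) \<longleftrightarrow> P (pos t0)" if "std_tab l m ?D s" for s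
    using that t0
  proof (induction rule: std_tab_induct)
    case (step t i)
    then show ?case using adj[of t i] by blast
  qed simp
  have "P (pos t)" using P cong[of p "pos t"] t(2) by metis
  then have "P (pos t')" using all t(1) t'(1) by blast
  then show "P q" using cong[of "pos t'" q] t'(2) by metis
qed

section \<open>Neighbours of a newly added node\<close>

lemma addable_iff:
  assumes "young_diagram l D"
  shows "x \<in> addable l D \<longleftrightarrow> x \<notin> D \<and> valid_node l x \<and> (\<forall>y. valid_node l y \<longrightarrow> nle y x \<longrightarrow> y \<noteq> x \<longrightarrow> y \<in> D)"
proof
  assume "x \<in> addable l D"
  then have x: "x \<notin> D" "young_diagram l (insert x D)" by (auto simp: addable_def)
  then show "x \<notin> D \<and> valid_node l x \<and> (\<forall>y. valid_node l y \<longrightarrow> nle y x \<longrightarrow> y \<noteq> x \<longrightarrow> y \<in> D)"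
    using young_diagramD(1)[OF x(2), of x] young_diagramD(2)[OF x(2), of x] by blast
next
  assume *: "x \<notin> D \<and> valid_node l x \<and> (\<forall>y. valid_node l y \<longrightarrow> nle y x \<longrightarrow> y \<noteq> x \<longrightarrow> y \<in> D)"
  have "young_diagram l (insert x D)"
    unfolding young_diagram_def
  proof (intro conjI ballI allI impI)
    show "finite (insert x D)" using young_diagram_finite[OF assms] by simp
    fix z assume z: "z \<in> insert x D"
    then show "valid_node l z" using * young_diagramD(1)[OF assms] by blast
    fix y assume "valid_node l y" "nle y z"
    then show "y \<in> insert x D" using z * young_diagramD(2)[OF assms, of z y] by blast
  qed
  then show "x \<in> addable l D" using * by (simp add: addable_def)
qed

lemma young_diagram_remove:
  assumes D: "young_diagram l D" and max: "\<And>z. z \<in> D \<Longrightarrow> nle g z \<Longrightarrow> z = g"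
  shows "young_diagram l (D - {g})"
  unfolding young_diagram_def
proof (intro conjI ballI allI impI)
  show "finite (D - {g})" using D by (simp add: young_diagram_def)
  fix z assume z: "z \<in> D - {g}"
  then show "valid_node l z" using young_diagramD(1)[OF D] by blast
  fix y assume y: "valid_node l y" "nle y z"
  then show "y \<in> D - {g}" using young_diagramD(2)[OF D _ y] max[of z] z by auto
qed

text \<open>The right neighbour of \<open>b\<close> can only be blocked by a missing node above it
  in its own column. Then the node \<open>g\<close> above \<open>b\<close> ends its row, and it ends
  its column since \<open>b\<close> is not in \<open>D\<close>. So \<open>g\<close> is removable and
  has the content of the blocked neighbour.\<close>

lemma blocked_right:
  assumes D: "young_diagram l D" and b: "b \<in> addable l D"
    and no: "(row b, col b + 1, cmp b) \<notin> addable l (insert b D)"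
  shows "\<exists>g\<in>D. diag g = diag b + 1 \<and> nle g b \<and> young_diagram l (D - {g})"
proof -
  let ?r = "(row b, col b + 1, cmp b)" and ?g = "(row b - 1, col b, cmp b)"
  have vb: "valid_node l b" and nb: "b \<notin> D" using b addable_iff[OF D] by auto
  have D': "young_diagram l (insert b D)" using b by (simp add: addable_def)
  have rD: "?r \<notin> D"
    using young_diagramD(2)[OF D, of ?r b] vb nb by (auto simp: nle_def)
  moreover have "?r \<noteq> b" by (auto simp: prod_eq_iff)
  ultimately obtain y where y: "valid_node l y" "nle y ?r" "y \<noteq> ?r" "y \<notin> insert b D"
    using no vb addable_iff[OF D', of ?r] by (auto simp: valid_node_def)
  have "\<not> nle y b" using young_diagramD(2)[OF D' _ y(1), of b] y(4) by auto
  then have yc: "col y = col b + 1" "row y < row b" "cmp y = cmp b"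
    using y by (auto simp: nle_def prod_eq_iff)
  then have row: "1 \<le> row b - 1" using y(1) by (auto simp: valid_node_def)
  have "?g \<in> insert b D"
    using row vb by - (rule young_diagramD(2)[OF D', of b], auto simp: valid_node_def nle_def)
  moreover have "?g \<noteq> b" using row by (auto simp: prod_eq_iff)
  ultimately have g: "?g \<in> D" by simp
  have max: "z = ?g" if z: "z \<in> D" "nle ?g z" for z
  proof (rule ccontr)
    assume ne: "z \<noteq> ?g"
    have "\<not> nle b z" using young_diagramD(2)[OF D z(1) vb] nb by auto
    moreover have zg: "row b - 1 \<le> row z" "col b \<le> col z" "cmp z = cmp b" using z(2) by (auto simp: nle_def)
    ultimately have "row z = row b - 1" using row by (simp add: nle_def)
    moreover from this have "col z \<noteq> col b" using ne zg by (simp add: prod_eq_iff)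
    ultimately have "nle y z" using yc zg unfolding nle_def by linarith
    then show False using young_diagramD(2)[OF D z(1) y(1)] y(4) by auto
  qed
  have "diag ?g = diag b + 1" "nle ?g b" using row by (auto simp: diag_def nle_def)
  then show ?thesis using g young_diagram_remove[OF D max] by blast
qed

text \<open>The transposed situation, with \<open>g\<close> the left neighbour of
  \<open>b\<close>.\<close>

lemma blocked_below:
  assumes D: "young_diagram l D" and b: "b \<in> addable l D"
    and no: "(row b + 1, col b, cmp b) \<notin> addable l (insert b D)"
  shows "\<exists>g\<in>D. diag g = diag b - 1 \<and> nle g b \<and> young_diagram l (D - {g})"
proof -
  let ?r = "(row b + 1, col b, cmp b)" and ?g = "(row b, col b - 1, cmp b)"
  have vb: "valid_node l b" and nb: "b \<notin> D" using b addable_iff[OF D] by auto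
  have D': "young_diagram l (insert b D)" using b by (simp add: addable_def)
  have rD: "?r \<notin> D"
    using young_diagramD(2)[OF D, of ?r b] vb nb by (auto simp: nle_def)
  moreover have "?r \<noteq> b" by (auto simp: prod_eq_iff)
  ultimately obtain y where y: "valid_node l y" "nle y ?r" "y \<noteq> ?r" "y \<notin> insert b D"
    using no vb addable_iff[OF D', of ?r] by (auto simp: valid_node_def)
  have "\<not> nle y b" using young_diagramD(2)[OF D' _ y(1), of b] y(4) by auto
  then have yc: "row y = row b + 1" "col y < col b" "cmp y = cmp b"
    using y by (auto simp: nle_def prod_eq_iff)
  then have col: "1 \<le> col b - 1" using y(1) by (auto simp: valid_node_def)
  have "?g \<in> insert b D"
    using col vb by - (rule young_diagramD(2)[OF D', of b], auto simp: valid_node_def nle_def)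
  moreover have "?g \<noteq> b" using col by (auto simp: prod_eq_iff)
  ultimately have g: "?g \<in> D" by simp
  have max: "z = ?g" if z: "z \<in> D" "nle ?g z" for z
  proof (rule ccontr)
    assume ne: "z \<noteq> ?g"
    have "\<not> nle b z" using young_diagramD(2)[OF D z(1) vb] nb by auto
    moreover have zg: "col b - 1 \<le> col z" "row b \<le> row z" "cmp z = cmp b" using z(2) by (auto simp: nle_def)
    ultimately have "col z = col b - 1" using col by (simp add: nle_def)
    moreover from this have "row z \<noteq> row b" using ne zg by (simp add: prod_eq_iff)
    ultimately have "nle y z" using yc zg unfolding nle_def by linarith
    then show False using young_diagramD(2)[OF D z(1) y(1)] y(4) by auto
  qed
  have "diag ?g = diag b - 1" "nle ?g b" using col by (auto simp: diag_def nle_def)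
  then show ?thesis using g young_diagram_remove[OF D max] by blast
qed

text \<open>Equal content means the same diagonal of the same component, so such a node is
  comparable with \<open>b\<close>, and comparability forces equality. But \<open>b\<close> cannot
  be added while \<open>g\<close> is absent.\<close>

lemma content_not_addable_after_removal:
  fixes u :: "nat \<Rightarrow> 'k::field"
  assumes S: "separated l n u" and D: "young_diagram l D" and b: "b \<in> addable l D"
    and g: "g \<in> D" "nle g b" "diag g \<noteq> diag b" "young_diagram l (D - {g})"
    and card: "card D + 1 \<le> n" and a: "a \<in> addable l (D - {g})"
  shows "ct u a \<noteq> ct u b"
proof
  assume eq: "ct u a = ct u b"
  let ?E = "insert a (D - {g}) \<union> insert b D"
  have fin: "finite D" by (rule young_diagram_finite[OF D])
  have nb: "b \<notin> D" using b by (simp add: addable_def)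
  have E: "young_diagram l ?E" using a b by (intro young_diagram_Un) (auto simp: addable_def)
  have "?E \<subseteq> insert a (insert b D)" by auto
  then have "card ?E \<le> card (insert a (insert b D))" using fin by (intro card_mono) auto
  also have "\<dots> \<le> card D + 2" using fin by (simp add: card_insert_if)
  finally have c: "int (card ?E) + \<bar>0\<bar> \<le> int n + 1" using card by linarith
  have same: "cmp a = cmp b" "diag a = diag b"
    using content_separation[OF S E _ _ c, of a b] eq by auto
  have va: "valid_node l a" and vb: "valid_node l b" and vg: "valid_node l g"
    using young_diagramD(1)[OF E] g by auto
  have cmp: "nle a b \<or> nle b a" using same by (auto simp: nle_def diag_def)
  have "a = b"
  proof (rule ccontr)
    assume ne: "a \<noteq> b"
    show False
      using cmp
    proof
      assume "nle a b"
      then have "a \<in> insert b D" using young_diagramD(2)[of l "insert b D" b a] b va by (auto simp: addable_def)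
      then show False using a ne same g(3) by (auto simp: addable_def)
    next
      assume "nle b a"
      then have "b \<in> insert a (D - {g})" using young_diagramD(2)[of l "insert a (D - {g})" a b] a vb by (auto simp: addable_def)
      then show False using nb ne by auto
    qed
  qed
  then have "g \<in> insert b (D - {g})"
    using young_diagramD(2)[of l "insert a (D - {g})" a g] a vg g by (auto simp: addable_def)
  then show False using g by auto
qed

section \<open>Multipartitions and conjugation\<close>

lemma downclosed_nat_set:
  assumes "finite S" "\<And>a. a \<in> S \<Longrightarrow> 1 \<le> a" "\<And>a b. a \<in> S \<Longrightarrow> 1 \<le> b \<Longrightarrow> b \<le> a \<Longrightarrow> b \<in> S"
  shows "S = {1..card S}"
proof (cases "S = {}")
  case False
  define m where "m = Max S"
  have "m \<in> S" "\<And>a. a \<in> S \<Longrightarrow> a \<le> m" using assms(1) False by (auto simp: m_def)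
  then have "S = {1..m}" using assms(2,3) unfolding set_eq_iff atLeastAtMost_iff by blast
  then show ?thesis by (metis card_atLeastAtMost diff_Suc_1)
qed simp

definition conj_node :: "nat \<Rightarrow> node \<Rightarrow> node" where
  "conj_node l x = (col x, row x, l + 1 - cmp x)"

text \<open>Standard tableaux of every shape together: the index set of the idempotents.\<close>

definition tabs :: "nat \<Rightarrow> nat \<Rightarrow> tableau set" where
  "tabs l n = {t. \<exists>D. std_tab l n D t}"

lemma multipartition_antimono:
  assumes "multipartition l n lam" "1 \<le> a" "a \<le> b"
  shows "lam c b \<le> lam c a"
  using assms(3)
proof (induction b rule: dec_induct)
  case (step b)
  then have "lam c (Suc b) \<le> lam c b" using assms(1,2) by (simp add: multipartition_def)
  then show ?case using step by simp
qed simp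

lemma diagram_iff: "x \<in> diagram lam \<longleftrightarrow> 1 \<le> col x \<and> col x \<le> lam (cmp x) (row x)"
  by (cases x) (simp add: diagram_def)

section \<open>Multipartitions as down-sets of nodes\<close>

lemma card_diagram_part:
  assumes "finite C" "\<And>c. c \<in> C \<Longrightarrow> finite {i. lam c i \<noteq> 0}"
  shows "finite {x \<in> diagram lam. cmp x \<in> C}" "card {x \<in> diagram lam. cmp x \<in> C} = (\<Sum>c\<in>C. comp_size lam c)"
proof -
  let ?S = "SIGMA c:C. SIGMA i:{i. lam c i \<noteq> 0}. {1..lam c i}"
  let ?f = "\<lambda>(c, i, j). (i, j, c) :: node"
  have eq: "{x \<in> diagram lam. cmp x \<in> C} = ?f ` ?S"
    by (force simp: diagram_def image_iff)
  have inj: "inj_on ?f ?S" by (auto simp: inj_on_def)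
  have fin: "finite ?S" using assms by auto
  show "finite {x \<in> diagram lam. cmp x \<in> C}" unfolding eq using fin by (rule finite_imageI)
  show "card {x \<in> diagram lam. cmp x \<in> C} = (\<Sum>c\<in>C. comp_size lam c)"
    unfolding eq card_image[OF inj] comp_size_def using assms by (simp add: card_SigmaI)
qed

lemma multipartition_finite: "multipartition l n lam \<Longrightarrow> finite {i. lam c i \<noteq> 0}"
  by (simp add: multipartition_def)

lemma multipartition_valid: "multipartition l n lam \<Longrightarrow> x \<in> diagram lam \<Longrightarrow> valid_node l x"
proof -
  assume m: "multipartition l n lam" and x: "x \<in> diagram lam"
  then have "lam (cmp x) (row x) \<noteq> 0" by (auto simp: diagram_iff)
  then have "1 \<le> cmp x \<and> cmp x \<le> l \<and> 1 \<le> row x" using m unfolding multipartition_def by blast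
  then show ?thesis using x by (simp add: valid_node_def diagram_iff)
qed

lemma young_diagram_diagram:
  assumes m: "multipartition l n lam"
  shows "young_diagram l (diagram lam)" "card (diagram lam) = n"
proof -
  have eq: "diagram lam = {x \<in> diagram lam. cmp x \<in> {1..l}}"
    using multipartition_valid[OF m] by (auto simp: valid_node_def)
  have fin: "finite (diagram lam)"
    using card_diagram_part(1)[of "{1..l}" lam] multipartition_finite[OF m] eq by simp
  show "card (diagram lam) = n"
    using card_diagram_part(2)[of "{1..l}" lam] multipartition_finite[OF m] eq m by (simp add: multipartition_def)
  show "young_diagram l (diagram lam)"
    unfolding young_diagram_def
  proof (intro conjI ballI allI impI)
    fix x assume x: "x \<in> diagram lam"
    then show "valid_node l x" by (rule multipartition_valid[OF m])
    fix y assume y: "valid_node l y" "nle y x"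
    have "lam (cmp x) (row x) \<le> lam (cmp x) (row y)"
      using multipartition_antimono[OF m, of "row y" "row x"] y by (simp add: valid_node_def nle_def)
    then show "y \<in> diagram lam" using x y by (auto simp: diagram_iff valid_node_def nle_def)
  qed (rule fin)
qed

lemma diagram_row_length: "lam c i = card {j. (i, j, c) \<in> diagram lam}"
proof -
  have "{j. (i, j, c) \<in> diagram lam} = {1..lam c i}" by (auto simp: diagram_def)
  then show ?thesis by simp
qed

lemma diagram_inj: "diagram lam = diagram mu \<Longrightarrow> lam = mu"
  by (intro ext) (metis diagram_row_length)

lemma young_diagram_rows:
  assumes D: "young_diagram l D"
  shows "{j. (i, j, c) \<in> D} = {1..card {j. (i, j, c) \<in> D}}"
    and "{i. (i, j, c) \<in> D} = {1..card {i. (i, j, c) \<in> D}}"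
proof -
  have fin: "finite D" using D by (simp add: young_diagram_def)
  have val: "1 \<le> a \<and> 1 \<le> b \<and> 1 \<le> c \<and> c \<le> l" if "(a, b, c) \<in> D" for a b c
    using young_diagramD(1)[OF D that] by (simp add: valid_node_def)
  have down: "(a', b', c) \<in> D" if "(a, b, c) \<in> D" "1 \<le> a'" "a' \<le> a" "1 \<le> b'" "b' \<le> b" for a b a' b' c
    using young_diagramD(2)[OF D that(1), of "(a', b', c)"] that val[OF that(1)]
    by (simp add: valid_node_def nle_def)
  show "{j. (i, j, c) \<in> D} = {1..card {j. (i, j, c) \<in> D}}"
  proof (rule downclosed_nat_set)
    show "finite {j. (i, j, c) \<in> D}"
      by (rule finite_subset[OF _ finite_imageI[OF fin, of col]]) force
  qed (use val down in blast)+
  show "{i. (i, j, c) \<in> D} = {1..card {i. (i, j, c) \<in> D}}"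
  proof (rule downclosed_nat_set)
    show "finite {i. (i, j, c) \<in> D}"
      by (rule finite_subset[OF _ finite_imageI[OF fin, of row]]) force
  qed (use val down in blast)+
qed

lemma young_diagram_multipartition:
  assumes D: "young_diagram l D"
  shows "\<exists>lam. multipartition l (card D) lam \<and> diagram lam = D"
proof -
  define lam where "lam c i = card {j. (i, j, c) \<in> D}" for c i
  have rows: "(i, j, c) \<in> D \<longleftrightarrow> 1 \<le> j \<and> j \<le> lam c i" for i j c
    using young_diagram_rows(1)[OF D, of i c] unfolding lam_def by auto
  then have dia: "diagram lam = D" by (auto simp: diagram_def)
  have fin: "finite D" using D by (simp add: young_diagram_def)
  have val: "1 \<le> a \<and> 1 \<le> b \<and> 1 \<le> c \<and> c \<le> l" if "(a, b, c) \<in> D" for a b c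
    using young_diagramD(1)[OF D that] by (simp add: valid_node_def)
  have one: "lam c i \<noteq> 0 \<longleftrightarrow> (i, 1, c) \<in> D" for c i using rows[of i 1 c] by auto
  have finr: "finite {i. lam c i \<noteq> 0}" for c
  proof (rule finite_subset[OF _ finite_imageI[OF fin, of row]])
    show "{i. lam c i \<noteq> 0} \<subseteq> row ` D" unfolding one by force
  qed
  have anti: "lam c (Suc i) \<le> lam c i" if i: "1 \<le> i" for c i
  proof (cases "lam c (Suc i) = 0")
    case False
    then have "(Suc i, lam c (Suc i), c) \<in> D" by (simp add: rows)
    then have "(i, lam c (Suc i), c) \<in> D"
      using young_diagramD(2)[OF D, of "(Suc i, lam c (Suc i), c)" "(i, lam c (Suc i), c)"] i val
      by (simp add: valid_node_def nle_def)
    then show ?thesis by (simp add: rows)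
  qed simp
  have eq: "diagram lam = {x \<in> diagram lam. cmp x \<in> {1..l}}" using val by (auto simp: dia)
  have "(\<Sum>c=1..l. comp_size lam c) = card D"
    using card_diagram_part(2)[of "{1..l}" lam] finr eq dia by simp
  then have "multipartition l (card D) lam"
    unfolding multipartition_def using finr anti one val by blast
  then show ?thesis using dia by blast
qed

lemma Std_iff_std_tab:
  assumes m: "multipartition l n lam"
  shows "t \<in> Std n lam \<longleftrightarrow> std_tab l n (diagram lam) t"
proof
  assume t: "t \<in> Std n lam"
  have D: "young_diagram l (diagram lam)" by (rule young_diagram_diagram[OF m])
  have rowlt: "t (i, j, c) < t (i, j', c)" if "(i, j, c) \<in> diagram lam" "(i, j', c) \<in> diagram lam" "j < j'" for i j j' c
    using t that unfolding Std_def by blast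
  have collt: "t (i, j, c) < t (i', j, c)" if "(i, j, c) \<in> diagram lam" "(i', j, c) \<in> diagram lam" "i < i'" for i i' j c
    using t that unfolding Std_def by blast
  have "t x < t y" if xy: "x \<in> diagram lam" "y \<in> diagram lam" "nle x y" "x \<noteq> y" for x y
  proof -
    \<comment> \<open>The corner reached by moving along the row of \<open>x\<close> to the column
      of \<open>y\<close>. One leg uses strictness in rows, the other in columns, and at least one
      leg is not trivial.\<close>
    let ?z = "(row x, col y, cmp x)"
    have vx: "valid_node l x" "valid_node l y" using young_diagramD(1)[OF D] xy by auto
    have z: "?z \<in> diagram lam"
      using young_diagramD(2)[OF D xy(2), of ?z] vx xy(3) by (auto simp: valid_node_def nle_def)
    have "t x \<le> t ?z"
    proof (cases "col x = col y")
      case True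
      then have "?z = x" by (simp add: prod_eq_iff)
      then show ?thesis by simp
    next
      case False
      then show ?thesis using rowlt[of "row x" "col x" "cmp x" "col y"] xy z by (simp add: nle_def)
    qed
    moreover have "t ?z \<le> t y"
    proof (cases "row x = row y")
      case True
      then have "?z = y" using xy by (simp add: prod_eq_iff nle_def)
      then show ?thesis by simp
    next
      case False
      then show ?thesis using collt[of "row x" "col y" "cmp x" "row y"] xy z by (simp add: nle_def)
    qed
    moreover have "t x < t ?z \<or> t ?z < t y"
      using rowlt[of "row x" "col x" "cmp x" "col y"] collt[of "row x" "col y" "cmp x" "row y"] xy z
      by (auto simp: nle_def prod_eq_iff)
    ultimately show ?thesis by linarith
  qed
  then show "std_tab l n (diagram lam) t"
    using t D by (auto simp: Std_def tableaux_def std_tab_def)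
next
  assume t: "std_tab l n (diagram lam) t"
  then have lt: "t x < t y" if "x \<in> diagram lam" "y \<in> diagram lam" "nle x y" "x \<noteq> y" for x y
    using that by (auto simp: std_tab_def)
  show "t \<in> Std n lam"
    unfolding Std_def tableaux_def
    using t lt by (auto simp: std_tab_def nle_def)
qed

lemma std_tab_card: "std_tab l n D t \<Longrightarrow> card D = n"
  using bij_betw_same_card[of t D "{1..n}"] by (simp add: std_tab_def)

lemma std_tab_multipartition:
  assumes "std_tab l n D t"
  shows "\<exists>lam. multipartition l n lam \<and> diagram lam = D"
  using young_diagram_multipartition[of l D] assms std_tab_card[OF assms] by (simp add: std_tab_def)

lemma tabs_eq: "tabs l n = {t. \<exists>lam. multipartition l n lam \<and> t \<in> Std n lam}"
  using Std_iff_std_tab std_tab_multipartition unfolding tabs_def by blast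

lemma contents_eq: "contents l n u k = (\<lambda>t. content u t k) ` tabs l n"
  unfolding contents_def tabs_eq by blast

lemma finite_tabs: "finite (tabs l n)"
proof (rule finite_subset)
  let ?B = "{..n} \<times> {..n} \<times> {..l}"
  show "tabs l n \<subseteq> {t. \<forall>x. (x \<in> ?B \<longrightarrow> t x \<in> {..n}) \<and> (x \<notin> ?B \<longrightarrow> t x = 0)}"
  proof clarify
    fix t x assume "t \<in> tabs l n"
    then obtain D where t: "std_tab l n D t" by (auto simp: tabs_def)
    have D: "young_diagram l D" using t by (simp add: std_tab_def)
    have "x \<in> ?B" if x: "x \<in> D"
    proof -
      have "card {z \<in> D. cmp z = cmp x} \<le> n"
        using std_tab_card[OF t] card_mono[of D "{z \<in> D. cmp z = cmp x}"] D by (simp add: young_diagram_def)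
      then have "col x + row x \<le> Suc n" using hook_card[OF D x x] by simp
      then show ?thesis using young_diagramD(1)[OF D x] by (cases x) (auto simp: valid_node_def)
    qed
    then show "(x \<in> ?B \<longrightarrow> t x \<in> {..n}) \<and> (x \<notin> ?B \<longrightarrow> t x = 0)"
      using std_tab_pos(4)[OF t, of x] t by (cases "x \<in> D") (auto simp: std_tab_def)
  qed
  show "finite {t. \<forall>x. (x \<in> ?B \<longrightarrow> t x \<in> {..n}) \<and> (x \<notin> ?B \<longrightarrow> t x = 0)}"
    by (rule finite_set_of_finite_funs) auto
qed

text \<open>The nodes up to \<open>x\<close> in reading order are the earlier components, the
  earlier rows of its component and the initial part of its row: the three summands of
  \<open>tab_upper\<close>.\<close>

lemma tab_upper_rank:
  assumes m: "multipartition l n lam" and x: "x \<in> diagram lam"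
  shows "tab_upper lam x = card {y \<in> diagram lam. y = x \<or> before y x}"
proof -
  obtain i j c where xe: "x = (i, j, c)" by (cases x)
  let ?D = "diagram lam"
  have j: "1 \<le> j" "j \<le> lam c i" using x by (auto simp: xe diagram_def)
  have fin: "finite ?D" using young_diagram_diagram[OF m] by (simp add: young_diagram_def)
  have val: "1 \<le> row y \<and> 1 \<le> cmp y" if "y \<in> ?D" for y using multipartition_valid[OF m that] by (simp add: valid_node_def)
  let ?A = "{y \<in> ?D. cmp y \<in> {1..<c}}" and ?B = "{y \<in> ?D. cmp y = c \<and> row y \<in> {1..<i}}"
    and ?C = "{y \<in> ?D. cmp y = c \<and> row y = i \<and> col y \<le> j}"
  have "{y \<in> ?D. y = x \<or> before y x} = ?A \<union> (?B \<union> ?C)"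
    using val x by (auto simp: before_def xe prod_eq_iff)
  moreover have "card (?A \<union> (?B \<union> ?C)) = card ?A + card (?B \<union> ?C)"
    by (rule card_Un_disjoint) (use fin in auto)
  moreover have "card (?B \<union> ?C) = card ?B + card ?C"
    by (rule card_Un_disjoint) (use fin in auto)
  moreover have "card ?A = (\<Sum>c'\<in>{1..<c}. comp_size lam c')"
    by (rule card_diagram_part) (use multipartition_finite[OF m] in auto)
  moreover have "card ?B = (\<Sum>i'\<in>{1..<i}. lam c i')"
  proof -
    have "?B = (\<lambda>(a, b). (a, b, c)) ` (SIGMA a:{1..<i}. {1..lam c a})"
      by (force simp: diagram_def image_iff)
    moreover have "inj_on (\<lambda>(a, b). (a, b, c)) (SIGMA a:{1..<i}. {1..lam c a})" by (auto simp: inj_on_def)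
    ultimately show ?thesis by (simp add: card_image card_SigmaI)
  qed
  moreover have "card ?C = j"
  proof -
    have "?C = (\<lambda>b. (i, b, c)) ` {1..j}" using j by (force simp: diagram_def image_iff)
    moreover have "inj_on (\<lambda>b. (i, b, c)) {1..j}" by (auto simp: inj_on_def)
    ultimately show ?thesis by (simp add: card_image)
  qed
  ultimately show ?thesis using x by (simp add: tab_upper_def xe)
qed

lemma std_tab_exists:
  assumes D: "young_diagram l D" and c: "card D = n"
  shows "\<exists>t. std_tab l n D t"
  using young_diagram_path[OF D] path_std_tab[of l n] unfolding c by metis

text \<open>Proved by comparison: some tableau without inversions exists, and its entries are the
  same ranks.\<close>

lemma tab_upper_std:
  assumes m: "multipartition l n lam"
  shows "std_tab l n (diagram lam) (tab_upper lam)" "inversions (diagram lam) (tab_upper lam) = {}"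
proof -
  obtain t where t: "std_tab l n (diagram lam) t" "inversions (diagram lam) t = {}"
    using std_tab_exists[OF young_diagram_diagram[OF m]] std_tab_no_inversions_exists by blast
  have "tab_upper lam x = t x" for x
  proof (cases "x \<in> diagram lam")
    case True
    then show ?thesis using std_tab_rank[OF t True] tab_upper_rank[OF m True] by simp
  next
    case False
    then show ?thesis using t by (cases x) (auto simp: tab_upper_def std_tab_def)
  qed
  then have "tab_upper lam = t" by auto
  then show "std_tab l n (diagram lam) (tab_upper lam)" "inversions (diagram lam) (tab_upper lam) = {}"
    using t by auto
qed

section \<open>Conjugate nodes, diagrams and tableaux\<close>

lemma conj_node_conj_node: "valid_node l x \<Longrightarrow> conj_node l (conj_node l x) = x"
  by (auto simp: conj_node_def valid_node_def prod_eq_iff)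

lemma valid_conj_node: "valid_node l x \<Longrightarrow> valid_node l (conj_node l x)"
  by (auto simp: conj_node_def valid_node_def)

lemma nle_conj_node: "valid_node l x \<Longrightarrow> valid_node l y \<Longrightarrow> nle (conj_node l x) (conj_node l y) \<longleftrightarrow> nle x y"
  by (auto simp: conj_node_def valid_node_def nle_def)

lemma diag_conj_node: "diag (conj_node l x) = - diag x"
  by (simp add: diag_def conj_node_def)

text \<open>Transposition negates the diagonal, and the reversed negated parameters negate the rest.
  So conjugation negates all contents, in step with the passage from \<open>L\<close> to
  \<open>- L\<close>.\<close>

lemma ct_conj_node: "valid_node l x \<Longrightarrow> ct (\<lambda>j. - u (l + 1 - j)) (conj_node l x) = - ct u x"
  by (auto simp: ct_def diag_conj_node) (simp add: conj_node_def valid_node_def)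

lemma young_diagram_conj:
  assumes D: "young_diagram l D"
  shows "young_diagram l (conj_node l ` D)"
  unfolding young_diagram_def
proof (intro conjI ballI allI impI)
  fix x assume "x \<in> conj_node l ` D"
  then obtain z where z: "x = conj_node l z" "z \<in> D" by blast
  have vz: "valid_node l z" using young_diagramD(1)[OF D z(2)] .
  then show vx: "valid_node l x" using valid_conj_node z by simp
  fix y assume y: "valid_node l y" "nle y x"
  have "nle (conj_node l y) z"
    using nle_conj_node[OF y(1) vx] y(2) z(1) conj_node_conj_node[OF vz] by simp
  then have "conj_node l y \<in> D" using young_diagramD(2)[OF D z(2)] valid_conj_node[OF y(1)] by blast
  then show "y \<in> conj_node l ` D" using conj_node_conj_node[OF y(1)] by (metis imageI)
qed (use D in \<open>simp add: young_diagram_def\<close>)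

lemma inj_on_conj_node: "young_diagram l D \<Longrightarrow> inj_on (conj_node l) D"
  by (rule inj_on_inverseI[of _ "conj_node l"]) (simp add: conj_node_conj_node young_diagramD(1))

text \<open>Only the diagram is computed. Being a down-set, it belongs to some multipartition, and a
  multipartition is determined by its diagram.\<close>

lemma conj_diagram:
  assumes m: "multipartition l n lam"
  shows "multipartition l n (conj_mpart l lam)" "diagram (conj_mpart l lam) = conj_node l ` diagram lam"
proof -
  let ?D = "diagram lam"
  have D: "young_diagram l ?D" by (rule young_diagram_diagram[OF m])
  have "(j, i, c) \<in> diagram (conj_mpart l lam) \<longleftrightarrow> (j, i, c) \<in> conj_node l ` ?D" for i j c
  proof (cases "1 \<le> c \<and> c \<le> l \<and> 1 \<le> j")
    case True
    have "{i. 1 \<le> i \<and> j \<le> lam (l + 1 - c) i} = {i. (i, j, l + 1 - c) \<in> ?D}"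
      using True multipartition_valid[OF m, of "(_, j, l + 1 - c)"] by (auto simp: diagram_iff valid_node_def)
    then have "(j, i, c) \<in> diagram (conj_mpart l lam) \<longleftrightarrow> i \<in> {1..card {i. (i, j, l + 1 - c) \<in> ?D}}"
      using True by (simp add: diagram_iff[of "(j, i, c)"] conj_mpart_def)
    also have "\<dots> \<longleftrightarrow> (i, j, l + 1 - c) \<in> ?D"
      unfolding young_diagram_rows(2)[OF D, of j "l + 1 - c", symmetric] by simp
    also have "\<dots> \<longleftrightarrow> (j, i, c) \<in> conj_node l ` ?D"
    proof
      assume "(i, j, l + 1 - c) \<in> ?D"
      then show "(j, i, c) \<in> conj_node l ` ?D" using True by (intro image_eqI) (auto simp: conj_node_def)
    next
      assume "(j, i, c) \<in> conj_node l ` ?D"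
      then obtain z where z: "z \<in> ?D" "(j, i, c) = conj_node l z" by blast
      then have "z = (i, j, l + 1 - c)"
        using multipartition_valid[OF m z(1)] by (auto simp: conj_node_def valid_node_def prod_eq_iff)
      then show "(i, j, l + 1 - c) \<in> ?D" using z by simp
    qed
    finally show ?thesis .
  next
    case False
    then have "(j, i, c) \<notin> diagram (conj_mpart l lam)" by (auto simp: diagram_iff conj_mpart_def)
    moreover have "(j, i, c) \<notin> conj_node l ` ?D"
      using False young_diagramD(1)[OF young_diagram_conj[OF D], of "(j, i, c)"] by (auto simp: valid_node_def)
    ultimately show ?thesis by simp
  qed
  then show eq: "diagram (conj_mpart l lam) = conj_node l ` ?D" by auto
  have "card (conj_node l ` ?D) = n"
    using card_image[OF inj_on_conj_node[OF D]] young_diagram_diagram(2)[OF m] by simp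
  then obtain mu where "multipartition l n mu" "diagram mu = conj_node l ` ?D"
    using young_diagram_multipartition[OF young_diagram_conj[OF D]] by auto
  then show "multipartition l n (conj_mpart l lam)" using eq diagram_inj by metis
qed

lemma conj_tab_apply: "conj_tab l t x = (if 1 \<le> cmp x \<and> cmp x \<le> l then t (conj_node l x) else 0)"
  by (cases x) (simp add: conj_tab_def conj_node_def)

lemma conj_tab_std:
  assumes t: "std_tab l n D t"
  shows "std_tab l n (conj_node l ` D) (conj_tab l t)"
proof -
  have D: "young_diagram l D" using t by (simp add: std_tab_def)
  have ct: "conj_tab l t (conj_node l x) = t x" if "x \<in> D" for x
    using conj_node_conj_node[OF young_diagramD(1)[OF D that]] valid_conj_node[OF young_diagramD(1)[OF D that]]
    by (simp add: conj_tab_apply valid_node_def)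
  have "bij_betw (conj_tab l t) (conj_node l ` D) {1..n}"
  proof -
    have "bij_betw (conj_tab l t \<circ> conj_node l) D {1..n}"
      using t bij_betw_cong[of D t "conj_tab l t \<circ> conj_node l" "{1..n}"] ct by (simp add: std_tab_def)
    moreover have "bij_betw (conj_node l) D (conj_node l ` D)"
      using inj_on_conj_node[OF D] by (simp add: bij_betw_def)
    ultimately show ?thesis using bij_betw_comp_iff by blast
  qed
  moreover have "conj_tab l t x = 0" if x: "x \<notin> conj_node l ` D" for x
  proof (rule ccontr)
    assume ne: "conj_tab l t x \<noteq> 0"
    then have c: "1 \<le> cmp x" "cmp x \<le> l" "t (conj_node l x) \<noteq> 0" by (auto simp: conj_tab_apply split: if_splits)
    then have "conj_node l x \<in> D" using t by (auto simp: std_tab_def)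
    then have v: "valid_node l (conj_node l x)" using young_diagramD(1)[OF D] by blast
    then have "valid_node l x" using c by (auto simp: valid_node_def conj_node_def)
    then show False using x \<open>conj_node l x \<in> D\<close> conj_node_conj_node by (metis imageI)
  qed
  moreover have "conj_tab l t x < conj_tab l t y"
    if h: "x \<in> conj_node l ` D" "y \<in> conj_node l ` D" "nle x y" "x \<noteq> y" for x y
  proof -
    obtain a b where ab: "x = conj_node l a" "y = conj_node l b" "a \<in> D" "b \<in> D" using h by blast
    then have "nle a b" "a \<noteq> b" using h nle_conj_node young_diagramD(1)[OF D] by auto
    then show ?thesis using ab ct t by (auto simp: std_tab_def)
  qed
  ultimately show ?thesis using young_diagram_conj[OF D] by (auto simp: std_tab_def)
qed

lemma conj_conj_image: "young_diagram l D \<Longrightarrow> conj_node l ` conj_node l ` D = D"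
  using conj_node_conj_node young_diagramD(1) by (force simp: image_iff)

lemma conj_tab_conj_tab:
  assumes t: "std_tab l n D t"
  shows "conj_tab l (conj_tab l t) = t"
proof
  fix x
  have D: "young_diagram l D" using t by (simp add: std_tab_def)
  show "conj_tab l (conj_tab l t) x = t x"
  proof (cases "valid_node l x")
    case True
    then show ?thesis
      using conj_node_conj_node[OF True] valid_conj_node[OF True] by (simp add: conj_tab_apply valid_node_def)
  next
    case False
    then have "x \<notin> D" using young_diagramD(1)[OF D] by blast
    then have "t x = 0" using t by (simp add: std_tab_def)
    moreover have "conj_tab l (conj_tab l t) x = 0 \<or> conj_tab l (conj_tab l t) x = t x"
      by (cases x) (auto simp: conj_tab_def)
    ultimately show ?thesis by simp
  qed
qed

lemma pos_conj_tab:
  assumes t: "std_tab l n D t" and k: "k \<in> {1..n}"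
  shows "pos (conj_tab l t) k = conj_node l (pos t k)"
proof -
  have D: "young_diagram l D" using t by (simp add: std_tab_def)
  have p: "pos t k \<in> D" "t (pos t k) = k" using std_tab_pos[OF t] k by auto
  have "conj_tab l t (conj_node l (pos t k)) = k"
    using conj_node_conj_node[OF young_diagramD(1)[OF D p(1)]] valid_conj_node[OF young_diagramD(1)[OF D p(1)]] p
    by (simp add: conj_tab_apply valid_node_def)
  then show ?thesis using std_tab_pos(3)[OF conj_tab_std[OF t], of "conj_node l (pos t k)"] p by auto
qed

lemma conj_tab_sw: "1 \<le> i \<Longrightarrow> conj_tab l (sw i \<circ> t) = sw i \<circ> conj_tab l t"
  by (auto simp: fun_eq_iff conj_tab_apply transpose_def)

lemma conj_tab_tabs: "t \<in> tabs l n \<Longrightarrow> conj_tab l t \<in> tabs l n"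
  unfolding tabs_def using conj_tab_std by blast

lemma tab_lower_std:
  assumes m: "multipartition l n lam"
  shows "std_tab l n (diagram lam) (tab_lower l lam)" "conj_tab l (tab_lower l lam) = tab_upper (conj_mpart l lam)"
proof -
  have "std_tab l n (conj_node l ` diagram (conj_mpart l lam)) (tab_lower l lam)"
    unfolding tab_lower_def by (rule conj_tab_std[OF tab_upper_std(1)[OF conj_diagram(1)[OF m]]])
  then show "std_tab l n (diagram lam) (tab_lower l lam)"
    using conj_diagram(2)[OF m] conj_conj_image[OF young_diagram_diagram(1)[OF m]] by simp
  show "conj_tab l (tab_lower l lam) = tab_upper (conj_mpart l lam)"
    unfolding tab_lower_def by (rule conj_tab_conj_tab[OF tab_upper_std(1)[OF conj_diagram(1)[OF m]]])
qed

text \<open>Conjugation preserves the node order but reverses the reading order of incomparable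
  nodes. This exchanges inversions and non-inversions among the latter.\<close>

lemma before_conj_node:
  assumes "valid_node l x" "valid_node l y" "before x y" "\<not> nle x y" 
  shows "before (conj_node l y) (conj_node l x)"
  using assms by (auto simp: before_def conj_node_def valid_node_def nle_def)

lemma separated_conj:
  fixes u :: "nat \<Rightarrow> 'k::field"
  assumes "separated l n u"
  shows "separated l n (\<lambda>j. - u (l + 1 - j))"
  unfolding separated_def
proof (intro conjI ballI allI impI)
  fix a b :: nat and d :: int
  assume ab: "a \<in> {1..l}" "b \<in> {1..l}" "a \<noteq> b" "\<bar>d\<bar> < int n"
  have *: "\<forall>a\<in>{1..l}. \<forall>b\<in>{1..l}. a \<noteq> b \<longrightarrow> (\<forall>d::int. \<bar>d\<bar> < int n \<longrightarrow> of_int d + u a - u b \<noteq> 0)"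
    using assms by (simp add: separated_def)
  have "of_int d + u (l + 1 - b) - u (l + 1 - a) \<noteq> 0"
  proof (rule *[rule_format])
    show "l + 1 - b \<noteq> l + 1 - a" using ab by simp arith
  qed (use ab in auto)
  then show "of_int d + - u (l + 1 - a) - - u (l + 1 - b) \<noteq> 0" by (simp add: algebra_simps)
qed (use assms in \<open>simp add: separated_def\<close>)

section \<open>The spectrum of the Jucys-Murphy elements\<close>

text \<open>The relations live in an arbitrary ring, with a central scalar map
  \<open>\<kappa>\<close> in place of an algebra structure. Instances are the Hecke algebra, the
  same ring with \<open>- s\<close> and \<open>- L\<close>, rings of linear operators, and the
  ground field.\<close>

locale hecke_rel =
  fixes l n :: nat and u :: "nat \<Rightarrow> 'k::field"
    and \<kappa> :: "'k \<Rightarrow> 'r::ring_1" and s L :: "nat \<Rightarrow> 'r"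
  assumes kap_add: "\<kappa> (a + b) = \<kappa> a + \<kappa> b"
    and kap_mult: "\<kappa> (a * b) = \<kappa> a * \<kappa> b"
    and kap_1 [simp]: "\<kappa> 1 = 1"
    and kap_central: "\<kappa> a * x = x * \<kappa> a"
    and cyclotomic: "(\<Prod>j\<leftarrow>[1..<Suc l]. L 1 - \<kappa> (u j)) = 0"
    and s_sq: "1 \<le> i \<Longrightarrow> i < n \<Longrightarrow> s i * s i = 1"
    and s_comm: "1 \<le> i \<Longrightarrow> i < n \<Longrightarrow> 1 \<le> j \<Longrightarrow> j < n \<Longrightarrow> \<bar>int i - int j\<bar> > 1 \<Longrightarrow> s i * s j = s j * s i"
    and s_braid: "1 \<le> i \<Longrightarrow> i + 1 < n \<Longrightarrow> s i * s (i + 1) * s i = s (i + 1) * s i * s (i + 1)"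
    and L_comm: "1 \<le> i \<Longrightarrow> i \<le> n \<Longrightarrow> 1 \<le> k \<Longrightarrow> k \<le> n \<Longrightarrow> L i * L k = L k * L i"
    and s_L_comm: "1 \<le> i \<Longrightarrow> i < n \<Longrightarrow> 1 \<le> k \<Longrightarrow> k \<le> n \<Longrightarrow> k \<noteq> i \<Longrightarrow> k \<noteq> i + 1 \<Longrightarrow> s i * L k = L k * s i"
    and L_rec: "1 \<le> i \<Longrightarrow> i < n \<Longrightarrow> L (i + 1) = s i * L i * s i + s i"
begin

lemma kap_0 [simp]: "\<kappa> 0 = 0"
  using kap_add[of 0 0] by simp

lemma kap_uminus: "\<kappa> (- a) = - \<kappa> a"
  using kap_add[of "- a" a] by (simp add: eq_neg_iff_add_eq_0)

lemma kap_diff: "\<kappa> (a - b) = \<kappa> a - \<kappa> b"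
  using kap_add[of a "- b"] by (simp add: kap_uminus)

lemma kap_neg_one [simp]: "\<kappa> (- 1) = - 1"
  by (simp add: kap_uminus)

lemma kap_power: "\<kappa> (a ^ m) = \<kappa> a ^ m"
  by (induction m) (simp_all add: kap_mult)

lemma kap_of_nat: "\<kappa> (of_nat m) = of_nat m"
  by (induction m) (simp_all add: kap_add)

lemma kap_left_commute: "x * (\<kappa> a * y) = \<kappa> a * (x * y)"
  by (metis kap_central mult.assoc)

lemma kap_kap: "\<kappa> a * (\<kappa> b * x) = \<kappa> (a * b) * x"
  by (simp add: kap_mult mult.assoc)

lemmas L_kap = kap_left_commute[of "L _"]
lemmas s_kap = kap_left_commute[of "s _"]

lemma kap_zero_cancel:
  assumes "\<kappa> a * x = 0" "a \<noteq> 0"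
  shows "x = 0"
proof -
  have "\<kappa> (1 / a) * (\<kappa> a * x) = 0" using assms(1) by simp
  then show ?thesis using assms(2) by (simp add: kap_kap)
qed

section \<open>Products of linear factors and eigenvectors\<close>

definition ann :: "'r \<Rightarrow> 'k list \<Rightarrow> 'r" where
  "ann X cs = (\<Prod>c\<leftarrow>cs. X - \<kappa> c)"

lemma ann_simps [simp]: "ann X [] = 1" "ann X (c # cs) = (X - \<kappa> c) * ann X cs"
  by (simp_all add: ann_def)

lemma ann_append: "ann X (cs @ ds) = ann X cs * ann X ds"
  by (simp add: ann_def)

lemma linear_commute: "X * Y = Y * X \<Longrightarrow> (X - \<kappa> a) * (Y - \<kappa> b) = (Y - \<kappa> b) * (X - \<kappa> a)"
  by (simp add: algebra_simps kap_central[of a] kap_central[of b X])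

lemma commute_ann: "Z * X = X * Z \<Longrightarrow> Z * ann X cs = ann X cs * Z"
proof (induction cs)
  case (Cons c cs)
  have *: "Z * (X - \<kappa> c) = (X - \<kappa> c) * Z"
    using Cons.prems kap_central[of c Z] by (simp add: left_diff_distrib right_diff_distrib)
  have "Z * ann X (c # cs) = (Z * (X - \<kappa> c)) * ann X cs" by (simp add: mult.assoc)
  also have "\<dots> = (X - \<kappa> c) * (Z * ann X cs)" by (simp only: * mult.assoc)
  also have "\<dots> = (X - \<kappa> c) * (ann X cs * Z)" using Cons by simp
  finally show ?case by (simp add: mult.assoc)
qed simp

lemma linear_ann: "(X - \<kappa> c) * ann X cs = ann X cs * (X - \<kappa> c)"
  by (rule commute_ann) (simp add: left_diff_distrib right_diff_distrib kap_central[of c])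

lemma intertwine_ann:
  assumes "X * Z = Z * Y"
  shows "ann X cs * Z = Z * ann Y cs"
proof (induction cs)
  case (Cons c cs)
  have *: "(X - \<kappa> c) * Z = Z * (Y - \<kappa> c)"
    using assms kap_central[of c Z] by (simp add: left_diff_distrib right_diff_distrib)
  have "ann X (c # cs) * Z = (X - \<kappa> c) * (ann X cs * Z)" by (simp add: mult.assoc)
  also have "\<dots> = ((X - \<kappa> c) * Z) * ann Y cs" using Cons by (simp add: mult.assoc)
  also have "\<dots> = Z * ann Y (c # cs)" by (simp add: * mult.assoc)
  finally show ?case .
qed simp

lemma ann_remove: "c \<in> set cs \<Longrightarrow> ann X cs = (X - \<kappa> c) * ann X (remove1 c cs)"
proof (induction cs)
  case (Cons d cs)
  show ?case
  proof (cases "d = c")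
    case False
    then have "ann X (d # cs) = (X - \<kappa> d) * ((X - \<kappa> c) * ann X (remove1 c cs))" using Cons by simp
    also have "\<dots> = (X - \<kappa> c) * ((X - \<kappa> d) * ann X (remove1 c cs))"
      using linear_commute[of X X d c] by (metis mult.assoc)
    finally show ?thesis using False by simp
  qed simp
qed simp

lemma ann_perm: "mset cs = mset ds \<Longrightarrow> ann X cs = ann X ds"
proof (induction cs arbitrary: ds)
  case (Cons c cs)
  then have "c \<in> set ds" "mset cs = mset (remove1 c ds)"
    by (metis list.set_intros(1) set_mset_mset, metis mset_remove1 add_mset_remove_trivial mset.simps(2))
  then show ?case using Cons.IH[of "remove1 c ds"] ann_remove[of c ds X] by (simp only: ann_simps)
qed simp

lemma ann_eigen: "X * w = \<kappa> a * w \<Longrightarrow> ann X cs * w = \<kappa> (\<Prod>c\<leftarrow>cs. a - c) * w"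
proof (induction cs)
  case (Cons c cs)
  have "ann X (c # cs) * w = (X - \<kappa> c) * (\<kappa> (\<Prod>c\<leftarrow>cs. a - c) * w)"
    using Cons by (simp add: mult.assoc)
  also have "\<dots> = \<kappa> (\<Prod>c\<leftarrow>cs. a - c) * ((X - \<kappa> c) * w)" by (rule kap_left_commute)
  also have "(X - \<kappa> c) * w = \<kappa> (a - c) * w" using Cons.prems by (simp add: left_diff_distrib kap_diff)
  finally show ?case by (simp add: kap_kap mult.commute)
qed simp

lemma ann_eigen_zero:
  assumes "X * w = \<kappa> a * w" "a \<in> set cs"
  shows "ann X cs * w = 0"
proof -
  have "(\<Prod>c\<leftarrow>cs. a - c) = 0" using assms(2) by (auto simp: prod_list_zero_iff)
  then show ?thesis using ann_eigen[OF assms(1)] by simp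
qed

lemma ann_eigen_nonzero:
  assumes "X * w = \<kappa> a * w" "a \<notin> set cs" "ann X cs * w = 0"
  shows "w = 0"
proof -
  have "(\<Prod>c\<leftarrow>cs. a - c) \<noteq> 0" using assms(2) by (auto simp: prod_list_zero_iff)
  then show ?thesis using ann_eigen[OF assms(1)] kap_zero_cancel assms(3) by metis
qed

text \<open>Induction on the roots: apply \<open>X - c\<close> to \<open>v\<close>, decompose the
  result and divide its part of eigenvalue \<open>d\<close> by \<open>d - c\<close>; what remains of
  \<open>v\<close> is an eigenvector for \<open>c\<close>. The property \<open>Q\<close> is carried
  along so that the components keep the weight of \<open>v\<close> for the earlier
  \<open>L j\<close>.\<close>

lemma eigen_decomposition:
  assumes "distinct cs" "ann X cs * v = 0" "Q v"
    and Q: "\<And>w. Q w \<Longrightarrow> Q (X * w)" "\<And>c w. Q w \<Longrightarrow> Q (\<kappa> c * w)"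
      "\<And>w w'. Q w \<Longrightarrow> Q w' \<Longrightarrow> Q (w + w')" "\<And>w w'. Q w \<Longrightarrow> Q w' \<Longrightarrow> Q (w - w')"
  shows "\<exists>f. v = (\<Sum>c\<in>set cs. f c) \<and> (\<forall>c\<in>set cs. X * f c = \<kappa> c * f c \<and> Q (f c))"
  using assms(1-3)
proof (induction cs arbitrary: v)
  case (Cons c cs)
  have Q0: "Q 0" using Q(2)[OF Cons.prems(3), of 0] by simp
  let ?w = "(X - \<kappa> c) * v"
  have "ann X cs * ?w = 0" using Cons.prems(2) linear_ann[of X c cs] by (simp add: mult.assoc[symmetric])
  moreover have "Q ?w" using Q Cons.prems(3) by (simp add: left_diff_distrib)
  ultimately obtain g where g: "?w = (\<Sum>d\<in>set cs. g d)" "\<And>d. d \<in> set cs \<Longrightarrow> X * g d = \<kappa> d * g d \<and> Q (g d)"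
    using Cons.IH[of ?w] Cons.prems(1) by auto
  define h where "h d = \<kappa> (1 / (d - c)) * g d" for d
  have ne: "d \<noteq> c" if "d \<in> set cs" for d using that Cons.prems(1) by auto
  have Xh: "X * h d = \<kappa> d * h d" if "d \<in> set cs" for d
  proof -
    have "X * h d = \<kappa> (1 / (d - c)) * (X * g d)" unfolding h_def by (rule kap_left_commute)
    also have "\<dots> = \<kappa> d * h d" using g(2)[OF that] by (simp add: h_def kap_kap)
    finally show ?thesis .
  qed
  have lin: "(X - \<kappa> c) * h d = g d" if "d \<in> set cs" for d
  proof -
    have "(X - \<kappa> c) * h d = \<kappa> (d - c) * h d" using Xh[OF that] by (simp add: left_diff_distrib kap_diff)
    then show ?thesis using ne[OF that] by (simp add: h_def kap_kap)
  qed
  let ?r = "v - (\<Sum>d\<in>set cs. h d)"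
  have "(X - \<kappa> c) * ?r = 0"
    using lin by (simp add: right_diff_distrib sum_distrib_left g(1) del: left_diff_distrib)
  then have Xr: "X * ?r = \<kappa> c * ?r" by (simp add: left_diff_distrib)
  have "Q (\<Sum>d\<in>A. h d)" if "A \<subseteq> set cs" for A
    using finite_subset[OF that finite_set] that
  proof (induction A rule: finite_induct)
    case (insert d A)
    then show ?case using Q(3)[of "h d"] Q(2) g(2) by (simp add: h_def)
  qed (simp add: Q0)
  then have Qr: "Q ?r" using Q(4) Cons.prems(3) by blast
  have c: "c \<notin> set cs" using Cons.prems(1) by simp
  have "(\<Sum>d\<in>set cs. (h(c := ?r)) d) = (\<Sum>d\<in>set cs. h d)"
    using c by (intro sum.cong) auto
  then have "v = (\<Sum>d\<in>set (c # cs). (h(c := ?r)) d)"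
    using c by simp
  moreover have "X * (h(c := ?r)) d = \<kappa> d * (h(c := ?r)) d \<and> Q ((h(c := ?r)) d)" if "d \<in> set (c # cs)" for d
    using that Xh Xr Qr g(2) Q(2) c by (cases "d = c") (auto simp: h_def)
  ultimately show ?case by blast
qed (simp add: ann_def)

text \<open>Vectors are elements of the ring itself, on which the \<open>L j\<close> act by left
  multiplication.\<close>

definition weight :: "nat \<Rightarrow> (nat \<Rightarrow> 'k) \<Rightarrow> 'r \<Rightarrow> bool" where
  "weight m a v \<longleftrightarrow> (\<forall>j\<in>{1..m}. L j * v = \<kappa> (a j) * v)"

lemma weight_zero [simp]: "weight m a 0" by (simp add: weight_def)

lemma weight_add: "weight m a v \<Longrightarrow> weight m a w \<Longrightarrow> weight m a (v + w)"
  by (simp add: weight_def distrib_left)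

lemma weight_diff: "weight m a v \<Longrightarrow> weight m a w \<Longrightarrow> weight m a (v - w)"
  by (simp add: weight_def right_diff_distrib)

lemma weight_kap: "weight m a v \<Longrightarrow> weight m a (\<kappa> c * v)"
  by (simp add: weight_def L_kap kap_kap mult.commute)

lemma weight_commute:
  assumes "\<And>j. 1 \<le> j \<Longrightarrow> j \<le> m \<Longrightarrow> L j * z = z * L j" "weight m a v"
  shows "weight m a (z * v)"
  unfolding weight_def
proof
  fix j assume j: "j \<in> {1..m}"
  have "L j * (z * v) = z * (L j * v)" using assms(1)[of j] j by (simp add: mult.assoc[symmetric])
  also have "\<dots> = \<kappa> (a j) * (z * v)" using assms(2) j by (simp add: weight_def kap_left_commute)
  finally show "L j * (z * v) = \<kappa> (a j) * (z * v)" .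
qed

lemma weight_L: "weight m a v \<Longrightarrow> m \<le> n \<Longrightarrow> 1 \<le> k \<Longrightarrow> k \<le> n \<Longrightarrow> weight m a (L k * v)"
  by (rule weight_commute) (auto intro: L_comm)

lemma weight_cong: "(\<And>j. 1 \<le> j \<Longrightarrow> j \<le> m \<Longrightarrow> a j = b j) \<Longrightarrow> weight m a v = weight m b v"
  by (simp add: weight_def)

lemma weight_mono: "weight m a v \<Longrightarrow> k \<le> m \<Longrightarrow> weight k a v"
  by (simp add: weight_def)

lemma weight_Suc: "weight (Suc m) a v \<longleftrightarrow> weight m a v \<and> L (Suc m) * v = \<kappa> (a (Suc m)) * v"
  unfolding weight_def by (auto simp: le_Suc_eq Ball_def)

lemma L_s: "1 \<le> i \<Longrightarrow> i < n \<Longrightarrow> L i * s i = s i * L (i + 1) - 1"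
  using L_rec[of i] s_sq[of i] by (simp add: distrib_left mult.assoc[symmetric])

lemma L_s': "1 \<le> i \<Longrightarrow> i < n \<Longrightarrow> L (i + 1) * s i = s i * L i + 1"
  using L_rec[of i] s_sq[of i] by (simp add: distrib_right mult.assoc)

text \<open>The usual intertwiner. Because of the constant in
  \<open>L i * s i = s i * L (i + 1) - 1\<close>, the reflection has to be corrected by the inverse
  difference of the eigenvalues before it exchanges them.\<close>

lemma weight_swap:
  assumes i: "1 \<le> i" "i < m" and m: "m \<le> n" and w: "weight m a w" and ne: "a i \<noteq> a (i + 1)"
  shows "weight m (a \<circ> sw i) (s i * w - \<kappa> (1 / (a (i + 1) - a i)) * w)"
  unfolding weight_def
proof
  fix j assume j: "j \<in> {1..m}"
  define \<rho> where "\<rho> = 1 / (a (i + 1) - a i)"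
  have \<rho>: "\<rho> * (a (i + 1) - a i) = 1" using ne by (simp add: \<rho>_def)
  have wt: "L k * w = \<kappa> (a k) * w" if "k \<in> {1..m}" for k using w that by (simp add: weight_def)
  have wi: "L i * w = \<kappa> (a i) * w" "L (i + 1) * w = \<kappa> (a (i + 1)) * w" using wt i by auto
  consider "j = i" | "j = i + 1" | "j \<noteq> i" "j \<noteq> i + 1" by blast
  then have "L j * (s i * w - \<kappa> \<rho> * w) = \<kappa> ((a \<circ> sw i) j) * (s i * w - \<kappa> \<rho> * w)"
  proof cases
    case 1
    have "L i * (s i * w) = (s i * L (i + 1) - 1) * w" using L_s[of i] i m by (simp add: mult.assoc[symmetric])
    also have "\<dots> = \<kappa> (a (i + 1)) * (s i * w) - w"
      using wi by (simp add: left_diff_distrib mult.assoc L_kap s_kap)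
    finally have "L i * (s i * w - \<kappa> \<rho> * w) = \<kappa> (a (i + 1)) * (s i * w) - w - \<kappa> (\<rho> * a i) * w"
      using wi by (simp add: right_diff_distrib L_kap s_kap kap_kap)
    also have "\<dots> = \<kappa> (a (i + 1)) * (s i * w) - \<kappa> (1 + \<rho> * a i) * w"
      by (simp add: kap_add distrib_right)
    also have "1 + \<rho> * a i = a (i + 1) * \<rho>" using \<rho> by (simp add: algebra_simps)
    finally show ?thesis using 1 by (simp add: right_diff_distrib kap_kap)
  next
    case 2
    have "L (i + 1) * (s i * w) = (s i * L i + 1) * w" using L_s'[of i] i m by (simp add: mult.assoc[symmetric])
    also have "\<dots> = \<kappa> (a i) * (s i * w) + w"
      using wi by (simp add: distrib_right mult.assoc L_kap s_kap)
    finally have "L (i + 1) * (s i * w - \<kappa> \<rho> * w) = \<kappa> (a i) * (s i * w) + w - \<kappa> (\<rho> * a (i + 1)) * w"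
      using wi by (simp add: right_diff_distrib L_kap s_kap kap_kap)
    also have "\<dots> = \<kappa> (a i) * (s i * w) - \<kappa> (\<rho> * a (i + 1) - 1) * w"
      by (simp add: kap_diff left_diff_distrib)
    also have "\<rho> * a (i + 1) - 1 = a i * \<rho>" using \<rho> by (simp add: algebra_simps)
    finally show ?thesis using 2 by (simp add: right_diff_distrib kap_kap)
  next
    case 3
    have "L j * (s i * w) = s i * (L j * w)"
      using s_L_comm[of i j] 3 i j m by (simp add: mult.assoc[symmetric])
    then have "L j * (s i * w - \<kappa> \<rho> * w) = \<kappa> (a j) * (s i * w) - \<kappa> (\<rho> * a j) * w"
      using wt[OF j] by (simp add: right_diff_distrib L_kap s_kap kap_kap)
    then show ?thesis using 3 by (simp add: right_diff_distrib kap_kap mult.commute)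
  qed
  then show "L j * (s i * w - \<kappa> (1 / (a (i + 1) - a i)) * w) =
      \<kappa> ((a \<circ> sw i) j) * (s i * w - \<kappa> (1 / (a (i + 1) - a i)) * w)"
    by (simp only: \<rho>_def)
qed

text \<open>If the intertwined vector vanishes, \<open>s i\<close> acts on \<open>w\<close> by
  \<open>r\<close>, and \<open>s i * s i = 1\<close> forces \<open>r * r = 1\<close> unless
  \<open>w\<close> is zero.\<close>

lemma swap_zero:
  assumes i: "1 \<le> i" "i < n" and z: "s i * w - \<kappa> r * w = 0" and r: "r \<noteq> 1" "r \<noteq> - 1"
  shows "w = 0"
proof -
  have "s i * w = \<kappa> r * w" using z by simp
  then have "s i * (s i * w) = \<kappa> (r * r) * w" by (simp add: L_kap s_kap kap_kap)
  then have "w = \<kappa> (r * r) * w" using s_sq[OF i] by (simp add: mult.assoc[symmetric])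
  then have "\<kappa> (1 - r * r) * w = 0" by (simp add: kap_diff left_diff_distrib)
  moreover have "1 - r * r \<noteq> 0" using r by (metis right_minus_eq square_eq_1_iff)
  ultimately show ?thesis by (rule kap_zero_cancel)
qed

text \<open>Under these sign assumptions the two sides of the braid relation act on \<open>w\<close>
  by \<open>e\<close> and by \<open>- e\<close>.\<close>

lemma braid_zero:
  assumes k: "1 \<le> k" "k + 1 < n" and w: "s k * w = \<kappa> (- e) * w" "s (k + 1) * w = \<kappa> e * w"
    and e: "e = 1 \<or> e = - 1" and two: "(2 :: 'k) \<noteq> 0"
  shows "w = 0"
proof -
  have "s k * (s (k + 1) * (s k * w)) = \<kappa> e * w"
    using w e by (auto simp: kap_uminus)
  moreover have "s (k + 1) * (s k * (s (k + 1) * w)) = \<kappa> (- e) * w"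
    using w e by (auto simp: kap_uminus)
  moreover have "s k * (s (k + 1) * (s k * w)) = s (k + 1) * (s k * (s (k + 1) * w))"
    using s_braid[OF k] by (simp add: mult.assoc[symmetric])
  ultimately have "\<kappa> e * w = \<kappa> (- e) * w" by simp
  then have "\<kappa> (e + e) * w = \<kappa> (e + - e) * w" by (simp only: kap_add distrib_right)
  then have "\<kappa> (e + e) * w = 0" by simp
  moreover have "e + e \<noteq> 0" using e two by auto
  ultimately show ?thesis by (rule kap_zero_cancel)
qed

end

locale hecke_separated = hecke_rel +
  assumes separated: "separated l n u"
begin

text \<open>The inductive statement about the spectrum. It is proved for \<open>k + 1\<close> from
  its cases \<open>k\<close> and \<open>k - 1\<close>, the latter because the braid relation reaches
  two steps back.\<close>

definition local_spectrum :: "nat \<Rightarrow> bool" where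
  "local_spectrum k \<longleftrightarrow> (\<forall>p v xs. path l (k - 1) p \<longrightarrow> weight (k - 1) (ct u \<circ> p) v \<longrightarrow>
     distinct xs \<longrightarrow> set xs = addable l (p ` {1..k - 1}) \<longrightarrow> ann (L k) (map (ct u) xs) * v = 0)"

lemma addable_list: "young_diagram l D \<Longrightarrow> \<exists>xs. distinct xs \<and> set xs = addable l D"
  using finite_distinct_list[OF finite_addable, of D l] by (auto simp: young_diagram_def)

text \<open>The nodes addable to the empty diagram are the corners of the components, with contents
  \<open>u c\<close>, so this is the cyclotomic relation.\<close>

lemma local_spectrum_1: "local_spectrum 1"
  unfolding local_spectrum_def
proof (intro allI impI)
  fix p :: "nat \<Rightarrow> node" and v and xs :: "node list"
  assume xs: "distinct xs" "set xs = addable l (p ` {1..1 - 1})"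
  define ys where "ys = map (\<lambda>c. (1, 1, c) :: node) [1..<Suc l]"
  have "addable l {} = (\<lambda>c. (1, 1, c)) ` {1..l}"
  proof (intro equalityI subsetI)
    fix x assume x: "x \<in> addable l {}"
    then have v: "valid_node l x" by (simp add: addable_iff)
    have "(1, 1, cmp x) = x"
    proof (rule ccontr)
      assume "(1, 1, cmp x) \<noteq> x"
      moreover have "valid_node l (1, 1, cmp x)" "nle (1, 1, cmp x) x" using v by (auto simp: valid_node_def nle_def)
      ultimately show False using x by (simp add: addable_iff)
    qed
    then show "x \<in> (\<lambda>c. (1, 1, c)) ` {1..l}" using v by (intro image_eqI[of _ _ "cmp x"]) (auto simp: valid_node_def)
  next
    fix x assume "x \<in> (\<lambda>c. (1::nat, 1::nat, c)) ` {1..l}"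
    then show "x \<in> addable l {}" by (auto simp: addable_iff valid_node_def nle_def)
  qed
  moreover have "set ys = (\<lambda>c. (1, 1, c)) ` {1..l}" by (auto simp: ys_def simp del: upt_Suc)
  moreover have "p ` {1..1 - 1} = {}" by simp
  ultimately have "set ys = set xs" using xs(2) by metis
  moreover have "distinct ys" by (simp add: ys_def distinct_map inj_on_def del: upt_Suc)
  ultimately have "mset xs = mset ys" using xs(1) set_eq_iff_mset_eq_distinct by metis
  then have "ann (L 1) (map (ct u) xs) = ann (L 1) (map (ct u) ys)" by (intro ann_perm) simp
  also have "\<dots> = (\<Prod>j\<leftarrow>[1..<Suc l]. L 1 - \<kappa> (u j))"
    by (simp add: ann_def ys_def comp_def ct_def diag_def del: upt_Suc)
  finally show "ann (L 1) (map (ct u) xs) * v = 0" using cyclotomic by simp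
qed

lemma local_spectrumD:
  assumes "local_spectrum k" "path l (k - 1) p" "weight (k - 1) (ct u \<circ> p) v"
    "distinct xs" "set xs = addable l (p ` {1..k - 1})"
  shows "ann (L k) (map (ct u) xs) * v = 0"
  using assms unfolding local_spectrum_def by blast

lemma local_spectrum_not_addable:
  assumes T: "local_spectrum k" and p: "path l (k - 1) p" and w: "weight (k - 1) (ct u \<circ> p) w"
    and Lw: "L k * w = \<kappa> a * w" and a: "a \<notin> ct u ` addable l (p ` {1..k - 1})"
  shows "w = 0"
proof -
  obtain xs where xs: "distinct xs" "set xs = addable l (p ` {1..k - 1})"
    using addable_list[OF pathD[OF p order_refl]] by blast
  have "ann (L k) (map (ct u) xs) * w = 0" by (rule local_spectrumD[OF T p w xs])
  moreover have "a \<notin> set (map (ct u) xs)" using a xs(2) by simp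
  ultimately show ?thesis using ann_eigen_nonzero[OF Lw] by blast
qed

lemma addable_content_inj:
  assumes x: "x \<in> addable l D" and y: "y \<in> addable l D" and card: "card D + 1 \<le> n" and eq: "ct u x = ct u y"
  shows "x = y"
  using addable_separation[OF separated x y, of 0] card eq by fastforce

text \<open>With equal eigenvalues \<open>L k - \<kappa> (ct u b)\<close> maps
  \<open>s k * w\<close> to \<open>- w\<close> and then to 0: a Jordan block of size two. The
  annihilating product of \<open>local_spectrum\<close> has simple roots and excludes it.\<close>

lemma equal_weights_zero:
  assumes k: "1 \<le> k" "k < n" and T: "local_spectrum k" and p: "path l (k - 1) p"
    and w: "weight (k - 1) (ct u \<circ> p) w" and b: "b \<in> addable l (p ` {1..k - 1})"
    and Lk: "L k * w = \<kappa> (ct u b) * w" and Lk1: "L (k + 1) * w = \<kappa> (ct u b) * w"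
  shows "w = 0"
proof -
  obtain xs where xs: "distinct xs" "set xs = addable l (p ` {1..k - 1}) - {b}"
    using finite_distinct_list[of "addable l (p ` {1..k - 1}) - {b}"] finite_addable by auto
  let ?z = "s k * w"
  have "weight (k - 1) (ct u \<circ> p) ?z"
    by (rule weight_commute[OF _ w]) (use s_L_comm[of k] k in auto)
  then have "ann (L k) (map (ct u) (xs @ [b])) * ?z = 0"
    by (rule local_spectrumD[OF T p]) (use xs b in auto)
  moreover have "ann (L k) (map (ct u) (xs @ [b])) * ?z = ann (L k) (map (ct u) xs) * ((L k - \<kappa> (ct u b)) * ?z)"
    by (simp add: ann_append mult.assoc)
  moreover have "(L k - \<kappa> (ct u b)) * ?z = - w"
  proof -
    have "L k * ?z = (s k * L (k + 1) - 1) * w" using L_s[of k] k by (simp add: mult.assoc[symmetric])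
    also have "\<dots> = \<kappa> (ct u b) * ?z - w" using Lk1 by (simp add: left_diff_distrib mult.assoc s_kap)
    finally show ?thesis by (simp add: left_diff_distrib)
  qed
  ultimately have "ann (L k) (map (ct u) xs) * w = 0" by simp
  moreover have "ct u b \<notin> set (map (ct u) xs)"
  proof
    assume "ct u b \<in> set (map (ct u) xs)"
    then obtain x where "x \<in> addable l (p ` {1..k - 1})" "x \<noteq> b" "ct u x = ct u b" using xs(2) by force
    then show False using addable_content_inj[of x "p ` {1..k - 1}" b] b path_card[OF p order_refl] k by auto
  qed
  ultimately show ?thesis using ann_eigen_nonzero[OF Lk] by blast
qed

text \<open>An admissible swap makes both nodes addable to the same diagram.\<close>

lemma path_swap_content:
  assumes p: "path l m p" "path l m (p \<circ> sw i)" and i: "1 \<le> i" "i < m" and m: "m \<le> n" and e: "\<bar>e\<bar> \<le> 1"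
  shows "ct u (p (i + 1)) - ct u (p i) \<noteq> of_int e"
proof -
  have a: "p (i + 1) \<in> addable l (p ` {1..i - 1})" using path_swap_iff(3)[OF p(1) i] p(2) by simp
  have b: "p i \<in> addable l (p ` {1..i - 1})" using path_addable[OF p(1), of i] i by simp
  have ne: "p (i + 1) \<noteq> p i" using p(1) i by (auto simp: path_def dest: inj_onD)
  have "card (p ` {1..i - 1}) = i - 1" using path_card[OF p(1)] i by simp
  then have "ct u (p (i + 1)) - ct u (p i) + of_int (- e) \<noteq> 0"
    using addable_separation[OF separated a b ne, of "- e"] e i m by simp
  then show ?thesis by simp
qed

text \<open>Write \<open>b\<close> for \<open>p k\<close> and choose a path that adds
  \<open>g\<close> immediately before \<open>b\<close>. The weights at \<open>k - 1\<close>,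
  \<open>k\<close>, \<open>k + 1\<close> are then \<open>ct u b + \<epsilon>\<close>,
  \<open>ct u b\<close>, \<open>ct u b + \<epsilon>\<close>. Neither adjacent pair can be exchanged,
  so the two reflections act by opposite signs, against the braid relation. Admissible swaps carry
  the conclusion back to the given path.\<close>

lemma blocked_zero:
  assumes k: "1 \<le> k" "k + 1 \<le> n" and T: "local_spectrum k" and T': "2 \<le> k \<Longrightarrow> local_spectrum (k - 1)"
    and p: "path l k p" and g: "g \<in> p ` {1..k - 1}" "diag g = diag (p k) + e" "nle g (p k)"
      "young_diagram l (p ` {1..k - 1} - {g})" and e: "e = 1 \<or> e = - 1"
    and w: "weight k (ct u \<circ> p) w" and Lw: "L (k + 1) * w = \<kappa> (ct u (p k) + of_int e) * w"
  shows "w = 0"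
proof -
  define D where "D = p ` {1..k - 1}"
  define b where "b = p k"
  define \<epsilon> :: 'a where "\<epsilon> = of_int e"
  have \<epsilon>: "\<epsilon> = 1 \<or> \<epsilon> = - 1" using e by (auto simp: \<epsilon>_def)
  then have \<epsilon>0: "\<epsilon> \<noteq> 0" "1 / \<epsilon> = \<epsilon>" by auto
  have k2: "2 \<le> k" using g(1) by (cases "k = 1") auto
  have p1: "path l (k - 1) p" using path_mono[OF p] by simp
  have D: "young_diagram l D" and cD: "card D = k - 1"
    using pathD[OF p1 order_refl] path_card[OF p1 order_refl] by (auto simp: D_def)
  have b: "b \<in> addable l D" using path_addable[OF p, of k] k by (simp add: b_def D_def)
  have gD: "g \<in> D" "young_diagram l (D - {g})" using g by (auto simp: D_def)
  have ctg: "ct u g = ct u b + \<epsilon>" using g(2,3) by (simp add: ct_def nle_def b_def \<epsilon>_def)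
  have "card (D - {g}) = k - 2" using gD cD young_diagram_finite[OF D] by simp
  then obtain q0 where q0: "path l (k - 2) q0" "q0 ` {1..k - 2} = D - {g}"
    using young_diagram_path[OF gD(2)] by auto
  \<comment> \<open>A path through \<open>D\<close> whose last node is \<open>g\<close>; it exists
    since \<open>D - {g}\<close> is a diagram.\<close>
  define q where "q = q0(k - 1 := g)"
  have "path l (k - 2) q" using q0(1) by (subst path_cong[of _ _ q0]) (auto simp: q_def)
  moreover have qim: "q ` {1..k - 2} = D - {g}"
    unfolding q0(2)[symmetric] by (intro image_cong) (auto simp: q_def)
  moreover have "g \<in> addable l (D - {g})" using gD D by (auto simp: addable_def insert_absorb)
  moreover have Sk: "Suc (k - 2) = k - 1" using k2 by simp
  moreover have "q (Suc (k - 2)) = g" unfolding Sk by (simp add: q_def)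
  ultimately have "path l (Suc (k - 2)) q" by (intro iffD2[OF path_Suc]) simp
  then have q: "path l (k - 1) q" unfolding Sk .
  have qD: "q ` {1..k - 1} = D"
    using image_atLeastAtMost_Suc[of q "k - 2"] qim gD unfolding Sk by (auto simp: q_def)
  define P where "P q \<longleftrightarrow> (\<forall>w. weight (k - 1) (ct u \<circ> q) w \<longrightarrow> L k * w = \<kappa> (ct u b) * w \<longrightarrow>
      L (k + 1) * w = \<kappa> (ct u b + \<epsilon>) * w \<longrightarrow> w = 0)" for q
  have Pq: "P q"
    unfolding P_def
  proof (intro allI impI)
    fix w assume w: "weight (k - 1) (ct u \<circ> q) w" "L k * w = \<kappa> (ct u b) * w" "L (k + 1) * w = \<kappa> (ct u b + \<epsilon>) * w"
    define a where "a = (ct u \<circ> q)(k := ct u b, k + 1 := ct u b + \<epsilon>)"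
    have "weight (k - 1) a w" using w(1) k2 by (subst weight_cong[of _ _ "ct u \<circ> q"]) (auto simp: a_def)
    then have "weight (Suc (k - 1)) a w" using w(2) k by (subst weight_Suc) (simp add: a_def)
    then have wa: "weight (k + 1) a w" using w(3) k weight_Suc[of k a w] by (simp add: a_def)
    have a: "a (k - 1) = ct u b + \<epsilon>" "a k = ct u b" "a (k + 1) = ct u b + \<epsilon>"
      using k2 ctg by (auto simp: a_def q_def)
    have k1: "k - 1 + 1 = k" using k by simp
    have w1: "weight (k + 1) (a \<circ> sw (k - 1)) (s (k - 1) * w - \<kappa> (- \<epsilon>) * w)"
    proof -
      have "1 / (a k - a (k - 1)) = - \<epsilon>" using a \<epsilon>0 by simp
      then show ?thesis using weight_swap[of "k - 1" "k + 1" a w] k2 k wa a \<epsilon>0 unfolding k1 by simp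
    qed
    \<comment> \<open>The exchanged vector would have weight \<open>ct u b\<close> at step
      \<open>k - 1\<close>, but no node addable to \<open>D - {g}\<close> has this content.\<close>
    have s1: "s (k - 1) * w - \<kappa> (- \<epsilon>) * w = 0"
    proof (rule local_spectrum_not_addable[OF T'[OF k2]])
      have e: "k - 1 - 1 = k - 2" by simp
      show "path l (k - 1 - 1) q0" using q0(1) e by simp
      have "weight (k - 2) (a \<circ> sw (k - 1)) (s (k - 1) * w - \<kappa> (- \<epsilon>) * w)"
        by (rule weight_mono[OF w1]) simp
      then show "weight (k - 1 - 1) (ct u \<circ> q0) (s (k - 1) * w - \<kappa> (- \<epsilon>) * w)"
        unfolding e by (subst weight_cong[of _ _ "a \<circ> sw (k - 1)"]) (auto simp: a_def q_def transpose_def)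
      have "k - 1 \<in> {1..k + 1}" using k2 by auto
      then have "L (k - 1) * (s (k - 1) * w - \<kappa> (- \<epsilon>) * w) =
          \<kappa> ((a \<circ> sw (k - 1)) (k - 1)) * (s (k - 1) * w - \<kappa> (- \<epsilon>) * w)"
        using w1 unfolding weight_def by blast
      then show "L (k - 1) * (s (k - 1) * w - \<kappa> (- \<epsilon>) * w) = \<kappa> (ct u b) * (s (k - 1) * w - \<kappa> (- \<epsilon>) * w)"
        using k1 a(2) by simp
      have "ct u x \<noteq> ct u b" if "x \<in> addable l (D - {g})" for x
        by (rule content_not_addable_after_removal[OF separated D b gD(1) _ _ gD(2) _ that])
          (use g e cD k \<open>e = 1 \<or> e = - 1\<close> in \<open>auto simp: b_def\<close>)
      then have "ct u b \<notin> ct u ` addable l (D - {g})" by force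
      then show "ct u b \<notin> ct u ` addable l (q0 ` {1..k - 1 - 1})" unfolding e q0(2) .
    qed
    have w2: "weight (k + 1) (a \<circ> sw k) (s k * w - \<kappa> \<epsilon> * w)"
    proof -
      have "1 / (a (k + 1) - a k) = \<epsilon>" using a \<epsilon>0 by simp
      then show ?thesis using weight_swap[of k "k + 1" a w] k wa a \<epsilon>0 by simp
    qed
    \<comment> \<open>This exchange would put \<open>ct u b + \<epsilon>\<close> at step
      \<open>k\<close>. Nodes addable to \<open>D\<close> other than \<open>b\<close> do not have a
      content neighbouring that of \<open>b\<close>, and \<open>b\<close> itself has another
      one.\<close>
    have s2: "s k * w - \<kappa> \<epsilon> * w = 0"
    proof (rule local_spectrum_not_addable[OF T q])
      have "weight (k - 1) (a \<circ> sw k) (s k * w - \<kappa> \<epsilon> * w)"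
        by (rule weight_mono[OF w2]) simp
      then show "weight (k - 1) (ct u \<circ> q) (s k * w - \<kappa> \<epsilon> * w)"
        using k by (subst weight_cong[of _ _ "a \<circ> sw k"]) (auto simp: a_def transpose_def)
      have "k \<in> {1..k + 1}" using k by auto
      then have "L k * (s k * w - \<kappa> \<epsilon> * w) = \<kappa> ((a \<circ> sw k) k) * (s k * w - \<kappa> \<epsilon> * w)"
        using w2 unfolding weight_def by blast
      then show "L k * (s k * w - \<kappa> \<epsilon> * w) = \<kappa> (ct u b + \<epsilon>) * (s k * w - \<kappa> \<epsilon> * w)"
        using a(3) by simp
      have "ct u x \<noteq> ct u b + \<epsilon>" if x: "x \<in> addable l D" for x
      proof (cases "x = b")
        case False
        have "ct u x - ct u b + of_int (- e) \<noteq> 0"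
          by (rule addable_separation[OF separated x b False]) (use cD k e in auto)
        then show ?thesis by (auto simp: \<epsilon>_def)
      qed (use \<epsilon>0 in auto)
      then show "ct u b + \<epsilon> \<notin> ct u ` addable l (q ` {1..k - 1})" unfolding qD by force
    qed
    have two: "(2 :: 'a) \<noteq> 0" using separated_of_int[OF separated, of 2] k by auto
    show "w = 0"
      by (rule braid_zero[of "k - 1" w \<epsilon>]) (use s1 s2 k k2 k1 \<epsilon> two in auto)
  qed
  \<comment> \<open>Intertwiners for \<open>i < k - 1\<close> commute with \<open>L k\<close> and
    \<open>L (k + 1)\<close>, and they kill no nonzero vector because the content difference along a
    swap is neither 1 nor -1.\<close>
  have "P p"
  proof (rule path_connected[where P = P, OF q p1 _ Pq])
    show "q ` {1..k - 1} = p ` {1..k - 1}" using qD by (simp only: D_def)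
  next
    fix p q assume eq: "\<And>j. j \<in> {1..k - 1} \<Longrightarrow> p j = q j" and "P p"
    moreover have "weight (k - 1) (ct u \<circ> q) w = weight (k - 1) (ct u \<circ> p) w" for w
      by (rule weight_cong) (use eq in auto)
    ultimately show "P q" by (simp add: P_def)
  next
    fix q i assume q: "path l (k - 1) q" "path l (k - 1) (q \<circ> sw i)" and i: "1 \<le> i" "i < k - 1" and P: "P q"
    show "P (q \<circ> sw i)"
      unfolding P_def
    proof (intro allI impI)
      fix w assume w: "weight (k - 1) (ct u \<circ> (q \<circ> sw i)) w" "L k * w = \<kappa> (ct u b) * w" "L (k + 1) * w = \<kappa> (ct u b + \<epsilon>) * w"
      let ?a = "ct u \<circ> (q \<circ> sw i)"
      let ?r = "1 / (?a (i + 1) - ?a i)"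
      have ne: "?a (i + 1) - ?a i \<noteq> of_int e" if "\<bar>e\<bar> \<le> 1" for e
        using path_swap_content[OF q(2) _ i(1) i(2) _ that] q(1) k unfolding sw_sw_right by simp
      have "?a i \<noteq> ?a (i + 1)" using ne[of 0] by auto
      then have "weight (k - 1) (?a \<circ> sw i) (s i * w - \<kappa> ?r * w)"
        by (intro weight_swap[OF i _ w(1)]) (use k in auto)
      moreover have "?a \<circ> sw i = ct u \<circ> q" by (auto simp: fun_eq_iff)
      moreover have comm: "L j * (s i * w - \<kappa> ?r * w) = \<kappa> c * (s i * w - \<kappa> ?r * w)"
        if "L j * w = \<kappa> c * w" "j = k \<or> j = k + 1" for j c
      proof -
        have "s i * L j = L j * s i" using s_L_comm[of i j] that i k by auto
        then have "L j * (s i * w) = s i * (L j * w)" by (metis mult.assoc)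
        then show ?thesis using that(1) by (simp add: right_diff_distrib L_kap s_kap kap_kap mult.commute)
      qed
      ultimately have "s i * w - \<kappa> ?r * w = 0" using P w(2,3) unfolding P_def by metis
      moreover have "?r \<noteq> 1" using ne[of 1] by (auto simp: divide_eq_eq)
      moreover have "?r \<noteq> - 1" using ne[of "- 1"] by (auto simp: divide_eq_eq) (metis minus_diff_eq minus_equation_iff)
      ultimately show "w = 0" using swap_zero[of i w ?r] i k by simp
    qed
  qed
  moreover have "weight (Suc (k - 1)) (ct u \<circ> p) w" using w k by simp
  then have "weight (k - 1) (ct u \<circ> p) w" "L k * w = \<kappa> (ct u b) * w"
    using weight_Suc[of "k - 1" "ct u \<circ> p" w] k by (auto simp: b_def)
  ultimately show ?thesis using Lw by (auto simp: P_def b_def \<epsilon>_def)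
qed

text \<open>The element \<open>\<phi>\<close> intertwines \<open>L k\<close> and
  \<open>L (k + 1)\<close> without dividing by their difference. The annihilator of
  \<open>L k\<close> on \<open>\<phi> * v\<close> becomes one of \<open>L (k + 1)\<close> on
  \<open>v\<close>, up to the factor \<open>\<phi> * \<phi>\<close>. This leaves the roots
  \<open>ct u b + 1\<close>, \<open>ct u b - 1\<close> and the contents of the nodes addable to
  \<open>D\<close>; those not belonging to nodes addable to \<open>insert b D\<close> have to be
  dropped.\<close>

lemma local_spectrum_step:
  assumes k: "1 \<le> k" "k + 1 \<le> n" and T: "local_spectrum k" and T': "2 \<le> k \<Longrightarrow> local_spectrum (k - 1)"
  shows "local_spectrum (k + 1)"
  unfolding local_spectrum_def add_diff_cancel_right'
proof (intro allI impI)
  fix p v xs'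
  assume p: "path l k p" and v: "weight k (ct u \<circ> p) v"
    and xs': "distinct xs'" "set xs' = addable l (p ` {1..k})"
  define D where "D = p ` {1..k - 1}"
  define b where "b = p k"
  define x where "x = L k"
  define y where "y = L (k + 1)"
  have p1: "path l (k - 1) p" using path_mono[OF p] by simp
  have D: "young_diagram l D" and cD: "card D = k - 1"
    using pathD[OF p1 order_refl] path_card[OF p1 order_refl] by (auto simp: D_def)
  have b: "b \<in> addable l D" using path_addable[OF p, of k] k by (simp add: b_def D_def)
  have Dk: "p ` {1..k} = insert b D"
    using image_atLeastAtMost_Suc[of p "k - 1"] k by (simp add: b_def D_def)
  obtain xs where xs: "distinct xs" "set xs = addable l D" using addable_list[OF D] by blast
  define cs where "cs = map (ct u) xs"
  have kn: "k < n" using k by simp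
  have xsy: "x * s k = s k * y - 1" using L_s[of k] k by (simp add: x_def y_def)
  have ysx: "y * s k = s k * x + 1" using L_s'[of k] k by (simp add: x_def y_def)
  have xy: "x * y = y * x" using L_comm[of k "k + 1"] k by (simp add: x_def y_def)
  \<comment> \<open>On a weight vector with distinct eigenvalues at \<open>k\<close> and
    \<open>k + 1\<close> this is the intertwiner of \<open>weight_swap\<close> times their
    difference.\<close>
  define \<phi> where "\<phi> = s k * (x - y) + 1"
  have x\<phi>: "x * \<phi> = \<phi> * y"
  proof -
    have "x * \<phi> = (x * s k) * (x - y) + x" by (simp add: \<phi>_def distrib_left mult.assoc)
    also have "\<dots> = s k * (y * (x - y)) + y" by (simp add: xsy left_diff_distrib mult.assoc)
    also have "y * (x - y) = (x - y) * y" using xy by (simp add: left_diff_distrib right_diff_distrib)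
    finally show ?thesis by (simp add: \<phi>_def distrib_right mult.assoc)
  qed
  have y\<phi>: "y * \<phi> = \<phi> * x"
  proof -
    have "y * \<phi> = (y * s k) * (x - y) + y" by (simp add: \<phi>_def distrib_left mult.assoc)
    also have "\<dots> = s k * (x * (x - y)) + x" by (simp add: ysx distrib_right mult.assoc)
    also have "x * (x - y) = (x - y) * x" using xy by (simp add: left_diff_distrib right_diff_distrib)
    finally show ?thesis by (simp add: \<phi>_def distrib_right mult.assoc)
  qed
  have \<phi>\<phi>: "\<phi> * \<phi> = 1 - (x - y) * (x - y)"
  proof -
    have "(x - y) * \<phi> = - (\<phi> * (x - y))"
      using x\<phi> y\<phi> by (simp add: left_diff_distrib right_diff_distrib)
    then have "\<phi> * \<phi> = - (s k * (\<phi> * (x - y))) + \<phi>"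
      by (subst \<phi>_def) (simp add: distrib_right mult.assoc)
    also have "s k * (\<phi> * (x - y)) = (x - y) * (x - y) + s k * (x - y)"
      using s_sq[OF k(1) kn] by (simp add: \<phi>_def distrib_right distrib_left mult.assoc[symmetric])
    finally show ?thesis by (simp add: \<phi>_def)
  qed
  have v1: "weight (k - 1) (ct u \<circ> p) v" using weight_mono[OF v] by simp
  have xv: "x * v = \<kappa> (ct u b) * v" using v k by (auto simp: weight_def x_def b_def)
  have commL: "L j * \<phi> = \<phi> * L j" if "1 \<le> j" "j \<le> k - 1" for j
  proof -
    have "L j * (s k * (x - y)) = s k * (L j * (x - y))"
      using s_L_comm[of k j] that k by (simp add: mult.assoc[symmetric])
    also have "L j * (x - y) = (x - y) * L j"
      using L_comm[of j k] L_comm[of j "k + 1"] that k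
      by (simp add: x_def y_def left_diff_distrib right_diff_distrib)
    finally show ?thesis by (simp add: \<phi>_def distrib_left distrib_right mult.assoc)
  qed
  have "weight (k - 1) (ct u \<circ> p) (\<phi> * v)" by (rule weight_commute[OF commL v1])
  then have "ann x cs * (\<phi> * v) = 0"
    unfolding x_def cs_def using local_spectrumD[OF T p1] xs by (simp add: D_def)
  then have "\<phi> * (ann y cs * v) = 0"
    using intertwine_ann[OF x\<phi>, of cs] by (simp add: mult.assoc[symmetric])
  then have "\<phi> * (\<phi> * (ann y cs * v)) = 0" by simp
  \<comment> \<open>Multiplying by \<open>\<phi>\<close> once more removes the reflection: its
    square is a polynomial in \<open>L k\<close> and \<open>L (k + 1)\<close>.\<close>
  then have z: "(1 - (x - y) * (x - y)) * (ann y cs * v) = 0" using \<phi>\<phi> by (simp add: mult.assoc[symmetric])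
  have xA: "x * (ann y cs * v) = \<kappa> (ct u b) * (ann y cs * v)"
    using commute_ann[OF xy, of cs] xv by (metis kap_left_commute mult.assoc)
  have diff: "(x - y) * w = \<kappa> (ct u b) * w - y * w" if "x * w = \<kappa> (ct u b) * w" for w
    using that by (simp add: left_diff_distrib)
  have xyA: "x * (y * (ann y cs * v)) = \<kappa> (ct u b) * (y * (ann y cs * v))"
    using xA xy by (metis kap_left_commute mult.assoc)
  \<comment> \<open>Since \<open>x\<close> acts by the scalar \<open>ct u b\<close>, the factor
    \<open>1 - (x - y) * (x - y)\<close> becomes minus the product of the two linear factors in
    \<open>y\<close> with roots \<open>ct u b + 1\<close> and \<open>ct u b - 1\<close>.\<close>
  have "ann y ((ct u b + 1) # (ct u b - 1) # cs) * v =
      (y - \<kappa> (ct u b + 1)) * ((y - \<kappa> (ct u b - 1)) * (ann y cs * v))"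
    by (simp add: mult.assoc)
  also have "\<dots> = - ((1 - (x - y) * (x - y)) * (ann y cs * v))"
  proof -
    define A where "A = ann y cs * v"
    define c where "c = \<kappa> (ct u b)"
    have d: "(x - y) * A = c * A - y * A" "(x - y) * (c * A - y * A) = c * (c * A - y * A) - y * (c * A - y * A)"
      using diff xA xyA by (auto simp: A_def c_def left_diff_distrib right_diff_distrib kap_left_commute[of x])
    have yc: "y * (c * A) = c * (y * A)" by (simp add: c_def kap_left_commute)
    show ?thesis
      unfolding A_def[symmetric] kap_add kap_diff kap_1 c_def[symmetric]
      by (simp add: left_diff_distrib[of 1] mult.assoc d)
        (simp add: left_diff_distrib right_diff_distrib distrib_left distrib_right yc)
  qed
  finally have ann0: "ann y ((ct u b + 1) # (ct u b - 1) # cs) * v = 0" using z by simp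
  have two: "(2 :: 'a) \<noteq> 0" using separated_of_int[OF separated, of 2] k by auto
  have nin: "ct u b + of_int e \<notin> set cs" if e: "e = 1 \<or> e = - 1" for e
  proof
    assume "ct u b + of_int e \<in> set cs"
    then obtain g where g: "g \<in> addable l D" "ct u g = ct u b + of_int e" using xs by (auto simp: cs_def)
    then have "g \<noteq> b" using e by auto
    then have "ct u g - ct u b + of_int (- e) \<noteq> 0"
      by (rule addable_separation[OF separated g(1) b]) (use e cD k in auto)
    then show False using g by simp
  qed
  have "distinct cs"
    unfolding cs_def distinct_map
    using xs addable_content_inj[of _ D] cD k by (auto intro!: inj_onI)
  then have dist: "distinct ((ct u b + 1) # (ct u b - 1) # cs)"
    using nin[of 1] nin[of "- 1"] two by (auto simp: eq_diff_eq add.assoc) 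
  have Q: "weight k (ct u \<circ> p) (y * w)" if "weight k (ct u \<circ> p) w" for w
    using weight_L[OF that, of "k + 1"] k by (simp add: y_def)
  obtain f where f: "v = (\<Sum>c\<in>set ((ct u b + 1) # (ct u b - 1) # cs). f c)"
    and f': "\<And>c. c \<in> set ((ct u b + 1) # (ct u b - 1) # cs) \<Longrightarrow> y * f c = \<kappa> c * f c \<and> weight k (ct u \<circ> p) (f c)"
    using eigen_decomposition[OF dist ann0, of "weight k (ct u \<circ> p)", OF v Q weight_kap weight_add weight_diff]
    by blast
  \<comment> \<open>The roots are treated one by one: \<open>ct u b + 1\<close> and
    \<open>ct u b - 1\<close> survive only if the corresponding neighbour of \<open>b\<close> is
    addable, \<open>ct u b\<close> never does, and the other nodes addable to \<open>D\<close> stay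
    addable.\<close>
  have zero_or: "f c = 0 \<or> c \<in> ct u ` addable l (insert b D)" if c: "c \<in> set ((ct u b + 1) # (ct u b - 1) # cs)" for c
  proof -
    have w: "weight k (ct u \<circ> p) (f c)" and yw: "L (k + 1) * f c = \<kappa> c * f c" using f'[OF c] by (auto simp: y_def)
    have blocked: "f c = 0" if h: "c = ct u b + of_int e" "e = 1 \<or> e = - 1"
      "\<exists>g\<in>D. diag g = diag b + e \<and> nle g b \<and> young_diagram l (D - {g})" for e
    proof -
      obtain g where g: "g \<in> D" "diag g = diag b + e" "nle g b" "young_diagram l (D - {g})" using h(3) by blast
      show ?thesis
        by (rule blocked_zero[OF k T T' p _ _ _ _ h(2) w, of g]) (use g yw h(1) in \<open>simp_all add: D_def b_def\<close>)
    qed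
    consider "c = ct u b + 1" | "c = ct u b - 1" | x where "x \<in> addable l D" "c = ct u x"
      using c xs by (auto simp: cs_def)
    then show ?thesis
    proof cases
      case 1
      show ?thesis
      proof (cases "(row b, col b + 1, cmp b) \<in> addable l (insert b D)")
        case True
        then show ?thesis using 1 by (intro disjI2 image_eqI[OF _ True]) (simp add: ct_def diag_def)
      next
        case False
        show ?thesis using blocked[of 1] blocked_right[OF D b False] 1 by simp
      qed
    next
      case 2
      show ?thesis
      proof (cases "(row b + 1, col b, cmp b) \<in> addable l (insert b D)")
        case True
        then show ?thesis using 2 by (intro disjI2 image_eqI[OF _ True]) (simp add: ct_def diag_def)
      next
        case False
        show ?thesis using blocked[of "- 1"] blocked_below[OF D b False] 2 by simp
      qed
    next
      case (3 z)
      show ?thesis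
      proof (cases "z = b")
        case True
        have w1: "weight (k - 1) (ct u \<circ> p) (f c)" using weight_mono[OF w] by simp
        have "L k * f c = \<kappa> (ct u b) * f c" using w k by (auto simp: weight_def b_def)
        then have "f c = 0"
          using equal_weights_zero[OF k(1) kn T p1 w1, of b] b yw 3 True by (simp add: D_def)
        then show ?thesis by simp
      next
        case False
        have "young_diagram l (insert z (insert b D))"
          using young_diagram_Un[of l "insert z D" "insert b D"] 3 b
          by (simp add: addable_def insert_commute)
        then have "z \<in> addable l (insert b D)" using 3 False by (simp add: addable_def)
        then show ?thesis using 3 by blast
      qed
    qed
  qed
  have "ann (L (k + 1)) (map (ct u) xs') * f c = 0" if c: "c \<in> set ((ct u b + 1) # (ct u b - 1) # cs)" for c
    using zero_or[OF c]
  proof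
    assume "c \<in> ct u ` addable l (insert b D)"
    then have "c \<in> set (map (ct u) xs')" unfolding set_map xs'(2) Dk .
    then show ?thesis using f'[OF c] by (intro ann_eigen_zero) (simp_all add: y_def)
  qed simp
  then show "ann (L (k + 1)) (map (ct u) xs') * v = 0"
    unfolding f sum_distrib_left by (intro sum.neutral) blast
qed

theorem local_spectrum_all: "1 \<le> k \<Longrightarrow> k \<le> n \<Longrightarrow> local_spectrum k"
proof (induction k rule: less_induct)
  case (less k)
  show ?case
  proof (cases "k = 1")
    case False
    then have "local_spectrum (k - 1 + 1)"
      using less by (intro local_spectrum_step) auto
    then show ?thesis using less.prems by simp
  qed (use local_spectrum_1 in simp)
qed

section \<open>Decomposition of the ring into weight vectors\<close>

inductive std_span :: "nat \<Rightarrow> 'b \<Rightarrow> bool" for m where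
  std_span_0: "std_span m 0"
| std_span_add: "path l m p \<Longrightarrow> weight m (ct u \<circ> p) w \<Longrightarrow> std_span m v \<Longrightarrow> std_span m (w + v)"

lemma std_span_plus: "std_span m v \<Longrightarrow> std_span m w \<Longrightarrow> std_span m (v + w)"
  by (induction rule: std_span.induct) (auto simp: add.assoc intro: std_span.intros)

lemma std_span_sum: "finite A \<Longrightarrow> (\<And>c. c \<in> A \<Longrightarrow> std_span m (f c)) \<Longrightarrow> std_span m (\<Sum>c\<in>A. f c)"
  by (induction A rule: finite_induct) (auto intro: std_span_0 std_span_plus)

text \<open>The annihilating product of \<open>L (Suc m)\<close> has distinct roots, so a vector
  with the weight of a path splits into eigenvectors, one for each way of prolonging the
  path.\<close>

lemma std_span_Suc:
  assumes m: "m < n" and v: "std_span m v"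
  shows "std_span (Suc m) v"
  using v
proof (induction rule: std_span.induct)
  case (std_span_add p w v)
  obtain xs where xs: "distinct xs" "set xs = addable l (p ` {1..m})"
    using addable_list[OF pathD[OF std_span_add(1) order_refl]] by blast
  have T: "local_spectrum (Suc m)" using local_spectrum_all m by simp
  have ann0: "ann (L (Suc m)) (map (ct u) xs) * w = 0"
    using local_spectrumD[OF T, of p w xs] std_span_add xs by simp
  have "card (p ` {1..m}) + 1 \<le> n" using path_card[OF std_span_add(1) order_refl] m by simp
  then have "inj_on (ct u) (set xs)" unfolding xs(2) by (intro inj_onI addable_content_inj)
  then have dist: "distinct (map (ct u) xs)" using xs(1) by (simp add: distinct_map)
  have Q: "weight m (ct u \<circ> p) (L (Suc m) * w)" if "weight m (ct u \<circ> p) w" for w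
    using weight_L[OF that] m by simp
  obtain f where f: "w = (\<Sum>c\<in>set (map (ct u) xs). f c)"
    and f': "\<And>c. c \<in> set (map (ct u) xs) \<Longrightarrow> L (Suc m) * f c = \<kappa> c * f c \<and> weight m (ct u \<circ> p) (f c)"
    using eigen_decomposition[OF dist ann0, of "weight m (ct u \<circ> p)", OF std_span_add(2) Q weight_kap weight_add weight_diff]
    by blast
  have "std_span (Suc m) w"
    unfolding f
  proof (rule std_span_sum)
    fix c assume c: "c \<in> set (map (ct u) xs)"
    then obtain x where x: "x \<in> addable l (p ` {1..m})" "c = ct u x" using xs by auto
    let ?q = "p(Suc m := x)"
    have "path l m ?q" using std_span_add(1) by (subst path_cong[of m _ p]) auto
    moreover have "?q ` {1..m} = p ` {1..m}" by (intro image_cong) auto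
    ultimately have "path l (Suc m) ?q" using x by (simp add: path_Suc)
    moreover have "weight (Suc m) (ct u \<circ> ?q) (f c)"
    proof -
      have "weight m (ct u \<circ> ?q) (f c)" using f'[OF c] by (subst weight_cong[of _ _ "ct u \<circ> p"]) auto
      then show ?thesis using f'[OF c] x by (simp add: weight_Suc)
    qed
    ultimately have "std_span (Suc m) (f c + 0)" by (intro std_span.intros)
    then show "std_span (Suc m) (f c)" by simp
  qed simp
  then show ?case using std_span_add by (intro std_span_plus)
qed (rule std_span_0)

theorem std_span_all: "m \<le> n \<Longrightarrow> std_span m v"
proof (induction m)
  case 0
  have "std_span 0 (v + 0)" by (intro std_span.intros) (auto simp: path_def weight_def)
  then show ?case by simp
next
  case (Suc m)
  then show ?case using std_span_Suc by simp
qed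

end

section \<open>The idempotents of standard tableaux\<close>

text \<open>The definitions beginning with \<open>gen_\<close> repeat the polynomial ones with
  arbitrary ring elements for the generators; the \<open>cls_\<close> lemmas at the end identify
  them in the quotient.\<close>

definition gen_F :: "('k::field \<Rightarrow> 'r::ring_1) \<Rightarrow> (nat \<Rightarrow> 'r) \<Rightarrow> nat \<Rightarrow> nat \<Rightarrow> (nat \<Rightarrow> 'k) \<Rightarrow> tableau \<Rightarrow> 'r" where
  "gen_F \<kappa> L l n u t =
     (\<Prod>k\<leftarrow>[1..<Suc n].
        set_prod (\<lambda>c. \<kappa> (1 / (content u t k - c)) * (L k - \<kappa> c)) (contents l n u k - {content u t k}))"

definition gen_perm :: "(nat \<Rightarrow> 'r::monoid_mult) \<Rightarrow> nat \<Rightarrow> (nat \<Rightarrow> nat) \<Rightarrow> 'r" where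
  "gen_perm s n w = (\<Prod>i\<leftarrow>(SOME is. set is \<subseteq> {1..<n} \<and> word_perm is = w). s i)"

lemma set_prod_list:
  assumes "finite A"
  shows "\<exists>xs. distinct xs \<and> set xs = A \<and> set_prod f A = (\<Prod>x\<leftarrow>xs. f x)"
proof -
  have "\<exists>xs. distinct xs \<and> set xs = A" using finite_distinct_list[OF assms] by blast
  from someI_ex[OF this] show ?thesis unfolding set_prod_def by blast
qed

lemma finite_contents: "finite (contents l n u k)"
  unfolding contents_eq using finite_tabs by (rule finite_imageI)

text \<open>This is \<open>r\<close> at \<open>t\<close> divided by \<open>r\<close> at the initial
  tableau, as \<open>r_coeff_eq\<close> shows: a swap that creates an inversion multiplies
  \<open>r\<close> by the factor of that pair.\<close>

definition norm_ratio :: "(nat \<Rightarrow> 'k::field) \<Rightarrow> node set \<Rightarrow> tableau \<Rightarrow> 'k" where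
  "norm_ratio u D t = (\<Prod>(x, y)\<in>inversions D t. 1 - 1 / (ct u x - ct u y)\<^sup>2)"

lemma std_tab_less: "std_tab l n D t \<Longrightarrow> x \<in> D \<Longrightarrow> y \<in> D \<Longrightarrow> nle x y \<Longrightarrow> x \<noteq> y \<Longrightarrow> t x < t y"
  by (simp add: std_tab_def)

lemma tabs_sw_shape:
  assumes "c \<in> tabs l n" "std_tab l n D (sw i \<circ> c)" "1 \<le> i" "i < n"
  shows "std_tab l n D c"
proof -
  obtain E where E: "std_tab l n E c" using assms(1) by (auto simp: tabs_def)
  from std_tab_sw(2)[OF E assms(3,4,2)] E show ?thesis by simp
qed

context hecke_rel
begin

definition Pw :: "nat list \<Rightarrow> 'r" where "Pw is = prod_list (map s is)"

lemma Pw_simps [simp]: "Pw [] = 1" "Pw (i # is) = s i * Pw is" "Pw (is @ js) = Pw is * Pw js"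
  by (simp_all add: Pw_def)

lemma Pw_word_perm:
  assumes "set is \<subseteq> {1..<n}" "set js \<subseteq> {1..<n}" "word_perm is = word_perm js"
  shows "Pw is = Pw js"
  unfolding Pw_def by (rule coxeter_words[of n s]) (use assms s_sq s_comm s_braid in auto)

lemma gen_perm_word:
  assumes "set is \<subseteq> {1..<n}" "word_perm is = w"
  shows "gen_perm s n w = Pw is"
proof -
  let ?js = "SOME is. set is \<subseteq> {1..<n} \<and> word_perm is = w"
  have "set ?js \<subseteq> {1..<n} \<and> word_perm ?js = w" by (rule someI[of _ "is"]) (use assms in simp)
  then have "Pw ?js = Pw is" using Pw_word_perm[of ?js "is"] assms by simp
  then show ?thesis by (simp add: gen_perm_def Pw_def)
qed

lemma eigen_prod_list:
  assumes "\<And>x. x \<in> set xs \<Longrightarrow> f x * v = \<kappa> (g x) * v"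
  shows "(\<Prod>x\<leftarrow>xs. f x) * v = \<kappa> (\<Prod>x\<leftarrow>xs. g x) * v"
  using assms
proof (induction xs)
  case (Cons x xs)
  have "(\<Prod>x\<leftarrow>x # xs. f x) * v = f x * ((\<Prod>x\<leftarrow>xs. f x) * v)" by (simp add: mult.assoc)
  also have "\<dots> = \<kappa> (\<Prod>x\<leftarrow>xs. g x) * (f x * v)" using Cons kap_left_commute[of "f x"] by simp
  also have "\<dots> = \<kappa> (\<Prod>x\<leftarrow>x # xs. g x) * v" using Cons.prems[of x] by (simp add: kap_kap mult.commute)
  finally show ?case .
qed simp

section \<open>Interpolation in the \<open>L k\<close> on weight vectors\<close>

abbreviation F :: "tableau \<Rightarrow> 'r" where "F \<equiv> gen_F \<kappa> L l n u"

lemma F_eigen: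
  assumes "weight n a v"
  shows "F t * v = \<kappa> (\<Prod>k=1..n. \<Prod>c\<in>contents l n u k - {content u t k}. (a k - c) / (content u t k - c)) * v"
proof -
  have "set_prod (\<lambda>c. \<kappa> (1 / (content u t k - c)) * (L k - \<kappa> c)) (contents l n u k - {content u t k}) * v =
      \<kappa> (\<Prod>c\<in>contents l n u k - {content u t k}. (a k - c) / (content u t k - c)) * v"
    if k: "k \<in> set [1..<Suc n]" for k
  proof -
    let ?A = "contents l n u k - {content u t k}"
    let ?f = "\<lambda>c. \<kappa> (1 / (content u t k - c)) * (L k - \<kappa> c)"
    obtain xs where xs: "distinct xs" "set xs = ?A" "set_prod ?f ?A = (\<Prod>x\<leftarrow>xs. ?f x)"
      using set_prod_list[of ?A ?f] finite_contents by blast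
    have Lk: "L k * v = \<kappa> (a k) * v" using assms k by (auto simp: weight_def)
    have "(\<Prod>x\<leftarrow>xs. ?f x) * v = \<kappa> (\<Prod>x\<leftarrow>xs. (a k - x) / (content u t k - x)) * v"
    proof (rule eigen_prod_list)
      fix c
      have "?f c * v = \<kappa> (1 / (content u t k - c)) * (\<kappa> (a k - c) * v)"
        using Lk by (simp add: mult.assoc left_diff_distrib kap_diff)
      then show "?f c * v = \<kappa> ((a k - c) / (content u t k - c)) * v" by (simp add: kap_kap)
    qed
    also have "(\<Prod>x\<leftarrow>xs. (a k - x) / (content u t k - x)) = (\<Prod>c\<in>?A. (a k - c) / (content u t k - c))"
      using prod.distinct_set_conv_list[OF xs(1)] xs(2) by metis
    finally show ?thesis using xs(3) by simp
  qed
  then have "F t * v = \<kappa> (\<Prod>k\<leftarrow>[1..<Suc n]. \<Prod>c\<in>contents l n u k - {content u t k}. (a k - c) / (content u t k - c)) * v"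
    unfolding gen_F_def by (rule eigen_prod_list)
  also have "(\<Prod>k\<leftarrow>[1..<Suc n]. \<Prod>c\<in>contents l n u k - {content u t k}. (a k - c) / (content u t k - c)) =
      (\<Prod>k=1..n. \<Prod>c\<in>contents l n u k - {content u t k}. (a k - c) / (content u t k - c))"
    by (subst prod.distinct_set_conv_list[symmetric])
      (simp_all add: atLeastLessThanSuc_atLeastAtMost del: upt_Suc)
  finally show ?thesis .
qed

lemma F_eigen_same:
  assumes "weight n a v" "\<And>k. k \<in> {1..n} \<Longrightarrow> a k = content u t k"
  shows "F t * v = v"
proof -
  have "(\<Prod>c\<in>contents l n u k - {content u t k}. (a k - c) / (content u t k - c)) = 1" if "k \<in> {1..n}" for k
    by (rule prod.neutral) (use assms(2)[OF that] in auto)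
  then show ?thesis using F_eigen[OF assms(1), of t] by (simp add: prod.neutral)
qed

lemma F_eigen_other:
  assumes "weight n a v" "k \<in> {1..n}" "a k \<in> contents l n u k" "a k \<noteq> content u t k"
  shows "F t * v = 0"
proof -
  have "(\<Prod>c\<in>contents l n u k - {content u t k}. (a k - c) / (content u t k - c)) = 0"
    by (rule prod_zero) (use assms finite_contents in \<open>auto intro!: bexI[of _ "a k"]\<close>)
  then have "(\<Prod>k=1..n. \<Prod>c\<in>contents l n u k - {content u t k}. (a k - c) / (content u t k - c)) = 0"
    by (intro prod_zero) (use assms(2) in auto)
  from F_eigen[OF assms(1), of t, unfolded this] show ?thesis by simp
qed

end

context hecke_separated
begin

text \<open>Entry by entry: two paths that agree so far add their next nodes to the same diagram,
  and addable nodes are told apart by content.\<close>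

lemma contents_separate:
  assumes t: "std_tab l n D t" and t': "std_tab l n D' t'"
    and eq: "\<And>k. k \<in> {1..n} \<Longrightarrow> content u t k = content u t' k"
  shows "t = t'"
proof -
  have "\<forall>j\<in>{1..k}. pos t j = pos t' j" if "k \<le> n" for k
    using that
  proof (induction k)
    case (Suc k)
    then have IH: "pos t j = pos t' j" if "j \<in> {1..k}" for j using that by simp
    have im: "pos t ` {1..k} = pos t' ` {1..k}" using IH by (intro image_cong) auto
    have p: "path l n (pos t)" "path l n (pos t')" using std_tab_path t t' by auto
    have a: "pos t (Suc k) \<in> addable l (pos t ` {1..k})" "pos t' (Suc k) \<in> addable l (pos t ` {1..k})"
      using path_addable[OF p(1), of "Suc k"] path_addable[OF p(2), of "Suc k"] Suc.prems im by auto
    have "card (pos t ` {1..k}) + 1 \<le> n" using path_card[OF p(1), of k] Suc.prems by simp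
    moreover have "ct u (pos t (Suc k)) = ct u (pos t' (Suc k))"
      using eq[of "Suc k"] Suc.prems by (simp add: content_pos)
    ultimately have "pos t (Suc k) = pos t' (Suc k)" using addable_content_inj[OF a] by simp
    then show ?case using IH by (auto simp: le_Suc_eq)
  qed simp
  then have "pos t k = pos t' k" if "k \<in> {1..n}" for k using that by auto
  then show ?thesis by (rule std_tab_ext(1)[OF t t'])
qed

lemma F_weight:
  assumes t: "t \<in> tabs l n" and t': "t' \<in> tabs l n" and v: "weight n (content u t') v"
  shows "F t * v = (if t = t' then v else 0)"
proof (cases "t = t'")
  case True
  then show ?thesis using F_eigen_same[OF v] by simp
next
  case False
  then obtain k where k: "k \<in> {1..n}" "content u t k \<noteq> content u t' k"
    using contents_separate t t' unfolding tabs_def by blast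
  have "content u t' k \<in> contents l n u k" unfolding contents_eq using t' by blast
  then show ?thesis using F_eigen_other[OF v k(1)] k False by auto
qed

lemma path_tab:
  assumes "path l n p" "weight n (ct u \<circ> p) w"
  shows "\<exists>t\<in>tabs l n. weight n (content u t) w"
proof -
  obtain t where t: "std_tab l n (p ` {1..n}) t" "\<And>k. k \<in> {1..n} \<Longrightarrow> pos t k = p k"
    using path_std_tab[OF assms(1)] by blast
  have "weight n (content u t) w = weight n (ct u \<circ> p) w"
    by (rule weight_cong) (use t(2) in \<open>simp add: content_pos\<close>)
  then show ?thesis using assms(2) t(1) by (auto simp: tabs_def)
qed

text \<open>On a weight vector of a path one \<open>F t\<close> acts as the identity and the others
  vanish, and by \<open>std_span_all\<close> the element 1 is a sum of such vectors.\<close>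

lemma F_sum: "(\<Sum>t\<in>tabs l n. F t) = 1"
proof -
  have "(\<Sum>t\<in>tabs l n. F t) * v = v" if "std_span n v" for v
    using that
  proof (induction rule: std_span.induct)
    case (std_span_add p w v)
    obtain t where t: "t \<in> tabs l n" "weight n (content u t) w" using path_tab[OF std_span_add(1,2)] by blast
    have "(\<Sum>b\<in>tabs l n. F b) * w = (\<Sum>b\<in>tabs l n. if b = t then w else 0)"
      unfolding sum_distrib_right by (intro sum.cong) (use F_weight t in auto)
    also have "\<dots> = w" using t(1) finite_tabs by simp
    finally show ?case using std_span_add by (simp add: distrib_left)
  qed simp
  from this[of 1] std_span_all[of n 1] show ?thesis by simp
qed

lemma weight_F:
  assumes t: "t \<in> tabs l n"
  shows "weight n (content u t) (F t)"
proof -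
  have "weight n (content u t) (F t * v)" if "std_span n v" for v
    using that
  proof (induction rule: std_span.induct)
    case (std_span_add p w v)
    obtain t' where t': "t' \<in> tabs l n" "weight n (content u t') w" using path_tab[OF std_span_add(1,2)] by blast
    then have "weight n (content u t) (F t * w)" using F_weight[OF t t'] by simp
    then show ?case using std_span_add by (simp add: distrib_left weight_add)
  qed simp
  from this[of 1] std_span_all[of n 1] show ?thesis by simp
qed

lemma F_F: "a \<in> tabs l n \<Longrightarrow> b \<in> tabs l n \<Longrightarrow> F a * F b = (if a = b then F b else 0)"
  using F_weight weight_F by blast

lemma insert_F: "x * y = (\<Sum>c\<in>tabs l n. x * F c * y)"
proof -
  have "x * y = x * (\<Sum>t\<in>tabs l n. F t) * y" using F_sum by simp
  then show ?thesis by (simp add: sum_distrib_left sum_distrib_right)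
qed

lemma L_F: "t \<in> tabs l n \<Longrightarrow> k \<in> {1..n} \<Longrightarrow> L k * F t = \<kappa> (content u t k) * F t"
  using weight_F by (simp add: weight_def)

text \<open>The eigenvalue of \<open>L k\<close> was known for multiplication from the left only;
  inserting the decomposition of 1 on the right transfers it to the other side.\<close>

lemma F_L: 
  assumes t: "t \<in> tabs l n" and k: "k \<in> {1..n}"
  shows "F t * L k = \<kappa> (content u t k) * F t"
proof -
  have "F t * L k = (\<Sum>b\<in>tabs l n. F t * (L k * F b))"
    using insert_F[of "F t * L k" 1] by (simp add: mult.assoc)
  also have "\<dots> = (\<Sum>b\<in>tabs l n. if b = t then \<kappa> (content u t k) * F t else 0)"
    by (intro sum.cong) (use t L_F k F_F in \<open>auto simp: kap_left_commute[of "F t"]\<close>)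
  also have "\<dots> = \<kappa> (content u t k) * F t" using t finite_tabs by simp
  finally show ?thesis .
qed

section \<open>Matrix entries of the simple reflections\<close>

definition axial :: "nat \<Rightarrow> tableau \<Rightarrow> 'a" where
  "axial i t = content u t (i + 1) - content u t i"

text \<open>Equal contents of consecutive entries would put them on one diagonal. They would then be
  independent, hence both addable, whereas addable nodes of one component lie at least two diagonals
  apart.\<close>

lemma axial_nonzero:
  assumes t: "t \<in> tabs l n" and i: "1 \<le> i" "i < n"
  shows "axial i t \<noteq> 0"
proof
  assume z: "axial i t = 0"
  obtain D where D: "std_tab l n D t" using t by (auto simp: tabs_def)
  have p: "path l n (pos t)" using std_tab_path[OF D] by simp
  have "ct u (pos t (i + 1)) - ct u (pos t i) + of_int 0 = 0" using z by (simp add: axial_def content_pos)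
  then have same: "cmp (pos t (i + 1)) = cmp (pos t i)" "diag (pos t (i + 1)) = diag (pos t i)"
    using content_separation[OF separated pathD[OF p order_refl], of "pos t (i + 1)" "pos t i" 0] path_card[OF p order_refl] i
    by auto
  then have "path l n (pos t \<circ> sw i)" using path_swap_iff(1)[OF p i] by simp
  then have a: "pos t (i + 1) \<in> addable l (pos t ` {1..i - 1})" using path_swap_iff(3)[OF p i] by simp
  moreover have b: "pos t i \<in> addable l (pos t ` {1..i - 1})" using path_addable[OF p, of i] i by simp
  moreover have "pos t (i + 1) \<noteq> pos t i" using p i by (auto simp: path_def dest: inj_onD)
  ultimately show False using addable_diag same by fastforce
qed

lemma s_F_weight:
  assumes t: "t \<in> tabs l n" and i: "1 \<le> i" "i < n"
  shows "weight n (content u t \<circ> sw i) (s i * F t - \<kappa> (1 / axial i t) * F t)"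
  unfolding axial_def
  by (rule weight_swap[OF i order_refl weight_F[OF t]]) (use axial_nonzero[OF assms] in \<open>auto simp: axial_def\<close>)

text \<open>The intertwined vector would carry the content of entry \<open>i + 1\<close> already at
  step \<open>i\<close>. If the swap is not standard, no node addable there has this content, so the
  vector is zero and \<open>s i\<close> acts by a scalar.\<close>

lemma s_F_nonstandard:
  assumes t: "t \<in> tabs l n" and i: "1 \<le> i" "i < n" and b: "sw i \<circ> t \<notin> tabs l n"
  shows "s i * F t = \<kappa> (1 / axial i t) * F t"
proof -
  obtain D where D: "std_tab l n D t" using t by (auto simp: tabs_def)
  have p: "path l n (pos t)" using std_tab_path[OF D] by simp
  let ?z = "s i * F t - \<kappa> (1 / axial i t) * F t"
  let ?D = "pos t ` {1..i - 1}"
  let ?x = "pos t i" and ?y = "pos t (i + 1)"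
  have np: "\<not> path l n (pos t \<circ> sw i)" using std_tab_sw(1)[OF D i] b by (auto simp: tabs_def)
  have adj: "cmp ?x = cmp ?y" "\<bar>diag ?x - diag ?y\<bar> = 1" using path_swap_iff(1)[OF p i] np by auto
  have ny: "?y \<notin> addable l ?D" using path_swap_iff(3)[OF p i] np by simp
  have w: "weight n (content u t \<circ> sw i) ?z" by (rule s_F_weight[OF t i])
  have p1: "path l (i - 1) (pos t)" using path_mono[OF p] i by simp
  have "?z = 0"
  proof (rule local_spectrum_not_addable[OF local_spectrum_all p1])
    have "weight (i - 1) (content u t \<circ> sw i) ?z" using weight_mono[OF w] i by simp
    then show "weight (i - 1) (ct u \<circ> pos t) ?z"
      by (subst weight_cong[of _ _ "content u t \<circ> sw i"]) (auto simp: content_pos transpose_def)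
    have "L i * ?z = \<kappa> ((content u t \<circ> sw i) i) * ?z" using w i unfolding weight_def by simp
    then show "L i * ?z = \<kappa> (ct u ?y) * ?z" by (simp add: content_pos)
    show "ct u ?y \<notin> ct u ` addable l ?D"
    proof
      assume "ct u ?y \<in> ct u ` addable l ?D"
      then obtain g where g: "g \<in> addable l ?D" "ct u ?y = ct u g" by blast
      \<comment> \<open>A hypothetical node \<open>g\<close> of that content can be joined to the
        diagram after step \<open>i + 1\<close>. Then \<open>g\<close> and the node of entry
        \<open>i + 1\<close> lie on one diagonal and are comparable, and both orders are
        impossible.\<close>
      let ?E = "insert g ?D \<union> pos t ` {1..i + 1}"
      have E: "young_diagram l ?E"
        using g pathD[OF p, of "i + 1"] i by (intro young_diagram_Un) (auto simp: addable_def)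
      have sub: "?D \<subseteq> pos t ` {1..i + 1}" using i by (intro image_mono) auto
      then have Eg: "?E = insert g (pos t ` {1..i + 1})" by blast
      have "card (pos t ` {1..i + 1}) = i + 1" using path_card[OF p] i by simp
      then have "card ?E \<le> i + 2" unfolding Eg by (simp add: card_insert_if)
      then have same: "cmp ?y = cmp g" "diag ?y = diag g"
        using content_separation[OF separated E, of ?y g 0] g(2) i by auto
      have Dg: "young_diagram l (insert g ?D)" "g \<notin> ?D" using g by (auto simp: addable_def)
      have Dx: "young_diagram l (pos t ` {1..i + 1})" using pathD[OF p, of "i + 1"] i by simp
      have y: "?y \<in> pos t ` {1..i + 1}" by simp
      have inj: "inj_on (pos t) {1..n}" using p by (simp add: path_def)
      have ynD: "?y \<notin> ?D" using inj i by (auto dest!: inj_onD)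
      have vy: "valid_node l ?y" and vg: "valid_node l g" using young_diagramD(1)[OF E] y by auto
      have "g \<noteq> ?y" using g ny by auto
      have "nle g ?y \<or> nle ?y g" using same by (auto simp: nle_def diag_def)
      then show False
      proof
        assume "nle g ?y"
        then have "g \<in> pos t ` {1..i + 1}" using young_diagramD(2)[OF Dx y vg] by simp
        then obtain j where j: "j \<in> {1..i + 1}" "g = pos t j" by blast
        then have "\<not> j \<le> i - 1" using Dg(2) by auto
        moreover have "j \<noteq> i + 1" using j \<open>g \<noteq> ?y\<close> by auto
        ultimately have "j = i" using j by auto
        then show False using j same adj by simp
      next
        assume "nle ?y g"
        then have "?y \<in> insert g ?D" using young_diagramD(2)[OF Dg(1), of g ?y] vy by simp
        then show False using \<open>g \<noteq> ?y\<close> ynD by auto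
      qed
    qed
  qed (use i in auto)
  then show ?thesis by simp
qed

text \<open>Up to a multiple of \<open>F t\<close>, the product \<open>s i * F t\<close> has the
  weight of the swapped tableau, or vanishes if there is none.\<close>

lemma F_s_F_zero:
  assumes a: "a \<in> tabs l n" and t: "t \<in> tabs l n" and i: "1 \<le> i" "i < n" and ne: "a \<noteq> t" "a \<noteq> sw i \<circ> t"
  shows "F a * s i * F t = 0"
proof (cases "sw i \<circ> t \<in> tabs l n")
  case False
  have "F a * s i * F t = \<kappa> (1 / axial i t) * (F a * F t)"
    using s_F_nonstandard[OF t i False] kap_left_commute[of "F a"] by (simp add: mult.assoc)
  then show ?thesis using F_F[OF a t] ne by simp
next
  case True
  obtain D where D: "std_tab l n D t" using t by (auto simp: tabs_def)
  let ?z = "s i * F t - \<kappa> (1 / axial i t) * F t"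
  have "weight n (content u (sw i \<circ> t)) ?z = weight n (content u t \<circ> sw i) ?z"
    by (rule weight_cong) (use pos_sw[OF D i] in \<open>simp add: content_pos\<close>)
  then have "F a * ?z = 0" using F_weight[OF a True] s_F_weight[OF t i] ne by simp
  then show ?thesis
    using F_F[OF a t] ne kap_left_commute[of "F a"] by (simp add: right_diff_distrib mult.assoc)
qed

lemma sw_comp_neq:
  assumes t: "std_tab l n D t" and i: "1 \<le> i" "i < n"
  shows "sw i \<circ> t \<noteq> t"
proof
  assume "sw i \<circ> t = t"
  then have "sw i (t (pos t i)) = t (pos t i)" by (metis comp_apply)
  then show False using std_tab_pos(2)[OF t, of i] i by simp
qed

lemma F_s_F_diag:
  assumes t: "t \<in> tabs l n" and i: "1 \<le> i" "i < n"
  shows "F t * s i * F t = \<kappa> (1 / axial i t) * F t"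
proof (cases "sw i \<circ> t \<in> tabs l n")
  case False
  then show ?thesis
    using s_F_nonstandard[OF t i False] kap_left_commute[of "F t"] F_F[OF t t] by (simp add: mult.assoc)
next
  case True
  obtain D where D: "std_tab l n D t" using t by (auto simp: tabs_def)
  let ?z = "s i * F t - \<kappa> (1 / axial i t) * F t"
  have "weight n (content u (sw i \<circ> t)) ?z = weight n (content u t \<circ> sw i) ?z"
    by (rule weight_cong) (use pos_sw[OF D i] in \<open>simp add: content_pos\<close>)
  then have "F t * ?z = 0" using F_weight[OF t True] s_F_weight[OF t i] sw_comp_neq[OF D i] by auto
  then show ?thesis
    using F_F[OF t t] kap_left_commute[of "F t"] by (simp add: right_diff_distrib mult.assoc)
qed

lemma F_s_expand:
  assumes t: "t \<in> tabs l n" and i: "1 \<le> i" "i < n"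
  shows "F t * s i = \<kappa> (1 / axial i t) * F t + (if sw i \<circ> t \<in> tabs l n then F t * s i * F (sw i \<circ> t) else 0)"
proof -
  obtain D where D: "std_tab l n D t" using t by (auto simp: tabs_def)
  have ne: "sw i \<circ> t \<noteq> t" by (rule sw_comp_neq[OF D i])
  have "F t * s i = (\<Sum>c\<in>tabs l n. F t * s i * F c)" using insert_F[of "F t * s i" 1] by simp
  also have "\<dots> = (\<Sum>c\<in>tabs l n. (if c = t then \<kappa> (1 / axial i t) * F t else 0) + (if c = sw i \<circ> t then F t * s i * F (sw i \<circ> t) else 0))"
  proof (rule sum.cong[OF refl])
    fix c assume c: "c \<in> tabs l n"
    have "t \<noteq> sw i \<circ> c" if "c \<noteq> sw i \<circ> t" using that sw_sw by metis
    then show "F t * s i * F c = (if c = t then \<kappa> (1 / axial i t) * F t else 0) + (if c = sw i \<circ> t then F t * s i * F (sw i \<circ> t) else 0)"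
      using F_s_F_zero[OF t c i] F_s_F_diag[OF t i] ne by auto
  qed
  also have "\<dots> = \<kappa> (1 / axial i t) * F t + (if sw i \<circ> t \<in> tabs l n then F t * s i * F (sw i \<circ> t) else 0)"
    using t finite_tabs by (simp add: sum.distrib)
  finally show ?thesis .
qed

text \<open>Expand \<open>F t * (s i * s i) * F t = F t\<close> in the middle: staying at
  \<open>t\<close> contributes the inverse square of the axial distance, and the rest passes through
  the swapped tableau.\<close>

lemma F_s_F_s_F:
  assumes t: "t \<in> tabs l n" and i: "1 \<le> i" "i < n" and b: "sw i \<circ> t \<in> tabs l n"
  shows "F t * s i * F (sw i \<circ> t) * s i * F t = \<kappa> (1 - 1 / (axial i t)\<^sup>2) * F t"
proof -
  define Y where "Y = F t * s i * F (sw i \<circ> t) * s i * F t"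
  have e: "F t * s i = \<kappa> (1 / axial i t) * F t + F t * s i * F (sw i \<circ> t)"
    using F_s_expand[OF t i] b by simp
  have "F t * s i * (s i * F t) = F t * (s i * s i) * F t" by (simp add: mult.assoc)
  then have "F t = F t * s i * (s i * F t)" unfolding s_sq[OF i] using F_F[OF t t] by simp
  also have "\<dots> = (\<kappa> (1 / axial i t) * F t + F t * s i * F (sw i \<circ> t)) * (s i * F t)"
    by (rule arg_cong[OF e, of "\<lambda>x. x * (s i * F t)"])
  also have "\<dots> = \<kappa> (1 / axial i t) * (F t * s i * F t) + Y"
    unfolding Y_def by (simp add: distrib_right mult.assoc)
  also have "F t * s i * F t = \<kappa> (1 / axial i t) * F t" by (rule F_s_F_diag[OF t i])
  also have "\<kappa> (1 / axial i t) * (\<kappa> (1 / axial i t) * F t) = \<kappa> (1 / (axial i t)\<^sup>2) * F t"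
    by (simp add: kap_kap power2_eq_square)
  finally have "Y = F t - \<kappa> (1 / (axial i t)\<^sup>2) * F t" by (metis add_diff_cancel_left')
  also have "\<dots> = \<kappa> (1 - 1 / (axial i t)\<^sup>2) * F t" by (simp add: kap_diff left_diff_distrib)
  finally show ?thesis unfolding Y_def .
qed

text \<open>Each letter of the word keeps a tableau or swaps two of its entries, so words connect
  only tableaux of one shape.\<close>

lemma Pw_shape:
  assumes a: "std_tab l n D a" and b: "b \<in> tabs l n" and w: "set is \<subseteq> {1..<n}"
    and nz: "F a * Pw is * F b \<noteq> 0"
  shows "std_tab l n D b"
  using a w nz
proof (induction "is" arbitrary: a)
  case Nil
  have "a \<in> tabs l n" using Nil by (auto simp: tabs_def)
  then have "a = b" using F_F[of a b] b Nil(3) by (auto split: if_splits)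
  then show ?case using Nil by simp
next
  case (Cons i "is")
  have i: "1 \<le> i" "i < n" using Cons.prems by auto
  have ta: "a \<in> tabs l n" using Cons.prems by (auto simp: tabs_def)
  have "F a * Pw (i # is) * F b = (\<Sum>c\<in>tabs l n. (F a * s i) * F c * (Pw is * F b))"
    using insert_F[of "F a * s i" "Pw is * F b"] by (simp add: mult.assoc)
  then obtain c where c: "c \<in> tabs l n" "(F a * s i) * F c * (Pw is * F b) \<noteq> 0"
    using Cons.prems(3) by (metis (mono_tags, lifting) sum.neutral)
  then have "F a * s i * F c \<noteq> 0" by auto
  then have "c = a \<or> a = sw i \<circ> c" using F_s_F_zero[OF ta c(1) i] by auto
  then have "std_tab l n D c"
  proof
    assume "a = sw i \<circ> c"
    then show ?thesis using tabs_sw_shape[OF c(1) _ i] Cons.prems(1) by blast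
  qed (use Cons.prems in simp)
  moreover have "F c * Pw is * F b \<noteq> 0" using c(2) by (metis mult.assoc mult_zero_right)
  ultimately show ?case using Cons by auto
qed

lemma axial_sw:
  assumes t: "std_tab l n D t" and i: "1 \<le> i" "i < n"
  shows "axial i (sw i \<circ> t) = - axial i t"
  using pos_sw[OF t i, of i] pos_sw[OF t i, of "i + 1"] i by (simp add: axial_def content_pos)

text \<open>Among all tableaux that can be reached along the letters of the word, \<open>t\<close> is the only one with
  the maximal number of inversions, which makes \<open>F t0 * Pw is * F t\<close> computable.\<close>

lemma reduced_word:
  assumes t: "std_tab l n D t" and t0: "std_tab l n D t0" "inversions D t0 = {}"
  shows "\<exists>is. set is \<subseteq> {1..<n} \<and> word_perm is \<circ> t0 = t \<and>
    (\<forall>v\<in>tabs l n. F t0 * Pw is * F v \<noteq> 0 \<longrightarrow> std_tab l n D v \<and> (v = t \<or> inv_count D v < inv_count D t)) \<and>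
    (\<forall>v\<in>tabs l n. F v * Pw (rev is) * F t0 \<noteq> 0 \<longrightarrow> std_tab l n D v \<and> (v = t \<or> inv_count D v < inv_count D t)) \<and>
    (F t0 * Pw is * F t) * (F t * Pw (rev is) * F t0) = \<kappa> (norm_ratio u D t) * F t0 \<and>
    (F t * Pw (rev is) * F t0) * (F t0 * Pw is * F t) = \<kappa> (norm_ratio u D t) * F t"
  using t t0
proof (induction rule: std_tab_induct)
  case init
  have T0: "t0 \<in> tabs l n" using t0 by (auto simp: tabs_def)
  have ratio: "norm_ratio u D t0 = 1" using t0(2) by (simp add: norm_ratio_def)
  have eq: "v = t0" if "v \<in> tabs l n" "F t0 * F v \<noteq> 0 \<or> F v * F t0 \<noteq> 0" for v
    using F_F[OF T0 that(1)] F_F[OF that(1) T0] that(2) by (auto split: if_splits)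
  have FF: "F t0 * F t0 = F t0" using F_F[OF T0 T0] by simp
  show ?case
  proof (intro exI[of _ "[]"] conjI ballI impI)
    fix v assume v: "v \<in> tabs l n"
    show "std_tab l n D v" "v = t0 \<or> inv_count D v < inv_count D t0" if "F t0 * Pw [] * F v \<noteq> 0"
      using eq[OF v] that t0(1) by auto
    show "std_tab l n D v" "v = t0 \<or> inv_count D v < inv_count D t0" if "F v * Pw (rev []) * F t0 \<noteq> 0"
      using eq[OF v] that t0(1) by auto
  qed (simp_all add: FF ratio)
next
  case (step t i)
  let ?t' = "sw i \<circ> t"
  have i: "1 \<le> i" "i < n" by fact+
  have T0: "t0 \<in> tabs l n" and T: "t \<in> tabs l n" and T': "?t' \<in> tabs l n"
    using t0 step by (auto simp: tabs_def)
  have inv: "inv_count D ?t' = Suc (inv_count D t)" by (rule inv_count_sw[OF step(1) i step(5)])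
  from step.IH obtain js where js: "set js \<subseteq> {1..<n}" "word_perm js \<circ> t0 = t"
    and up: "\<forall>v\<in>tabs l n. F t0 * Pw js * F v \<noteq> 0 \<longrightarrow> std_tab l n D v \<and> (v = t \<or> inv_count D v < inv_count D t)"
    and down: "\<forall>v\<in>tabs l n. F v * Pw (rev js) * F t0 \<noteq> 0 \<longrightarrow> std_tab l n D v \<and> (v = t \<or> inv_count D v < inv_count D t)"
    and n1: "(F t0 * Pw js * F t) * (F t * Pw (rev js) * F t0) = \<kappa> (norm_ratio u D t) * F t0"
    and n2: "(F t * Pw (rev js) * F t0) * (F t0 * Pw js * F t) = \<kappa> (norm_ratio u D t) * F t"
    by (elim exE conjE) (rule that; assumption)
  note up = up[rule_format] and down = down[rule_format]
  let ?A = "F t0 * Pw js * F t" and ?B = "F t * Pw (rev js) * F t0"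
  \<comment> \<open>A further letter adds at most one inversion, so tableaux with fewer inversions
    than \<open>t\<close> lead only to tableaux with fewer than \<open>?t'\<close>.\<close>
  have reach: "std_tab l n D v \<and> (v = ?t' \<or> inv_count D v < inv_count D ?t')"
    if c: "std_tab l n D c" "c = t \<or> inv_count D c < inv_count D t" and v: "v \<in> tabs l n" "v = c \<or> v = sw i \<circ> c" for c v
  proof -
    have sv: "std_tab l n D v"
    proof (cases "v = c")
      case False
      then have "c = sw i \<circ> v" using v(2) sw_sw by metis
      then show ?thesis using tabs_sw_shape[OF v(1) _ i] c(1) by blast
    qed (use c in simp)
    have "inv_count D v \<le> Suc (inv_count D c)"
      using v(2) inv_count_sw_le[OF c(1) _ i] sv by auto
    then show ?thesis using c(2) v(2) sv inv by auto
  qed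
  have up': "std_tab l n D v \<and> (v = ?t' \<or> inv_count D v < inv_count D ?t')"
    if v: "v \<in> tabs l n" "F t0 * Pw (js @ [i]) * F v \<noteq> 0" for v
  proof -
    have "F t0 * Pw (js @ [i]) * F v = (\<Sum>c\<in>tabs l n. (F t0 * Pw js) * F c * (s i * F v))"
      using insert_F[of "F t0 * Pw js" "s i * F v"] by (simp add: mult.assoc)
    then obtain c where c: "c \<in> tabs l n" "(F t0 * Pw js) * F c * (s i * F v) \<noteq> 0"
      using v(2) by (metis (mono_tags, lifting) sum.neutral)
    have "F t0 * Pw js * F c \<noteq> 0" using c(2) by auto
    moreover have "F c * s i * F v \<noteq> 0" using c(2) by (metis mult.assoc mult_zero_right)
    then have "v = c \<or> v = sw i \<circ> c" using F_s_F_zero[OF c(1) v(1) i] sw_sw by metis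
    ultimately show ?thesis using up[OF c(1)] reach v(1) by blast
  qed
  have down': "std_tab l n D v \<and> (v = ?t' \<or> inv_count D v < inv_count D ?t')"
    if v: "v \<in> tabs l n" "F v * Pw (rev (js @ [i])) * F t0 \<noteq> 0" for v
  proof -
    have "F v * Pw (rev (js @ [i])) * F t0 = (\<Sum>c\<in>tabs l n. (F v * s i) * F c * (Pw (rev js) * F t0))"
      using insert_F[of "F v * s i" "Pw (rev js) * F t0"] by (simp add: mult.assoc)
    then obtain c where c: "c \<in> tabs l n" "(F v * s i) * F c * (Pw (rev js) * F t0) \<noteq> 0"
      using v(2) by (metis (mono_tags, lifting) sum.neutral)
    have "F v * s i * F c \<noteq> 0" using c(2) by auto
    then have "v = c \<or> v = sw i \<circ> c" using F_s_F_zero[OF v(1) c(1) i] by metis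
    moreover have "F c * Pw (rev js) * F t0 \<noteq> 0" using c(2) by (metis mult.assoc mult_zero_right)
    ultimately show ?thesis using down[OF c(1)] reach v(1) by blast
  qed
  have ne: "?t' \<noteq> t" by (rule sw_comp_neq[OF step(1) i])
  \<comment> \<open>Of the tableaux inserted before the last letter only \<open>t\<close> and the
    target lead to the target, and the target has too many inversions to be reached by
    \<open>js\<close>.\<close>
  have A': "F t0 * Pw (js @ [i]) * F ?t' = ?A * s i * F ?t'"
  proof -
    have "F t0 * Pw (js @ [i]) * F ?t' = (\<Sum>c\<in>tabs l n. (F t0 * Pw js) * F c * (s i * F ?t'))"
      using insert_F[of "F t0 * Pw js" "s i * F ?t'"] by (simp add: mult.assoc)
    also have "\<dots> = (\<Sum>c\<in>tabs l n. if c = t then ?A * s i * F ?t' else 0)"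
    proof (rule sum.cong[OF refl])
      fix c assume c: "c \<in> tabs l n"
      have "(F t0 * Pw js) * F c * (s i * F ?t') = 0" if "c \<noteq> t"
      proof (cases "c = ?t'")
        case True
        then have "F t0 * Pw js * F c = 0" using up[OF c] inv that by auto
        then show ?thesis by simp
      next
        case False
        then have "c \<noteq> sw i \<circ> ?t'" using that sw_sw by metis
        then have "F c * s i * F ?t' = 0" using F_s_F_zero[OF c T' i] False by blast
        then show ?thesis by (simp add: mult.assoc)
      qed
      then show "(F t0 * Pw js) * F c * (s i * F ?t') = (if c = t then ?A * s i * F ?t' else 0)"
        by (simp add: mult.assoc)
    qed
    also have "\<dots> = ?A * s i * F ?t'" using T finite_tabs by simp
    finally show ?thesis .
  qed
  have B': "F ?t' * Pw (rev (js @ [i])) * F t0 = F ?t' * s i * ?B"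
  proof -
    have "F ?t' * Pw (rev (js @ [i])) * F t0 = (\<Sum>c\<in>tabs l n. (F ?t' * s i) * F c * (Pw (rev js) * F t0))"
      using insert_F[of "F ?t' * s i" "Pw (rev js) * F t0"] by (simp add: mult.assoc)
    also have "\<dots> = (\<Sum>c\<in>tabs l n. if c = t then F ?t' * s i * ?B else 0)"
    proof (rule sum.cong[OF refl])
      fix c assume c: "c \<in> tabs l n"
      have "(F ?t' * s i) * F c * (Pw (rev js) * F t0) = 0" if "c \<noteq> t"
      proof (cases "c = ?t'")
        case True
        then have "F c * Pw (rev js) * F t0 = 0" using down[OF c] inv that by auto
        then show ?thesis by (simp add: mult.assoc)
      next
        case False
        then have "F ?t' * s i * F c = 0" using F_s_F_zero[OF T' c i] that sw_sw by metis
        then show ?thesis by simp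
      qed
      then show "(F ?t' * s i) * F c * (Pw (rev js) * F t0) = (if c = t then F ?t' * s i * ?B else 0)"
        by (simp add: mult.assoc)
    qed
    also have "\<dots> = F ?t' * s i * ?B" using T finite_tabs by simp
    finally show ?thesis .
  qed
  define r where "r = 1 - 1 / (axial i t)\<^sup>2"
  have ratio: "norm_ratio u D ?t' = r * norm_ratio u D t"
  proof -
    have "finite D" using step(1) by (simp add: std_tab_def young_diagram_def)
    moreover have "(ct u (pos t i) - ct u (pos t (i + 1)))\<^sup>2 = (axial i t)\<^sup>2"
      by (simp add: axial_def content_pos power2_commute)
    ultimately show ?thesis
      using inversions_sw[OF step(1) i step(5)] finite_inversions by (simp add: norm_ratio_def r_def)
  qed
  have AF: "?A * F t = ?A" "F t * ?B = ?B"
    using F_F[OF T T] by (simp_all add: mult.assoc) (simp add: mult.assoc[symmetric])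
  have sFs: "F t * s i * F ?t' * s i * F t = \<kappa> r * F t"
    unfolding r_def by (rule F_s_F_s_F[OF T i T'])
  have sFs': "F ?t' * s i * F t * s i * F ?t' = \<kappa> r * F ?t'"
  proof -
    have "sw i \<circ> ?t' \<in> tabs l n" using T unfolding sw_sw .
    from F_s_F_s_F[OF T' i this] show ?thesis
      unfolding sw_sw using axial_sw[OF step(1) i] by (simp add: r_def)
  qed
  have FF': "F ?t' * F ?t' = F ?t'" using F_F[OF T' T'] by simp
  \<comment> \<open>In \<open>m1\<close> the loop of one swap, worth \<open>r\<close>, sits inside
    the loop of the word \<open>js\<close>; in \<open>m2\<close> the nesting is reversed.\<close>
  have m1: "(?A * s i * F ?t') * (F ?t' * s i * ?B) = \<kappa> (norm_ratio u D ?t') * F t0"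
  proof -
    have "(?A * s i * F ?t') * (F ?t' * s i * ?B) = ((?A * F t) * s i * F ?t') * (F ?t' * s i * (F t * ?B))"
      unfolding AF ..
    also have "\<dots> = ?A * (F t * s i * (F ?t' * F ?t') * s i * F t) * ?B" by (simp only: mult.assoc)
    also have "\<dots> = ?A * (\<kappa> r * F t) * ?B" unfolding FF' sFs ..
    also have "\<dots> = \<kappa> r * ((?A * F t) * ?B)" using kap_left_commute[of ?A] by (simp only: mult.assoc)
    also have "\<dots> = \<kappa> r * (\<kappa> (norm_ratio u D t) * F t0)" unfolding AF n1 ..
    finally show ?thesis unfolding kap_kap ratio .
  qed
  have m2: "(F ?t' * s i * ?B) * (?A * s i * F ?t') = \<kappa> (norm_ratio u D ?t') * F ?t'"
  proof -
    have "(F ?t' * s i * ?B) * (?A * s i * F ?t') = F ?t' * s i * (?B * ?A) * s i * F ?t'" by (simp only: mult.assoc)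
    also have "\<dots> = F ?t' * s i * (\<kappa> (norm_ratio u D t) * F t) * s i * F ?t'" unfolding n2 ..
    also have "\<dots> = \<kappa> (norm_ratio u D t) * (F ?t' * s i * F t * s i * F ?t')"
      using kap_left_commute[of "F ?t' * s i"] by (simp only: mult.assoc)
    also have "\<dots> = \<kappa> (norm_ratio u D t) * (\<kappa> r * F ?t')" unfolding sFs' ..
    finally show ?thesis unfolding kap_kap ratio mult.commute[of r] .
  qed
  have w: "word_perm (js @ [i]) \<circ> t0 = ?t'" using js(2) by (simp add: word_perm_append comp_assoc)
  have sset: "set (js @ [i]) \<subseteq> {1..<n}" using js(1) i by auto
  note m1' = m1[folded A' B'] and m2' = m2[folded A' B']
  show ?case
  proof (intro exI[of _ "js @ [i]"] conjI ballI impI)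
    fix v assume v: "v \<in> tabs l n"
    show "std_tab l n D v" "v = ?t' \<or> inv_count D v < inv_count D ?t'" if "F t0 * Pw (js @ [i]) * F v \<noteq> 0"
      using up'[OF v that] by blast+
    show "std_tab l n D v" "v = ?t' \<or> inv_count D v < inv_count D ?t'" if "F v * Pw (rev (js @ [i])) * F t0 \<noteq> 0"
      using down'[OF v that] by blast+
  qed (rule sset w m1' m2')+
qed

end

section \<open>The initial tableau\<close>

definition gen_X :: "(nat \<Rightarrow> 'r::ring_1) \<Rightarrow> nat \<Rightarrow> mpart \<Rightarrow> 'r" where
  "gen_X s n lam = (\<Sum>w\<in>young n lam. gen_perm s n w)"

definition gen_U :: "('k \<Rightarrow> 'r::ring_1) \<Rightarrow> (nat \<Rightarrow> 'r) \<Rightarrow> nat \<Rightarrow> (nat \<Rightarrow> 'k) \<Rightarrow> mpart \<Rightarrow> 'r" where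
  "gen_U \<kappa> L l u lam =
     (\<Prod>r\<leftarrow>[2..<Suc l]. \<Prod>k\<leftarrow>[1..<Suc (\<Sum>c\<in>{1..<r}. comp_size lam c)]. (L k - \<kappa> (u r)))"

text \<open>The prescribed value of \<open>r\<close> at the initial tableau.\<close>

definition r_init :: "nat \<Rightarrow> (nat \<Rightarrow> 'k::field) \<Rightarrow> mpart \<Rightarrow> 'k" where
  "r_init l u lam = (\<Prod>c=1..l. \<Prod>i | lam c i \<noteq> 0. of_nat (fact (lam c i))) *
     (\<Prod>a=1..l. \<Prod>b\<in>{a<..l}. \<Prod>(i, j)\<in>{(i, j). (i, j, a) \<in> diagram lam}. (of_nat j - of_nat i + u a - u b))"

lemma ct_eq: "ct u (i, j, c) = of_nat j - of_nat i + u c"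
  by (simp add: ct_def diag_def)

section \<open>Products over the nodes of a diagram\<close>

lemma multipartition_diagram_bij:
  assumes m: "multipartition l n lam"
  shows "(\<Prod>x\<in>diagram lam. f x) = (\<Prod>c=1..l. \<Prod>i | lam c i \<noteq> 0. \<Prod>j=1..lam c i. f (i, j, c))"
    and "(\<Prod>x\<in>diagram lam. f x) = (\<Prod>a=1..l. \<Prod>(i, j)\<in>{(i, j). (i, j, a) \<in> diagram lam}. f (i, j, a))"
proof -
  have fin: "finite {i. lam c i \<noteq> 0}" for c by (rule multipartition_finite[OF m])
  let ?S = "SIGMA c:{1..l}. SIGMA i:{i. lam c i \<noteq> 0}. {1..lam c i}"
  let ?f = "\<lambda>(c, i, j). (i, j, c) :: node"
  have img: "diagram lam = ?f ` ?S"
  proof (intro equalityI subsetI)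
    fix x assume x: "x \<in> diagram lam"
    then have "valid_node l x" by (rule multipartition_valid[OF m])
    then show "x \<in> ?f ` ?S"
      using x by (intro image_eqI[of _ _ "(cmp x, row x, col x)"]) (auto simp: diagram_iff valid_node_def)
  qed (auto simp: diagram_iff)
  have inj: "inj_on ?f ?S" by (auto simp: inj_on_def)
  have "(\<Prod>x\<in>diagram lam. f x) = (\<Prod>x\<in>?S. f (?f x))" 
    using prod.reindex[OF inj, of f] unfolding img[symmetric] comp_def .
  also have "\<dots> = (\<Prod>(c, y)\<in>?S. case y of (i, j) \<Rightarrow> f (i, j, c))"
    by (rule prod.cong[OF refl]) (simp add: case_prod_unfold)
  also have "\<dots> = (\<Prod>c=1..l. \<Prod>(i, j)\<in>(SIGMA i:{i. lam c i \<noteq> 0}. {1..lam c i}). f (i, j, c))"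
    by (rule prod.Sigma[symmetric]) (use fin in auto)
  also have "\<dots> = (\<Prod>c=1..l. \<Prod>i | lam c i \<noteq> 0. \<Prod>j=1..lam c i. f (i, j, c))"
    by (rule prod.cong[OF refl], rule prod.Sigma[symmetric]) (use fin in auto)
  finally show "(\<Prod>x\<in>diagram lam. f x) = (\<Prod>c=1..l. \<Prod>i | lam c i \<noteq> 0. \<Prod>j=1..lam c i. f (i, j, c))" .
  let ?T = "SIGMA a:{1..l}. {(i, j). (i, j, a) \<in> diagram lam}"
  have finT: "finite {(i, j). (i, j, a) \<in> diagram lam}" for a
  proof (rule finite_subset)
    show "{(i, j). (i, j, a) \<in> diagram lam} \<subseteq> (\<lambda>x. (row x, col x)) ` diagram lam" by force
    show "finite ((\<lambda>x. (row x, col x)) ` diagram lam)"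
      using young_diagram_finite[OF young_diagram_diagram(1)[OF m]] by simp
  qed
  have img: "diagram lam = (\<lambda>(a, i, j). (i, j, a)) ` ?T"
  proof (intro equalityI subsetI)
    fix x assume x: "x \<in> diagram lam"
    then have "valid_node l x" by (rule multipartition_valid[OF m])
    then show "x \<in> (\<lambda>(a, i, j). (i, j, a)) ` ?T"
      using x by (intro image_eqI[of _ _ "(cmp x, row x, col x)"]) (auto simp: valid_node_def)
  qed auto
  have inj: "inj_on (\<lambda>(a, i, j). (i, j, a)) ?T" by (auto simp: inj_on_def)
  have "(\<Prod>x\<in>diagram lam. f x) = (\<Prod>x\<in>?T. f ((\<lambda>(a, i, j). (i, j, a)) x))"
    using prod.reindex[OF inj, of f] unfolding img[symmetric] comp_def .
  also have "\<dots> = (\<Prod>(a, y)\<in>?T. case y of (i, j) \<Rightarrow> f (i, j, a))"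
    by (rule prod.cong[OF refl]) (simp add: case_prod_unfold)
  also have "\<dots> = (\<Prod>a=1..l. \<Prod>(i, j)\<in>{(i, j). (i, j, a) \<in> diagram lam}. f (i, j, a))"
    by (rule prod.Sigma[symmetric]) (use finT in auto)
  finally show "(\<Prod>x\<in>diagram lam. f x) = (\<Prod>a=1..l. \<Prod>(i, j)\<in>{(i, j). (i, j, a) \<in> diagram lam}. f (i, j, a))" .
qed

locale initial_tableau =
  fixes l n :: nat and lam :: mpart
  assumes mp: "multipartition l n lam"
begin

abbreviation "D \<equiv> diagram lam"
abbreviation "t0 \<equiv> tab_upper lam"

lemmas t0 = tab_upper_std(1)[OF mp] and t0_inv = tab_upper_std(2)[OF mp]

lemma finite_D: "finite D"
  using young_diagram_finite[OF young_diagram_diagram(1)[OF mp]] .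

section \<open>Rows of the initial tableau and the Young subgroup\<close>

definition row_of :: "nat \<Rightarrow> nat \<times> nat" where "row_of k = (row (pos t0 k), cmp (pos t0 k))"

lemma before_pos_t0: "a \<in> {1..n} \<Longrightarrow> b \<in> {1..n} \<Longrightarrow> before (pos t0 a) (pos t0 b) \<longleftrightarrow> a < b"
proof -
  assume a: "a \<in> {1..n}" and b: "b \<in> {1..n}"
  have D: "pos t0 a \<in> D" "pos t0 b \<in> D" "t0 (pos t0 a) = a" "t0 (pos t0 b) = b" using std_tab_pos[OF t0] a b by auto
  have no: "\<not> (before x y \<and> t0 y < t0 x)" if "x \<in> D" "y \<in> D" for x y
    using t0_inv that unfolding inversions_def by blast
  show ?thesis
  proof
    assume "before (pos t0 a) (pos t0 b)"
    moreover from this have "a \<noteq> b" by auto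
    ultimately show "a < b" using no[of "pos t0 a" "pos t0 b"] D by simp
  next
    assume lt: "a < b"
    then have "pos t0 a \<noteq> pos t0 b" using D(3,4) by (metis less_irrefl)
    moreover have "\<not> before (pos t0 b) (pos t0 a)" using no[OF D(2,1)] D(3,4) lt by simp
    ultimately show "before (pos t0 a) (pos t0 b)" using before_total by blast
  qed
qed

lemma row_of_interval:
  assumes "1 \<le> a" "a \<le> b" "b \<le> c" "c \<le> n" "row_of a = row_of c"
  shows "row_of b = row_of c"
proof (cases "a = b \<or> b = c")
  case False
  then have "before (pos t0 a) (pos t0 b)" "before (pos t0 b) (pos t0 c)"
    using before_pos_t0[of a b] before_pos_t0[of b c] assms by auto
  then show ?thesis using assms(5)
    by (cases "pos t0 a"; cases "pos t0 b"; cases "pos t0 c") (auto simp: row_of_def before_def)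
qed (use assms in auto)

lemma young_block_perms: "young n lam = block_perms n row_of"
proof -
  have "(\<forall>(i, j, c)\<in>D. \<exists>j'. (i, j', c) \<in> D \<and> w (t0 (i, j, c)) = t0 (i, j', c)) \<longleftrightarrow>
      (\<forall>k\<in>{1..n}. row_of (w k) = row_of k)" if w: "w permutes {1..n}" for w
  proof
    assume *: "\<forall>(i, j, c)\<in>D. \<exists>j'. (i, j', c) \<in> D \<and> w (t0 (i, j, c)) = t0 (i, j', c)"
    show "\<forall>k\<in>{1..n}. row_of (w k) = row_of k"
    proof
      fix k assume k: "k \<in> {1..n}"
      obtain i j c where x: "pos t0 k = (i, j, c)" by (cases "pos t0 k")
      then have "(i, j, c) \<in> D" "t0 (i, j, c) = k" using std_tab_pos[OF t0] k by metis+
      then obtain j' where "(i, j', c) \<in> D" "w k = t0 (i, j', c)" using * by fast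
      then have "pos t0 (w k) = (i, j', c)" using std_tab_pos(3)[OF t0] by simp
      then show "row_of (w k) = row_of k" by (simp add: row_of_def x)
    qed
  next
    assume *: "\<forall>k\<in>{1..n}. row_of (w k) = row_of k"
    show "\<forall>(i, j, c)\<in>D. \<exists>j'. (i, j', c) \<in> D \<and> w (t0 (i, j, c)) = t0 (i, j', c)"
    proof clarify
      fix i j c assume x: "(i, j, c) \<in> D"
      let ?k = "t0 (i, j, c)"
      have k: "?k \<in> {1..n}" using std_tab_pos(4)[OF t0 x] .
      then have wk: "w ?k \<in> {1..n}" using permutes_in_image[OF w] by blast
      have "row_of (w ?k) = (i, c)" using * k std_tab_pos(3)[OF t0 x] by (simp add: row_of_def)
      then have "pos t0 (w ?k) = (i, col (pos t0 (w ?k)), c)" by (simp add: row_of_def prod_eq_iff)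
      then show "\<exists>j'. (i, j', c) \<in> D \<and> w ?k = t0 (i, j', c)"
        using std_tab_pos(1,2)[OF t0 wk] by metis
    qed
  qed
  then show ?thesis unfolding young_def block_perms_def by blast
qed

lemma young_words: "w \<in> young n lam \<Longrightarrow>
    \<exists>is. set is \<subseteq> {i. 1 \<le> i \<and> i < n \<and> row_of i = row_of (i + 1)} \<and> word_perm is = w"
  unfolding young_block_perms by (rule block_perms_words) (rule row_of_interval)

text \<open>Consecutive entries of a row are comparable, so they cannot be swapped, and by
  \<open>path_swap_iff\<close> their diagonals differ by one.\<close>

lemma row_step:
  assumes i: "1 \<le> i" "i < n" and r: "row_of i = row_of (i + 1)"
  shows "pos t0 (i + 1) = (row (pos t0 i), col (pos t0 i) + 1, cmp (pos t0 i))" "sw i \<circ> t0 \<notin> tabs l n"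
proof -
  have p: "path l n (pos t0)" using std_tab_path[OF t0] by simp
  have "before (pos t0 i) (pos t0 (i + 1))" using before_pos_t0[of i "i + 1"] i by simp
  then have nle: "nle (pos t0 i) (pos t0 (i + 1))" using r by (auto simp: before_def row_of_def nle_def)
  then have np: "\<not> path l n (pos t0 \<circ> sw i)" using path_swap_iff(2)[OF p i] by simp
  then have "\<bar>diag (pos t0 i) - diag (pos t0 (i + 1))\<bar> = 1" using path_swap_iff(1)[OF p i] by simp
  moreover have rc: "row (pos t0 i) = row (pos t0 (i + 1))" "cmp (pos t0 i) = cmp (pos t0 (i + 1))"
    using r unfolding row_of_def by blast+
  ultimately have "col (pos t0 (i + 1)) = col (pos t0 i) + 1" using nle unfolding nle_def diag_def by linarith
  then show "pos t0 (i + 1) = (row (pos t0 i), col (pos t0 i) + 1, cmp (pos t0 i))"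
    using rc by (simp only: prod_eq_iff fst_conv snd_conv)
  show "sw i \<circ> t0 \<notin> tabs l n" using np std_tab_sw(2)[OF t0 i] by (auto simp: tabs_def)
qed

text \<open>The range of \<open>k\<close> in the factors \<open>L k - \<kappa> (u r)\<close>. By
  \<open>below_iff\<close> it consists of the entries of the initial tableau in components before
  \<open>r\<close>.\<close>

definition below :: "nat \<Rightarrow> nat" where "below r = (\<Sum>c\<in>{1..<r}. comp_size lam c)"

lemma below_iff: "k \<in> {1..n} \<Longrightarrow> k \<le> below r \<longleftrightarrow> cmp (pos t0 k) < r"
proof -
  assume k: "k \<in> {1..n}"
  let ?x = "pos t0 k" and ?A = "{y \<in> D. cmp y \<in> {1..<r}}" and ?B = "{y \<in> D. y = pos t0 k \<or> before y (pos t0 k)}"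
  have x: "?x \<in> D" "t0 ?x = k" using std_tab_pos(1,2)[OF t0 k] by auto
  have A: "card ?A = below r" unfolding below_def
    by (rule card_diagram_part(2)) (use multipartition_finite[OF mp] in auto)
  have B: "card ?B = k" using tab_upper_rank[OF mp x(1)] x(2) by simp
  have pos: "1 \<le> cmp y" if "y \<in> D" for y using multipartition_valid[OF mp that] by (simp add: valid_node_def)
  show ?thesis
  proof (cases "cmp ?x < r")
    case True
    then have "?B \<subseteq> ?A" using pos by (auto simp: before_def)
    then have "k \<le> below r" using card_mono[of ?A ?B] finite_D A B by simp
    then show ?thesis using True by simp
  next
    case False
    then have "insert ?x ?A \<subseteq> ?B" using x by (auto simp: before_def)
    then have "card (insert ?x ?A) \<le> k" using card_mono[of ?B "insert ?x ?A"] finite_D B by simp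
    then show ?thesis using False finite_D A by simp
  qed
qed

lemma below_le: "below r \<le> n"
proof -
  have "card {y \<in> D. cmp y \<in> {1..<r}} \<le> card D" using finite_D by (intro card_mono) auto
  moreover have "card {y \<in> D. cmp y \<in> {1..<r}} = below r" unfolding below_def
    by (rule card_diagram_part(2)) (use multipartition_finite[OF mp] in auto)
  ultimately show ?thesis using young_diagram_diagram(2)[OF mp] by simp
qed

lemma prod_pos_t0: "(\<Prod>k=1..n. f (pos t0 k)) = (\<Prod>x\<in>D. f x)"
proof -
  have "bij_betw (pos t0) {1..n} D"
    using std_tab_path[OF t0] by (auto simp: path_def bij_betw_def)
  then show ?thesis by (rule prod.reindex_bij_betw)
qed

text \<open>By \<open>card_block_perms\<close> the order is the product of the columns of all
  entries, and the columns along a row of length \<open>m\<close> multiply to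
  \<open>m!\<close>.\<close>

lemma card_young:
  "card (young n lam) = (\<Prod>c=1..l. \<Prod>i | lam c i \<noteq> 0. fact (lam c i))"
proof -
  have "card {j\<in>{1..k}. row_of j = row_of k} = col (pos t0 k)" if k: "k \<in> {1..n}" for k
  proof -
    let ?x = "pos t0 k"
    have x: "?x \<in> D" using std_tab_pos(1,2)[OF t0 k] by simp
    have "bij_betw (\<lambda>j. col (pos t0 j)) {j\<in>{1..k}. row_of j = row_of k} {1..col ?x}"
    proof (rule bij_betw_imageI)
      show "inj_on (\<lambda>j. col (pos t0 j)) {j\<in>{1..k}. row_of j = row_of k}"
      proof (rule inj_onI)
        fix a b assume ab: "a \<in> {j\<in>{1..k}. row_of j = row_of k}" "b \<in> {j\<in>{1..k}. row_of j = row_of k}"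
          "col (pos t0 a) = col (pos t0 b)"
        then have "row_of a = row_of b" by simp
        then have "row (pos t0 a) = row (pos t0 b)" "cmp (pos t0 a) = cmp (pos t0 b)" by (simp_all add: row_of_def)
        then have "pos t0 a = pos t0 b" using ab(3) by (intro prod_eqI)
        moreover have "a \<in> {1..n}" "b \<in> {1..n}" using ab(1,2) k by simp_all
        ultimately show "a = b" using std_tab_pos(2)[OF t0] by metis
      qed
      show "(\<lambda>j. col (pos t0 j)) ` {j\<in>{1..k}. row_of j = row_of k} = {1..col ?x}"
      proof (intro equalityI subsetI)
        fix c assume "c \<in> (\<lambda>j. col (pos t0 j)) ` {j\<in>{1..k}. row_of j = row_of k}"
        then obtain j where j: "j \<in> {1..k}" "row_of j = row_of k" "c = col (pos t0 j)" by auto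
        have "j = k \<or> before (pos t0 j) ?x" using before_pos_t0[of j k] j k by auto
        moreover have "row (pos t0 j) = row ?x" "cmp (pos t0 j) = cmp ?x" using j(2) unfolding row_of_def by blast+
        ultimately have "c \<le> col ?x" using j(3) unfolding before_def by auto
        moreover have "pos t0 j \<in> D" using std_tab_pos(1)[OF t0, of j] j k by auto
        then have "1 \<le> c" using j by (simp add: diagram_iff)
        ultimately show "c \<in> {1..col ?x}" by simp
      next
        fix c assume c: "c \<in> {1..col ?x}"
        let ?y = "(row ?x, c, cmp ?x)"
        have y: "?y \<in> D" using x c by (auto simp: diagram_iff)
        let ?j = "t0 ?y"
        have j: "?j \<in> {1..n}" "pos t0 ?j = ?y" using std_tab_pos(3,4)[OF t0 y] by auto
        have "?y = ?x \<or> before ?y ?x" using c by (auto simp: before_def prod_eq_iff)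
        then have "?j \<le> k" using before_pos_t0[OF j(1) k] j std_tab_pos(2)[OF t0 k] by auto
        then show "c \<in> (\<lambda>j. col (pos t0 j)) ` {j\<in>{1..k}. row_of j = row_of k}"
          using j by (intro image_eqI[of _ _ ?j]) (auto simp: row_of_def)
      qed
    qed
    then show ?thesis using bij_betw_same_card by fastforce
  qed
  then have "card (young n lam) = (\<Prod>k=1..n. col (pos t0 k))"
    unfolding young_block_perms card_block_perms by (intro prod.cong) auto
  also have "\<dots> = (\<Prod>c=1..l. \<Prod>i | lam c i \<noteq> 0. \<Prod>j=1..lam c i. j)"
    using prod_pos_t0[of "\<lambda>x. col x"] multipartition_diagram_bij(1)[OF mp, of "\<lambda>x. col x"] by simp
  finally show ?thesis by (simp add: fact_prod)
qed

text \<open>The two factors are the eigenvalues of \<open>X\<close> and \<open>U\<close> on the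
  idempotent of the initial tableau. The proof exchanges the order of the two products over
  components.\<close>

lemma r_init_eq:
  fixes u :: "nat \<Rightarrow> 'k::field"
  shows "r_init l u lam = of_nat (card (young n lam)) * (\<Prod>r=2..l. \<Prod>k=1..below r. content u t0 k - u r)"
proof -
  let ?S = "\<lambda>a. {(i, j). (i, j, a) \<in> diagram lam}"
  have key: "(\<Prod>k=1..below r. content u t0 k - u r) = (\<Prod>a\<in>{1..<r}. \<Prod>(i, j)\<in>?S a. of_nat j - of_nat i + u a - u r)"
    if r: "r \<in> {2..l}" for r
  proof -
    have "(\<Prod>k=1..below r. content u t0 k - u r) = (\<Prod>k=1..n. if cmp (pos t0 k) < r then content u t0 k - u r else 1)"
    proof -
      have "{1..below r} = {k\<in>{1..n}. cmp (pos t0 k) < r}" using below_iff below_le[of r] by fastforce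
      then show ?thesis by (simp only: prod.inter_filter[OF finite_atLeastAtMost])
    qed
    also have "\<dots> = (\<Prod>x\<in>D. if cmp x < r then ct u x - u r else 1)"
      unfolding content_pos by (rule prod_pos_t0)
    also have "\<dots> = (\<Prod>a=1..l. \<Prod>(i, j)\<in>?S a. if a < r then of_nat j - of_nat i + u a - u r else 1)"
      unfolding multipartition_diagram_bij(2)[OF mp] by (intro prod.cong refl) (auto simp: ct_eq)
    also have "\<dots> = (\<Prod>a=1..l. if a < r then \<Prod>(i, j)\<in>?S a. of_nat j - of_nat i + u a - u r else 1)"
      by (intro prod.cong) (auto simp: case_prod_unfold)
    also have "\<dots> = (\<Prod>a\<in>{a\<in>{1..l}. a < r}. \<Prod>(i, j)\<in>?S a. of_nat j - of_nat i + u a - u r)"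
      by (rule prod.inter_filter[symmetric]) simp
    also have "{a\<in>{1..l}. a < r} = {1..<r}" using r by auto
    finally show ?thesis .
  qed
  have "(\<Prod>r=2..l. \<Prod>k=1..below r. content u t0 k - u r) =
      (\<Prod>r\<in>{2..l}. \<Prod>a\<in>{1..<r}. \<Prod>(i, j)\<in>?S a. of_nat j - of_nat i + u a - u r)"
    by (rule prod.cong[OF refl], rule key)
  also have "\<dots> = (\<Prod>(r, a)\<in>(SIGMA r:{2..l}. {1..<r}). \<Prod>(i, j)\<in>?S a. of_nat j - of_nat i + u a - u r)"
    by (rule prod.Sigma) auto
  also have "\<dots> = (\<Prod>(a, r)\<in>(SIGMA a:{1..l}. {a<..l}). \<Prod>(i, j)\<in>?S a. of_nat j - of_nat i + u a - u r)"
    by (rule prod.reindex_bij_witness[of _ "\<lambda>(a, r). (r, a)" "\<lambda>(r, a). (a, r)"]) auto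
  also have "\<dots> = (\<Prod>a=1..l. \<Prod>r\<in>{a<..l}. \<Prod>(i, j)\<in>?S a. of_nat j - of_nat i + u a - u r)"
    by (rule prod.Sigma[symmetric]) auto
  finally show ?thesis unfolding r_init_def card_young by (simp add: of_nat_prod)
qed

end

section \<open>The seminormal form\<close>

locale hecke_shape = hecke_separated + initial_tableau
begin

text \<open>The reflections inside a row of the initial tableau, which generate the Young
  subgroup.\<close>

definition simple :: "nat \<Rightarrow> bool" where
  "simple i \<longleftrightarrow> 1 \<le> i \<and> i < n \<and> row_of i = row_of (i + 1)"

abbreviation X :: 'b where "X \<equiv> gen_X s n lam"
abbreviation U :: 'b where "U \<equiv> gen_U \<kappa> L l u lam"

lemma t0_tabs: "t0 \<in> tabs l n"
  using t0 by (auto simp: tabs_def)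

lemma axial_simple:
  assumes "simple i"
  shows "axial i t0 = 1"
proof -
  have i: "1 \<le> i" "i < n" "row_of i = row_of (i + 1)" using assms by (auto simp: simple_def)
  have "diag (pos t0 (i + 1)) = diag (pos t0 i) + 1" "cmp (pos t0 (i + 1)) = cmp (pos t0 i)"
    using row_step(1)[OF i] by (simp_all add: diag_def)
  then show ?thesis by (simp add: axial_def content_pos ct_def)
qed

text \<open>Neighbours in a row have axial distance 1, and their swap is not standard.\<close>

lemma F_t0_s: "simple i \<Longrightarrow> F t0 * s i = F t0"
  using F_s_expand[OF t0_tabs, of i] axial_simple[of i] row_step(2)[of i] by (simp add: simple_def)

lemma F_t0_Pw: "(\<And>i. i \<in> set is \<Longrightarrow> simple i) \<Longrightarrow> F t0 * Pw is = F t0"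
  by (induction "is") (simp_all add: mult.assoc[symmetric] F_t0_s)

lemma young_simple_word:
  assumes "w \<in> young n lam"
  shows "\<exists>is. (\<forall>i\<in>set is. simple i) \<and> gen_perm s n w = Pw is"
proof -
  obtain "is" where "is": "set is \<subseteq> {i. 1 \<le> i \<and> i < n \<and> row_of i = row_of (i + 1)}" "word_perm is = w"
    using young_words[OF assms] by blast
  moreover have "set is \<subseteq> {1..<n}" using "is"(1) by auto
  ultimately show ?thesis using gen_perm_word[of "is" w] by (intro exI[of _ "is"]) (auto simp: simple_def)
qed

lemma F_t0_X: "F t0 * X = of_nat (card (young n lam)) * F t0"
proof -
  have "F t0 * gen_perm s n w = F t0" if "w \<in> young n lam" for w
    using young_simple_word[OF that] F_t0_Pw by auto
  then show ?thesis by (simp add: gen_X_def sum_distrib_left)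
qed

lemma young_sw:
  assumes "simple i" "w \<in> young n lam"
  shows "w \<circ> sw i \<in> young n lam"
proof -
  have i: "1 \<le> i" "i < n" "row_of i = row_of (i + 1)" using assms by (auto simp: simple_def)
  have w: "w permutes {1..n}" "\<And>k. k \<in> {1..n} \<Longrightarrow> row_of (w k) = row_of k"
    using assms(2) by (auto simp: young_block_perms block_perms_def)
  have "w \<circ> sw i permutes {1..n}"
    by (rule permutes_compose[OF permutes_swap_id w(1)]) (use i in auto)
  moreover have "row_of ((w \<circ> sw i) k) = row_of k" if k: "k \<in> {1..n}" for k
  proof -
    have "row_of (sw i k) = row_of k" using i(3) by (auto simp: transpose_def)
    then show ?thesis using w(2)[OF sw_in[OF i(1,2) k]] by simp
  qed
  ultimately show ?thesis by (simp add: young_block_perms block_perms_def)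
qed

lemma s_X:
  assumes "simple i"
  shows "s i * X = X"
proof -
  have i: "1 \<le> i" "i < n" using assms by (auto simp: simple_def)
  have "s i * gen_perm s n w = gen_perm s n (w \<circ> sw i)" if w: "w \<in> young n lam" for w
  proof -
    obtain "is" where "is": "set is \<subseteq> {1..<n}" "word_perm is = w"
      using permutes_words[of w n] w by (auto simp: young_def)
    then have "gen_perm s n (w \<circ> sw i) = Pw (i # is)"
      by (intro gen_perm_word) (use i in \<open>auto simp: word_perm_Cons\<close>)
    then show ?thesis using gen_perm_word[OF "is"] by simp
  qed
  then have "s i * X = (\<Sum>w\<in>young n lam. gen_perm s n (w \<circ> sw i))"
    by (simp add: gen_X_def sum_distrib_left)
  also have "\<dots> = X"
    unfolding gen_X_def
    by (rule sum.reindex_bij_witness[of _ "\<lambda>w. w \<circ> sw i" "\<lambda>w. w \<circ> sw i"])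
      (use young_sw[OF assms] in \<open>simp_all only: sw_sw_right\<close>)
  finally show ?thesis .
qed

section \<open>Commutation and eigenvalue of \<open>U\<close>\<close>

definition Ub :: "nat \<Rightarrow> 'a \<Rightarrow> 'b" where "Ub b c = (\<Prod>k\<leftarrow>[1..<Suc b]. (L k - \<kappa> c))"

lemma Ub_0 [simp]: "Ub 0 c = 1" and Ub_Suc: "Ub (Suc b) c = Ub b c * (L (Suc b) - \<kappa> c)"
  by (simp_all add: Ub_def)

lemma s_linear:
  assumes "1 \<le> i" "i < n" "1 \<le> k" "k \<le> n" "k \<noteq> i" "k \<noteq> i + 1"
  shows "s i * (L k - \<kappa> c) = (L k - \<kappa> c) * s i"
  using s_L_comm[OF assms] kap_central[of c "s i"] by (simp add: left_diff_distrib right_diff_distrib)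

text \<open>For \<open>i < b\<close> the factors of \<open>L i\<close> and \<open>L (i + 1)\<close>
  both occur, and their product commutes with \<open>s i\<close>; for \<open>i > b\<close> neither
  occurs. Only the cut at \<open>i = b\<close> separates them.\<close>

lemma s_Ub:
  assumes i: "1 \<le> i" "i < n" and b: "b \<le> n" "i \<noteq> b"
  shows "s i * Ub b c = Ub b c * s i"
  using b
proof (induction b rule: less_induct)
  case (less b)
  consider "b = 0" | "b = i + 1" | "1 \<le> b" "b \<noteq> i + 1" by linarith
  then show ?case
  proof cases
    case 2
    let ?A = "Ub (i - 1) c" and ?x = "L i - \<kappa> c" and ?y = "L (i + 1) - \<kappa> c"
    have Ub: "Ub b c = ?A * (?x * ?y)"
      using Ub_Suc[of "i - 1" c] Ub_Suc[of i c] 2 i by (simp add: mult.assoc)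
    have A: "s i * ?A = ?A * s i" using less.IH[of "i - 1"] i 2 by auto
    have xs: "?x * s i = s i * ?y - 1"
      using L_s[OF i] kap_central[of c "s i"] by (simp add: left_diff_distrib right_diff_distrib)
    have ys: "?y * s i = s i * ?x + 1"
      using L_s'[OF i] kap_central[of c "s i"] by (simp add: left_diff_distrib right_diff_distrib)
    have xy: "?x * ?y = ?y * ?x" by (rule linear_commute) (rule L_comm, use i in auto)
    have "(?x * ?y) * s i = ?x * (s i * ?x) + ?x" by (simp only: mult.assoc ys distrib_left mult_1_right)
    also have "\<dots> = (?x * s i) * ?x + ?x" by (simp add: mult.assoc)
    also have "\<dots> = (s i * ?y) * ?x - ?x + ?x"
      unfolding xs by (simp only: left_diff_distrib[of "s i * ?y" 1 ?x] mult_1_left)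
    also have "\<dots> = s i * (?x * ?y)" unfolding xy by (simp only: diff_add_cancel mult.assoc)
    finally show ?thesis unfolding Ub using A by (metis mult.assoc)
  next
    case 3
    then have bi: "b - 1 \<noteq> i" "b - 1 < b" using less.prems by auto
    have Ub: "Ub b c = Ub (b - 1) c * (L b - \<kappa> c)" using Ub_Suc[of "b - 1" c] 3 by simp
    have IH: "s i * Ub (b - 1) c = Ub (b - 1) c * s i" using less.IH[OF bi(2)] bi less.prems by auto
    have lin: "s i * (L b - \<kappa> c) = (L b - \<kappa> c) * s i" using s_linear[OF i, of b c] 3 less.prems by auto
    show ?thesis unfolding Ub using IH lin by (metis mult.assoc)
  qed simp
qed

lemma U_eq: "U = (\<Prod>r\<leftarrow>[2..<Suc l]. Ub (below r) (u r))"
  by (simp add: gen_U_def Ub_def below_def)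

lemma prod_list_commute:
  fixes f :: "'c \<Rightarrow> 'b"
  shows "(\<And>r. r \<in> set rs \<Longrightarrow> z * f r = f r * z) \<Longrightarrow> z * (\<Prod>r\<leftarrow>rs. f r) = (\<Prod>r\<leftarrow>rs. f r) * z"
proof (induction rs)
  case (Cons r rs)
  have "z * (\<Prod>r\<leftarrow>r # rs. f r) = (z * f r) * (\<Prod>r\<leftarrow>rs. f r)" by (simp add: mult.assoc)
  also have "\<dots> = f r * (z * (\<Prod>r\<leftarrow>rs. f r))" using Cons.prems[of r] by (simp add: mult.assoc)
  also have "\<dots> = f r * ((\<Prod>r\<leftarrow>rs. f r) * z)" using Cons by simp
  finally show ?case by (simp add: mult.assoc)
qed simp

text \<open>Entries of one row lie in one component, so no range of factors in \<open>U\<close> ends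
  between \<open>i\<close> and \<open>i + 1\<close>.\<close>

lemma s_U:
  assumes "simple i"
  shows "s i * U = U * s i"
  unfolding U_eq
proof (rule prod_list_commute)
  fix r
  have i: "1 \<le> i" "i < n" "row_of i = row_of (i + 1)" using assms by (auto simp: simple_def)
  have "i \<noteq> below r"
  proof
    assume "i = below r"
    then have "cmp (pos t0 i) < r" "\<not> cmp (pos t0 (i + 1)) < r"
      using below_iff[of i r] below_iff[of "i + 1" r] i by auto
    then show False using i(3) by (simp add: row_of_def)
  qed
  then show "s i * Ub (below r) (u r) = Ub (below r) (u r) * s i"
    by (intro s_Ub i below_le)
qed

lemma Pw_U: "(\<And>i. i \<in> set is \<Longrightarrow> simple i) \<Longrightarrow> Pw is * U = U * Pw is"
proof (induction "is")
  case (Cons i "is")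
  then have "Pw (i # is) * U = (s i * U) * Pw is" by (simp add: mult.assoc)
  then show ?case using s_U[of i] Cons.prems by (simp add: mult.assoc)
qed simp

lemma X_U: "X * U = U * X"
proof -
  have "gen_perm s n w * U = U * gen_perm s n w" if "w \<in> young n lam" for w
    using young_simple_word[OF that] Pw_U by auto
  then show ?thesis by (simp add: gen_X_def sum_distrib_left sum_distrib_right)
qed

lemma right_eigen_prod_list:
  fixes f :: "'c \<Rightarrow> 'b"
  assumes "\<And>x. x \<in> set xs \<Longrightarrow> v * f x = \<kappa> (g x) * v"
  shows "v * (\<Prod>x\<leftarrow>xs. f x) = \<kappa> (\<Prod>x\<leftarrow>xs. g x) * v"
  using assms
proof (induction xs)
  case (Cons x xs)
  have "v * (\<Prod>x\<leftarrow>x # xs. f x) = (v * f x) * (\<Prod>x\<leftarrow>xs. f x)" by (simp add: mult.assoc)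
  also have "\<dots> = \<kappa> (g x) * (v * (\<Prod>x\<leftarrow>xs. f x))" using Cons.prems[of x] by (simp add: mult.assoc)
  also have "\<dots> = \<kappa> (\<Prod>x\<leftarrow>x # xs. g x) * v" using Cons by (simp add: kap_kap)
  finally show ?case .
qed simp

lemma F_Ub:
  assumes "v \<in> tabs l n" "b \<le> n"
  shows "F v * Ub b c = \<kappa> (\<Prod>k=1..b. content u v k - c) * F v"
proof -
  have "F v * Ub b c = \<kappa> (\<Prod>k\<leftarrow>[1..<Suc b]. content u v k - c) * F v"
    unfolding Ub_def
  proof (rule right_eigen_prod_list)
    fix k assume "k \<in> set [1..<Suc b]"
    then have "F v * L k = \<kappa> (content u v k) * F v" using F_L[OF assms(1)] assms(2) by auto
    then show "F v * (L k - \<kappa> c) = \<kappa> (content u v k - c) * F v"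
      using kap_central[of c "F v"] by (simp add: right_diff_distrib left_diff_distrib kap_diff)
  qed
  also have "(\<Prod>k\<leftarrow>[1..<Suc b]. content u v k - c) = (\<Prod>k=1..b. content u v k - c)"
    by (subst prod.distinct_set_conv_list[symmetric]) (simp_all add: atLeastLessThanSuc_atLeastAtMost del: upt_Suc)
  finally show ?thesis .
qed

lemma F_U:
  assumes "v \<in> tabs l n"
  shows "F v * U = \<kappa> (\<Prod>r=2..l. \<Prod>k=1..below r. content u v k - u r) * F v"
proof -
  have "F v * U = \<kappa> (\<Prod>r\<leftarrow>[2..<Suc l]. \<Prod>k=1..below r. content u v k - u r) * F v"
    unfolding U_eq by (rule right_eigen_prod_list) (rule F_Ub[OF assms below_le])
  also have "(\<Prod>r\<leftarrow>[2..<Suc l]. \<Prod>k=1..below r. content u v k - u r) = (\<Prod>r=2..l. \<Prod>k=1..below r. content u v k - u r)"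
    by (subst prod.distinct_set_conv_list[symmetric]) (simp_all add: atLeastLessThanSuc_atLeastAtMost del: upt_Suc)
  finally show ?thesis .
qed

lemma F_t0_X_U: "F t0 * (X * U) = \<kappa> (r_init l u lam) * F t0"
proof -
  have "F t0 * (X * U) = (F t0 * X) * U" by (simp add: mult.assoc)
  also have "\<dots> = of_nat (card (young n lam)) * (F t0 * U)" by (simp add: F_t0_X mult.assoc)
  also have "\<dots> = \<kappa> (of_nat (card (young n lam))) * (\<kappa> (\<Prod>r=2..l. \<Prod>k=1..below r. content u t0 k - u r) * F t0)"
    unfolding F_U[OF t0_tabs] kap_of_nat ..
  finally show ?thesis unfolding kap_kap r_init_eq .
qed

text \<open>Only the initial tableau survives: otherwise either a factor of \<open>U\<close> vanishes, or the first
  entry at which \<open>v\<close> differs from the initial tableau can be moved down by a reflection that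
  fixes \<open>X\<close>.\<close>

lemma F_X_U_zero:
  assumes v: "std_tab l n D v" and ne: "v \<noteq> t0"
  shows "F v * (X * U) = 0"
proof -
  have "F v * (X * U) = 0"
    if "std_tab l n D v" "k \<in> {1..n}" "pos v k \<noteq> pos t0 k" "\<And>j. 1 \<le> j \<Longrightarrow> j < k \<Longrightarrow> pos v j = pos t0 j" for k v
    using that
  proof (induction k arbitrary: v rule: less_induct)
    case (less k)
    note v = less.prems(1) and k = less.prems(2) and ne = less.prems(3) and eq = less.prems(4)
    have V: "v \<in> tabs l n" using v by (auto simp: tabs_def)
    let ?y = "pos v k" and ?x = "pos t0 k"
    have yD: "?y \<in> D" "v ?y = k" and xD: "?x \<in> D" "t0 ?x = k"
      using std_tab_pos(1,2)[OF v k] std_tab_pos(1,2)[OF t0 k] by auto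
    have val: "valid_node l z" if "z \<in> D" for z using multipartition_valid[OF mp that] .
    have vlt: "v z < k \<longleftrightarrow> t0 z < k" if z: "z \<in> D" for z
    proof
      assume "v z < k"
      then have "pos t0 (v z) = z" using eq[of "v z"] std_tab_pos(3,4)[OF v z] by simp
      then show "t0 z < k" using \<open>v z < k\<close> std_tab_pos(2)[OF t0, of "v z"] std_tab_pos(4)[OF v z] by simp
    next
      assume "t0 z < k"
      then have "pos v (t0 z) = z" using eq[of "t0 z"] std_tab_pos(3,4)[OF t0 z] by simp
      then show "v z < k" using \<open>t0 z < k\<close> std_tab_pos(2)[OF v, of "t0 z"] std_tab_pos(4)[OF t0 z] by simp
    qed
    have "k < t0 ?y"
    proof -
      have "\<not> t0 ?y < k" using vlt[OF yD(1)] yD(2) by simp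
      moreover have "t0 ?y \<noteq> k" using ne std_tab_pos(3)[OF t0 yD(1)] by auto
      ultimately show ?thesis by simp
    qed
    then have bef: "before ?x ?y"
      using before_pos_t0[OF k std_tab_pos(4)[OF t0 yD(1)]] std_tab_pos(3)[OF t0 yD(1)] by simp
    have nle: "\<not> nle ?x ?y"
    proof
      assume "nle ?x ?y"
      then have "v ?x < v ?y" using std_tab_less[OF v xD(1) yD(1)] ne by metis
      then show False using vlt[OF xD(1)] xD(2) yD(2) by simp
    qed
    show ?case
    proof (cases "cmp ?x = cmp ?y")
      case False
      let ?r = "cmp ?y"
      \<comment> \<open>The corner of this component has content \<open>u ?r\<close>. As
        \<open>v\<close> has entered the component by step \<open>k\<close>, the corner has an entry
        at most \<open>k\<close>, which is in the range of the factors for \<open>?r\<close>: one of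
        them vanishes.\<close>
      let ?z = "(1, 1, ?r) :: node"
      have lt: "cmp ?x < ?r" using bef False by (auto simp: before_def)
      have vy: "valid_node l ?y" by (rule val[OF yD(1)])
      have zy: "nle ?z ?y" "valid_node l ?z" using vy by (auto simp: nle_def valid_node_def)
      have zD: "?z \<in> D"
        using young_diagramD(2)[OF young_diagram_diagram(1)[OF mp] yD(1) zy(2,1)] .
      have "v ?z \<le> k"
        using std_tab_less[OF v zD yD(1) zy(1)] yD(2) by (cases "?z = ?y") (metis order_refl, metis less_imp_le)
      then have vz: "v ?z \<in> {1..below ?r}"
        using below_iff[OF k, of ?r] lt std_tab_pos(4)[OF v zD] by auto
      have r: "?r \<in> {2..l}" using lt vy val[OF xD(1)] by (auto simp: valid_node_def)
      have "content u v (v ?z) = u ?r"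
        using std_tab_pos(3)[OF v zD] by (simp add: content_pos ct_def diag_def)
      then have "(\<Prod>k=1..below ?r. content u v k - u ?r) = 0"
        by (intro prod_zero) (use vz in auto)
      then have "(\<Prod>r=2..l. \<Prod>k=1..below r. content u v k - u r) = 0"
        by (intro prod_zero) (use r in auto)
      then have "F v * U = 0" using F_U[OF V] by (metis kap_0 mult_zero_left)
      then show ?thesis unfolding X_U by (simp add: mult.assoc[symmetric])
    next
      case True
      have rows: "row ?x < row ?y" "col ?y < col ?x" using bef nle True by (auto simp: before_def nle_def)
      \<comment> \<open>The left neighbour of \<open>?x\<close> exists because \<open>?y\<close>
        lies in an earlier column. It carries the entry \<open>k - 1\<close> in both
        tableaux.\<close>
      let ?w = "(row ?x, col ?x - 1, cmp ?x)"
      have vx: "valid_node l ?x" and vy: "valid_node l ?y" using val xD yD by auto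
      have wD: "?w \<in> D" using xD rows vy by (auto simp: diagram_iff valid_node_def)
      have "before ?w ?x" using rows by (auto simp: before_def)
      have wle: "{z \<in> D. z = ?x \<or> before z ?x} = insert ?x {z \<in> D. z = ?w \<or> before z ?w}"
        using xD wD rows by (auto simp: before_def prod_eq_iff)
      have "?x \<notin> {z \<in> D. z = ?w \<or> before z ?w}" using rows by (auto simp: before_def prod_eq_iff)
      then have "t0 ?x = Suc (t0 ?w)"
        using tab_upper_rank[OF mp xD(1)] tab_upper_rank[OF mp wD] wle finite_D by simp
      then have tw: "t0 ?w = k - 1" "k = Suc (k - 1)" using xD(2) by auto
      have k1: "k - 1 \<in> {1..n}" using std_tab_pos(4)[OF t0 wD] tw by simp
      define i where "i = k - 1"
      have ik: "k = i + 1" using tw(2) by (simp add: i_def)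
      have i: "1 \<le> i" "i < n"
        using k1 k ik unfolding i_def[symmetric] atLeastAtMost_iff by linarith+
      have pw: "pos t0 i = ?w" using std_tab_pos(3)[OF t0 wD] tw by (simp add: i_def)
      have pvw: "pos v i = ?w" using eq[of i] i ik pw by simp
      have simple: "simple i" using i unfolding simple_def row_of_def ik[symmetric] pw by simp
      \<comment> \<open>Axial distance 1 would put \<open>?y\<close> one diagonal after
        \<open>?w\<close>, but \<open>?y\<close> lies in a later row than \<open>?w\<close> and not
        further to the right.\<close>
      have ax: "axial i v \<noteq> 1"
      proof
        assume "axial i v = 1"
        then have "ct u ?y - ct u ?w + of_int (- 1) = 0" using pvw unfolding axial_def content_pos ik[symmetric] by simp
        moreover have "int (card D) + \<bar>- 1\<bar> \<le> int n + 1" using young_diagram_diagram(2)[OF mp] by simp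
        ultimately have "diag ?y - diag ?w + - 1 = 0"
          using content_separation[OF separated young_diagram_diagram(1)[OF mp] yD(1) wD] by blast
        then show False using rows by (simp add: diag_def)
      qed
      let ?b = "sw i \<circ> v"
      \<comment> \<open>If the swap is standard, it already deviates from the initial tableau at
        entry \<open>k - 1\<close>, so the induction hypothesis applies to it.\<close>
      have other: "F ?b * (X * U) = 0" if "?b \<in> tabs l n"
      proof (rule less.IH[of i])
        have "std_tab l n D (sw i \<circ> ?b)" using v unfolding sw_sw .
        then show b: "std_tab l n D ?b" by (rule tabs_sw_shape[OF that _ i])
        have pb: "pos ?b j = pos v (sw i j)" if "j \<in> {1..n}" for j by (rule pos_sw[OF v i that])
        have "pos ?b i = ?y" using pb[of i] i ik by simp
        then show "pos ?b i \<noteq> pos t0 i" unfolding pw using rows by (auto simp: prod_eq_iff)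
        fix j assume j: "1 \<le> j" "j < i"
        then have "sw i j = j" by (simp add: transpose_def)
        then show "pos ?b j = pos t0 j" using pb[of j] j i eq[of j] ik by simp
      qed (use ik i in auto)
      have "F v * (X * U) = F v * s i * (X * U)" using s_X[OF simple] by (metis mult.assoc)
      also have "\<dots> = \<kappa> (1 / axial i v) * (F v * (X * U)) +
          (if ?b \<in> tabs l n then F v * s i * (F ?b * (X * U)) else 0)"
        by (subst F_s_expand[OF V i]) (simp add: distrib_right mult.assoc)
      also have "\<dots> = \<kappa> (1 / axial i v) * (F v * (X * U))" using other by simp
      finally have "\<kappa> (1 - 1 / axial i v) * (F v * (X * U)) = 0" by (simp add: kap_diff left_diff_distrib)
      moreover have "1 - 1 / axial i v \<noteq> 0" using ax by (auto simp: divide_eq_eq)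
      ultimately show ?thesis by (rule kap_zero_cancel)
    qed
  qed
  moreover have "\<exists>k\<in>{1..n}. pos v k \<noteq> pos t0 k"
    using std_tab_ext(1)[OF v t0] ne by blast
  then obtain k where "k \<in> {1..n}" "pos v k \<noteq> pos t0 k" by blast
  define m where "m = (LEAST k. k \<in> {1..n} \<and> pos v k \<noteq> pos t0 k)"
  have m: "m \<in> {1..n} \<and> pos v m \<noteq> pos t0 m"
    unfolding m_def by (rule LeastI[of _ k]) (use \<open>k \<in> {1..n}\<close> \<open>pos v k \<noteq> pos t0 k\<close> in blast)
  have "pos v j = pos t0 j" if "1 \<le> j" "j < m" for j
  proof (rule ccontr)
    assume "pos v j \<noteq> pos t0 j"
    then have "m \<le> j" unfolding m_def by (intro Least_le) (use that m in auto)
    then show False using that by simp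
  qed
  ultimately show ?thesis using m v by blast
qed

text \<open>Insert the idempotents between the word and \<open>X * U\<close>. Words preserve the
  shape, so only tableaux of shape \<open>lam\<close> occur there, and \<open>F_X_U_zero\<close>
  leaves the initial one.\<close>

theorem seminormal_form:
  assumes a: "std_tab l n D a" and wa: "set as \<subseteq> {1..<n}" and z: "z \<in> UNIV"
  shows "F a * Pw as * (X * U) * z = \<kappa> (r_init l u lam) * (F a * Pw as * F t0 * z)"
proof -
  have A: "a \<in> tabs l n" using a by (auto simp: tabs_def)
  have "F a * Pw as * (X * U) = (\<Sum>v\<in>tabs l n. (F a * Pw as * F v) * (F v * (X * U)))"
  proof -
    have "F v * F v = F v" if "v \<in> tabs l n" for v using F_F[OF that that] by simp
    moreover have "(F a * Pw as * F v) * (F v * (X * U)) = F a * Pw as * (F v * F v) * (X * U)" for v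
      by (simp add: mult.assoc)
    ultimately have "(F a * Pw as * F v) * (F v * (X * U)) = F a * Pw as * F v * (X * U)" if "v \<in> tabs l n" for v
      using that by simp
    then show ?thesis using insert_F[of "F a * Pw as" "X * U"] by simp
  qed
  also have "\<dots> = (\<Sum>v\<in>tabs l n. if v = t0 then F a * Pw as * F t0 * (F t0 * (X * U)) else 0)"
  proof (rule sum.cong[OF refl])
    fix v assume v: "v \<in> tabs l n"
    show "(F a * Pw as * F v) * (F v * (X * U)) = (if v = t0 then F a * Pw as * F t0 * (F t0 * (X * U)) else 0)"
    proof (cases "F a * Pw as * F v = 0")
      case True
      then show ?thesis by auto
    next
      case False
      then have "std_tab l n D v" using Pw_shape[OF a v wa] by simp
      then show ?thesis using F_X_U_zero[of v] by auto
    qed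
  qed
  also have "\<dots> = F a * Pw as * F t0 * (F t0 * (X * U))" using t0_tabs finite_tabs by simp
  also have "\<dots> = F a * Pw as * F t0 * (\<kappa> (r_init l u lam) * F t0)" unfolding F_t0_X_U ..
  also have "\<dots> = \<kappa> (r_init l u lam) * (F a * Pw as * (F t0 * F t0))"
    using kap_left_commute[of "F a * Pw as * F t0"] by (simp add: mult.assoc)
  also have "F t0 * F t0 = F t0" using F_F[OF t0_tabs t0_tabs] by simp
  finally show ?thesis by (simp add: mult.assoc)
qed

end

section \<open>The coefficients r\<close>

lemma dominance_sum:
  assumes S: "finite S" "\<And>z. z \<in> S \<Longrightarrow> 1 \<le> row z \<and> 1 \<le> cmp z"
    and mu: "\<And>c i. mu c i = card {z\<in>S. cmp z = c \<and> row z = i}"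
  shows "(\<Sum>c\<in>{1..<a}. comp_size mu c) + (\<Sum>j=1..b. mu a j) =
    card {z\<in>S. cmp z < a \<or> (cmp z = a \<and> row z \<le> b)}"
proof -
  have comp: "comp_size mu c = card {z\<in>S. cmp z = c}" for c
  proof -
    let ?T = "{z\<in>S. cmp z = c}"
    have "{i. mu c i \<noteq> 0} = row ` ?T" using S(1) by (auto simp: mu)
    then have "comp_size mu c = (\<Sum>i\<in>row ` ?T. \<Sum>z\<in>{z\<in>?T. row z = i}. 1)"
      unfolding comp_size_def mu by (intro sum.cong) (auto intro!: arg_cong[of _ _ card])
    also have "\<dots> = (\<Sum>z\<in>?T. 1)" using S(1) by (intro sum.image_gen[symmetric]) auto
    finally show ?thesis by simp
  qed
  have "(\<Sum>c\<in>{1..<a}. comp_size mu c) = (\<Sum>c\<in>{1..<a}. \<Sum>z\<in>{z\<in>{z\<in>S. cmp z < a}. cmp z = c}. 1)"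
    unfolding comp by (intro sum.cong) (auto intro!: arg_cong[of _ _ card])
  also have "\<dots> = (\<Sum>z\<in>{z\<in>S. cmp z < a}. 1)"
    by (rule sum.group) (use S in auto)
  finally have 1: "(\<Sum>c\<in>{1..<a}. comp_size mu c) = card {z\<in>S. cmp z < a}" by simp
  have "(\<Sum>j=1..b. mu a j) = (\<Sum>j=1..b. \<Sum>z\<in>{z\<in>{z\<in>S. cmp z = a \<and> row z \<le> b}. row z = j}. 1)"
    unfolding mu by (intro sum.cong) (auto intro!: arg_cong[of _ _ card])
  also have "\<dots> = (\<Sum>z\<in>{z\<in>S. cmp z = a \<and> row z \<le> b}. 1)"
    by (rule sum.group) (use S in auto)
  finally have 2: "(\<Sum>j=1..b. mu a j) = card {z\<in>S. cmp z = a \<and> row z \<le> b}" by simp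
  have "{z\<in>S. cmp z < a \<or> (cmp z = a \<and> row z \<le> b)} = {z\<in>S. cmp z < a} \<union> {z\<in>S. cmp z = a \<and> row z \<le> b}"
    by auto
  moreover have "card ({z\<in>S. cmp z < a} \<union> {z\<in>S. cmp z = a \<and> row z \<le> b}) =
      card {z\<in>S. cmp z < a} + card {z\<in>S. cmp z = a \<and> row z \<le> b}"
    by (rule card_Un_disjoint) (use S(1) in auto)
  ultimately show ?thesis using 1 2 by simp
qed

lemma dominates_shape_upto:
  assumes s: "std_tab l n D s" and t: "std_tab l n D t"
  shows "dominates l (shape_upto s k) (shape_upto t k) \<longleftrightarrow>
    (\<forall>a\<in>{1..l}. \<forall>b\<ge>1. card {z\<in>D. t z \<le> k \<and> (cmp z < a \<or> (cmp z = a \<and> row z \<le> b))} \<le>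
       card {z\<in>D. s z \<le> k \<and> (cmp z < a \<or> (cmp z = a \<and> row z \<le> b))})"
proof -
  have sum: "(\<Sum>c\<in>{1..<a}. comp_size (shape_upto v k) c) + (\<Sum>j=1..b. shape_upto v k a j) =
      card {z\<in>D. v z \<le> k \<and> (cmp z < a \<or> (cmp z = a \<and> row z \<le> b))}" if v: "std_tab l n D v" for v a b
  proof -
    have D: "young_diagram l D" using v by (simp add: std_tab_def)
    have shape: "shape_upto v k c i = card {z\<in>{z\<in>D. v z \<le> k}. cmp z = c \<and> row z = i}" for c i
    proof -
      have pos: "Suc 0 \<le> v z \<longleftrightarrow> z \<in> D" for z
        using std_tab_pos(4)[OF v, of z] v by (cases "z \<in> D") (auto simp: std_tab_def)
      have "bij_betw (\<lambda>j. (i, j, c)) {j. 1 \<le> v (i, j, c) \<and> v (i, j, c) \<le> k}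
          {z\<in>{z\<in>D. v z \<le> k}. cmp z = c \<and> row z = i}"
        by (rule bij_betw_imageI) (auto simp: inj_on_def pos image_iff prod_eq_iff)
      then show ?thesis unfolding shape_upto_def by (rule bij_betw_same_card)
    qed
    have "(\<Sum>c\<in>{1..<a}. comp_size (shape_upto v k) c) + (\<Sum>j=1..b. shape_upto v k a j) =
        card {z\<in>{z\<in>D. v z \<le> k}. cmp z < a \<or> (cmp z = a \<and> row z \<le> b)}"
      by (rule dominance_sum[OF _ _ shape])
        (use young_diagram_finite[OF D] young_diagramD(1)[OF D] in \<open>auto simp: valid_node_def\<close>)
    also have "{z\<in>{z\<in>D. v z \<le> k}. cmp z < a \<or> (cmp z = a \<and> row z \<le> b)} =
        {z\<in>D. v z \<le> k \<and> (cmp z < a \<or> (cmp z = a \<and> row z \<le> b))}" by auto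
    finally show ?thesis .
  qed
  show ?thesis unfolding dominates_def sum[OF s] sum[OF t] ..
qed

text \<open>The subtableaux of the two differ only at \<open>k = i\<close>, where one has the node
  of \<open>i + 1\<close> and the other that of \<open>i\<close>. Counting nodes up to a given row
  favours the node whose row comes first; the rows are different because the swap is
  standard.\<close>

lemma sdominates_sw:
  assumes t: "std_tab l n D t" and s: "std_tab l n D (sw i \<circ> t)" and i: "1 \<le> i" "i < n"
  shows "tab_sdominates l (sw i \<circ> t) t \<longleftrightarrow> before (pos t (i + 1)) (pos t i)"
proof -
  let ?s = "sw i \<circ> t"
  let ?x = "pos t (i + 1)" and ?y = "pos t i"
  have xy: "?x \<in> D" "?y \<in> D" "t ?x = i + 1" "t ?y = i" using std_tab_pos(1,2)[OF t] i by auto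
  have ne: "?s \<noteq> t"
  proof
    assume "?s = t"
    then have "sw i (t ?y) = t ?y" by (metis comp_apply)
    then show False using xy by simp
  qed
  have D: "young_diagram l D" using t by (simp add: std_tab_def)
  have fin: "finite D" using young_diagram_finite[OF D] .
  have eq: "z = ?x \<longleftrightarrow> t z = i + 1" "z = ?y \<longleftrightarrow> t z = i" if "z \<in> D" for z
    using xy std_tab_pos(3)[OF t that] by auto
  have xney: "?x \<noteq> ?y" using xy by auto
  have np: "path l n (pos t \<circ> sw i)" using std_tab_sw(2)[OF t i s] by simp
  have nrow: "\<not> (cmp ?x = cmp ?y \<and> row ?x = row ?y)"
  proof
    assume same: "cmp ?x = cmp ?y \<and> row ?x = row ?y"
    have "\<not> nle ?y ?x" using path_swap_iff(2)[OF std_tab_path(1)[OF t] i] np by simp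
    then have "nle ?x ?y" using same by (auto simp: nle_def)
    then have "t ?x < t ?y" using std_tab_less[OF t] xy xney by blast
    then show False using xy by simp
  qed
  let ?seg = "\<lambda>a b z. cmp z < a \<or> (cmp z = a \<and> row z \<le> b)"
  have other: "{z\<in>D. ?s z \<le> k \<and> P z} = {z\<in>D. t z \<le> k \<and> P z}" if "k \<noteq> i" for k P
  proof -
    have "sw i m \<le> k \<longleftrightarrow> m \<le> k" for m using that by (auto simp: transpose_def)
    then show ?thesis by (simp del: One_nat_def add_Suc_right)
  qed
  have at_i: "{z\<in>D. ?s z \<le> i \<and> P z} = ({z\<in>D. t z \<le> i \<and> P z} - {?y}) \<union> {z. z = ?x \<and> P z}" for P
  proof -
    have sw: "sw i m \<le> i \<longleftrightarrow> m = i + 1 \<or> (m \<le> i \<and> m \<noteq> i)" for m by (auto simp: transpose_def)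
    have "?s z \<le> i \<longleftrightarrow> z = ?x \<or> (t z \<le> i \<and> z \<noteq> ?y)" if "z \<in> D" for z
      unfolding comp_apply sw eq[OF that] ..
    then show ?thesis using xy(1,3) by blast
  qed
  have finA: "finite {z\<in>D. t z \<le> i \<and> P z}" for P using fin by simp
  show ?thesis
  proof
    assume "before ?x ?y"
    then have seg: "?seg a b ?x" if "?seg a b ?y" for a b using that by (auto simp: before_def)
    have "tab_dominates l ?s t"
      unfolding tab_dominates_def dominates_shape_upto[OF s t]
    proof (intro allI ballI impI)
      fix k a b
      show "card {z\<in>D. t z \<le> k \<and> ?seg a b z} \<le> card {z\<in>D. ?s z \<le> k \<and> ?seg a b z}"
      proof (cases "k = i")
        case False
        then show ?thesis using other by simp
      next
        case True
        let ?A = "{z\<in>D. t z \<le> i \<and> ?seg a b z}"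
        have xA: "?x \<notin> ?A" using xy by simp
        show ?thesis
        proof (cases "?seg a b ?y")
          case seg_y: True
          have "{z. z = ?x \<and> ?seg a b z} = {?x}" using seg[OF seg_y] by blast
          then have ins: "{z\<in>D. ?s z \<le> i \<and> ?seg a b z} = insert ?x (?A - {?y})"
            unfolding at_i by blast
          have yA: "?y \<in> ?A" using xy seg_y by simp
          have "card (insert ?x (?A - {?y})) = Suc (card (?A - {?y}))"
            by (rule card_insert_disjoint) (use xA finA[of "?seg a b"] in blast)+
          then have "card {z\<in>D. ?s z \<le> i \<and> ?seg a b z} = Suc (card (?A - {?y}))"
            unfolding ins .
          also have "\<dots> = card ?A" by (rule card.remove[OF finA yA, symmetric])
          finally show ?thesis using True by simp
        next
          case False
          then have "?A \<subseteq> {z\<in>D. ?s z \<le> i \<and> ?seg a b z}" unfolding at_i by blast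
          then show ?thesis using True fin by (auto intro: card_mono)
        qed
      qed
    qed
    then show "tab_sdominates l ?s t" using ne by (simp add: tab_sdominates_def)
  next
    assume dom: "tab_sdominates l ?s t"
    show "before ?x ?y"
    proof (rule ccontr)
      assume "\<not> before ?x ?y"
      then have "before ?y ?x" using before_total xney by blast
      \<comment> \<open>The cut at the row of \<open>?y\<close> counts \<open>?y\<close> but not
        \<open>?x\<close>, which violates dominance.\<close>
      then have nx: "\<not> ?seg (cmp ?y) (row ?y) ?x" using nrow by (auto simp: before_def)
      let ?A = "{z\<in>D. t z \<le> i \<and> ?seg (cmp ?y) (row ?y) z}"
      have dif: "{z\<in>D. ?s z \<le> i \<and> ?seg (cmp ?y) (row ?y) z} = ?A - {?y}"
        unfolding at_i Collect_conv_if if_not_P[OF nx] by simp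
      have "?y \<in> ?A" using xy by simp
      then have lt: "card {z\<in>D. ?s z \<le> i \<and> ?seg (cmp ?y) (row ?y) z} < card ?A"
        unfolding dif by (rule card_Diff1_less[OF finA])
      have "valid_node l ?y" using young_diagramD(1)[OF D xy(2)] .
      then have "card ?A \<le> card {z\<in>D. ?s z \<le> i \<and> ?seg (cmp ?y) (row ?y) z}"
        using dom unfolding tab_sdominates_def tab_dominates_def dominates_shape_upto[OF s t]
        by (auto simp: valid_node_def)
      then show False using lt by simp
    qed
  qed
qed

section \<open>Closed form of r\<close>

lemma inversion_content:
  fixes u :: "nat \<Rightarrow> 'k::field"
  assumes S: "separated l n u" and t: "std_tab l n D t" and xy: "(x, y) \<in> inversions D t" and e: "\<bar>e\<bar> \<le> 1"
  shows "ct u x - ct u y + of_int e \<noteq> 0"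
proof
  assume eq: "ct u x - ct u y + of_int e = 0"
  have D: "young_diagram l D" using t by (simp add: std_tab_def)
  have h: "x \<in> D" "y \<in> D" "before x y" "t y < t x" using xy by (auto simp: inversions_def)
  have "int (card D) + \<bar>e\<bar> \<le> int n + 1" using std_tab_card[OF t] e by simp
  from content_separation[OF S D h(1,2) this eq] have same: "cmp x = cmp y" "diag x - diag y + e = 0" by auto
  have "\<not> nle x y" using std_tab_less[OF t h(1,2)] h(3,4) by (cases "x = y") auto
  then have "row x < row y" "col y < col x" using same h(3) by (auto simp: nle_def before_def)
  then show False using same e by (simp add: diag_def)
qed

text \<open>A factor vanishes only at content difference 1 or -1. Inverted nodes of one component
  are incomparable, hence at least two diagonals apart.\<close>

lemma norm_ratio_nonzero:
  fixes u :: "nat \<Rightarrow> 'k::field"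
  assumes S: "separated l n u" and t: "std_tab l n D t"
  shows "norm_ratio u D t \<noteq> 0"
proof -
  have fin: "finite (inversions D t)"
    using t by (intro finite_inversions) (simp add: std_tab_def young_diagram_def)
  have "1 - 1 / (ct u x - ct u y)\<^sup>2 \<noteq> 0" if xy: "(x, y) \<in> inversions D t" for x y
  proof
    assume "1 - 1 / (ct u x - ct u y)\<^sup>2 = 0"
    then have "(ct u x - ct u y)\<^sup>2 = 1" by (auto simp: divide_eq_eq split: if_splits)
    then have "ct u x - ct u y = 1 \<or> ct u x - ct u y = - 1" by (simp add: power2_eq_1_iff)
    then show False using inversion_content[OF S t xy, of 1] inversion_content[OF S t xy, of "- 1"] by auto
  qed
  then show ?thesis unfolding norm_ratio_def using fin by (auto simp: prod_zero_iff case_prod_unfold)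
qed

lemma norm_ratio_sw:
  fixes u :: "nat \<Rightarrow> 'k::field"
  assumes t: "std_tab l n D t" and i: "1 \<le> i" "i < n" and b: "before (pos t i) (pos t (i + 1))"
  shows "norm_ratio u D (sw i \<circ> t) = (1 - 1 / (content u t i - content u t (i + 1))\<^sup>2) * norm_ratio u D t"
proof -
  have "finite D" using t by (simp add: std_tab_def young_diagram_def)
  then show ?thesis
    unfolding norm_ratio_def inversions_sw(1)[OF t i b]
    using inversions_sw(2)[OF t i b] finite_inversions by (simp add: content_pos)
qed

lemma r_init_nonzero:
  fixes u :: "nat \<Rightarrow> 'k::field"
  assumes S: "separated l n u" and m: "multipartition l n lam"
  shows "r_init l u lam \<noteq> 0"
proof -
  have D: "young_diagram l (diagram lam)" "card (diagram lam) = n" using young_diagram_diagram[OF m] by auto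
  have fin: "finite (diagram lam)" using young_diagram_finite[OF D(1)] .
  have "of_nat (fact m) \<noteq> (0 :: 'k)" if "m \<le> n" for m
    using that
  proof (induction m)
    case (Suc m)
    have "(of_nat (Suc m) :: 'k) \<noteq> 0" using S Suc.prems unfolding separated_def by (metis le_add1 plus_1_eq_Suc)
    then show ?case using Suc by (simp only: fact_Suc of_nat_mult of_nat_id) simp
  qed simp
  moreover have "lam c i \<le> n" for c i
  proof -
    have "{j. (i, j, c) \<in> diagram lam} = col ` {x \<in> diagram lam. row x = i \<and> cmp x = c}" by force
    then have "lam c i \<le> card {x \<in> diagram lam. row x = i \<and> cmp x = c}"
      using diagram_row_length[of lam c i] card_image_le[of "{x \<in> diagram lam. row x = i \<and> cmp x = c}" col] fin by simp
    also have "\<dots> \<le> n" using D(2) fin card_mono[of "diagram lam" "{x \<in> diagram lam. row x = i \<and> cmp x = c}"] by simp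
    finally show ?thesis .
  qed
  ultimately have 1: "(\<Prod>c=1..l. \<Prod>i | lam c i \<noteq> 0. of_nat (fact (lam c i)) :: 'k) \<noteq> 0"
    using multipartition_finite[OF m] by (simp add: prod_zero_iff)
  have "of_nat j - of_nat i + u a - u b \<noteq> 0"
    if h: "a \<in> {1..l}" "b \<in> {a<..l}" "(i, j, a) \<in> diagram lam" for a b i j
  proof -
    have "\<bar>diag (i, j, a)\<bar> < int (card {z \<in> diagram lam. cmp z = a})"
      using diag_card1[OF D(1) h(3)] by simp
    also have "\<dots> \<le> int n" using D(2) fin card_mono[of "diagram lam" "{z \<in> diagram lam. cmp z = a}"] by simp
    finally have "of_int (diag (i, j, a)) + u a - u b \<noteq> 0" using S h(1,2) unfolding separated_def by auto
    then show ?thesis by (simp add: diag_def)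
  qed
  then have "(\<Prod>a=1..l. \<Prod>b\<in>{a<..l}. \<Prod>(i, j)\<in>{(i, j). (i, j, a) \<in> diagram lam}. (of_nat j - of_nat i + u a - u b)) \<noteq> 0"
  proof -
    assume *: "\<And>a b i j. a \<in> {1..l} \<Longrightarrow> b \<in> {a<..l} \<Longrightarrow> (i, j, a) \<in> diagram lam \<Longrightarrow> of_nat j - of_nat i + u a - u b \<noteq> 0"
    have "(\<Prod>(i, j)\<in>{(i, j). (i, j, a) \<in> diagram lam}. (of_nat j - of_nat i + u a - u b)) \<noteq> 0"
      if "a \<in> {1..l}" "b \<in> {a<..l}" for a b
    proof (cases "finite {(i, j). (i, j, a) \<in> diagram lam}")
      case True
      then show ?thesis using *[OF that] by (auto simp: prod_zero_iff)
    qed simp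
    then show ?thesis by (simp add: prod_zero_iff)
  qed
  then show ?thesis using 1 by (simp add: r_init_def)
qed

text \<open>The witness is the closed form itself. The shape is read off from the nonzero values of
  the tableau, so that one function serves all shapes.\<close>

lemma r_family_exists:
  fixes u :: "nat \<Rightarrow> 'k::field"
  assumes S: "separated l n u"
  shows "\<exists>r. is_r_family l n u r"
proof -
  define sh where "sh t = (\<lambda>c i. card {j. t (i, j, c) \<noteq> (0::nat)})" for t :: tableau
  define r where "r t = r_init l u (sh t) * norm_ratio u {x. t x \<noteq> 0} t" for t
  have shape: "{x. t x \<noteq> 0} = diagram lam" "sh t = lam"
    if "multipartition l n lam" "std_tab l n (diagram lam) t" for lam t
  proof -
    show D: "{x. t x \<noteq> 0} = diagram lam" using std_tab_unique_shape[OF that(2)] by simp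
    have "t x \<noteq> 0 \<longleftrightarrow> x \<in> diagram lam" for x using D by blast
    then show "sh t = lam" unfolding sh_def by (intro ext) (simp add: diagram_row_length[of lam])
  qed
  have rt: "r t = r_init l u lam * norm_ratio u (diagram lam) t"
    if "multipartition l n lam" "std_tab l n (diagram lam) t" for lam t
    unfolding r_def shape[OF that] ..
  have "is_r_family l n u r"
    unfolding is_r_family_def
  proof (intro conjI allI impI ballI)
    fix lam t assume m: "multipartition l n lam" and "t \<in> Std n lam"
    then have t: "std_tab l n (diagram lam) t" using Std_iff_std_tab by blast
    show "r t \<noteq> 0" using rt[OF m t] r_init_nonzero[OF S m] norm_ratio_nonzero[OF S t] by simp
  next
    fix lam assume m: "multipartition l n lam"
    have "r (tab_upper lam) = r_init l u lam"
      using rt[OF m tab_upper_std(1)[OF m]] tab_upper_std(2)[OF m] by (simp add: norm_ratio_def)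
    then show "r (tab_upper lam) = (\<Prod>c=1..l. \<Prod>i | lam c i \<noteq> 0. of_nat (fact (lam c i))) *
          (\<Prod>a=1..l. \<Prod>b\<in>{a<..l}. \<Prod>(i, j)\<in>{(i, j). (i, j, a) \<in> diagram lam}. (of_nat j - of_nat i + u a - u b))"
      unfolding r_init_def .
  next
    fix lam s t i
    assume m: "multipartition l n lam" and st: "s \<in> Std n lam" "t \<in> Std n lam" and i': "i \<in> {1..<n}"
      and h: "s = sw i \<circ> t \<and> tab_sdominates l s t"
    have i: "1 \<le> i" "i < n" using i' by auto
    have s: "std_tab l n (diagram lam) s" and t: "std_tab l n (diagram lam) t"
      using st Std_iff_std_tab[OF m] by auto
    have ts: "t = sw i \<circ> s" using h sw_sw by metis
    have "before (pos t (i + 1)) (pos t i)" using sdominates_sw[OF t _ i] s h by blast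
    then have b: "before (pos s i) (pos s (i + 1))" using pos_sw[OF t i] i h by simp
    have ct: "content u t i = content u s (i + 1)" using pos_sw[OF s i, of i] i ts by (simp add: content_pos)
    define q where "q = content u s i - content u s (i + 1)"
    have "(pos s i, pos s (i + 1)) \<in> inversions (diagram lam) t"
      using inversions_sw(1)[OF s i b] ts by simp
    from inversion_content[OF S t this, of 0] have q: "q \<noteq> 0" by (simp add: q_def content_pos)
    have "r t = (1 - 1 / q\<^sup>2) * r s"
      unfolding rt[OF m t] rt[OF m s] using norm_ratio_sw[OF s i b, of u] ts by (simp add: q_def)
    moreover have "r s \<noteq> 0" using rt[OF m s] r_init_nonzero[OF S m] norm_ratio_nonzero[OF S s] by simp
    ultimately have "r t / r s = 1 - 1 / q\<^sup>2" by simp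
    also have "\<dots> = (q + 1) * (q - 1) / q\<^sup>2" using q by (simp add: field_simps power2_eq_square)
    finally show "r t / r s = (content u s i - content u t i + 1) * (content u s i - content u t i - 1) /
             (content u s i - content u t i)\<^sup>2"
      unfolding ct q_def .
  qed
  then show ?thesis by blast
qed

text \<open>The required properties determine a family along \<open>std_tab_induct\<close>, so it
  does not matter which one \<open>SOME\<close> picks.\<close>

theorem r_coeff_eq:
  fixes u :: "nat \<Rightarrow> 'k::field"
  assumes S: "separated l n u" and m: "multipartition l n lam" and t: "std_tab l n (diagram lam) t"
  shows "r_coeff l n u t = r_init l u lam * norm_ratio u (diagram lam) t"
proof -
  have fam: "is_r_family l n u (r_coeff l n u)"
    unfolding r_coeff_def using r_family_exists[OF S] by (rule someI_ex)
  let ?r = "r_coeff l n u"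
  show ?thesis
    using t tab_upper_std[OF m]
  proof (induction rule: std_tab_induct)
    case init
    have "?r (tab_upper lam) = r_init l u lam" using fam m unfolding is_r_family_def r_init_def by blast
    then show ?case using tab_upper_std(2)[OF m] by (simp add: norm_ratio_def)
  next
    case (step s i)
    let ?t = "sw i \<circ> s"
    note s = step(1) and t = step(2) and i = step(3,4) and b = step(5)
    have st: "s = sw i \<circ> ?t" unfolding sw_sw ..
    have "before (pos ?t (i + 1)) (pos ?t i)" using b pos_sw[OF s i] i by simp
    then have dom: "tab_sdominates l s ?t" using sdominates_sw[OF t _ i] s unfolding sw_sw by blast
    have ct: "content u ?t i = content u s (i + 1)" using pos_sw[OF s i, of i] i by (simp add: content_pos)
    define q where "q = content u s i - content u s (i + 1)"
    have "(pos s i, pos s (i + 1)) \<in> inversions (diagram lam) ?t" using inversions_sw(1)[OF s i b] by simp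
    from inversion_content[OF S t this, of 0] have q: "q \<noteq> 0" by (simp add: q_def content_pos)
    have "s \<in> Std n lam" "?t \<in> Std n lam" "i \<in> {1..<n}" using s t i Std_iff_std_tab[OF m] by auto
    then have "?r ?t / ?r s = (content u s i - content u ?t i + 1) * (content u s i - content u ?t i - 1) /
             (content u s i - content u ?t i)\<^sup>2" and ne: "?r s \<noteq> 0"
      using fam m st dom unfolding is_r_family_def by blast+
    then have "?r ?t / ?r s = (q + 1) * (q - 1) / q\<^sup>2" unfolding ct q_def by blast
    also have "\<dots> = 1 - 1 / q\<^sup>2" using q by (simp add: field_simps power2_eq_square)
    finally have "?r ?t = (1 - 1 / q\<^sup>2) * ?r s" using ne by (simp add: divide_eq_eq)
    also have "\<dots> = r_init l u lam * ((1 - 1 / q\<^sup>2) * norm_ratio u (diagram lam) s)" unfolding step.IH by simp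
    also have "(1 - 1 / q\<^sup>2) * norm_ratio u (diagram lam) s = norm_ratio u (diagram lam) ?t"
      unfolding norm_ratio_sw[OF s i b] q_def ..
    finally show ?case .
  qed
qed

section \<open>The conjugate presentation\<close>

definition gen_m ::
  "('k::field \<Rightarrow> 'r::ring_1) \<Rightarrow> (nat \<Rightarrow> 'r) \<Rightarrow> (nat \<Rightarrow> 'r) \<Rightarrow> nat \<Rightarrow> nat \<Rightarrow> (nat \<Rightarrow> 'k) \<Rightarrow> mpart \<Rightarrow> tableau \<Rightarrow> tableau \<Rightarrow> 'r" where
  "gen_m \<kappa> s L l n u lam a b =
     gen_perm s n (inv_into UNIV (d_perm n lam a)) * gen_X s n lam * gen_U \<kappa> L l u lam * gen_perm s n (d_perm n lam b)"

definition gen_n_low ::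
  "('k::field \<Rightarrow> 'r::ring_1) \<Rightarrow> (nat \<Rightarrow> 'r) \<Rightarrow> (nat \<Rightarrow> 'r) \<Rightarrow> nat \<Rightarrow> nat \<Rightarrow> (nat \<Rightarrow> 'k) \<Rightarrow> mpart \<Rightarrow> 'r" where
  "gen_n_low \<kappa> s L l n u lam =
     (- 1) ^ (\<Sum>i=1..l. (i - 1) * comp_size lam i) *
     (\<Sum>w\<in>young n (conj_mpart l lam). (- 1) ^ perm_length n w * gen_perm s n w) *
     (\<Prod>r\<leftarrow>[2..<Suc l]. \<Prod>k\<leftarrow>[1..<Suc (\<Sum>c\<in>{l + 2 - r..l}. comp_size lam c)]. (L k - \<kappa> (u (l + 1 - r))))"

definition gen_n ::
  "('k::field \<Rightarrow> 'r::ring_1) \<Rightarrow> (nat \<Rightarrow> 'r) \<Rightarrow> (nat \<Rightarrow> 'r) \<Rightarrow> nat \<Rightarrow> nat \<Rightarrow> (nat \<Rightarrow> 'k) \<Rightarrow> mpart \<Rightarrow> tableau \<Rightarrow> tableau \<Rightarrow> 'r" where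
  "gen_n \<kappa> s L l n u lam a b =
     (- 1) ^ (perm_length n (d'_perm l n lam a) + perm_length n (d'_perm l n lam b)) *
     gen_perm s n (inv_into UNIV (d'_perm l n lam a)) * gen_n_low \<kappa> s L l n u lam * gen_perm s n (d'_perm l n lam b)"

lemma permutes_tableau_unique:
  assumes t: "std_tab l n D t" and w: "w permutes {1..n}" "w' permutes {1..n}" and eq: "w \<circ> t = w' \<circ> t"
  shows "w = w'"
proof
  fix k show "w k = w' k"
  proof (cases "k \<in> {1..n}")
    case True
    then show ?thesis using fun_cong[OF eq, of "pos t k"] std_tab_pos(2)[OF t True] by simp
  qed (use w in \<open>simp add: permutes_not_in\<close>)
qed

lemma d_perm_word:
  assumes m: "multipartition l n lam" and "set is \<subseteq> {1..<n}" "word_perm is \<circ> tab_upper lam = t"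
  shows "d_perm n lam t = word_perm is"
  unfolding d_perm_def
  by (rule the_equality)
    (use assms word_perm_permutes[of "is" n] permutes_tableau_unique[OF tab_upper_std(1)[OF m]] in auto)

lemma conj_tab_comp: "w 0 = 0 \<Longrightarrow> conj_tab l (w \<circ> t) = w \<circ> conj_tab l t"
  by (auto simp: fun_eq_iff conj_tab_apply)

lemma word_perm_0: "set is \<subseteq> {1..<n} \<Longrightarrow> word_perm is 0 = 0"
  using word_perm_permutes[of "is" n] by (simp add: permutes_not_in)

lemma word_tab_lower:
  assumes t: "std_tab l n D t" and "set is \<subseteq> {1..<n}"
    and "word_perm is \<circ> tab_upper (conj_mpart l lam) = conj_tab l t"
  shows "word_perm is \<circ> tab_lower l lam = t"
proof -
  have "conj_tab l (word_perm is \<circ> tab_upper (conj_mpart l lam)) = word_perm is \<circ> tab_lower l lam"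
    using conj_tab_comp word_perm_0[OF assms(2)] by (simp add: tab_lower_def)
  then show ?thesis using assms(3) conj_tab_conj_tab[OF t] by simp
qed

text \<open>As \<open>tab_lower\<close> is the conjugate of the initial tableau of the conjugate
  shape, one word computes \<open>d'\<close> of \<open>t\<close> and \<open>d\<close> of its
  conjugate.\<close>

lemma d'_perm_word:
  assumes m: "multipartition l n lam" and t: "std_tab l n D t" and w: "set is \<subseteq> {1..<n}"
    "word_perm is \<circ> tab_upper (conj_mpart l lam) = conj_tab l t"
  shows "d'_perm l n lam t = word_perm is"
  unfolding d'_perm_def
  by (rule the_equality)
    (use word_tab_lower[OF t w] word_perm_permutes[OF w(1)] permutes_tableau_unique[OF tab_lower_std(1)[OF m]] in auto)

text \<open>A swap that creates an inversion of \<open>t\<close> removes one of the conjugate. The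
  factor is the same because conjugation negates the contents.\<close>

lemma conj_step:
  assumes t: "std_tab l n D t" and s: "std_tab l n D (sw i \<circ> t)" and i: "1 \<le> i" "i < n"
    and b: "before (pos t i) (pos t (i + 1))"
  shows "inv_count (conj_node l ` D) (conj_tab l t) = Suc (inv_count (conj_node l ` D) (conj_tab l (sw i \<circ> t)))"
    and "norm_ratio (\<lambda>j. - u (l + 1 - j)) (conj_node l ` D) (conj_tab l t) =
      (1 - 1 / (content u t i - content u t (i + 1))\<^sup>2) *
      norm_ratio (\<lambda>j. - u (l + 1 - j)) (conj_node l ` D) (conj_tab l (sw i \<circ> t))"
proof -
  let ?c = "conj_tab l (sw i \<circ> t)"
  have D: "young_diagram l D" using t by (simp add: std_tab_def)
  have c: "std_tab l n (conj_node l ` D) ?c" by (rule conj_tab_std[OF s])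
  have sc: "sw i \<circ> ?c = conj_tab l t" using conj_tab_sw[OF i(1)] sw_sw by metis
  have val: "valid_node l (pos t i)" "valid_node l (pos t (i + 1))"
    using young_diagramD(1)[OF D] std_tab_pos(1)[OF t] i by auto
  have p: "pos ?c i = conj_node l (pos t (i + 1))" "pos ?c (i + 1) = conj_node l (pos t i)"
    using pos_conj_tab[OF s] pos_sw[OF t i] i by auto
  have "\<not> nle (pos t i) (pos t (i + 1))"
    using path_swap_iff(2)[OF std_tab_path(1)[OF t] i] std_tab_sw(2)[OF t i s] by simp
  then have bc: "before (pos ?c i) (pos ?c (i + 1))"
    unfolding p by (rule before_conj_node[OF val b])
  show "inv_count (conj_node l ` D) (conj_tab l t) = Suc (inv_count (conj_node l ` D) ?c)"
    using inv_count_sw[OF c i bc] unfolding sc .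
  have "content (\<lambda>j. - u (l + 1 - j)) ?c i = - content u t (i + 1)"
    "content (\<lambda>j. - u (l + 1 - j)) ?c (i + 1) = - content u t i"
    unfolding content_pos p by (rule ct_conj_node[OF val(2)], rule ct_conj_node[OF val(1)])
  then show "norm_ratio (\<lambda>j. - u (l + 1 - j)) (conj_node l ` D) (conj_tab l t) =
      (1 - 1 / (content u t i - content u t (i + 1))\<^sup>2) * norm_ratio (\<lambda>j. - u (l + 1 - j)) (conj_node l ` D) ?c"
    using norm_ratio_sw[OF c i bc, of "\<lambda>j. - u (l + 1 - j)"] unfolding sc by simp
qed

lemma conj_invariants:
  fixes u :: "nat \<Rightarrow> 'k::field"
  assumes m: "multipartition l n lam" and t: "std_tab l n (diagram lam) t"
  defines "D' \<equiv> conj_node l ` diagram lam"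
  shows "inv_count (diagram lam) t + inv_count D' (conj_tab l t) = inv_count D' (conj_tab l (tab_upper lam))"
    and "norm_ratio u (diagram lam) t * norm_ratio (\<lambda>j. - u (l + 1 - j)) D' (conj_tab l t) =
      norm_ratio (\<lambda>j. - u (l + 1 - j)) D' (conj_tab l (tab_upper lam))"
proof -
  let ?D = "diagram lam" and ?u = "\<lambda>j. - u (l + 1 - j)"
  have "inv_count ?D t + inv_count D' (conj_tab l t) = inv_count D' (conj_tab l (tab_upper lam)) \<and>
    norm_ratio u ?D t * norm_ratio ?u D' (conj_tab l t) = norm_ratio ?u D' (conj_tab l (tab_upper lam))"
    using t tab_upper_std[OF m]
  proof (induction rule: std_tab_induct)
    case init
    then show ?case using tab_upper_std(2)[OF m] by (simp add: inv_count_def norm_ratio_def)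
  next
    case (step t i)
    have 1: "inv_count D' (conj_tab l t) = Suc (inv_count D' (conj_tab l (sw i \<circ> t)))"
      unfolding D'_def by (rule conj_step(1)[OF step(1-5)])
    have 2: "norm_ratio ?u D' (conj_tab l t) =
        (1 - 1 / (content u t i - content u t (i + 1))\<^sup>2) * norm_ratio ?u D' (conj_tab l (sw i \<circ> t))"
      unfolding D'_def by (rule conj_step(2)[OF step(1-5)])
    have 3: "inv_count ?D (sw i \<circ> t) = Suc (inv_count ?D t)" by (rule inv_count_sw[OF step(1,3-5)])
    have 4: "norm_ratio u ?D (sw i \<circ> t) = (1 - 1 / (content u t i - content u t (i + 1))\<^sup>2) * norm_ratio u ?D t"
      by (rule norm_ratio_sw[OF step(1,3-5)])
    show ?case
    proof
      show "inv_count ?D (sw i \<circ> t) + inv_count D' (conj_tab l (sw i \<circ> t)) = inv_count D' (conj_tab l (tab_upper lam))"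
        unfolding 3 using conjunct1[OF step.IH] unfolding 1 by simp
      show "norm_ratio u ?D (sw i \<circ> t) * norm_ratio ?u D' (conj_tab l (sw i \<circ> t)) = norm_ratio ?u D' (conj_tab l (tab_upper lam))"
        unfolding 4 using conjunct2[OF step.IH] unfolding 2 by (simp only: mult_ac)
    qed
  qed
  then show "inv_count (diagram lam) t + inv_count D' (conj_tab l t) = inv_count D' (conj_tab l (tab_upper lam))"
    and "norm_ratio u (diagram lam) t * norm_ratio (\<lambda>j. - u (l + 1 - j)) D' (conj_tab l t) =
      norm_ratio (\<lambda>j. - u (l + 1 - j)) D' (conj_tab l (tab_upper lam))" by blast+
qed

text \<open>The left side does not depend on \<open>t\<close>, and at \<open>tab_lower\<close> the
  conjugate is an initial tableau, whose own factor is 1.\<close>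

lemma norm_ratio_tab_lower:
  fixes u :: "nat \<Rightarrow> 'k::field"
  assumes m: "multipartition l n lam" and t: "std_tab l n (diagram lam) t"
  shows "norm_ratio u (diagram lam) t *
      norm_ratio (\<lambda>j. - u (l + 1 - j)) (diagram (conj_mpart l lam)) (conj_tab l t) =
    norm_ratio u (diagram lam) (tab_lower l lam)"
proof -
  have "norm_ratio (\<lambda>j. - u (l + 1 - j)) (diagram (conj_mpart l lam)) (conj_tab l (tab_lower l lam)) = 1"
    unfolding tab_lower_std(2)[OF m] using tab_upper_std(2)[OF conj_diagram(1)[OF m]] by (simp add: norm_ratio_def)
  then show ?thesis
    using conj_invariants(2)[OF m t, of u] conj_invariants(2)[OF m tab_lower_std(1)[OF m], of u] conj_diagram(2)[OF m]
    by simp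
qed

section \<open>Signs relating n to m of the conjugate shape\<close>

lemma comp_size_conj:
  assumes m: "multipartition l n lam" and c: "c \<in> {1..l}"
  shows "comp_size (conj_mpart l lam) c = comp_size lam (l + 1 - c)"
proof -
  have size: "comp_size mu c = card {x \<in> diagram mu. cmp x = c}" if "multipartition l n mu" for mu c
    using card_diagram_part(2)[of "{c}" mu] multipartition_finite[OF that] by simp
  let ?A = "{x \<in> diagram lam. cmp x = l + 1 - c}"
  have "{x \<in> diagram (conj_mpart l lam). cmp x = c} = conj_node l ` ?A"
    unfolding conj_diagram(2)[OF m] using multipartition_valid[OF m] c
    by (fastforce simp: conj_node_def valid_node_def)
  moreover have "inj_on (conj_node l) ?A"
    by (rule inj_on_subset[OF inj_on_conj_node[OF young_diagram_diagram(1)[OF m]]]) auto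
  ultimately show ?thesis unfolding size[OF m] size[OF conj_diagram(1)[OF m]] by (simp add: card_image)
qed

lemma sum_comp_size_conj:
  assumes m: "multipartition l n lam" and r: "2 \<le> r" "r \<le> l"
  shows "(\<Sum>c\<in>{1..<r}. comp_size (conj_mpart l lam) c) = (\<Sum>c\<in>{l + 2 - r..l}. comp_size lam c)"
proof -
  have "(\<Sum>c\<in>{1..<r}. comp_size (conj_mpart l lam) c) = (\<Sum>c\<in>{1..<r}. comp_size lam (l + 1 - c))"
    by (intro sum.cong refl comp_size_conj[OF m]) (use r in auto)
  also have "\<dots> = (\<Sum>c\<in>{l + 2 - r..l}. comp_size lam c)"
    by (rule sum.reindex_bij_witness[of _ "\<lambda>c. l + 1 - c" "\<lambda>c. l + 1 - c"]) (use r in auto)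
  finally show ?thesis .
qed

text \<open>Component \<open>c\<close> belongs to the tails of \<open>c - 1\<close> values of
  \<open>r\<close>. This identifies the number of factors negated in \<open>U\<close> with the
  exponent of the sign in \<open>n_low\<close>.\<close>

lemma sum_of_tails:
  fixes f :: "nat \<Rightarrow> nat"
  shows "(\<Sum>r=2..l. \<Sum>c\<in>{l + 2 - r..l}. f c) = (\<Sum>c=1..l. (c - 1) * f c)"
proof -
  have "(\<Sum>r=2..l. \<Sum>c\<in>{l + 2 - r..l}. f c) = (\<Sum>(r, c)\<in>(SIGMA r:{2..l}. {l + 2 - r..l}). f c)"
    by (rule sum.Sigma) auto
  also have "\<dots> = (\<Sum>(c, r)\<in>(SIGMA c:{1..l}. {l + 2 - c..l}). f c)"
    by (rule sum.reindex_bij_witness[of _ "\<lambda>(c, r). (r, c)" "\<lambda>(r, c). (c, r)"]) auto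
  also have "\<dots> = (\<Sum>c=1..l. \<Sum>r\<in>{l + 2 - c..l}. f c)"
    by (rule sum.Sigma[symmetric]) auto
  also have "\<dots> = (\<Sum>c=1..l. (c - 1) * f c)" by (intro sum.cong) auto
  finally show ?thesis .
qed

lemma neg_one_power_left_commute: "x * ((- 1) ^ k * y) = (- 1) ^ k * (x * (y :: 'r::ring_1))"
  by (cases "even k") auto

lemma minus_left_commute_rule: "- x * ((- 1) ^ k * y) = (- 1) ^ Suc k * (x * (y :: 'r::ring_1))"
  by (cases "even k") auto

lemma prod_list_neg:
  fixes f :: "'c \<Rightarrow> 'r::ring_1"
  shows "(\<Prod>x\<leftarrow>xs. - f x) = (- 1) ^ length xs * (\<Prod>x\<leftarrow>xs. f x)"
proof (induction xs)
  case (Cons x xs)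
  then show ?case by (simp only: list.map prod_list.Cons length_Cons minus_left_commute_rule)
qed simp

lemma prod_list_sign:
  fixes f :: "'c \<Rightarrow> 'r::ring_1"
  shows "(\<Prod>x\<leftarrow>xs. (- 1) ^ e x * f x) = (- 1) ^ (\<Sum>x\<leftarrow>xs. e x) * (\<Prod>x\<leftarrow>xs. f x)"
proof (induction xs)
  case (Cons x xs)
  have "(\<Prod>x\<leftarrow>x # xs. (- 1) ^ e x * f x) = (- 1) ^ e x * (f x * ((- 1) ^ (\<Sum>x\<leftarrow>xs. e x) * (\<Prod>x\<leftarrow>xs. f x)))"
    using Cons by (simp add: mult.assoc)
  also have "\<dots> = (- 1) ^ e x * ((- 1) ^ (\<Sum>x\<leftarrow>xs. e x) * (f x * (\<Prod>x\<leftarrow>xs. f x)))"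
    unfolding neg_one_power_left_commute[of "f x"] ..
  finally show ?case by (simp add: power_add mult.assoc)
qed simp

lemma gen_perm_neg:
  fixes s :: "nat \<Rightarrow> 'r::ring_1"
  assumes "w permutes {1..n}"
  shows "gen_perm (\<lambda>i. - s i) n w = (- 1) ^ perm_length n w * gen_perm s n w"
proof -
  let ?js = "SOME is. set is \<subseteq> {1..<n} \<and> word_perm is = w"
  have "set ?js \<subseteq> {1..<n} \<and> word_perm ?js = w"
    using someI_ex[OF permutes_words[OF assms]] .
  then have "(- 1 :: 'r) ^ perm_length n w = (- 1) ^ length ?js" by (intro perm_length_word) auto
  then show ?thesis unfolding gen_perm_def by (simp add: prod_list_neg)
qed

text \<open>Negating \<open>s\<close> attaches to each permutation its sign; negating
  \<open>L\<close> and the parameters negates every factor of \<open>U\<close>. The signs that arise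
  are those built into the definition of n.\<close>

lemma gen_n_eq:
  fixes \<kappa> :: "'k::field \<Rightarrow> 'r::ring_1"
  assumes neg: "\<And>x. \<kappa> (- x) = - \<kappa> x"
    and m: "multipartition l n lam" and a: "std_tab l n (diagram lam) a" and b: "std_tab l n (diagram lam) b"
  shows "gen_n \<kappa> s L l n u lam a b =
    gen_m \<kappa> (\<lambda>i. - s i) (\<lambda>k. - L k) l n (\<lambda>j. - u (l + 1 - j)) (conj_mpart l lam) (conj_tab l a) (conj_tab l b)"
proof -
  note m' = conj_diagram(1)[OF m]
  have word: "\<exists>is. set is \<subseteq> {1..<n} \<and> word_perm is \<circ> tab_upper (conj_mpart l lam) = conj_tab l t"
    if t: "std_tab l n (diagram lam) t" for t
  proof -
    have c: "std_tab l n (diagram (conj_mpart l lam)) (conj_tab l t)"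
      using conj_tab_std[OF t] conj_diagram(2)[OF m] by simp
    show ?thesis
      using c tab_upper_std[OF m']
    proof (induction rule: std_tab_induct)
      case init
      then show ?case by (intro exI[of _ "[]"]) simp
    next
      case (step v i)
      then obtain js where "set js \<subseteq> {1..<n}" "word_perm js \<circ> tab_upper (conj_mpart l lam) = v" by blast
      then show ?case using step(3,4)
        by (intro exI[of _ "js @ [i]"]) (auto simp: word_perm_append comp_assoc)
    qed
  qed
  obtain ja where ja: "set ja \<subseteq> {1..<n}" "word_perm ja \<circ> tab_upper (conj_mpart l lam) = conj_tab l a"
    using word[OF a] by blast
  obtain jb where jb: "set jb \<subseteq> {1..<n}" "word_perm jb \<circ> tab_upper (conj_mpart l lam) = conj_tab l b"
    using word[OF b] by blast
  have da: "d'_perm l n lam a = word_perm ja" "d_perm n (conj_mpart l lam) (conj_tab l a) = word_perm ja"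
    using d'_perm_word[OF m a ja] d_perm_word[OF m' ja] by auto
  have db: "d'_perm l n lam b = word_perm jb" "d_perm n (conj_mpart l lam) (conj_tab l b) = word_perm jb"
    using d'_perm_word[OF m b jb] d_perm_word[OF m' jb] by auto
  \<comment> \<open>A word and its reverse have equal length, so a permutation and its inverse carry
    the same sign.\<close>
  have inv_sign: "(- 1 :: 'r) ^ perm_length n (word_perm (rev ja)) = (- 1) ^ perm_length n (word_perm ja)"
    using perm_length_word[of "rev ja" n "word_perm (rev ja)", where ?'r = 'r] perm_length_word[of ja n "word_perm ja", where ?'r = 'r] ja(1)
    by simp
  have pa: "gen_perm (\<lambda>i. - s i) n (inv_into UNIV (word_perm ja)) =
      (- 1) ^ perm_length n (word_perm ja) * gen_perm s n (inv_into UNIV (word_perm ja))"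
    unfolding inv_word_perm inv_sign[symmetric] by (rule gen_perm_neg, rule word_perm_permutes) (use ja in auto)
  have pb: "gen_perm (\<lambda>i. - s i) n (word_perm jb) = (- 1) ^ perm_length n (word_perm jb) * gen_perm s n (word_perm jb)"
    by (rule gen_perm_neg, rule word_perm_permutes) (use jb in auto)
  have X: "gen_X (\<lambda>i. - s i) n (conj_mpart l lam) =
      (\<Sum>w\<in>young n (conj_mpart l lam). (- 1) ^ perm_length n w * gen_perm s n w)"
    unfolding gen_X_def by (intro sum.cong refl gen_perm_neg) (auto simp: young_def)
  let ?b = "\<lambda>r. \<Sum>c\<in>{l + 2 - r..l}. comp_size lam c"
  have U: "gen_U \<kappa> (\<lambda>k. - L k) l (\<lambda>j. - u (l + 1 - j)) (conj_mpart l lam) =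
      (- 1) ^ (\<Sum>i=1..l. (i - 1) * comp_size lam i) *
      (\<Prod>r\<leftarrow>[2..<Suc l]. \<Prod>k\<leftarrow>[1..<Suc (?b r)]. (L k - \<kappa> (u (l + 1 - r))))"
  proof -
    have "gen_U \<kappa> (\<lambda>k. - L k) l (\<lambda>j. - u (l + 1 - j)) (conj_mpart l lam) =
        (\<Prod>r\<leftarrow>[2..<Suc l]. (- 1) ^ ?b r * (\<Prod>k\<leftarrow>[1..<Suc (?b r)]. (L k - \<kappa> (u (l + 1 - r)))))"
      unfolding gen_U_def
    proof (intro arg_cong[of _ _ prod_list] map_cong refl)
      fix r assume "r \<in> set [2..<Suc l]"
      then have r: "2 \<le> r" "r \<le> l" by auto
      have "(\<Prod>k\<leftarrow>[1..<Suc (?b r)]. (- L k - \<kappa> (- u (l + 1 - r)))) =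
          (\<Prod>k\<leftarrow>[1..<Suc (?b r)]. - (L k - \<kappa> (u (l + 1 - r))))"
        by (simp add: neg del: upt_Suc)
      also have "\<dots> = (- 1) ^ ?b r * (\<Prod>k\<leftarrow>[1..<Suc (?b r)]. (L k - \<kappa> (u (l + 1 - r))))"
        unfolding prod_list_neg by (simp del: upt_Suc)
      finally show "(\<Prod>k\<leftarrow>[1..<Suc (\<Sum>c\<in>{1..<r}. comp_size (conj_mpart l lam) c)]. (- L k - \<kappa> (- u (l + 1 - r)))) =
          (- 1) ^ ?b r * (\<Prod>k\<leftarrow>[1..<Suc (?b r)]. (L k - \<kappa> (u (l + 1 - r))))"
        unfolding sum_comp_size_conj[OF m r] .
    qed
    also have "\<dots> = (- 1) ^ (\<Sum>r\<leftarrow>[2..<Suc l]. ?b r) *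
        (\<Prod>r\<leftarrow>[2..<Suc l]. \<Prod>k\<leftarrow>[1..<Suc (?b r)]. (L k - \<kappa> (u (l + 1 - r))))"
      by (rule prod_list_sign)
    also have "(\<Sum>r\<leftarrow>[2..<Suc l]. ?b r) = (\<Sum>r=2..l. ?b r)"
      by (subst sum.distinct_set_conv_list[symmetric]) (simp_all add: atLeastLessThanSuc_atLeastAtMost del: upt_Suc)
    finally show ?thesis unfolding sum_of_tails .
  qed
  let ?X = "\<Sum>w\<in>young n (conj_mpart l lam). (- 1) ^ perm_length n w * gen_perm s n w"
    and ?U = "\<Prod>r\<leftarrow>[2..<Suc l]. \<Prod>k\<leftarrow>[1..<Suc (?b r)]. (L k - \<kappa> (u (l + 1 - r)))"
  \<comment> \<open>Powers of -1 are central; this brings the signs to the places prescribed by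
    \<open>gen_n\<close> and \<open>gen_n_low\<close>.\<close>
  have move: "(e * A) * X * (f * U) * (g * B) = (e * g) * A * (f * X * U) * B"
    if "\<And>x. x * f = f * x" "\<And>x. x * g = g * x" for e f g A X U B :: 'r
  proof -
    have "x * (f * y) = f * (x * y)" "x * (g * y) = g * (x * y)" for x y
      using that by (metis mult.assoc)+
    then have "(e * A) * X * (f * U) * (g * B) = f * (g * (e * (A * (X * (U * B)))))"
      "(e * g) * A * (f * X * U) * B = f * (g * (e * (A * (X * (U * B)))))"
      unfolding mult.assoc by metis+
    then show ?thesis by simp
  qed
  have comm: "x * (- 1) ^ k = (- 1) ^ k * x" for x :: 'r and k
    using neg_one_power_left_commute[of x k 1] by simp
  show ?thesis
    unfolding gen_n_def gen_n_low_def gen_m_def da db pa pb X U power_add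
    by (rule move[symmetric]) (rule comm)+
qed

context hecke_rel
begin

text \<open>In \<open>L_rec\<close> every term has odd degree in the generators, so all of them
  change sign. In the cyclotomic relation the factors appear in reverse order, which
  \<open>ann_perm\<close> repairs.\<close>

lemma hecke_rel_sharp: "hecke_rel l n (\<lambda>j. - u (l + 1 - j)) \<kappa> (\<lambda>i. - s i) (\<lambda>k. - L k)"
proof (unfold_locales, goal_cases)
  case 5
  have "(\<Prod>j\<leftarrow>[1..<Suc l]. - L 1 - \<kappa> (- u (l + 1 - j))) = (\<Prod>j\<leftarrow>[1..<Suc l]. - (L 1 - \<kappa> (u (l + 1 - j))))"
    by (simp add: kap_uminus del: upt_Suc)
  also have "\<dots> = (- 1) ^ l * ann (L 1) (map (\<lambda>j. u (l + 1 - j)) [1..<Suc l])"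
    unfolding prod_list_neg by (simp add: ann_def comp_def del: upt_Suc)
  also have "ann (L 1) (map (\<lambda>j. u (l + 1 - j)) [1..<Suc l]) = ann (L 1) (map u [1..<Suc l])"
  proof (rule ann_perm)
    have "mset (map (\<lambda>j. l + 1 - j) [1..<Suc l]) = mset [1..<Suc l]"
    proof (rule set_eq_iff_mset_eq_distinct[THEN iffD1])
      show "distinct (map (\<lambda>j. l + 1 - j) [1..<Suc l])" by (auto simp: distinct_map inj_on_def simp del: upt_Suc)
      show "set (map (\<lambda>j. l + 1 - j) [1..<Suc l]) = set [1..<Suc l]"
      proof -
        have "(\<lambda>j. l + 1 - j) ` {1..l} = {1..l}"
        proof (intro equalityI subsetI)
          fix x assume "x \<in> {1..l}"
          then show "x \<in> (\<lambda>j. l + 1 - j) ` {1..l}" by (intro image_eqI[of _ _ "l + 1 - x"]) auto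
        qed auto
        then show ?thesis by (simp add: atLeastLessThanSuc_atLeastAtMost del: upt_Suc)
      qed
    qed (simp del: upt_Suc)
    then have "mset (map u (map (\<lambda>j. l + 1 - j) [1..<Suc l])) = mset (map u [1..<Suc l])" by (simp only: mset_map)
    then show "mset (map (\<lambda>j. u (l + 1 - j)) [1..<Suc l]) = mset (map u [1..<Suc l])" by (simp add: comp_def del: upt_Suc)
  qed
  also have "ann (L 1) (map u [1..<Suc l]) = 0" using cyclotomic by (simp add: ann_def comp_def del: upt_Suc)
  finally show ?case by simp
next
  case (8 i) then show ?case using s_braid[of i] by simp
next
  case (11 i) then show ?case using L_rec[of i] by simp
next
  case (1 a b) show ?case by (rule kap_add)
next
  case (2 a b) show ?case by (rule kap_mult)
next
  case 3 show ?case by (rule kap_1)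
next
  case (4 a x) show ?case by (rule kap_central)
next
  case (6 i) then show ?case using s_sq[of i] by simp
next
  case (7 i j) then show ?case using s_comm[of i j] by simp
next
  case (9 i k) then show ?case using L_comm[of i k] by simp
next
  case (10 i k) then show ?case using s_L_comm[of i k] by simp
qed

end

section \<open>The dual seminormal basis\<close>

context hecke_separated
begin

lemma hecke_separated_sharp: "hecke_separated l n (\<lambda>j. - u (l + 1 - j)) \<kappa> (\<lambda>i. - s i) (\<lambda>k. - L k)"
  by (intro hecke_separated.intro hecke_separated_axioms.intro hecke_rel_sharp separated_conj separated)

text \<open>Both sides are compared on the idempotents \<open>F v\<close>, whose sum is 1. For the
  negated generators \<open>F v\<close> has as weight the contents of the conjugate of
  \<open>v\<close>.\<close>

lemma F_sharp:
  assumes t: "t \<in> tabs l n"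
  shows "gen_F \<kappa> (\<lambda>k. - L k) l n (\<lambda>j. - u (l + 1 - j)) (conj_tab l t) = F t"
proof -
  let ?u = "\<lambda>j. - u (l + 1 - j)"
  interpret C: hecke_separated l n ?u \<kappa> "\<lambda>i. - s i" "\<lambda>k. - L k"
    by (rule hecke_separated_sharp)
  have "C.F (conj_tab l t) * F v = (if v = t then F t else 0)" if v: "v \<in> tabs l n" for v
  proof -
    obtain D where D: "std_tab l n D v" using v by (auto simp: tabs_def)
    have "C.weight n (content ?u (conj_tab l v)) (F v)"
      unfolding C.weight_def
    proof
      fix k assume k: "k \<in> {1..n}"
      have "valid_node l (pos v k)"
        using std_tab_pos(1)[OF D k] D young_diagramD(1)[of l D "pos v k"] by (simp add: std_tab_def)
      then have "content ?u (conj_tab l v) k = - content u v k"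
        using pos_conj_tab[OF D k] ct_conj_node[of l "pos v k" u] by (simp add: content_pos)
      then show "- L k * F v = \<kappa> (content ?u (conj_tab l v) k) * F v"
        using L_F[OF v k] by (simp add: kap_uminus)
    qed
    then have "C.F (conj_tab l t) * F v = (if conj_tab l t = conj_tab l v then F v else 0)"
      using C.F_weight[OF conj_tab_tabs[OF t] conj_tab_tabs[OF v]] by blast
    moreover have "conj_tab l t = conj_tab l v \<longleftrightarrow> v = t"
    proof -
      obtain E where "std_tab l n E t" using t by (auto simp: tabs_def)
      then have "conj_tab l (conj_tab l t) = t" "conj_tab l (conj_tab l v) = v"
        using conj_tab_conj_tab D by blast+
      then show ?thesis by metis
    qed
    ultimately show ?thesis by auto
  qed
  then have "(\<Sum>v\<in>tabs l n. C.F (conj_tab l t) * F v * 1) = (\<Sum>v\<in>tabs l n. if v = t then F t else 0)"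
    by (intro sum.cong) auto
  also have "\<dots> = F t" using t finite_tabs by simp
  finally show ?thesis using insert_F[of "C.F (conj_tab l t)" 1] by simp
qed

lemma gen_m_form:
  assumes m: "multipartition l n lam" and a: "std_tab l n (diagram lam) a"
    and wa: "set wa \<subseteq> {1..<n}" "word_perm wa \<circ> tab_upper lam = a"
    and wb: "set wb \<subseteq> {1..<n}" "word_perm wb \<circ> tab_upper lam = b"
  shows "F a * gen_m \<kappa> s L l n u lam a b * F b = \<kappa> (r_init l u lam) *
    ((F a * Pw (rev wa) * F (tab_upper lam)) * (F (tab_upper lam) * Pw wb * F b))"
proof -
  interpret hecke_shape l n u \<kappa> s L lam
    by (intro hecke_shape.intro hecke_separated_axioms initial_tableau.intro m)
  have pa: "gen_perm s n (inv_into UNIV (d_perm n lam a)) = Pw (rev wa)"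
    unfolding d_perm_word[OF m wa] inv_word_perm by (rule gen_perm_word) (use wa in auto)
  have pb: "gen_perm s n (d_perm n lam b) = Pw wb"
    unfolding d_perm_word[OF m wb] by (rule gen_perm_word) (use wb in auto)
  have "F a * gen_m \<kappa> s L l n u lam a b * F b = F a * Pw (rev wa) * (X * U) * (Pw wb * F b)"
    unfolding gen_m_def pa pb by (simp only: mult.assoc)
  also have "\<dots> = \<kappa> (r_init l u lam) * (F a * Pw (rev wa) * F t0 * (Pw wb * F b))"
    by (rule seminormal_form[OF a]) (use wa in auto)
  also have "F a * Pw (rev wa) * F t0 * (Pw wb * F b) = F a * Pw (rev wa) * (F t0 * F t0) * (Pw wb * F b)"
    using F_F[OF t0_tabs t0_tabs] by simp
  finally show ?thesis by (simp only: mult.assoc)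
qed

lemma Pw_sharp:
  shows "hecke_rel.Pw (\<lambda>i. - s i) is = (- 1) ^ length is * Pw is"
proof -
  interpret C: hecke_rel l n "\<lambda>j. - u (l + 1 - j)" \<kappa> "\<lambda>i. - s i" "\<lambda>k. - L k"
    by (rule hecke_rel_sharp)
  show ?thesis unfolding C.Pw_def Pw_def by (rule prod_list_neg)
qed

text \<open>\<open>reduced_word\<close> for the negated generators, read back in the original ones.
  The signs of the words cancel in each loop. Inversions of a tableau and of its conjugate have
  constant sum, so the inequality between inversion numbers turns round.\<close>

lemma reduced_word_sharp:
  assumes m: "multipartition l n lam" and t: "std_tab l n (diagram lam) t"
  defines "t1 \<equiv> tab_lower l lam"
    and "N \<equiv> norm_ratio (\<lambda>j. - u (l + 1 - j)) (diagram (conj_mpart l lam)) (conj_tab l t)"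
  shows "\<exists>is. set is \<subseteq> {1..<n} \<and> word_perm is \<circ> tab_upper (conj_mpart l lam) = conj_tab l t \<and> word_perm is \<circ> t1 = t \<and>
    (\<forall>v\<in>tabs l n. F t1 * Pw is * F v \<noteq> 0 \<longrightarrow>
       std_tab l n (diagram lam) v \<and> (v = t \<or> inv_count (diagram lam) t < inv_count (diagram lam) v)) \<and>
    (\<forall>v\<in>tabs l n. F v * Pw (rev is) * F t1 \<noteq> 0 \<longrightarrow>
       std_tab l n (diagram lam) v \<and> (v = t \<or> inv_count (diagram lam) t < inv_count (diagram lam) v)) \<and>
    (F t1 * Pw is * F t) * (F t * Pw (rev is) * F t1) = \<kappa> N * F t1 \<and>
    (F t * Pw (rev is) * F t1) * (F t1 * Pw is * F t) = \<kappa> N * F t"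
proof -
  let ?u = "\<lambda>j. - u (l + 1 - j)" and ?D = "diagram lam" and ?D' = "diagram (conj_mpart l lam)"
  let ?t0 = "tab_upper (conj_mpart l lam)"
  interpret C: hecke_separated l n ?u \<kappa> "\<lambda>i. - s i" "\<lambda>k. - L k"
    by (rule hecke_separated_sharp)
  note m' = conj_diagram(1)[OF m]
  have D': "?D' = conj_node l ` ?D" by (rule conj_diagram(2)[OF m])
  have ct: "std_tab l n ?D' (conj_tab l t)" unfolding D' by (rule conj_tab_std[OF t])
  have T: "t \<in> tabs l n" and T1: "t1 \<in> tabs l n"
    using t tab_lower_std(1)[OF m] by (auto simp: tabs_def t1_def)
  have Ft: "C.F (conj_tab l t) = F t" and Ft1: "C.F ?t0 = F t1"
    using F_sharp[OF T] F_sharp[OF T1] tab_lower_std(2)[OF m] by (auto simp: t1_def)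
  have sgn: "x * ((- 1) ^ k * y) * z = (- 1) ^ k * (x * y * z)" for x y z :: 'b and k
    by (simp add: neg_one_power_left_commute mult.assoc)
  have sgn2: "((- 1) ^ k * x) * ((- 1) ^ k * y) = x * y" for x y :: 'b and k
    by (cases "even k") auto
  have pull_back: "std_tab l n ?D v \<and> (v = t \<or> inv_count ?D t < inv_count ?D v)"
    if v: "v \<in> tabs l n" and h: "std_tab l n ?D' (conj_tab l v) \<and>
      (conj_tab l v = conj_tab l t \<or> inv_count ?D' (conj_tab l v) < inv_count ?D' (conj_tab l t))" for v
  proof -
    obtain E where E: "std_tab l n E v" using v by (auto simp: tabs_def)
    have vv: "conj_tab l (conj_tab l v) = v" by (rule conj_tab_conj_tab[OF E])
    have "std_tab l n (conj_node l ` ?D') v" using conj_tab_std[of l n ?D' "conj_tab l v"] h vv by simp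
    then have sv: "std_tab l n ?D v"
      using D' conj_conj_image[OF young_diagram_diagram(1)[OF m]] by simp
    have "v = t" if "conj_tab l v = conj_tab l t" using that vv conj_tab_conj_tab[OF t] by metis
    moreover have "inv_count ?D t < inv_count ?D v" if "inv_count ?D' (conj_tab l v) < inv_count ?D' (conj_tab l t)"
      using that conj_invariants(1)[OF m t] conj_invariants(1)[OF m sv] unfolding D' by linarith
    ultimately show ?thesis using sv h by blast
  qed
  show ?thesis
    using C.reduced_word[OF ct tab_upper_std[OF m']]
  proof (elim exE conjE, goal_cases)
    case (1 js)
    have js: "set js \<subseteq> {1..<n}" "word_perm js \<circ> ?t0 = conj_tab l t" by fact+
    note up = 1(3) and down = 1(4) and n1 = 1(5)[folded N_def] and n2 = 1(6)[folded N_def]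
    show ?case
  proof (intro exI[of _ js] conjI ballI impI)
    show "set js \<subseteq> {1..<n}" "word_perm js \<circ> ?t0 = conj_tab l t" by fact+
    show "word_perm js \<circ> t1 = t" unfolding t1_def by (rule word_tab_lower[OF t js])
    fix v assume v: "v \<in> tabs l n"
    have Fv: "C.F (conj_tab l v) = F v" by (rule F_sharp[OF v])
    {
      assume nz: "F t1 * Pw js * F v \<noteq> 0"
      have "C.F ?t0 * C.Pw js * C.F (conj_tab l v) = (- 1) ^ length js * (F t1 * Pw js * F v)"
        unfolding Ft1 Fv Pw_sharp sgn ..
      then have "C.F ?t0 * C.Pw js * C.F (conj_tab l v) \<noteq> 0" using nz by (cases "even (length js)") auto
      then have "std_tab l n ?D v \<and> (v = t \<or> inv_count ?D t < inv_count ?D v)"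
        using up conj_tab_tabs[OF v] by (intro pull_back[OF v]) blast
    }
    then show "std_tab l n ?D v" "v = t \<or> inv_count ?D t < inv_count ?D v" if "F t1 * Pw js * F v \<noteq> 0"
      using that by blast+
    {
      assume nz: "F v * Pw (rev js) * F t1 \<noteq> 0"
      have "C.F (conj_tab l v) * C.Pw (rev js) * C.F ?t0 = (- 1) ^ length (rev js) * (F v * Pw (rev js) * F t1)"
        unfolding Ft1 Fv Pw_sharp sgn ..
      then have "C.F (conj_tab l v) * C.Pw (rev js) * C.F ?t0 \<noteq> 0" using nz by (cases "even (length js)") auto
      then have "std_tab l n ?D v \<and> (v = t \<or> inv_count ?D t < inv_count ?D v)"
        using down conj_tab_tabs[OF v] by (intro pull_back[OF v]) blast
    }
    then show "std_tab l n ?D v" "v = t \<or> inv_count ?D t < inv_count ?D v" if "F v * Pw (rev js) * F t1 \<noteq> 0"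
      using that by blast+
  next
    show "(F t1 * Pw js * F t) * (F t * Pw (rev js) * F t1) = \<kappa> N * F t1"
      using n1 unfolding Ft Ft1 Pw_sharp sgn length_rev sgn2 .
    show "(F t * Pw (rev js) * F t1) * (F t1 * Pw js * F t) = \<kappa> N * F t"
      using n2 unfolding Ft Ft1 Pw_sharp sgn length_rev sgn2 .
  qed
  qed
qed

theorem dual_seminormal_basis:
  assumes m: "multipartition l n lam" and a: "std_tab l n (diagram lam) a" and b: "std_tab l n (diagram lam) b"
  defines "u' \<equiv> \<lambda>j. - u (l + 1 - j)" and "lam' \<equiv> conj_mpart l lam"
  shows "F a * gen_n \<kappa> s L l n u lam a b * F b =
    \<kappa> ((- 1) ^ (perm_length n (d_perm n lam' (conj_tab l a)) + perm_length n (d_perm n lam' (conj_tab l b))) *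
       (r_coeff l n u' (conj_tab l a) * r_coeff l n u' (conj_tab l b) /
         (r_coeff l n u (tab_lower l lam) * r_coeff l n u' (tab_upper lam')))) *
    (F a * gen_m \<kappa> s L l n u lam a b * F b)"
proof -
  let ?D = "diagram lam" and ?D' = "diagram lam'"
  let ?a = "conj_tab l a" and ?b = "conj_tab l b"
  define t0 where "t0 = tab_upper lam"
  define t1 where "t1 = tab_lower l lam"
  define N where "N t = norm_ratio u' ?D' (conj_tab l t)" for t
  define N1 where "N1 = norm_ratio u ?D t1"
  have m': "multipartition l n lam'" unfolding lam'_def by (rule conj_diagram(1)[OF m])
  have S': "separated l n u'" unfolding u'_def by (rule separated_conj[OF separated])
  interpret C: hecke_separated l n u' \<kappa> "\<lambda>i. - s i" "\<lambda>k. - L k"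
    unfolding u'_def by (rule hecke_separated_sharp)
  have t0: "std_tab l n ?D t0" "inversions ?D t0 = {}" unfolding t0_def using tab_upper_std[OF m] by auto
  have t1: "std_tab l n ?D t1" unfolding t1_def by (rule tab_lower_std(1)[OF m])
  have ca: "std_tab l n ?D' ?a" and cb: "std_tab l n ?D' ?b"
    using conj_tab_std[OF a] conj_tab_std[OF b] conj_diagram(2)[OF m] by (auto simp: lam'_def)
  have A: "a \<in> tabs l n" and B: "b \<in> tabs l n" and T0: "t0 \<in> tabs l n" and T1: "t1 \<in> tabs l n"
    using a b t0 t1 by (auto simp: tabs_def)
  have Fa: "C.F ?a = F a" and Fb: "C.F ?b = F b" and F1: "C.F (tab_upper lam') = F t1"
    using F_sharp[OF A] F_sharp[OF B] F_sharp[OF T1] tab_lower_std(2)[OF m] by (auto simp: u'_def lam'_def t1_def)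
  from reduced_word[OF a t0] obtain wa where wa: "set wa \<subseteq> {1..<n}" "word_perm wa \<circ> t0 = a"
    and downa: "\<forall>v\<in>tabs l n. F v * Pw (rev wa) * F t0 \<noteq> 0 \<longrightarrow> std_tab l n ?D v \<and> (v = a \<or> inv_count ?D v < inv_count ?D a)"
    by (elim exE conjE) (rule that; assumption)
  from reduced_word[OF b t0] obtain wb where wb: "set wb \<subseteq> {1..<n}" "word_perm wb \<circ> t0 = b"
    and upb: "\<forall>v\<in>tabs l n. F t0 * Pw wb * F v \<noteq> 0 \<longrightarrow> std_tab l n ?D v \<and> (v = b \<or> inv_count ?D v < inv_count ?D b)"
    by (elim exE conjE) (rule that; assumption)
  from reduced_word[OF t1 t0, folded N1_def] obtain w1 where w1: "set w1 \<subseteq> {1..<n}" "word_perm w1 \<circ> t0 = t1"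
    and n1: "(F t1 * Pw (rev w1) * F t0) * (F t0 * Pw w1 * F t1) = \<kappa> N1 * F t1"
    by (elim exE conjE) (rule that; assumption)
  from reduced_word_sharp[OF m a, folded u'_def lam'_def t1_def, folded N_def] obtain va where va: "set va \<subseteq> {1..<n}" "word_perm va \<circ> tab_upper lam' = ?a" "word_perm va \<circ> t1 = a"
    and upa: "\<forall>v\<in>tabs l n. F t1 * Pw va * F v \<noteq> 0 \<longrightarrow> std_tab l n ?D v \<and> (v = a \<or> inv_count ?D a < inv_count ?D v)"
    and na: "(F a * Pw (rev va) * F t1) * (F t1 * Pw va * F a) = \<kappa> (N a) * F a"
    by (elim exE conjE) (rule that; assumption)
  from reduced_word_sharp[OF m b, folded u'_def lam'_def t1_def, folded N_def] obtain vb where vb: "set vb \<subseteq> {1..<n}" "word_perm vb \<circ> tab_upper lam' = ?b" "word_perm vb \<circ> t1 = b"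
    and downb: "\<forall>v\<in>tabs l n. F v * Pw (rev vb) * F t1 \<noteq> 0 \<longrightarrow> std_tab l n ?D v \<and> (v = b \<or> inv_count ?D b < inv_count ?D v)"
    and nb: "(F b * Pw (rev vb) * F t1) * (F t1 * Pw vb * F b) = \<kappa> (N b) * F b"
    by (elim exE conjE) (rule that; assumption)
  \<comment> \<open>The \<open>\<alpha>\<close> connect \<open>a\<close> and \<open>b\<close> with
    the initial tableau, the \<open>\<beta>\<close> with the final one; each \<open>\<gamma>\<close>
    runs opposite to the \<open>\<beta>\<close> of the same index.\<close>
  define \<alpha>a where "\<alpha>a = F a * Pw (rev wa) * F t0"
  define \<alpha>b where "\<alpha>b = F t0 * Pw wb * F b"
  define \<beta>a where "\<beta>a = F a * Pw (rev va) * F t1"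
  define \<beta>b where "\<beta>b = F t1 * Pw vb * F b"
  define \<gamma>a where "\<gamma>a = F t1 * Pw va * F a"
  define \<gamma>b where "\<gamma>b = F b * Pw (rev vb) * F t1"
  have undo: "word_perm (rev w) \<circ> (word_perm w \<circ> x) = x" for w and x :: tableau
    by (simp add: comp_assoc[symmetric] word_perm_rev)
  \<comment> \<open>Going from the initial tableau to \<open>b\<close> and on to the final one
    realizes the permutation of \<open>w1\<close>, so the two words agree in the algebra even if
    they differ as lists.\<close>
  have P1: "Pw w1 = Pw (wb @ rev vb)"
  proof (rule Pw_word_perm)
    show "word_perm w1 = word_perm (wb @ rev vb)"
    proof (rule permutes_tableau_unique[OF t0(1)])
      have "word_perm (wb @ rev vb) \<circ> t0 = word_perm (rev vb) \<circ> b"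
        using wb(2) by (simp add: word_perm_append comp_assoc)
      also have "\<dots> = t1" using undo[of vb t1] vb(3) by simp
      finally show "word_perm w1 \<circ> t0 = word_perm (wb @ rev vb) \<circ> t0" using w1(2) by simp
      show "word_perm w1 permutes {1..n}" by (rule word_perm_permutes[OF w1(1)])
      show "word_perm (wb @ rev vb) permutes {1..n}" by (rule word_perm_permutes) (use wb(1) vb(1) in auto)
    qed
  qed (use w1 wb vb in auto)
  have P2: "Pw (rev w1) = Pw (va @ rev wa)"
  proof (rule Pw_word_perm)
    show "word_perm (rev w1) = word_perm (va @ rev wa)"
    proof (rule permutes_tableau_unique[OF t1])
      have "word_perm (va @ rev wa) \<circ> t1 = word_perm (rev wa) \<circ> a"
        using va(3) by (simp add: word_perm_append comp_assoc)
      also have "\<dots> = t0" using undo[of wa t0] wa(2) by simp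
      finally show "word_perm (rev w1) \<circ> t1 = word_perm (va @ rev wa) \<circ> t1" using undo[of w1 t0] w1(2) by simp
      show "word_perm (rev w1) permutes {1..n}" by (rule word_perm_permutes) (use w1(1) in auto)
      show "word_perm (va @ rev wa) permutes {1..n}" by (rule word_perm_permutes) (use wa(1) va(1) in auto)
    qed
  qed (use w1 wa va in auto)
  \<comment> \<open>Left of the cut only \<open>b\<close> and tableaux with fewer inversions occur,
    right of it only \<open>b\<close> and tableaux with more.\<close>
  have up: "F t0 * Pw w1 * F t1 = \<alpha>b * \<gamma>b"
  proof -
    have "F t0 * Pw w1 * F t1 = (\<Sum>v\<in>tabs l n. (F t0 * Pw wb) * F v * (Pw (rev vb) * F t1))"
      using insert_F[of "F t0 * Pw wb" "Pw (rev vb) * F t1"] by (simp add: P1 mult.assoc)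
    also have "\<dots> = (\<Sum>v\<in>tabs l n. if v = b then \<alpha>b * \<gamma>b else 0)"
    proof (rule sum.cong[OF refl])
      fix v assume v: "v \<in> tabs l n"
      have eq: "(F t0 * Pw wb) * F v * (Pw (rev vb) * F t1) = (F t0 * Pw wb * F v) * (F v * Pw (rev vb) * F t1)"
      proof -
        have "(F t0 * Pw wb) * F v * (Pw (rev vb) * F t1) = F t0 * Pw wb * (F v * F v) * (Pw (rev vb) * F t1)"
          using F_F[OF v v] by simp
        then show ?thesis by (simp only: mult.assoc)
      qed
      show "(F t0 * Pw wb) * F v * (Pw (rev vb) * F t1) = (if v = b then \<alpha>b * \<gamma>b else 0)"
      proof (cases "v = b")
        case False
        have "F t0 * Pw wb * F v = 0 \<or> F v * Pw (rev vb) * F t1 = 0"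
          using upb downb v False by (metis less_asym)
        then show ?thesis using eq False by auto
      qed (use eq in \<open>simp add: \<alpha>b_def \<gamma>b_def\<close>)
    qed
    finally show ?thesis using B finite_tabs by simp
  qed
  have down: "F t1 * Pw (rev w1) * F t0 = \<gamma>a * \<alpha>a"
  proof -
    have "F t1 * Pw (rev w1) * F t0 = (\<Sum>v\<in>tabs l n. (F t1 * Pw va) * F v * (Pw (rev wa) * F t0))"
      using insert_F[of "F t1 * Pw va" "Pw (rev wa) * F t0"] by (simp add: P2 mult.assoc)
    also have "\<dots> = (\<Sum>v\<in>tabs l n. if v = a then \<gamma>a * \<alpha>a else 0)"
    proof (rule sum.cong[OF refl])
      fix v assume v: "v \<in> tabs l n"
      have eq: "(F t1 * Pw va) * F v * (Pw (rev wa) * F t0) = (F t1 * Pw va * F v) * (F v * Pw (rev wa) * F t0)"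
      proof -
        have "(F t1 * Pw va) * F v * (Pw (rev wa) * F t0) = F t1 * Pw va * (F v * F v) * (Pw (rev wa) * F t0)"
          using F_F[OF v v] by simp
        then show ?thesis by (simp only: mult.assoc)
      qed
      show "(F t1 * Pw va) * F v * (Pw (rev wa) * F t0) = (if v = a then \<gamma>a * \<alpha>a else 0)"
      proof (cases "v = a")
        case False
        have "F t1 * Pw va * F v = 0 \<or> F v * Pw (rev wa) * F t0 = 0"
          using upa downa v False by (metis less_asym)
        then show ?thesis using eq False by auto
      qed (use eq in \<open>simp add: \<alpha>a_def \<gamma>a_def\<close>)
    qed
    finally show ?thesis using A finite_tabs by simp
  qed
  have FF: "F a * F a = F a" "F b * F b = F b" "F t1 * F t1 = F t1" using F_F A B T1 by auto
  have proj: "F a * \<alpha>a = \<alpha>a" "\<alpha>b * F b = \<alpha>b" "F t1 * \<beta>b = \<beta>b"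
  proof -
    have "F a * \<alpha>a = (F a * F a) * (Pw (rev wa) * F t0)" unfolding \<alpha>a_def by (simp only: mult.assoc)
    then show "F a * \<alpha>a = \<alpha>a" unfolding FF \<alpha>a_def by (simp only: mult.assoc)
    have "\<alpha>b * F b = F t0 * Pw wb * (F b * F b)" unfolding \<alpha>b_def by (simp only: mult.assoc)
    then show "\<alpha>b * F b = \<alpha>b" unfolding FF \<alpha>b_def .
    have "F t1 * \<beta>b = (F t1 * F t1) * (Pw vb * F b)" unfolding \<beta>b_def by (simp only: mult.assoc)
    then show "F t1 * \<beta>b = \<beta>b" unfolding FF \<beta>b_def by (simp only: mult.assoc)
  qed
  \<comment> \<open>One product of six factors is evaluated twice: by the loops at \<open>a\<close>
    and \<open>b\<close>, and by the loop at \<open>t1\<close>.\<close>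
  have key: "\<kappa> (N a * N b) * (\<alpha>a * \<alpha>b) = \<kappa> N1 * (\<beta>a * \<beta>b)"
  proof -
    have "(\<beta>a * \<gamma>a) * (\<alpha>a * \<alpha>b) * (\<gamma>b * \<beta>b) = \<kappa> (N a) * (F a * \<alpha>a) * (\<kappa> (N b) * (\<alpha>b * F b))"
      using na nb kap_left_commute[of \<alpha>b "N b" "F b"]
      unfolding \<beta>a_def[symmetric] \<gamma>a_def[symmetric] \<beta>b_def[symmetric] \<gamma>b_def[symmetric]
      by (simp only: mult.assoc)
    also have "\<dots> = \<kappa> (N a * N b) * (\<alpha>a * \<alpha>b)"
      unfolding proj using kap_left_commute[of \<alpha>a "N b" \<alpha>b] by (simp only: mult.assoc kap_mult)
    finally have 1: "(\<beta>a * \<gamma>a) * (\<alpha>a * \<alpha>b) * (\<gamma>b * \<beta>b) = \<kappa> (N a * N b) * (\<alpha>a * \<alpha>b)" .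
    have "(\<beta>a * \<gamma>a) * (\<alpha>a * \<alpha>b) * (\<gamma>b * \<beta>b) = \<beta>a * ((\<gamma>a * \<alpha>a) * (\<alpha>b * \<gamma>b)) * \<beta>b" by (simp only: mult.assoc)
    also have "(\<gamma>a * \<alpha>a) * (\<alpha>b * \<gamma>b) = \<kappa> N1 * F t1" using n1 unfolding up down .
    also have "\<beta>a * (\<kappa> N1 * F t1) * \<beta>b = \<kappa> N1 * (\<beta>a * (F t1 * \<beta>b))"
      using kap_left_commute[of \<beta>a N1 "F t1"] by (simp only: mult.assoc)
    finally show ?thesis using 1 unfolding proj by simp
  qed
  define r0 where "r0 = r_init l u lam"
  define r0' where "r0' = r_init l u' lam'"
  have r0: "r0 \<noteq> 0" "r0' \<noteq> 0" "N1 \<noteq> 0"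
    unfolding r0_def r0'_def N1_def
    using r_init_nonzero[OF separated m] r_init_nonzero[OF S' m'] norm_ratio_nonzero[OF separated t1] by auto
  have f: "F a * gen_m \<kappa> s L l n u lam a b * F b = \<kappa> r0 * (\<alpha>a * \<alpha>b)"
    unfolding r0_def \<alpha>a_def \<alpha>b_def t0_def
    by (rule gen_m_form[OF m a]) (use wa wb in \<open>simp_all add: t0_def\<close>)
  have "C.F ?a * gen_m \<kappa> (\<lambda>i. - s i) (\<lambda>k. - L k) l n u' lam' ?a ?b * C.F ?b = \<kappa> r0' *
      ((C.F ?a * C.Pw (rev va) * C.F (tab_upper lam')) * (C.F (tab_upper lam') * C.Pw vb * C.F ?b))"
    unfolding r0'_def by (rule C.gen_m_form[OF m' ca va(1,2) vb(1,2)])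
  moreover have "F a * (((- 1) ^ length (rev va) * Pw (rev va)) * (F t1 * (F t1 * (((- 1) ^ length vb * Pw vb) * F b)))) =
      (- 1) ^ (length va + length vb) * (\<beta>a * \<beta>b)"
  proof -
    have "F a * (((- 1) ^ j * Y) * (F t1 * (F t1 * (((- 1) ^ k * Z) * F b)))) =
        (- 1) ^ (j + k) * ((F a * Y * F t1) * (F t1 * Z * F b))" for j k Y Z
      by (cases "even j"; cases "even k") (simp_all add: mult.assoc)
    then show ?thesis unfolding \<beta>a_def \<beta>b_def length_rev by blast
  qed
  ultimately have g: "F a * gen_n \<kappa> s L l n u lam a b * F b = \<kappa> r0' * ((- 1) ^ (length va + length vb) * (\<beta>a * \<beta>b))"
    unfolding gen_n_eq[where \<kappa> = \<kappa> and s = s and L = L and u = u, OF kap_uminus m a b]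
      Fa Fb F1 u'_def[symmetric] lam'_def[symmetric] Pw_sharp mult.assoc
    by simp
  define e :: 'a where "e = (- 1) ^ (perm_length n (d_perm n lam' ?a) + perm_length n (d_perm n lam' ?b))"
  have "(- 1 :: 'b) ^ (length va + length vb) = \<kappa> e"
    using perm_length_word[OF va(1) d_perm_word[OF m' va(1,2), symmetric], where ?'r = 'b]
      perm_length_word[OF vb(1) d_perm_word[OF m' vb(1,2), symmetric], where ?'r = 'b]
    by (simp add: e_def power_add kap_power kap_mult)
  then have "F a * gen_n \<kappa> s L l n u lam a b * F b = \<kappa> (r0' * e / N1) * (\<kappa> N1 * (\<beta>a * \<beta>b))"
    using g r0 by (simp add: kap_kap)
  also have "\<dots> = \<kappa> (r0' * e / N1 * (N a * N b) / r0) * (F a * gen_m \<kappa> s L l n u lam a b * F b)"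
    unfolding key[symmetric] f kap_kap using r0 by simp
  also have "r0' * e / N1 * (N a * N b) / r0 =
      e * (r_coeff l n u' ?a * r_coeff l n u' ?b / (r_coeff l n u (tab_lower l lam) * r_coeff l n u' (tab_upper lam')))"
  proof -
    have ra: "r_coeff l n u' ?a = r0' * N a" unfolding r0'_def N_def by (rule r_coeff_eq[OF S' m' ca])
    have rb: "r_coeff l n u' ?b = r0' * N b" unfolding r0'_def N_def by (rule r_coeff_eq[OF S' m' cb])
    have r1: "r_coeff l n u (tab_lower l lam) = r0 * N1"
      unfolding r0_def N1_def t1_def[symmetric] by (rule r_coeff_eq[OF separated m t1])
    have rt: "r_coeff l n u' (tab_upper lam') = r0'"
      using r_coeff_eq[OF S' m' tab_upper_std(1)[OF m']] tab_upper_std(2)[OF m'] by (simp add: r0'_def norm_ratio_def)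
    show ?thesis unfolding ra rb r1 rt using r0 by (simp add: field_simps)
  qed
  finally show ?thesis unfolding e_def .
qed

end

text \<open>The product of \<open>r\<close> at \<open>t\<close> and of \<open>r\<close> for the
  conjugate parameters at the conjugate of \<open>t\<close> does not depend on \<open>t\<close>.
  Solving for the former at \<open>a\<close> and \<open>b\<close> turns the first fraction into the
  second.\<close>

lemma coefficient_identity:
  fixes u :: "nat \<Rightarrow> 'k::field"
  assumes S: "separated l n u" and m: "multipartition l n lam"
    and a: "std_tab l n (diagram lam) a" and b: "std_tab l n (diagram lam) b"
  defines "u' \<equiv> \<lambda>j. - u (l + 1 - j)" and "lam' \<equiv> conj_mpart l lam"
  shows "r_coeff l n u (tab_lower l lam) * r_coeff l n u' (tab_upper lam') / (r_coeff l n u a * r_coeff l n u b) =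
      r_coeff l n u' (conj_tab l a) * r_coeff l n u' (conj_tab l b) /
        (r_coeff l n u (tab_lower l lam) * r_coeff l n u' (tab_upper lam'))"
    and "r_coeff l n u' (conj_tab l a) * r_coeff l n u' (conj_tab l b) /
        (r_coeff l n u (tab_lower l lam) * r_coeff l n u' (tab_upper lam')) \<noteq> 0"
proof -
  have m': "multipartition l n lam'" unfolding lam'_def by (rule conj_diagram(1)[OF m])
  have S': "separated l n u'" unfolding u'_def by (rule separated_conj[OF S])
  have c: "std_tab l n (diagram lam') (conj_tab l t)" if "std_tab l n (diagram lam) t" for t
    using conj_tab_std[OF that] conj_diagram(2)[OF m] by (simp add: lam'_def)
  have ne: "r_init l u lam \<noteq> 0" "r_init l u' lam' \<noteq> 0"
    using r_init_nonzero[OF S m] r_init_nonzero[OF S' m'] by auto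
  have rt: "r_coeff l n u' (tab_upper lam') = r_init l u' lam'"
    using r_coeff_eq[OF S' m' tab_upper_std(1)[OF m']] tab_upper_std(2)[OF m'] by (simp add: norm_ratio_def)
  have prod: "r_coeff l n u t * r_coeff l n u' (conj_tab l t) =
      r_coeff l n u (tab_lower l lam) * r_coeff l n u' (tab_upper lam')"
    if t: "std_tab l n (diagram lam) t" for t
    using norm_ratio_tab_lower[OF m t, of u]
    unfolding r_coeff_eq[OF S m t] r_coeff_eq[OF S' m' c[OF t]] r_coeff_eq[OF S m tab_lower_std(1)[OF m]] rt
    by (simp add: u'_def lam'_def)
  have nz: "r_coeff l n u t \<noteq> 0" "r_coeff l n u' (conj_tab l t) \<noteq> 0" if t: "std_tab l n (diagram lam) t" for t
    using r_coeff_eq[OF S m t] r_coeff_eq[OF S' m' c[OF t]] ne norm_ratio_nonzero[OF S t] norm_ratio_nonzero[OF S' c[OF t]]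
    by auto
  show "r_coeff l n u (tab_lower l lam) * r_coeff l n u' (tab_upper lam') / (r_coeff l n u a * r_coeff l n u b) =
      r_coeff l n u' (conj_tab l a) * r_coeff l n u' (conj_tab l b) /
        (r_coeff l n u (tab_lower l lam) * r_coeff l n u' (tab_upper lam'))"
  proof -
    have frac: "p / (ra * rb) = xa * xb / p" if "ra * xa = p" "rb * xb = p" "ra \<noteq> 0" "rb \<noteq> 0" "p \<noteq> 0"
      for p ra rb xa xb :: 'k
    proof -
      have "xa = p / ra" "xb = p / rb" using that by (auto simp: field_simps)
      then show ?thesis using that by (simp add: field_simps)
    qed
    show ?thesis
      by (rule frac[OF prod[OF a] prod[OF b] nz(1)[OF a] nz(1)[OF b]])
        (use nz(1)[OF tab_lower_std(1)[OF m]] rt ne in auto)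
  qed
  show "r_coeff l n u' (conj_tab l a) * r_coeff l n u' (conj_tab l b) /
        (r_coeff l n u (tab_lower l lam) * r_coeff l n u' (tab_upper lam')) \<noteq> 0"
    using nz(2)[OF a] nz(2)[OF b] nz(1)[OF tab_lower_std(1)[OF m]] rt ne by auto
qed

section \<open>Modules of the Hecke algebra\<close>

definition eval_letter :: "(nat \<Rightarrow> 'r) \<Rightarrow> (nat \<Rightarrow> 'r) \<Rightarrow> gen \<Rightarrow> 'r" where
  "eval_letter s L g = (case g of SGen i \<Rightarrow> s i | LGen k \<Rightarrow> L k)"

definition nc_eval ::
  "('k::field \<Rightarrow> 'r::ring_1) \<Rightarrow> (nat \<Rightarrow> 'r) \<Rightarrow> (nat \<Rightarrow> 'r) \<Rightarrow> 'k ncpoly \<Rightarrow> 'r" where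
  "nc_eval \<kappa> s L p =
     (\<Sum>w\<in>Poly_Mapping.keys p. \<kappa> (Poly_Mapping.lookup p w) * prod_list (map (eval_letter s L) (letters w)))"

lemma poly_mapping_sum_single: "p = (\<Sum>w\<in>Poly_Mapping.keys p. Poly_Mapping.single w (Poly_Mapping.lookup p w))"
proof (rule poly_mapping_eqI)
  fix k
  have "(\<Sum>w\<in>Poly_Mapping.keys p. Poly_Mapping.lookup (Poly_Mapping.single w (Poly_Mapping.lookup p w)) k) =
      (\<Sum>w\<in>Poly_Mapping.keys p. if w = k then Poly_Mapping.lookup p k else 0)"
    by (intro sum.cong) (auto simp: lookup_single when_def)
  also have "\<dots> = Poly_Mapping.lookup p k" by (simp add: in_keys_iff)
  finally show "Poly_Mapping.lookup p k =
      Poly_Mapping.lookup (\<Sum>w\<in>Poly_Mapping.keys p. Poly_Mapping.single w (Poly_Mapping.lookup p w)) k"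
    by (simp add: lookup_sum)
qed

locale scalars =
  fixes \<kappa> :: "'k::field \<Rightarrow> 'r::ring_1" and s L :: "nat \<Rightarrow> 'r"
  assumes sc_add: "\<kappa> (a + b) = \<kappa> a + \<kappa> b"
    and sc_mult: "\<kappa> (a * b) = \<kappa> a * \<kappa> b"
    and sc_1 [simp]: "\<kappa> 1 = 1"
    and sc_central: "\<kappa> a * x = x * \<kappa> a"
begin

abbreviation ev :: "'k ncpoly \<Rightarrow> 'r" where "ev \<equiv> nc_eval \<kappa> s L"

lemma sc_0 [simp]: "\<kappa> 0 = 0"
  using sc_add[of 0 0] by simp

lemma ev_superset:
  assumes "finite A" "Poly_Mapping.keys p \<subseteq> A"
  shows "ev p = (\<Sum>w\<in>A. \<kappa> (Poly_Mapping.lookup p w) * prod_list (map (eval_letter s L) (letters w)))"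
  unfolding nc_eval_def
  by (rule sum.mono_neutral_left) (use assms in \<open>auto simp: in_keys_iff\<close>)

lemma ev_add: "ev (p + q) = ev p + ev q"
proof -
  let ?A = "Poly_Mapping.keys p \<union> Poly_Mapping.keys q"
  have "ev (p + q) = (\<Sum>w\<in>?A. \<kappa> (Poly_Mapping.lookup (p + q) w) * prod_list (map (eval_letter s L) (letters w)))"
    by (rule ev_superset) (use keys_add[of p q] in auto)
  also have "\<dots> = ev p + ev q"
    using ev_superset[of ?A p] ev_superset[of ?A q]
    by (simp add: lookup_add sc_add distrib_right sum.distrib)
  finally show ?thesis .
qed

lemma ev_0 [simp]: "ev 0 = 0"
  by (simp add: nc_eval_def)

lemma ev_uminus: "ev (- p) = - ev p"
  using ev_add[of "- p" p] by (simp add: eq_neg_iff_add_eq_0)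

lemma ev_diff: "ev (p - q) = ev p - ev q"
  using ev_add[of p "- q"] by (simp add: ev_uminus)

lemma ev_sum: "ev (\<Sum>x\<in>A. f x) = (\<Sum>x\<in>A. ev (f x))"
  by (induction A rule: infinite_finite_induct) (simp_all add: ev_add)

lemma ev_single: "ev (Poly_Mapping.single w a) = \<kappa> a * prod_list (map (eval_letter s L) (letters w))"
  by (subst ev_superset[of "{w}"]) auto

lemma ev_1 [simp]: "ev 1 = 1"
  using ev_single[of 0 1] by (simp add: single_one) (simp add: zero_word_def)

lemma ev_single_mult:
  "ev (Poly_Mapping.single v a * Poly_Mapping.single w b) = ev (Poly_Mapping.single v a) * ev (Poly_Mapping.single w b)"
proof -
  let ?V = "prod_list (map (eval_letter s L) (letters v))" and ?W = "prod_list (map (eval_letter s L) (letters w))"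
  have "ev (Poly_Mapping.single v a * Poly_Mapping.single w b) = \<kappa> a * (\<kappa> b * ?V) * ?W"
    by (simp add: mult_single ev_single plus_word_def sc_mult mult.assoc)
  also have "\<dots> = \<kappa> a * (?V * \<kappa> b) * ?W" using sc_central[of b ?V] by simp
  finally show ?thesis by (simp add: ev_single mult.assoc)
qed

lemma ev_mult: "ev (p * q) = ev p * ev q"
proof -
  let ?f = "\<lambda>p w. Poly_Mapping.single w (Poly_Mapping.lookup p w)"
  have "ev (p * q) = ev ((\<Sum>v\<in>Poly_Mapping.keys p. ?f p v) * (\<Sum>w\<in>Poly_Mapping.keys q. ?f q w))"
    using poly_mapping_sum_single[of p] poly_mapping_sum_single[of q] by simp
  also have "\<dots> = (\<Sum>v\<in>Poly_Mapping.keys p. \<Sum>w\<in>Poly_Mapping.keys q. ev (?f p v) * ev (?f q w))"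
    by (simp add: sum_product ev_sum ev_single_mult)
  also have "\<dots> = ev (\<Sum>v\<in>Poly_Mapping.keys p. ?f p v) * ev (\<Sum>w\<in>Poly_Mapping.keys q. ?f q w)"
    by (simp add: sum_product ev_sum)
  finally show ?thesis using poly_mapping_sum_single[of p] poly_mapping_sum_single[of q] by simp
qed

lemma ev_prod_list: "ev (prod_list ps) = prod_list (map ev ps)"
  by (induction ps) (simp_all add: ev_mult)

lemma ev_sg [simp]: "ev (sg i) = s i" and ev_Lg [simp]: "ev (Lg k) = L k" and ev_scal [simp]: "ev (scal a) = \<kappa> a"
  by (simp_all add: sg_def Lg_def scal_def ev_single eval_letter_def zero_word_def)

text \<open>The elements of the free algebra that evaluate to 0 form an ideal containing the
  relators.\<close>

lemma ev_ideal:
  assumes n: "n \<ge> 1" and rel: "\<And>x. x \<in> relators l n u \<Longrightarrow> ev x = 0" and x: "x \<in> hecke_ideal l n u"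
  shows "ev x = 0"
proof -
  interpret FA: ring "free_algebra n :: 'k ncpoly ring" by (rule ring_free_algebra)
  let ?K = "{x \<in> carrier (free_algebra n). ev x = 0}"
  have "ideal ?K (free_algebra n)"
  proof (rule idealI[OF ring_free_algebra])
    show "subgroup ?K (add_monoid (free_algebra n))"
    proof
      fix x y assume "x \<in> ?K" "y \<in> ?K"
      then show "x \<otimes>\<^bsub>add_monoid (free_algebra n)\<^esub> y \<in> ?K"
        using FA.a_closed[of x y] by (simp add: free_algebra_def ev_add)
    next
      show "\<one>\<^bsub>add_monoid (free_algebra n)\<^esub> \<in> ?K"
        using FA.zero_closed by (simp add: free_algebra_def)
    next
      fix x assume x: "x \<in> ?K"
      then have c: "\<ominus>\<^bsub>free_algebra n\<^esub> x \<in> carrier (free_algebra n)" by simp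
      have "\<ominus>\<^bsub>free_algebra n\<^esub> x + x = 0" using FA.l_neg[of x] x by (simp add: free_algebra_def)
      then have "ev (\<ominus>\<^bsub>free_algebra n\<^esub> x) + ev x = 0" using ev_add ev_0 by metis
      then have "\<ominus>\<^bsub>free_algebra n\<^esub> x \<in> ?K" using c x by simp
      then show "inv\<^bsub>add_monoid (free_algebra n)\<^esub> x \<in> ?K" by (simp add: a_inv_def)
    qed auto
  next
    fix a x :: "'k ncpoly" assume "a \<in> ?K" "x \<in> carrier (free_algebra n)"
    then show "x \<otimes>\<^bsub>free_algebra n\<^esub> a \<in> ?K" "a \<otimes>\<^bsub>free_algebra n\<^esub> x \<in> ?K"
      using FA.m_closed[of x a] FA.m_closed[of a x] by (simp_all add: free_algebra_def ev_mult)
  qed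
  moreover have "relators l n u \<subseteq> ?K" using rel relators_carrier[OF n] by blast
  ultimately have "hecke_ideal l n u \<subseteq> ?K" unfolding hecke_ideal_def by (rule FA.genideal_minimal)
  then show ?thesis using x by blast
qed

end

lemma (in hecke_rel) scalars: "scalars \<kappa>"
  by unfold_locales (rule kap_add kap_mult kap_1 kap_central)+

lemma (in hecke_rel) nc_eval_ideal:
  assumes n: "n \<ge> 1" and x: "x \<in> hecke_ideal l n u"
  shows "nc_eval \<kappa> s L x = 0"
proof -
  interpret scalars \<kappa> s L by (rule scalars)
  have "ev x = 0" if "x \<in> relators l n u" for x
  proof -
    have cyc: "ev (\<Prod>j\<leftarrow>[1..<Suc l]. (Lg 1 - scal (u j))) = 0"
      using cyclotomic by (simp add: ev_prod_list ev_diff comp_def del: upt_Suc)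
    show ?thesis
      using that unfolding relators_def
      by (elim UnE CollectE exE conjE singletonE)
        (simp_all add: cyc[unfolded One_nat_def] ev_diff ev_mult ev_add s_sq s_comm s_braid[simplified] L_comm s_L_comm L_rec[simplified] del: upt_Suc)
  qed
  then show ?thesis by (rule ev_ideal[OF n _ x])
qed

text \<open>Linear operators are made into a ring type so that a module of the Hecke algebra becomes
  an instance of \<open>hecke_rel\<close>.\<close>

typedef (overloaded) ('i, 'k) lin = "{f :: ('i \<Rightarrow> 'k::field) \<Rightarrow> ('i \<Rightarrow> 'k).
    (\<forall>v w. f (\<lambda>i. v i + w i) = (\<lambda>i. f v i + f w i)) \<and> (\<forall>a v. f (\<lambda>i. a * v i) = (\<lambda>i. a * f v i))}"
  morphisms act Lin
  by (rule exI[of _ id]) simp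

setup_lifting type_definition_lin

lemma act_add: "act f (\<lambda>i. v i + w i) = (\<lambda>i. act f v i + act f w i)"
  and act_scale: "act f (\<lambda>i. a * v i) = (\<lambda>i. a * act f v i)"
  using act[of f] by auto

instantiation lin :: (type, field) ring_1
begin

lift_definition zero_lin :: "('a, 'b) lin" is "\<lambda>v i. 0" by simp
lift_definition one_lin :: "('a, 'b) lin" is "\<lambda>v. v" by simp
lift_definition plus_lin :: "('a, 'b) lin \<Rightarrow> ('a, 'b) lin \<Rightarrow> ('a, 'b) lin" is "\<lambda>f g v i. f v i + g v i"
  by (simp add: algebra_simps)
lift_definition minus_lin :: "('a, 'b) lin \<Rightarrow> ('a, 'b) lin \<Rightarrow> ('a, 'b) lin" is "\<lambda>f g v i. f v i - g v i"
  by (simp add: algebra_simps)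
lift_definition uminus_lin :: "('a, 'b) lin \<Rightarrow> ('a, 'b) lin" is "\<lambda>f v i. - f v i"
  by simp
lift_definition times_lin :: "('a, 'b) lin \<Rightarrow> ('a, 'b) lin \<Rightarrow> ('a, 'b) lin" is "\<lambda>f g v. f (g v)"
  by simp

instance
proof
  fix a b c :: "('a, 'b) lin"
  show "a * b * c = a * (b * c)" by transfer simp
  show "1 * a = a" "a * 1 = a" by (transfer, simp)+
  show "a + b + c = a + (b + c)" "a + b = b + a" "0 + a = a" "- a + a = 0" "a - b = a + - b"
    by (transfer, simp add: algebra_simps)+
  show "(a + b) * c = a * c + b * c" "a * (b + c) = a * b + a * c" by (transfer, simp)+
  show "(0 :: ('a, 'b) lin) \<noteq> 1"
  proof
    assume "(0 :: ('a, 'b) lin) = 1"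
    then have "act 0 (\<lambda>_ :: 'a. 1 :: 'b) = act 1 (\<lambda>_. 1)" by simp
    then show False by (simp add: zero_lin.rep_eq one_lin.rep_eq fun_eq_iff)
  qed
qed

end

lift_definition scl :: "'k::field \<Rightarrow> ('i, 'k) lin" is "\<lambda>a v i. a * v i"
  by (simp add: algebra_simps)

lemma lin_eqI: "(\<And>v. act f v = act g v) \<Longrightarrow> f = g"
  by (metis act_inject ext)

lemmas act_simps [simp] = zero_lin.rep_eq one_lin.rep_eq plus_lin.rep_eq minus_lin.rep_eq
  uminus_lin.rep_eq times_lin.rep_eq scl.rep_eq

lemma scalars_scl: "scalars scl"
proof
  fix a b :: "'k::field" and x :: "('i, 'k) lin"
  show "scl (a + b) = (scl a + scl b :: ('i, 'k) lin)" by (rule lin_eqI) (simp add: algebra_simps)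
  show "scl (a * b) = (scl a * scl b :: ('i, 'k) lin)" by (rule lin_eqI) (simp add: algebra_simps)
  show "scl 1 = (1 :: ('i, 'k) lin)" by (rule lin_eqI) simp
  show "scl a * x = x * scl a" by (rule lin_eqI) (simp add: act_scale)
qed

text \<open>The Jucys-Murphy elements are determined by the first one, and the relations involving the
  others follow from those involving the first two.\<close>

fun jucys_murphy :: "(nat \<Rightarrow> 'r::ring_1) \<Rightarrow> 'r \<Rightarrow> nat \<Rightarrow> 'r" where
  "jucys_murphy s x 0 = x"
| "jucys_murphy s x (Suc 0) = x"
| "jucys_murphy s x (Suc (Suc k)) = s (Suc k) * jucys_murphy s x (Suc k) * s (Suc k) + s (Suc k)"

lemma hecke_rel_jucys_murphy:
  fixes \<kappa> :: "'k::field \<Rightarrow> 'r::ring_1"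
  assumes "scalars \<kappa>" and cyc: "(\<Prod>j\<leftarrow>[1..<Suc l]. x - \<kappa> (u j)) = 0"
    and sq: "\<And>i. 1 \<le> i \<Longrightarrow> i < n \<Longrightarrow> s i * s i = 1"
    and comm: "\<And>i j. 1 \<le> i \<Longrightarrow> i < n \<Longrightarrow> 1 \<le> j \<Longrightarrow> j < n \<Longrightarrow> \<bar>int i - int j\<bar> > 1 \<Longrightarrow> s i * s j = s j * s i"
    and braid: "\<And>i. 1 \<le> i \<Longrightarrow> i + 1 < n \<Longrightarrow> s i * s (i + 1) * s i = s (i + 1) * s i * s (i + 1)"
    and sx: "\<And>i. 2 \<le> i \<Longrightarrow> i < n \<Longrightarrow> s i * x = x * s i"
    and xx: "2 \<le> n \<Longrightarrow> x * (s 1 * x * s 1 + s 1) = (s 1 * x * s 1 + s 1) * x"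
  shows "hecke_rel l n u \<kappa> s (jucys_murphy s x)"
proof -
  let ?L = "jucys_murphy s x"
  have rec: "?L (i + 1) = s i * ?L i * s i + s i" if "1 \<le> i" for i using that by (cases i) auto
  have L1: "?L 1 = x" by simp
  have c2: "z * (a * y * a + a) = (a * y * a + a) * z" if "z * a = a * z" "z * y = y * z" for z a y :: 'r
  proof -
    have "z * (a * y * a) = a * y * a * z" using that by (metis mult.assoc)
    then show ?thesis using that by (simp add: distrib_left distrib_right)
  qed
  have sL: "s i * ?L k = ?L k * s i" if "1 \<le> i" "i < n" "1 \<le> k" "k \<le> n" "k \<noteq> i" "k \<noteq> i + 1" for i k
    using that
  proof (induction k arbitrary: i rule: less_induct)
    case (less k)
    show ?case
    proof (cases "k = 1")
      case True
      then show ?thesis using sx[of i] less.prems by simp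
    next
      case False
      define j where "j = k - 1"
      have j: "k = j + 1" "1 \<le> j" "j < n" using False less.prems by (auto simp: j_def)
      show ?thesis
      proof (cases "j = i + 1")
        case ne: False
        have "s i * s j = s j * s i" using comm[of i j] j less.prems ne by auto
        moreover have "s i * ?L j = ?L j * s i" using less.IH[of j i] j less.prems ne by auto
        ultimately show ?thesis unfolding j(1) rec[OF j(2)] by (rule c2)
      next
        case True
        have i: "1 \<le> i" "i < n" and i2: "i + 1 < n" using True j less.prems by simp_all
        \<comment> \<open>Here \<open>k = i + 2\<close>, and \<open>L k\<close> has three terms
          built from \<open>L i\<close>, \<open>s i\<close> and \<open>s (i + 1)\<close>. By the
          braid relation the first commutes with \<open>s i\<close>, while moving \<open>s i\<close>
          across exchanges the contributions of the other two.\<close>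
        define a where "a = s i"
        define b where "b = s (i + 1)"
        define y where "y = ?L i"
        have aa: "a * a = 1" using sq i i2 by (auto simp: a_def b_def)
        have aba: "a * b * a = b * a * b" using braid[OF i(1) i2] by (simp add: a_def b_def)
        have yb: "b * y = y * b" using less.IH[of i "i + 1"] i i2 True j less.prems by (auto simp: b_def y_def)
        have "a * (b * (a * y * a) * b) = (a * b * a) * y * a * b" by (simp add: mult.assoc)
        also have "\<dots> = b * a * (b * y) * a * b" unfolding aba by (simp add: mult.assoc)
        also have "\<dots> = b * a * y * (b * a * b)" unfolding yb by (simp add: mult.assoc)
        also have "\<dots> = (b * (a * y * a) * b) * a" unfolding aba[symmetric] by (simp add: mult.assoc)
        finally have 1: "a * (b * (a * y * a) * b) = (b * (a * y * a) * b) * a" .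
        have 2: "a * (b * a * b) = b * a" unfolding aba[symmetric] mult.assoc[symmetric] aa by simp
        have 3: "b * a * b * a = a * b" unfolding aba[symmetric] unfolding mult.assoc aa by simp
        have "?L k = b * (a * y * a) * b + b * a * b + b"
          using rec[OF j(2)] rec[OF i(1)] unfolding j(1) True a_def b_def y_def
          by (simp only: distrib_left distrib_right)
        then show ?thesis unfolding a_def[symmetric]
          by (simp only: distrib_left distrib_right 1 2 3) (simp only: add.assoc add.left_commute add.commute)
      qed
    qed
  qed
  have LL: "?L i * ?L k = ?L k * ?L i" if "1 \<le> i" "i < k" "k \<le> n" for i k
    using that
  proof (induction i arbitrary: k rule: nat_induct_at_least)
    case base
    then show ?case
    proof (induction k rule: less_induct)
      case (less k)
      show ?case
      proof (cases "k = 2")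
        case True
        then show ?thesis using xx less.prems by (simp add: numeral_2_eq_2)
      next
        case False
        define j where "j = k - 1"
        have j: "k = j + 1" "1 \<le> j" "1 < j" "2 \<le> j" "j < n" using False less.prems by (auto simp: j_def)
        have "?L 1 * s j = s j * ?L 1" using sx[of j] j by simp
        moreover have "?L 1 * ?L j = ?L j * ?L 1" using less.IH[of j] j by simp
        ultimately show ?thesis unfolding j(1) rec[OF j(2)] by (rule c2)
      qed
    qed
  next
    case (Suc i)
    have "?L k * s i = s i * ?L k" using sL[of i k] Suc by simp
    moreover have "?L k * ?L i = ?L i * ?L k" using Suc.IH[of k] Suc.prems by simp
    ultimately have "?L k * ?L (i + 1) = ?L (i + 1) * ?L k" unfolding rec[OF Suc.hyps] by (rule c2)
    then show ?case by simp
  qed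
  have LL': "?L i * ?L k = ?L k * ?L i" if "1 \<le> i" "i \<le> n" "1 \<le> k" "k \<le> n" for i k
    using LL[of i k] LL[of k i] that by (cases i k rule: linorder_cases) simp_all
  interpret scalars \<kappa> by fact
  show ?thesis
  proof unfold_locales
    show "(\<Prod>j\<leftarrow>[1..<Suc l]. ?L 1 - \<kappa> (u j)) = 0" using cyc by (simp del: upt_Suc)
  qed (assumption | rule sc_add sc_mult sc_1 sc_central sq comm braid LL' sL rec)+
qed

section \<open>Computing with representatives of classes\<close>

abbreviation free_elts :: "nat \<Rightarrow> 'k::field ncpoly set" where
  "free_elts n \<equiv> carrier (free_algebra n)"

lemma free_elts_1 [simp]: "1 \<in> free_elts n"
  by (simp add: free_algebra_def zero_word_def)

lemma free_elts_0 [simp]: "0 \<in> free_elts n"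
  by (simp add: free_algebra_def)

lemma free_elts_add [intro]: "x \<in> free_elts n \<Longrightarrow> y \<in> free_elts n \<Longrightarrow> x + y \<in> free_elts n"
  using ring.ring_simprules(1)[OF ring_free_algebra, of x n y] by (simp add: free_algebra_def)

lemma free_elts_mult [intro]: "x \<in> free_elts n \<Longrightarrow> y \<in> free_elts n \<Longrightarrow> x * y \<in> free_elts n"
  using ring.ring_simprules(5)[OF ring_free_algebra, of x n y] by (simp add: free_algebra_def)

lemma free_elts_uminus [intro]: "x \<in> free_elts n \<Longrightarrow> - x \<in> free_elts n"
  by (simp add: free_algebra_def in_keys_iff)

lemma free_elts_diff [intro]: "x \<in> free_elts n \<Longrightarrow> y \<in> free_elts n \<Longrightarrow> x - y \<in> free_elts n"
  using free_elts_add[of x n "- y"] free_elts_uminus[of y n] by simp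

lemma free_elts_scal [simp]: "scal a \<in> free_elts n"
  by (simp add: free_algebra_def scal_def zero_word_def)

lemma free_elts_sg: "1 \<le> i \<Longrightarrow> i < n \<Longrightarrow> sg i \<in> free_elts n"
  by (simp add: free_algebra_def sg_def gens_def)

lemma free_elts_Lg: "1 \<le> k \<Longrightarrow> k \<le> n \<Longrightarrow> Lg k \<in> free_elts n"
  by (simp add: free_algebra_def Lg_def gens_def)

lemma free_elts_prod_list: "(\<And>x. x \<in> set xs \<Longrightarrow> x \<in> free_elts n) \<Longrightarrow> prod_list xs \<in> free_elts n"
  by (induction xs) auto

lemma free_elts_sum: "(\<And>x. x \<in> A \<Longrightarrow> f x \<in> free_elts n) \<Longrightarrow> sum f A \<in> free_elts n"
  by (induction A rule: infinite_finite_induct) auto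

lemma free_elts_power: "x \<in> free_elts n \<Longrightarrow> x ^ k \<in> free_elts n"
  by (induction k) auto

lemma free_algebra_ops [simp]:
  "x \<otimes>\<^bsub>free_algebra n\<^esub> y = x * y" "x \<oplus>\<^bsub>free_algebra n\<^esub> y = x + y"
  "\<zero>\<^bsub>free_algebra n\<^esub> = 0" "\<one>\<^bsub>free_algebra n\<^esub> = 1"
  by (simp_all add: free_algebra_def)

lemma ideal_hecke_ideal: "n \<ge> 1 \<Longrightarrow> ideal (hecke_ideal l n u) (free_algebra n)"
  unfolding hecke_ideal_def by (intro ring.genideal_ideal ring_free_algebra relators_carrier)

lemma relators_hecke_ideal: "n \<ge> 1 \<Longrightarrow> relators l n u \<subseteq> hecke_ideal l n u"
  unfolding hecke_ideal_def by (intro ring.genideal_self ring_free_algebra relators_carrier)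

lemma hecke_ideal_subset: "n \<ge> 1 \<Longrightarrow> x \<in> hecke_ideal l n u \<Longrightarrow> x \<in> free_elts n"
  using ideal.Icarr[OF ideal_hecke_ideal] by blast

lemma hecke_ideal_add: "n \<ge> 1 \<Longrightarrow> x \<in> hecke_ideal l n u \<Longrightarrow> y \<in> hecke_ideal l n u \<Longrightarrow> x + y \<in> hecke_ideal l n u"
  using additive_subgroup.a_closed[OF ideal.axioms(1)[OF ideal_hecke_ideal], of n x l u y] by simp

lemma hecke_ideal_0: "n \<ge> 1 \<Longrightarrow> 0 \<in> hecke_ideal l n u"
  using additive_subgroup.zero_closed[OF ideal.axioms(1)[OF ideal_hecke_ideal], of n l u] by simp

lemma hecke_ideal_mult_left: "n \<ge> 1 \<Longrightarrow> x \<in> hecke_ideal l n u \<Longrightarrow> y \<in> free_elts n \<Longrightarrow> y * x \<in> hecke_ideal l n u"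
  using ideal.I_l_closed[OF ideal_hecke_ideal, of n x l u y] by simp

lemma hecke_ideal_mult_right: "n \<ge> 1 \<Longrightarrow> x \<in> hecke_ideal l n u \<Longrightarrow> y \<in> free_elts n \<Longrightarrow> x * y \<in> hecke_ideal l n u"
  using ideal.I_r_closed[OF ideal_hecke_ideal, of n x l u y] by simp

lemma hecke_ideal_uminus: "n \<ge> 1 \<Longrightarrow> x \<in> hecke_ideal l n u \<Longrightarrow> - x \<in> hecke_ideal l n u"
  using hecke_ideal_mult_left[of n x l u "- 1"] free_elts_uminus[OF free_elts_1, of n] by auto

lemma proj_conv: "proj l n u x = (\<lambda>h. h + x) ` hecke_ideal l n u"
  by (auto simp: proj_def a_r_coset_def r_coset_def free_algebra_def)

lemma proj_eq_iff:
  assumes n: "n \<ge> 1"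
  shows "proj l n u x = proj l n u y \<longleftrightarrow> x - y \<in> hecke_ideal l n u"
proof
  assume eq: "proj l n u x = proj l n u y"
  have "x \<in> proj l n u x" unfolding proj_conv using hecke_ideal_0[OF n] by force
  then obtain h where "h \<in> hecke_ideal l n u" "x = h + y" unfolding eq unfolding proj_conv by blast
  then show "x - y \<in> hecke_ideal l n u" by simp
next
  assume d: "x - y \<in> hecke_ideal l n u"
  have *: "proj l n u x \<subseteq> proj l n u y" if d: "x - y \<in> hecke_ideal l n u" for x y
  proof
    fix z assume "z \<in> proj l n u x"
    then obtain h where h: "h \<in> hecke_ideal l n u" "z = h + x" unfolding proj_conv by blast
    have "h + (x - y) \<in> hecke_ideal l n u" using h d by (simp add: hecke_ideal_add[OF n])
    moreover have "z = (h + (x - y)) + y" using h by simp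
    ultimately show "z \<in> proj l n u y" unfolding proj_conv by blast
  qed
  have "y - x \<in> hecke_ideal l n u" using hecke_ideal_uminus[OF n d] by simp
  then show "proj l n u x = proj l n u y" using *[of x y] *[of y x] d by blast
qed

lemma carrier_hecke: "carrier (hecke l n u) = proj l n u ` free_elts n"
  unfolding hecke_def FactRing_def proj_def by (auto simp: A_RCOSETS_def RCOSETS_def a_r_coset_def)

lemma hecke_mult:
  "n \<ge> 1 \<Longrightarrow> x \<in> free_elts n \<Longrightarrow> y \<in> free_elts n \<Longrightarrow>
    proj l n u x \<otimes>\<^bsub>hecke l n u\<^esub> proj l n u y = proj l n u (x * y)"
  unfolding hecke_def FactRing_def proj_def
  using ideal.rcoset_mult_add[OF ideal_hecke_ideal, of n x y l u] by simp

lemma hecke_add: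
  "n \<ge> 1 \<Longrightarrow> x \<in> free_elts n \<Longrightarrow> y \<in> free_elts n \<Longrightarrow>
    proj l n u x \<oplus>\<^bsub>hecke l n u\<^esub> proj l n u y = proj l n u (x + y)"
  unfolding hecke_def FactRing_def proj_def
  using abelian_subgroup.a_rcos_sum[OF abelian_subgroupI3[OF ideal.axioms(1)[OF ideal_hecke_ideal] ring.is_abelian_group[OF ring_free_algebra]], of n x y l u]
  by simp

lemma hecke_zero: "n \<ge> 1 \<Longrightarrow> \<zero>\<^bsub>hecke l n u\<^esub> = proj l n u 0"
  unfolding proj_conv by (simp add: hecke_def FactRing_def)

lemma free_elts_induct [consumes 1, case_names add mult scal sg Lg]:
  assumes x: "x \<in> free_elts n"
    and add: "\<And>x y. P x \<Longrightarrow> P y \<Longrightarrow> P (x + y)" and mult: "\<And>x y. P x \<Longrightarrow> P y \<Longrightarrow> P (x * y)"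
    and scal: "\<And>a. P (scal a)" and sg: "\<And>i. 1 \<le> i \<Longrightarrow> i < n \<Longrightarrow> P (sg i)"
    and Lg: "\<And>k. 1 \<le> k \<Longrightarrow> k \<le> n \<Longrightarrow> P (Lg k)"
  shows "P x"
proof -
  have letter: "P (Poly_Mapping.single (Word [g]) 1)" if "g \<in> gens n" for g
    using that sg Lg by (auto simp: gens_def sg_def Lg_def)
  have word: "P (Poly_Mapping.single (Word gs) 1)" if "set gs \<subseteq> gens n" for gs
    using that
  proof (induction gs)
    case Nil
    then show ?case using scal[of 1] by (simp add: scal_def zero_word_def)
  next
    case (Cons g gs)
    have "Poly_Mapping.single (Word (g # gs)) 1 =
        Poly_Mapping.single (Word [g]) 1 * Poly_Mapping.single (Word gs) (1 :: 'a)"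
      by (simp add: mult_single plus_word_def)
    then show ?case using mult[OF letter Cons.IH] Cons.prems by simp
  qed
  have single: "P (Poly_Mapping.single w a)" if "set (letters w) \<subseteq> gens n" for w a
  proof -
    have "Poly_Mapping.single w a = scal a * Poly_Mapping.single (Word (letters w)) 1"
      by (simp add: scal_def mult_single)
    then show ?thesis using mult[OF scal word[OF that]] by simp
  qed
  have sum: "P (\<Sum>w\<in>A. Poly_Mapping.single w (f w))" if "\<And>w. w \<in> A \<Longrightarrow> set (letters w) \<subseteq> gens n" for A and f :: "word \<Rightarrow> 'a"
    using that
  proof (induction A rule: infinite_finite_induct)
    case (insert w A)
    then show ?case using add[OF single[of w "f w"]] by simp
  qed (use scal[of 0] in \<open>simp_all add: scal_def\<close>)
  show ?thesis
    by (subst poly_mapping_sum_single) (rule sum, use x in \<open>simp add: free_algebra_def\<close>)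
qed

text \<open>The kernel of \<open>\<theta>\<close> is a submodule with one-dimensional quotient,
  which semisimplicity has to split off. The classes that send \<open>v0\<close> into the kernel
  form a left ideal; the component of 1 in a complement, applied to \<open>v0\<close>, yields the
  vector.\<close>

lemma semisimple_eigenvector:
  fixes S :: "nat \<Rightarrow> ('i, 'k::field) lin" and \<theta> :: "('i \<Rightarrow> 'k) \<Rightarrow> 'k"
  assumes ss: "semisimple_ring (hecke l n u)" and n: "n \<ge> 1"
    and rel: "hecke_rel l n u scl S (jucys_murphy S x)"
    and th_add: "\<And>v w. \<theta> (\<lambda>i. v i + w i) = \<theta> v + \<theta> w"
    and th_scale: "\<And>a v. \<theta> (\<lambda>i. a * v i) = a * \<theta> v"
    and th_S: "\<And>i v. 1 \<le> i \<Longrightarrow> i < n \<Longrightarrow> \<theta> (act (S i) v) = \<theta> v"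
    and th_x: "\<And>v. \<theta> (act x v) = c * \<theta> v"
    and th_v0: "\<theta> v0 = 1"
  obtains w where "\<theta> w = 1" "\<And>i. 1 \<le> i \<Longrightarrow> i < n \<Longrightarrow> act (S i) w = w" "act x w = (\<lambda>i. c * w i)"
proof -
  interpret scalars scl S "jucys_murphy S x" by (rule scalars_scl)
  have th_diff: "\<theta> (\<lambda>i. v i - w i) = \<theta> v - \<theta> w" for v w
    using th_add[of v "\<lambda>i. (- 1) * w i"] th_scale[of "- 1" w] by simp
  have th_0: "\<theta> (\<lambda>i. 0) = 0" using th_scale[of 0 "\<lambda>i. 0"] by simp
  have ev_I: "ev y = ev z" if "proj l n u y = proj l n u z" for y z
    using that hecke_rel.nc_eval_ideal[OF rel n] unfolding proj_eq_iff[OF n] by (metis ev_diff eq_iff_diff_eq_0)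
  \<comment> \<open>Operators acting by a scalar on the quotient by the kernel of
    \<open>\<theta>\<close>. The generators do, hence so does the whole algebra.\<close>
  define good where "good f \<longleftrightarrow> (\<exists>a. \<forall>v. \<theta> (act f v) = a * \<theta> v)" for f
  have good_add: "good (f + g)" if fg: "good f" "good g" for f g
  proof -
    obtain a b where "\<And>v. \<theta> (act f v) = a * \<theta> v" "\<And>v. \<theta> (act g v) = b * \<theta> v"
      using fg unfolding good_def by blast
    then have "\<theta> (act (f + g) v) = (a + b) * \<theta> v" for v by (simp add: th_add distrib_right)
    then show ?thesis unfolding good_def by blast
  qed
  have good_mult: "good (f * g)" if fg: "good f" "good g" for f g
  proof -
    obtain a b where "\<And>v. \<theta> (act f v) = a * \<theta> v" "\<And>v. \<theta> (act g v) = b * \<theta> v"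
      using fg unfolding good_def by blast
    then have "\<theta> (act (f * g) v) = (a * b) * \<theta> v" for v by simp
    then show ?thesis unfolding good_def by blast
  qed
  have good_S: "good (S i)" if "1 \<le> i" "i < n" for i
    unfolding good_def using th_S[OF that] by (intro exI[of _ 1]) simp
  have good_x: "good x" unfolding good_def using th_x by blast
  have good_L: "good (jucys_murphy S x k)" if "1 \<le> k" "k \<le> n" for k
    using that
  proof (induction k rule: nat_induct_at_least)
    case base
    show ?case using good_x by simp
  next
    case (Suc k)
    have "good (S k * jucys_murphy S x k * S k + S k)"
      using Suc by (intro good_add good_mult good_S) auto
    then show ?case using \<open>1 \<le> k\<close> by (cases k) auto
  qed
  have good_ev: "good (ev y)" if "y \<in> free_elts n" for y
    using that
  proof (induction y rule: free_elts_induct)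
    case (scal a)
    show ?case unfolding good_def using th_scale by auto
  qed (simp_all add: ev_add ev_mult good_add good_mult good_S good_L)
  have th_ev: "\<theta> (act (ev y) v) = 0" if "y \<in> free_elts n" "\<theta> v = 0" for y v
    using good_ev[OF that(1)] that(2) unfolding good_def by auto
  define I where "I = {proj l n u y | y. y \<in> free_elts n \<and> \<theta> (act (ev y) v0) = 0}"
  have I_iff: "proj l n u y \<in> I \<longleftrightarrow> \<theta> (act (ev y) v0) = 0" if "y \<in> free_elts n" for y
    unfolding I_def using that by (auto dest: ev_I)
  interpret H: ring "hecke l n u" by (rule ring_hecke[OF n])
  have "left_ideal I (hecke l n u)"
    unfolding left_ideal_def
  proof (intro conjI ballI)
    have "subgroup I (add_monoid (hecke l n u))"
    proof
      show "I \<subseteq> carrier (add_monoid (hecke l n u))" by (auto simp: I_def carrier_hecke)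
      show "\<one>\<^bsub>add_monoid (hecke l n u)\<^esub> \<in> I"
        using I_iff[of 0] by (simp add: hecke_zero[OF n] th_0)
    next
      fix h h' assume "h \<in> I" "h' \<in> I"
      then obtain y z where "h = proj l n u y" "y \<in> free_elts n" "\<theta> (act (ev y) v0) = 0"
          "h' = proj l n u z" "z \<in> free_elts n" "\<theta> (act (ev z) v0) = 0"
        unfolding I_def by blast
      then show "h \<otimes>\<^bsub>add_monoid (hecke l n u)\<^esub> h' \<in> I"
        using free_elts_add[of y n z] by (simp add: hecke_add[OF n] I_iff ev_add th_add)
    next
      fix h assume "h \<in> I"
      then obtain y where y: "h = proj l n u y" "y \<in> free_elts n" "\<theta> (act (ev y) v0) = 0"
        unfolding I_def by blast
      have "proj l n u (- y) \<oplus>\<^bsub>hecke l n u\<^esub> h = \<zero>\<^bsub>hecke l n u\<^esub>"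
        using y free_elts_uminus[of y n] by (simp add: hecke_add[OF n] hecke_zero[OF n])
      then have "\<ominus>\<^bsub>hecke l n u\<^esub> h = proj l n u (- y)"
        using y free_elts_uminus[of y n] by (intro H.minus_equality) (auto simp: carrier_hecke)
      moreover have "proj l n u (- y) \<in> I"
        using y free_elts_uminus[of y n] th_diff[of "\<lambda>i. 0" "act (ev y) v0"]
        by (simp add: I_iff ev_uminus th_0)
      ultimately show "inv\<^bsub>add_monoid (hecke l n u)\<^esub> h \<in> I" by (simp add: a_inv_def)
    qed
    then show "additive_subgroup I (hecke l n u)" by (rule additive_subgroup.intro)
  next
    fix a h assume "a \<in> carrier (hecke l n u)" "h \<in> I"
    then obtain y z where "a = proj l n u y" "y \<in> free_elts n" "h = proj l n u z" "z \<in> free_elts n"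
        "\<theta> (act (ev z) v0) = 0"
      unfolding I_def carrier_hecke by blast
    then show "a \<otimes>\<^bsub>hecke l n u\<^esub> h \<in> I"
      using free_elts_mult[of y n z] by (simp add: hecke_mult[OF n] I_iff ev_mult th_ev)
  qed
  then obtain J where J: "left_ideal J (hecke l n u)" and IJ: "I \<inter> J = {\<zero>\<^bsub>hecke l n u\<^esub>}"
      and sum: "I <+>\<^bsub>hecke l n u\<^esub> J = carrier (hecke l n u)"
    using ss unfolding semisimple_ring_def by blast
  have "proj l n u 1 \<in> I <+>\<^bsub>hecke l n u\<^esub> J" unfolding sum carrier_hecke by simp
  then obtain h h' where h: "h \<in> I" "h' \<in> J" "proj l n u 1 = h \<oplus>\<^bsub>hecke l n u\<^esub> h'"
    unfolding set_add_def' by blast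
  have "h' \<in> carrier (hecke l n u)"
    using J h(2) unfolding left_ideal_def by (blast dest: additive_subgroup.a_Hcarr)
  then obtain b where b: "h' = proj l n u b" "b \<in> free_elts n" unfolding carrier_hecke by blast
  obtain a where a: "h = proj l n u a" "a \<in> free_elts n" "\<theta> (act (ev a) v0) = 0" using h(1) unfolding I_def by blast
  have "proj l n u 1 = proj l n u (a + b)" using h(3) a b by (simp add: hecke_add[OF n])
  from ev_I[OF this] have ab: "ev a + ev b = 1" by (simp add: ev_add)
  let ?w = "act (ev b) v0"
  have "act (ev a + ev b) v0 = v0" unfolding ab by simp
  then have "\<theta> (\<lambda>i. act (ev a) v0 i + ?w i) = 1" using th_v0 by simp
  then have w1: "\<theta> ?w = 1" using a(3) by (simp add: th_add)
  \<comment> \<open>If \<open>y\<close> moves \<open>?w\<close> into the kernel, the class of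
    \<open>y * b\<close> lies in both \<open>I\<close> and \<open>J\<close> and is therefore zero.
    This is applied to \<open>sg i - 1\<close> and \<open>Lg 1 - scal c\<close>.\<close>
  have kill: "act (ev y) ?w = (\<lambda>i. 0)" if y: "y \<in> free_elts n" "\<theta> (act (ev y) ?w) = 0" for y
  proof -
    have yb: "y * b \<in> free_elts n" using y b by auto
    have "proj l n u (y * b) \<in> J"
      using J h(2) y(1) b unfolding left_ideal_def by (auto simp: hecke_mult[OF n, symmetric] carrier_hecke)
    moreover have "proj l n u (y * b) \<in> I" using y(2) yb by (simp add: I_iff ev_mult)
    ultimately have "proj l n u (y * b) = proj l n u 0" using IJ by (auto simp: hecke_zero[OF n])
    from ev_I[OF this] have "ev y * ev b = 0" by (simp add: ev_mult)
    then have "act (ev y * ev b) v0 = act 0 v0" by simp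
    then show ?thesis by simp
  qed
  show ?thesis
  proof (rule that[of ?w])
    show "\<theta> ?w = 1" by (rule w1)
    show "act (S i) ?w = ?w" if i: "1 \<le> i" "i < n" for i
    proof -
      have "sg i - 1 \<in> free_elts n" using free_elts_sg[OF i] by auto
      from kill[OF this] have "(\<lambda>k. act (S i) ?w k - ?w k) = (\<lambda>k. 0)"
        by (simp add: ev_diff th_diff th_S[OF i])
      then show ?thesis by (simp add: fun_eq_iff)
    qed
    have "Lg 1 - scal c \<in> free_elts n" using free_elts_Lg[of 1 n] n by auto
    from kill[OF this] have "(\<lambda>k. act x ?w k - c * ?w k) = (\<lambda>k. 0)"
      by (simp add: ev_diff th_diff th_x th_scale)
    then show "act x ?w = (\<lambda>i. c * ?w i)" by (simp add: fun_eq_iff)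
  qed
qed

section \<open>Semisimplicity separates the parameters\<close>

lift_definition pull :: "('i \<Rightarrow> 'i) \<Rightarrow> ('i, 'k::field) lin" is "\<lambda>f v i. v (f i)"
  by simp

declare pull.rep_eq [simp]

lemma pull_mult: "pull f * pull g = pull (g \<circ> f)"
  by (rule lin_eqI) (simp add: fun_eq_iff)

lemma pull_id: "pull id = 1" "pull (\<lambda>i. i) = 1"
  by (rule lin_eqI, simp)+

lemma (in scalars) prod_list_linear_zero:
  assumes js: "a \<in> set js" "b \<in> set js" "a \<noteq> b" and zero: "(x - \<kappa> (u a)) * (x - \<kappa> (u b)) = 0"
  shows "(\<Prod>j\<leftarrow>js. x - \<kappa> (u j)) = 0"
proof -
  have comm: "(x - \<kappa> c) * (x - \<kappa> d) = (x - \<kappa> d) * (x - \<kappa> c)" for c d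
    using sc_central[of c x] sc_central[of d x] sc_central[of c "\<kappa> d"] by (simp add: algebra_simps)
  have split: "(\<Prod>j\<leftarrow>js. x - \<kappa> (u j)) = (x - \<kappa> (u a)) * (\<Prod>j\<leftarrow>remove1 a js. x - \<kappa> (u j))"
    if "a \<in> set js" for a js
    using that
  proof (induction js)
    case (Cons c js)
    show ?case
    proof (cases "a = c")
      case False
      let ?P = "\<Prod>j\<leftarrow>remove1 a js. x - \<kappa> (u j)"
      have "(\<Prod>j\<leftarrow>c # js. x - \<kappa> (u j)) = (x - \<kappa> (u c)) * ((x - \<kappa> (u a)) * ?P)"
        using Cons False by simp
      also have "\<dots> = (x - \<kappa> (u a)) * ((x - \<kappa> (u c)) * ?P)" using comm by (metis mult.assoc)
      finally show ?thesis using False by simp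
    qed simp
  qed simp
  have "(\<Prod>j\<leftarrow>js. x - \<kappa> (u j)) =
      ((x - \<kappa> (u a)) * (x - \<kappa> (u b))) * (\<Prod>j\<leftarrow>remove1 b (remove1 a js). x - \<kappa> (u j))"
    using split[of a js] split[of b "remove1 a js"] js by (simp add: mult.assoc)
  then show ?thesis by (simp add: zero)
qed

lemma transpose_relations:
  "sw i \<circ> sw i = id"
  "\<bar>int i - int j\<bar> > 1 \<Longrightarrow> sw i \<circ> sw j = sw j \<circ> sw i"
  "sw i \<circ> sw (i + 1) \<circ> sw i = sw (i + 1) \<circ> sw i \<circ> sw (i + 1)"
  by (auto simp: fun_eq_iff transpose_def)

lemma sum_reindex_involution:
  assumes "\<And>x. x \<in> A \<Longrightarrow> f x \<in> A" "\<And>x. x \<in> A \<Longrightarrow> f (f x) = x"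
  shows "(\<Sum>x\<in>A. g (f x)) = (\<Sum>x\<in>A. g x)"
  by (rule sum.reindex_bij_witness[where i = f and j = f]) (use assms in auto)

text \<open>Semisimplicity splits off the trivial quotient of the regular representation of the symmetric
  group, which needs an invariant vector with nonzero coefficient sum.\<close>

lemma semisimple_of_nat:
  fixes u :: "nat \<Rightarrow> 'k::field"
  assumes ss: "semisimple_ring (hecke l n u)" and l: "l \<ge> 1" and n: "n \<ge> 1" and m: "1 \<le> m" "m \<le> n"
  shows "(of_nat m :: 'k) \<noteq> 0"
proof -
  define S :: "nat \<Rightarrow> (nat \<Rightarrow> nat, 'k) lin" where "S i = pull (\<lambda>w. w \<circ> sw i)" for i
  \<comment> \<open>The first Jucys-Murphy element acts by the scalar \<open>u 1\<close>, which
    already satisfies the cyclotomic relation.\<close>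
  define x :: "(nat \<Rightarrow> nat, 'k) lin" where "x = scl (u 1)"
  define \<theta> :: "((nat \<Rightarrow> nat) \<Rightarrow> 'k) \<Rightarrow> 'k" where "\<theta> v = (\<Sum>w | w permutes {1..n}. v w)" for v
  have x: "y * x = x * y" for y unfolding x_def using scalars.sc_central[OF scalars_scl] by metis
  have rel: "hecke_rel l n u scl S (jucys_murphy S x)"
  proof (rule hecke_rel_jucys_murphy[OF scalars_scl])
    have "[1..<Suc l] = 1 # [2..<Suc l]" using l by (subst upt_conv_Cons) (auto simp: numeral_2_eq_2)
    then show "(\<Prod>j\<leftarrow>[1..<Suc l]. x - scl (u j)) = 0" unfolding x_def by simp
    show "S i * S i = 1" for i
      unfolding S_def pull_mult by (simp add: comp_def pull_id transpose_eq_iff)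
    show "S i * S j = S j * S i" if "\<bar>int i - int j\<bar> > 1" for i j
      unfolding S_def pull_mult using transpose_relations(2)[OF that] by (simp add: comp_def fun_eq_iff)
    show "S i * S (i + 1) * S i = S (i + 1) * S i * S (i + 1)" for i
      unfolding S_def pull_mult using transpose_relations(3)[of i] by (simp add: comp_def fun_eq_iff)
  qed (rule x, rule x[symmetric])
  obtain w where w: "\<theta> w = 1" "\<And>i. 1 \<le> i \<Longrightarrow> i < n \<Longrightarrow> act (S i) w = w"
  proof (rule semisimple_eigenvector[OF ss n rel, where \<theta> = \<theta> and c = "u 1" and ?v0.0 = "\<lambda>w. if w = id then 1 else 0"])
    show "\<theta> (\<lambda>i. v i + w i) = \<theta> v + \<theta> w" for v w by (simp add: \<theta>_def sum.distrib)
    show "\<theta> (\<lambda>i. a * v i) = a * \<theta> v" for a v by (simp add: \<theta>_def sum_distrib_left)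
    then show "\<theta> (act x v) = u 1 * \<theta> v" for v by (simp add: x_def)
    show "\<theta> (act (S i) v) = \<theta> v" if "1 \<le> i" "i < n" for i v
      unfolding \<theta>_def S_def pull.rep_eq
    proof (rule sum_reindex_involution)
      fix p assume "p \<in> {w. w permutes {1..n}}"
      then show "p \<circ> sw i \<in> {w. w permutes {1..n}}"
        using that permutes_compose[OF permutes_swap_id[of i "{1..n}" "i + 1"], of p] by auto
    qed simp
    show "\<theta> (\<lambda>w. if w = id then 1 else 0) = 1"
      by (simp add: \<theta>_def finite_permutations permutes_id)
  qed (use that in blast)
  have inv: "w (p \<circ> sw i) = w p" if "1 \<le> i" "i < n" for p i
    using w(2)[OF that] by (simp add: S_def fun_eq_iff)
  have const: "w (word_perm is) = w id" if "set is \<subseteq> {1..<n}" for "is"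
    using that
  proof (induction "is")
    case Nil
    then show ?case by (simp add: word_perm_def id_def)
  next
    case (Cons i "is")
    have "word_perm (i # is) = word_perm is \<circ> sw i"
      by (rule word_perm_Cons)
    then have "w (word_perm (i # is)) = w (word_perm is)" using inv[of i "word_perm is"] Cons.prems by (simp only:) simp
    then show ?case using Cons by simp
  qed
  \<comment> \<open>An invariant vector is constant on the permutations, so its coefficient sum is a
    multiple of \<open>n!\<close>; this sum is 1.\<close>
  have all: "w p = w id" if "p permutes {1..n}" for p
    using permutes_words[OF that] const by blast
  have "\<theta> w = (\<Sum>p | p permutes {1..n}. w id)" unfolding \<theta>_def by (intro sum.cong refl all) blast
  also have "\<dots> = of_nat (fact n) * w id" using card_permutations[of "{1..n}" n] by simp
  finally have "(of_nat (fact n) :: 'k) \<noteq> 0" using w(1) by auto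
  moreover have "m dvd fact n" using m by (intro dvd_fact) auto
  ultimately show ?thesis by (auto simp: dvd_def)
qed

text \<open>If \<open>u a = u b\<close>, the first Jucys-Murphy element may act on a plane by a
  Jordan block, with trivial reflections. Reading the coordinate \<open>False\<close> is an
  eigenfunctional, while every eigenvector vanishes there.\<close>

lemma semisimple_parameters_distinct:
  fixes u :: "nat \<Rightarrow> 'k::field"
  assumes ss: "semisimple_ring (hecke l n u)" and n: "n \<ge> 1" and ab: "a \<in> {1..l}" "b \<in> {1..l}" "a \<noteq> b"
  shows "u a \<noteq> u b"
proof
  assume eq: "u a = u b"
  define N :: "(bool, 'k) lin" where "N = Lin (\<lambda>v i. if i then v False else 0)"
  have N: "act N v = (\<lambda>i. if i then v False else 0)" for v
    unfolding N_def by (subst Lin_inverse) auto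
  define x where "x = scl (u a) + N"
  have rel: "hecke_rel l n u scl (\<lambda>_. 1) (jucys_murphy (\<lambda>_. 1) x)"
  proof (rule hecke_rel_jucys_murphy[OF scalars_scl])
    have "(x - scl (u a)) * (x - scl (u b)) = 0"
      by (rule lin_eqI) (simp add: x_def eq N fun_eq_iff)
    then show "(\<Prod>j\<leftarrow>[1..<Suc l]. x - scl (u j)) = 0"
      using ab by (intro scalars.prod_list_linear_zero[OF scalars_scl]) auto
  qed (simp_all add: algebra_simps)
  obtain w where w: "w False = 1" "act x w = (\<lambda>i. u a * w i)"
  proof (rule semisimple_eigenvector[OF ss n rel, where \<theta> = "\<lambda>v. v False" and c = "u a" and ?v0.0 = "\<lambda>_. 1"])
    show "act x v False = u a * v False" for v by (simp add: x_def N)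
  qed (use that in simp_all)
  show False using fun_cong[OF w(2), of True] w(1) by (simp add: x_def N)
qed

text \<open>The \<open>d\<close>-subsets of \<open>{1..n}\<close> span a module on which the coefficient sum is an eigenfunctional
  for \<open>u a\<close>, precisely because of the shift by \<open>d\<close>. The value \<open>u b\<close> on subsets without 1 leaves no
  invariant eigenvector to split it off.\<close>

lemma semisimple_parameters_not_shifted:
  fixes u :: "nat \<Rightarrow> 'k::field"
  assumes ss: "semisimple_ring (hecke l n u)" and n: "n \<ge> 1" and ab: "a \<in> {1..l}" "b \<in> {1..l}" "a \<noteq> b"
    and d: "1 \<le> d" "d < n"
  shows "u b \<noteq> u a + of_nat d"
proof
  assume eq: "u b = u a + of_nat d"
  have "(of_nat d :: 'k) \<noteq> 0" using d ab by (intro semisimple_of_nat[OF ss _ n]) auto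
  then have ne: "u a \<noteq> u b" using eq by simp
  define S :: "nat \<Rightarrow> (nat set, 'k) lin" where "S i = pull (image (sw i))" for i
  have S: "act (S i) v = (\<lambda>B. v (sw i ` B))" for i v by (simp add: S_def)
  \<comment> \<open>The sum, which replaces 1 by the elements outside \<open>B\<close>, is what
    makes \<open>x\<close> commute with \<open>S 1 * x * S 1 + S 1\<close>. It is strictly
    triangular, so \<open>x\<close> still satisfies the quadratic equation with roots
    \<open>u a\<close> and \<open>u b\<close>.\<close>
  define x :: "(nat set, 'k) lin" where "x = Lin (\<lambda>v B. if 1 \<in> B
      then u a * v B - (\<Sum>c\<in>{1..n} - B. v (insert c (B - {1}))) else u b * v B)"
  have x: "act x v = (\<lambda>B. if 1 \<in> B
      then u a * v B - (\<Sum>c\<in>{1..n} - B. v (insert c (B - {1}))) else u b * v B)" for v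
    unfolding x_def
    by (subst Lin_inverse) (auto simp: fun_eq_iff sum.distrib sum_distrib_left algebra_simps)
  have x1: "act x v B = u b * v B" if "1 \<notin> B" for v B using that by (simp add: x)
  have x2: "act x v (insert 1 C) = u a * v (insert 1 C) - (\<Sum>c\<in>{1..n} - insert 1 C. v (insert c C))"
    if "1 \<notin> C" for v C using that by (simp add: x)
  have rel: "hecke_rel l n u scl S (jucys_murphy S x)"
  proof (rule hecke_rel_jucys_murphy[OF scalars_scl])
    have "act ((x - scl (u a)) * (x - scl (u b))) v B = 0" for v B
    proof (cases "1 \<in> B")
      case True
      then have "act ((x - scl (u a)) * (x - scl (u b))) v B =
          - (\<Sum>c\<in>{1..n} - B. act (x - scl (u b)) v (insert c (B - {1})))"
        by (simp add: x del: One_nat_def)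
      also have "\<dots> = 0" using True by (auto simp: x intro!: sum.neutral)
      finally show ?thesis .
    qed (simp add: x1)
    then have "(x - scl (u a)) * (x - scl (u b)) = 0"
      by (intro lin_eqI) (simp add: fun_eq_iff)
    then show "(\<Prod>j\<leftarrow>[1..<Suc l]. x - scl (u j)) = 0"
      using ab by (intro scalars.prod_list_linear_zero[OF scalars_scl]) auto
    have img: "image f \<circ> image g = image (f \<circ> g)" for f g :: "nat \<Rightarrow> nat"
      by (simp add: fun_eq_iff image_comp)
    show "S i * S i = 1" for i
      unfolding S_def pull_mult img transpose_relations(1) image_id by (rule pull_id)
    show "S i * S j = S j * S i" if "\<bar>int i - int j\<bar> > 1" for i j
      unfolding S_def pull_mult img by (simp only: transpose_relations(2)[OF that])
    show "S i * S (i + 1) * S i = S (i + 1) * S i * S (i + 1)" for i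
      unfolding S_def pull_mult img by (simp only: comp_assoc[symmetric] transpose_relations(3))
    show "S i * x = x * S i" if i: "2 \<le> i" "i < n" for i
    proof (rule lin_eqI, rule ext)
      fix v :: "nat set \<Rightarrow> 'k" and B
      have inj: "inj (sw i)" by simp
      have 1: "1 \<in> sw i ` B \<longleftrightarrow> 1 \<in> B"
        using i inj_image_mem_iff[OF inj, of 1 B] by (simp add: transpose_def)
      have N: "{1..n} - sw i ` B = sw i ` ({1..n} - B)"
      proof -
        have "sw i ` {1..n} = {1..n}" using i by (intro permutes_image permutes_swap_id) auto
        then show ?thesis using image_set_diff[OF inj, of "{1..n}" B] by simp
      qed
      have sub: "insert (sw i c) (sw i ` B - {1}) = sw i ` insert c (B - {1})" for c
      proof -
        have "sw i 1 = 1" using i by (simp add: transpose_def)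
        then show ?thesis using image_set_diff[OF inj, of B "{1}"] by simp
      qed
      have "(\<Sum>c\<in>{1..n} - sw i ` B. v (insert c (sw i ` B - {1}))) =
          (\<Sum>c\<in>{1..n} - B. v (sw i ` insert c (B - {1})))"
        unfolding N by (subst sum.reindex) (auto simp only: comp_def sub intro!: inj_on_subset[OF inj] sum.cong)
      then show "act (S i * x) v B = act (x * S i) v B" by (simp only: times_lin.rep_eq x S 1)
    qed
    define y where "y = S 1 * x * S 1 + S 1"
    assume n2: "2 \<le> n"
    let ?R = "\<lambda>C. {3..n} - C"
    have t: "sw 1 1 = 2" "sw 1 2 = 1" by (simp_all add: numeral_2_eq_2)
    have sw1: "sw 1 ` C = C" "sw 1 ` insert 1 C = insert 2 C" "sw 1 ` insert 2 C = insert 1 C"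
      if C: "1 \<notin> C" "2 \<notin> C" for C
    proof -
      show *: "sw 1 ` C = C"
      proof -
        have "sw 1 ` C = (\<lambda>z. z) ` C" by (rule image_cong) (use C in \<open>auto simp: transpose_def numeral_2_eq_2\<close>)
        then show ?thesis by simp
      qed
      show "sw 1 ` insert 1 C = insert 2 C" "sw 1 ` insert 2 C = insert 1 C"
        unfolding image_insert * t by (rule refl)+
    qed
    have R1: "{1..n} - insert 1 C = insert 2 (?R C)" if "1 \<notin> C" "2 \<notin> C" for C using that n2 by auto
    have R2: "{1..n} - insert 1 (insert 2 C) = ?R C" for C using n2 by auto
    have R3: "?R (insert c C) = ?R C - {c}" for c C by auto
    have fin: "finite (?R C)" "2 \<notin> ?R C" for C by auto
    have y_act: "act y v B = act x (act (S 1) v) (sw 1 ` B) + v (sw 1 ` B)" for v B by (simp add: y_def S)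
    have x0: "act x v C = u b * v C" if "1 \<notin> C" "2 \<notin> C" for v C using that by (simp add: x1)
    have xa: "act x v (insert 1 C) = u a * v (insert 1 C) - v (insert 2 C) - (\<Sum>c\<in>?R C. v (insert c C))"
      if C: "1 \<notin> C" "2 \<notin> C" for v C
      unfolding x2[OF C(1)] R1[OF C] using fin by simp
    have xb: "act x v (insert 2 C) = u b * v (insert 2 C)" if "1 \<notin> C" for v C using that by (simp add: x1)
    have xab: "act x v (insert 1 (insert 2 C)) =
        u a * v (insert 1 (insert 2 C)) - (\<Sum>c\<in>?R C. v (insert c (insert 2 C)))"
      if C: "1 \<notin> C" for v C
      using x2[of "insert 2 C" v] C by (simp only: R2) simp
    have y0: "act y v C = (u b + 1) * v C" if C: "1 \<notin> C" "2 \<notin> C" for v C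
      unfolding y_act sw1[OF C] x0[OF C] S by (simp only: sw1[OF C] distrib_right mult_1_left)
    have ya: "act y v (insert 1 C) = u b * v (insert 1 C) + v (insert 2 C)" if C: "1 \<notin> C" "2 \<notin> C" for v C
      unfolding y_act sw1[OF C] xb[OF C(1)] S by (simp only: sw1[OF C])
    have ins: "1 \<notin> insert c C" "2 \<notin> insert c C" if "1 \<notin> C" "2 \<notin> C" "c \<in> ?R C" for c C using that by auto
    have yb: "act y v (insert 2 C) = u a * v (insert 2 C) - (\<Sum>c\<in>?R C. v (insert c C)) - v (insert 1 C) + v (insert 1 C)"
      if C: "1 \<notin> C" "2 \<notin> C" for v C
    proof -
      have "(\<Sum>c\<in>?R C. act (S 1) v (insert c C)) = (\<Sum>c\<in>?R C. v (insert c C))"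
        by (intro sum.cong refl) (simp only: S sw1[OF ins[OF C]])
      moreover have "act (S 1) v (insert 1 C) = v (insert 2 C)" "act (S 1) v (insert 2 C) = v (insert 1 C)"
        unfolding S sw1[OF C] by simp_all
      ultimately show ?thesis unfolding y_act sw1[OF C] xa[OF C] by simp
    qed
    have sw12: "sw 1 ` insert 1 (insert 2 C) = insert 1 (insert 2 C)" if C: "1 \<notin> C" "2 \<notin> C" for C
      unfolding image_insert sw1(1)[OF C] t by (rule insert_commute)
    have sw2c: "sw 1 ` insert c (insert 2 C) = insert 1 (insert c C)" if C: "1 \<notin> C" "2 \<notin> C" "c \<in> ?R C" for c C
    proof -
      have "insert c (insert 2 C) = insert 2 (insert c C)" by (rule insert_commute)
      then show ?thesis by (simp only: sw1(3)[OF ins[OF C]])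
    qed
    have yab: "act y v (insert 1 (insert 2 C)) =
        (u a + 1) * v (insert 1 (insert 2 C)) - (\<Sum>c\<in>?R C. v (insert 1 (insert c C)))"
      if C: "1 \<notin> C" "2 \<notin> C" for v C
    proof -
      have "(\<Sum>c\<in>?R C. act (S 1) v (insert c (insert 2 C))) = (\<Sum>c\<in>?R C. v (insert 1 (insert c C)))"
        by (intro sum.cong refl) (simp only: S sw2c[OF C])
      then show ?thesis unfolding y_act sw12[OF C] xab[OF C(1)] S sw12[OF C] by (simp add: distrib_right)
    qed
    have "act (x * y) v B = act (y * x) v B" for v B
    proof -
      \<comment> \<open>Commutation is checked on the four subsets that agree with \<open>B\<close>
        outside 1 and 2.\<close>
      define C where "C = B - {1, 2}"
      have C: "1 \<notin> C" "2 \<notin> C" by (auto simp: C_def)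
      note ins = ins[OF C]
      consider "B = C" | "B = insert 1 C" | "B = insert 2 C" | "B = insert 1 (insert 2 C)"
        unfolding C_def by (cases "1 \<in> B"; cases "2 \<in> B") blast+
      then show ?thesis
      proof cases
        case 1
        then show ?thesis by (simp add: x0[OF C] y0[OF C])
      next
        case 2
        have "(\<Sum>c\<in>?R C. act y v (insert c C)) = (u b + 1) * (\<Sum>c\<in>?R C. v (insert c C))"
          unfolding sum_distrib_left by (intro sum.cong refl) (rule y0[OF ins])
        then show ?thesis unfolding 2 times_lin.rep_eq xa[OF C] ya[OF C] yb[OF C] xb[OF C(1)]
          by (simp add: algebra_simps)
      next
        case 3
        have "(\<Sum>c\<in>?R C. act x v (insert c C)) = u b * (\<Sum>c\<in>?R C. v (insert c C))"
          unfolding sum_distrib_left by (intro sum.cong refl) (rule x0[OF ins])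
        then show ?thesis unfolding 3 times_lin.rep_eq xb[OF C(1)] yb[OF C]
          by (simp add: algebra_simps)
      next
        case 4
        \<comment> \<open>Replacing both 1 and 2 by new elements gives this double sum, with the
          same sign in both orders, so it cancels.\<close>
        let ?D = "\<Sum>c\<in>?R C. \<Sum>c'\<in>?R C - {c}. v (insert c' (insert c C))"
        have ysum: "(\<Sum>c\<in>?R C. act y v (insert c (insert 2 C))) =
            u a * (\<Sum>c\<in>?R C. v (insert c (insert 2 C))) - ?D"
        proof -
          have "act y v (insert c (insert 2 C)) =
              u a * v (insert c (insert 2 C)) - (\<Sum>c'\<in>?R C - {c}. v (insert c' (insert c C)))"
            if "c \<in> ?R C" for c
            using yb[OF ins[OF that], of v] by (simp only: R3 insert_commute[of c 2]) simp
          then show ?thesis by (simp add: sum_subtractf sum_distrib_left)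
        qed
        have xsum: "(\<Sum>c\<in>?R C. act x v (insert 1 (insert c C))) =
            u a * (\<Sum>c\<in>?R C. v (insert 1 (insert c C))) - (\<Sum>c\<in>?R C. v (insert c (insert 2 C))) - ?D"
        proof -
          have "act x v (insert 1 (insert c C)) =
              u a * v (insert 1 (insert c C)) - v (insert c (insert 2 C)) - (\<Sum>c'\<in>?R C - {c}. v (insert c' (insert c C)))"
            if "c \<in> ?R C" for c
            using xa[OF ins[OF that], of v] by (simp only: R3 insert_commute[of c 2])
          then show ?thesis by (simp add: sum_subtractf sum_distrib_left)
        qed
        show ?thesis unfolding 4 times_lin.rep_eq xab[OF C(1)] yab[OF C] xsum ysum
          by (simp add: algebra_simps)
      qed
    qed
    then have "x * y = y * x" by (intro lin_eqI ext)
    then show "x * (S 1 * x * S 1 + S 1) = (S 1 * x * S 1 + S 1) * x" unfolding y_def .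
  qed
  define D where "D = {B. B \<subseteq> {1..n} \<and> card B = d}"
  have finD: "finite D" unfolding D_def by (rule finite_subset[of _ "Pow {1..n}"]) auto
  define \<theta> :: "(nat set \<Rightarrow> 'k) \<Rightarrow> 'k" where "\<theta> v = (\<Sum>B\<in>D. v B)" for v
  obtain w where w: "\<theta> w = 1" "\<And>i. 1 \<le> i \<Longrightarrow> i < n \<Longrightarrow> act (S i) w = w" "act x w = (\<lambda>B. u a * w B)"
  proof (rule semisimple_eigenvector[OF ss n rel, where \<theta> = \<theta> and c = "u a" and ?v0.0 = "\<lambda>B. if B = {1..d} then 1 else 0"])
    show "\<theta> (\<lambda>i. v i + w i) = \<theta> v + \<theta> w" for v w by (simp add: \<theta>_def sum.distrib)
    show "\<theta> (\<lambda>i. a * v i) = a * \<theta> v" for a v by (simp add: \<theta>_def sum_distrib_left)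
    show "\<theta> (act (S i) v) = \<theta> v" if i: "1 \<le> i" "i < n" for i v
      unfolding \<theta>_def S
    proof (rule sum_reindex_involution)
      fix B assume "B \<in> D"
      moreover have "sw i ` {1..n} = {1..n}" using i by (intro permutes_image permutes_swap_id) auto
      ultimately show "sw i ` B \<in> D" unfolding D_def by (auto simp: card_image simp del: atLeastAtMost_iff)
    qed (simp add: image_comp transpose_relations)
    have "{1..d} \<in> D" using d by (auto simp: D_def)
    then show "\<theta> (\<lambda>B. if B = {1..d} then 1 else 0) = 1" using finD by (simp add: \<theta>_def)
    fix v :: "nat set \<Rightarrow> 'k"
    let ?E = "{B \<in> D. 1 \<in> B}" and ?E' = "{B \<in> D. 1 \<notin> B}"
    have DE: "D = ?E \<union> ?E'" by blast
    have split: "sum g D = sum g ?E + sum g ?E'" for g :: "nat set \<Rightarrow> 'k"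
      by (subst DE, rule sum.union_disjoint) (use finD in auto)
    have finB: "finite B" if "B \<in> D" for B using that by (auto simp: D_def intro: finite_subset)
    \<comment> \<open>Double counting: a subset without 1 arises from the replacement of 1 by any of
      its \<open>d\<close> elements. The resulting factor \<open>d\<close> turns \<open>u b\<close>
      into \<open>u a\<close> in the coefficient sum.\<close>
    have "(\<Sum>B\<in>?E. \<Sum>c\<in>{1..n} - B. v (insert c (B - {1}))) =
        (\<Sum>(B, c)\<in>(SIGMA B:?E. {1..n} - B). v (insert c (B - {1})))"
      using finD by (intro sum.Sigma) auto
    also have "\<dots> = (\<Sum>(B, c)\<in>(SIGMA B:?E'. B). v B)"
    proof (rule sum.reindex_bij_witness[where i = "\<lambda>(B, c). (insert 1 (B - {c}), c)"
          and j = "\<lambda>(B, c). (insert c (B - {1}), c)"])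
      fix p assume "p \<in> (SIGMA B:?E. {1..n} - B)"
      then obtain B c where p: "p = (B, c)" "B \<in> D" "1 \<in> B" "c \<in> {1..n}" "c \<notin> B" by blast
      then show "(\<lambda>(B, c). (insert 1 (B - {c}), c)) ((\<lambda>(B, c). (insert c (B - {1}), c)) p) = p" by auto
      have "card (insert c (B - {1})) = d" using p finB[of B] card_Suc_Diff1[of B 1] by (simp add: D_def)
      then show "(\<lambda>(B, c). (insert c (B - {1}), c)) p \<in> (SIGMA B:?E'. B)" using p by (auto simp: D_def)
    next
      fix p assume "p \<in> (SIGMA B:?E'. B)"
      then obtain B c where p: "p = (B, c)" "B \<in> D" "1 \<notin> B" "c \<in> B" by blast
      then show "(\<lambda>(B, c). (insert c (B - {1}), c)) ((\<lambda>(B, c). (insert 1 (B - {c}), c)) p) = p" by auto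
      have "card (insert 1 (B - {c})) = d" using p finB[of B] card_Suc_Diff1[of B c] by (simp add: D_def)
      then show "(\<lambda>(B, c). (insert 1 (B - {c}), c)) p \<in> (SIGMA B:?E. {1..n} - B)" using p n by (auto simp: D_def)
    qed auto
    also have "\<dots> = (\<Sum>B\<in>?E'. \<Sum>c\<in>B. v B)"
      using finD finB by (intro sum.Sigma[symmetric]) auto
    also have "\<dots> = (\<Sum>B\<in>?E'. of_nat d * v B)" by (intro sum.cong) (auto simp: D_def)
    finally have *: "(\<Sum>B\<in>?E. \<Sum>c\<in>{1..n} - B. v (insert c (B - {1}))) = of_nat d * sum v ?E'"
      by (simp add: sum_distrib_left)
    have "\<theta> (act x v) = (\<Sum>B\<in>?E. u a * v B - (\<Sum>c\<in>{1..n} - B. v (insert c (B - {1})))) + (\<Sum>B\<in>?E'. u b * v B)"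
      unfolding \<theta>_def split x by (intro arg_cong2[of _ _ _ _ "(+)"] sum.cong) auto
    also have "\<dots> = u a * sum v ?E - of_nat d * sum v ?E' + u b * sum v ?E'"
      by (simp only: sum_subtractf sum_distrib_left[symmetric] *)
    also have "\<dots> = u a * \<theta> v" unfolding \<theta>_def split eq by (simp add: algebra_simps)
    finally show "\<theta> (act x v) = u a * \<theta> v" .
  qed (use that in blast)
  \<comment> \<open>An eigenvector for \<open>u a\<close> vanishes on subsets without 1, and by
    invariance on every subset that misses some point. All \<open>d\<close>-subsets do, as
    \<open>d < n\<close>.\<close>
  have zero: "w B = 0" if "1 \<le> j" "j \<le> n" "j \<notin> B" for j B
    using that
  proof (induction j arbitrary: B rule: nat_induct_at_least)
    case base
    then have "u b * w B = u a * w B" using fun_cong[OF w(3), of B] x1[of B w] by simp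
    then show ?case using ne by simp
  next
    case (Suc j)
    have "w (sw j ` B) = 0"
    proof (rule Suc.IH)
      have "sw j (Suc j) \<in> sw j ` B \<longleftrightarrow> Suc j \<in> B" by (rule inj_image_mem_iff) simp
      then show "j \<notin> sw j ` B" using Suc.prems by simp
    qed (use Suc.prems in simp)
    then show ?case using fun_cong[OF w(2)[of j], of B] Suc by (simp add: S)
  qed
  have "w B = 0" if B: "B \<in> D" for B
  proof -
    have "B \<noteq> {1..n}" using B d by (auto simp: D_def)
    then obtain j where "j \<in> {1..n}" "j \<notin> B" using B unfolding D_def by blast
    then show ?thesis by (intro zero[of j B]) auto
  qed
  then have "\<theta> w = 0" by (simp add: \<theta>_def)
  then show False using w(1) by simp
qed

text \<open>A negative shift is a positive one with the two parameters exchanged.\<close>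

theorem semisimple_separated:
  fixes u :: "nat \<Rightarrow> 'k::field"
  assumes ss: "semisimple_ring (hecke l n u)" and l: "l \<ge> 1" and n: "n \<ge> 1"
  shows "separated l n u"
  unfolding separated_def
proof (intro conjI ballI allI impI)
  show "(of_nat m :: 'k) \<noteq> 0" if "1 \<le> m \<and> m \<le> n" for m
    using semisimple_of_nat[OF ss l n] that by blast
  fix a b and d :: int assume ab: "a \<in> {1..l}" "b \<in> {1..l}" "a \<noteq> b" and d: "\<bar>d\<bar> < int n"
  consider "d = 0" | m where "d = int m" "1 \<le> m" "m < n" | m where "d = - int m" "1 \<le> m" "m < n"
    using d by (cases d rule: int_cases2) force+
  then show "of_int d + u a - u b \<noteq> 0"
  proof cases
    case 1
    then show ?thesis using semisimple_parameters_distinct[OF ss n ab] by simp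
  next
    case 2
    then show ?thesis using semisimple_parameters_not_shifted[OF ss n ab 2(2,3)] by (simp add: algebra_simps)
  next
    case 3
    have "u a \<noteq> u b + of_nat m" using semisimple_parameters_not_shifted[OF ss n ab(2,1) ab(3)[symmetric] 3(2,3)] .
    then show ?thesis using 3 by (simp add: algebra_simps)
  qed
qed

section \<open>The Hecke algebra as a type\<close>

lemma scalars_scal: "scalars (scal :: 'k::field \<Rightarrow> 'k ncpoly)"
proof
  fix a b :: 'k and x :: "'k ncpoly"
  show "scal (a + b) = scal a + scal b" by (simp add: scal_def single_add)
  show "scal (a * b) = scal a * scal b" by (simp add: scal_def mult_single)
  show "scal 1 = (1 :: 'k ncpoly)" by (simp add: scal_def single_one)
  have "scal a * Poly_Mapping.single w b = Poly_Mapping.single w b * scal a" for w b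
    by (simp add: scal_def mult_single mult.commute)
  then have "scal a * (\<Sum>w\<in>Poly_Mapping.keys x. Poly_Mapping.single w (Poly_Mapping.lookup x w)) =
      (\<Sum>w\<in>Poly_Mapping.keys x. Poly_Mapping.single w (Poly_Mapping.lookup x w)) * scal a"
    unfolding sum_distrib_left sum_distrib_right by simp
  then show "scal a * x = x * scal a" using poly_mapping_sum_single[of x] by simp
qed

text \<open>The free algebra is a retract of the type of all noncommutative polynomials, so the Hecke ideal pulls
  back to a two-sided ideal of the whole type.\<close>

definition truncate :: "nat \<Rightarrow> 'k::field ncpoly \<Rightarrow> 'k ncpoly" where
  "truncate n = nc_eval scal (\<lambda>i. if 1 \<le> i \<and> i < n then sg i else 0) (\<lambda>k. if 1 \<le> k \<and> k \<le> n then Lg k else 0)"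

lemma truncate_hom [simp]:
  "truncate n (x + y) = truncate n x + truncate n y" "truncate n (x * y) = truncate n x * truncate n y"
  "truncate n (x - y) = truncate n x - truncate n y" "truncate n (- x) = - truncate n x"
  "truncate n 0 = 0" "truncate n 1 = 1" "truncate n (scal a) = scal a"
  unfolding truncate_def
  by (rule scalars.ev_add[OF scalars_scal] scalars.ev_mult[OF scalars_scal] scalars.ev_diff[OF scalars_scal]
    scalars.ev_uminus[OF scalars_scal] scalars.ev_0[OF scalars_scal] scalars.ev_1[OF scalars_scal]
    scalars.ev_scal[OF scalars_scal])+

lemma truncate_gens:
  "1 \<le> i \<Longrightarrow> i < n \<Longrightarrow> truncate n (sg i) = sg i" "1 \<le> k \<Longrightarrow> k \<le> n \<Longrightarrow> truncate n (Lg k) = Lg k"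
  unfolding truncate_def by (simp_all add: scalars.ev_sg[OF scalars_scal] scalars.ev_Lg[OF scalars_scal])

lemma truncate_free: "x \<in> free_elts n \<Longrightarrow> truncate n x = x"
  by (induction rule: free_elts_induct) (simp_all add: truncate_gens)

lemma truncate_in_free: "truncate n x \<in> free_elts n"
  unfolding truncate_def nc_eval_def
  by (intro free_elts_sum free_elts_mult free_elts_scal free_elts_prod_list)
    (auto simp: eval_letter_def free_elts_sg free_elts_Lg split: gen.splits)

text \<open>The one-dimensional representation with all reflections equal to 1 and
  \<open>u 1\<close> as first Jucys-Murphy element shows that the quotient is not zero, as the class
  \<open>ring_1\<close> demands.\<close>

lemma one_notin_hecke_ideal:
  fixes u :: "nat \<Rightarrow> 'k::field"
  assumes l: "l \<ge> 1" and n: "n \<ge> 1"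
  shows "1 \<notin> hecke_ideal l n u"
proof
  assume "1 \<in> hecke_ideal l n u"
  have sc: "scalars (\<lambda>a :: 'k. a)" by unfold_locales (simp_all add: algebra_simps)
  have "hecke_rel l n u (\<lambda>a. a) (\<lambda>_. 1) (jucys_murphy (\<lambda>_. 1) (u 1))"
  proof (rule hecke_rel_jucys_murphy[OF sc])
    have "[1..<Suc l] = 1 # [2..<Suc l]" using l by (subst upt_conv_Cons) (auto simp: numeral_2_eq_2)
    then show "(\<Prod>j\<leftarrow>[1..<Suc l]. u 1 - u j) = 0" by simp
  qed (simp_all add: algebra_simps)
  from hecke_rel.nc_eval_ideal[OF this n \<open>1 \<in> hecke_ideal l n u\<close>]
  have "nc_eval (\<lambda>a. a) (\<lambda>_. 1) (jucys_murphy (\<lambda>_. 1) (u 1)) (1 :: 'k ncpoly) = 0" .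
  then show False by (simp add: scalars.ev_1[OF sc])
qed

section \<open>The basis elements have representatives in the free algebra\<close>

lemma tableau_perm:
  assumes t: "std_tab l n D t" and t': "std_tab l n D t'"
  shows "\<exists>w. w permutes {1..n} \<and> w \<circ> t' = t"
proof (intro exI conjI)
  let ?w = "\<lambda>k. if k \<in> {1..n} then t (pos t' k) else k"
  have bij: "bij_betw t D {1..n}" "bij_betw t' D {1..n}" and z: "\<And>x. x \<notin> D \<Longrightarrow> t x = 0 \<and> t' x = 0"
    using t t' by (auto simp: std_tab_def)
  have "bij_betw (pos t') {1..n} D"
    by (rule bij_betw_byWitness[where f' = t']) (use std_tab_pos[OF t'] in auto)
  then have "bij_betw (t \<circ> pos t') {1..n} {1..n}" using bij(1) by (rule bij_betw_trans)
  then have "bij_betw ?w {1..n} {1..n}" by (rule bij_betw_cong[THEN iffD1, rotated]) simp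
  then show "?w permutes {1..n}" by (rule bij_imp_permutes) auto
  show "?w \<circ> t' = t"
  proof
    fix x show "(?w \<circ> t') x = t x"
      using std_tab_pos(3,4)[OF t', of x] z[of x] by (cases "x \<in> D") auto
  qed
qed

lemma d_perm_permutes:
  assumes m: "multipartition l n lam" and t: "std_tab l n (diagram lam) t"
  shows "d_perm n lam t permutes {1..n}" "d'_perm l n lam t permutes {1..n}"
proof -
  have ex: "\<exists>!w. w permutes {1..n} \<and> w \<circ> t' = t" if t': "std_tab l n (diagram lam) t'" for t'
    using tableau_perm[OF t t'] permutes_tableau_unique[OF t'] by blast
  show "d_perm n lam t permutes {1..n}"
    unfolding d_perm_def using theI'[OF ex[OF tab_upper_std(1)[OF m]]] by blast
  show "d'_perm l n lam t permutes {1..n}"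
    unfolding d'_perm_def using theI'[OF ex[OF tab_lower_std(1)[OF m]]] by blast
qed

lemma free_elts_perm_elt:
  assumes "w permutes {1..n}"
  shows "perm_elt n w \<in> free_elts n"
proof -
  have "\<exists>is. set is \<subseteq> {1..<n} \<and> word_perm is = w" by (rule permutes_words[OF assms])
  from someI_ex[OF this] show ?thesis
    unfolding perm_elt_def by (intro free_elts_prod_list) (auto simp: free_elts_sg)
qed

lemma free_elts_neg_one_power: "(- 1) ^ k \<in> free_elts n"
  by (intro free_elts_power free_elts_uminus free_elts_1)

lemma comp_size_sum_le:
  assumes "multipartition l n lam" "A \<subseteq> {1..l}"
  shows "(\<Sum>c\<in>A. comp_size lam c) \<le> n"
  using assms sum_mono2[of "{1..l}" A "comp_size lam"] by (auto simp: multipartition_def)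

lemma free_elts_F_elt: "F_elt l n u t \<in> free_elts n"
  unfolding F_elt_def set_prod_def
  by (intro free_elts_prod_list)
    (auto intro!: free_elts_prod_list free_elts_mult free_elts_diff free_elts_Lg simp del: upt_Suc)

lemma free_elts_m_elt:
  assumes m: "multipartition l n lam" and a: "std_tab l n (diagram lam) a" and b: "std_tab l n (diagram lam) b"
  shows "m_elt l n u lam a b \<in> free_elts n"
proof -
  have "(\<Sum>c\<in>{1..<r}. comp_size lam c) \<le> n" if "r \<in> set [2..<Suc l]" for r
    using that by (intro comp_size_sum_le[OF m]) auto
  then have U: "(\<Prod>r\<leftarrow>[2..<Suc l]. \<Prod>k\<leftarrow>[1..<Suc (\<Sum>c\<in>{1..<r}. comp_size lam c)]. (Lg k - scal (u r))) \<in> free_elts n"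
    by (intro free_elts_prod_list) (fastforce intro!: free_elts_prod_list free_elts_Lg simp del: upt_Suc)
  show ?thesis unfolding m_elt_def
    by (intro free_elts_mult U free_elts_sum free_elts_perm_elt permutes_inv d_perm_permutes[OF m] a b)
      (simp add: young_def)
qed

lemma free_elts_n_elt:
  assumes m: "multipartition l n lam" and a: "std_tab l n (diagram lam) a" and b: "std_tab l n (diagram lam) b"
  shows "n_elt l n u lam a b \<in> free_elts n"
proof -
  have "(\<Sum>c\<in>{l + 2 - r..l}. comp_size lam c) \<le> n" if "r \<in> set [2..<Suc l]" for r
    using that by (intro comp_size_sum_le[OF m]) auto
  then have U: "(\<Prod>r\<leftarrow>[2..<Suc l]. \<Prod>k\<leftarrow>[1..<Suc (\<Sum>c\<in>{l + 2 - r..l}. comp_size lam c)].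
      (Lg k - scal (u (l + 1 - r)))) \<in> free_elts n"
    by (intro free_elts_prod_list) (fastforce intro!: free_elts_prod_list free_elts_Lg simp del: upt_Suc)
  show ?thesis unfolding n_elt_def n_low_def
    by (intro free_elts_mult U free_elts_sum free_elts_perm_elt free_elts_neg_one_power permutes_inv d_perm_permutes[OF m] a b)
      (simp add: young_def)
qed

text \<open>Phrased as membership in the Hecke ideal, so that it makes sense for all parameters at
  once, without a quotient type.\<close>

definition dual_basis_relation :: "nat \<Rightarrow> nat \<Rightarrow> (nat \<Rightarrow> 'k::field) \<Rightarrow> bool" where
  "dual_basis_relation l n u \<longleftrightarrow>
     (\<forall>lam a b. multipartition l n lam \<longrightarrow> std_tab l n (diagram lam) a \<longrightarrow> std_tab l n (diagram lam) b \<longrightarrow>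
        F_elt l n u a * n_elt l n u lam a b * F_elt l n u b -
        scal ((- 1) ^ (perm_length n (d_perm n (conj_mpart l lam) (conj_tab l a))
                 + perm_length n (d_perm n (conj_mpart l lam) (conj_tab l b))) *
        (r'_coeff l n u (conj_tab l a) * r'_coeff l n u (conj_tab l b) /
         (r_coeff l n u (tab_lower l lam) * r'_coeff l n u (tab_upper (conj_mpart l lam))))) *
        (F_elt l n u a * m_elt l n u lam a b * F_elt l n u b) \<in> hecke_ideal l n u)"

text \<open>The results on an abstract ring with the Hecke relations need the Hecke algebra as a type, and
  types cannot depend on parameters. So the type below is made from one choice of parameters,
  which is a counterexample to the relation between the two bases if there is any.\<close>

definition chosen_params :: "nat \<times> nat \<times> (nat \<Rightarrow> 'k::field)" where
  "chosen_params = (SOME p. case p of (l, n, u) \<Rightarrow> l \<ge> 1 \<and> n \<ge> 1 \<and> separated l n u \<and>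
     (dual_basis_relation l n u \<longrightarrow>
       (\<forall>l n (u :: nat \<Rightarrow> 'k). l \<ge> 1 \<longrightarrow> n \<ge> 1 \<longrightarrow> separated l n u \<longrightarrow> dual_basis_relation l n u)))"

definition chosen_l :: "'k::field itself \<Rightarrow> nat" where
  "chosen_l _ = fst (chosen_params :: nat \<times> nat \<times> (nat \<Rightarrow> 'k))"

definition chosen_n :: "'k::field itself \<Rightarrow> nat" where
  "chosen_n _ = fst (snd (chosen_params :: nat \<times> nat \<times> (nat \<Rightarrow> 'k)))"

definition chosen_u :: "nat \<Rightarrow> 'k::field" where
  "chosen_u = snd (snd chosen_params)"

text \<open>A proof at the chosen parameters rules out counterexamples everywhere. If there is none,
  any separated parameters will do, and \<open>1\<close>, \<open>1\<close>, \<open>0\<close> show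
  that some exist.\<close>

lemma chosen_params:
  shows "chosen_l TYPE('k::field) \<ge> 1" "chosen_n TYPE('k) \<ge> 1"
    and "separated (chosen_l TYPE('k)) (chosen_n TYPE('k)) (chosen_u :: nat \<Rightarrow> 'k)"
    and "\<lbrakk>dual_basis_relation (chosen_l TYPE('k)) (chosen_n TYPE('k)) (chosen_u :: nat \<Rightarrow> 'k); l \<ge> 1; n \<ge> 1; separated l n u\<rbrakk>
      \<Longrightarrow> dual_basis_relation l n (u :: nat \<Rightarrow> 'k)"
proof -
  let ?P = "\<lambda>p :: nat \<times> nat \<times> (nat \<Rightarrow> 'k). case p of (l, n, u) \<Rightarrow> l \<ge> 1 \<and> n \<ge> 1 \<and> separated l n u \<and>
     (dual_basis_relation l n u \<longrightarrow>
       (\<forall>l n (u :: nat \<Rightarrow> 'k). l \<ge> 1 \<longrightarrow> n \<ge> 1 \<longrightarrow> separated l n u \<longrightarrow> dual_basis_relation l n u))"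
  have "\<exists>p. ?P p"
  proof (cases "\<forall>l n (u :: nat \<Rightarrow> 'k). l \<ge> 1 \<longrightarrow> n \<ge> 1 \<longrightarrow> separated l n u \<longrightarrow> dual_basis_relation l n u")
    case True
    have "separated 1 1 (\<lambda>_. 0 :: 'k)" by (auto simp: separated_def le_antisym)
    then have "?P (1, 1, \<lambda>_. 0)" using True by simp
    then show ?thesis by blast
  next
    case False
    then obtain l n and u :: "nat \<Rightarrow> 'k" where "l \<ge> 1" "n \<ge> 1" "separated l n u" "\<not> dual_basis_relation l n u"
      by blast
    then have "?P (l, n, u)" by simp
    then show ?thesis by blast
  qed
  from someI_ex[OF this] have "?P chosen_params" unfolding chosen_params_def .
  moreover have "chosen_params = (chosen_l TYPE('k), chosen_n TYPE('k), chosen_u :: nat \<Rightarrow> 'k)"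
    by (simp add: chosen_l_def chosen_n_def chosen_u_def)
  ultimately have *: "?P (chosen_l TYPE('k), chosen_n TYPE('k), chosen_u)" by (simp only:)
  from * show "chosen_l TYPE('k) \<ge> 1" "chosen_n TYPE('k) \<ge> 1"
      "separated (chosen_l TYPE('k)) (chosen_n TYPE('k)) (chosen_u :: nat \<Rightarrow> 'k)"
    unfolding prod.case by blast+
  assume "dual_basis_relation (chosen_l TYPE('k)) (chosen_n TYPE('k)) (chosen_u :: nat \<Rightarrow> 'k)" "l \<ge> 1" "n \<ge> 1" "separated l n u"
  then show "dual_basis_relation l n u" using * unfolding prod.case by blast
qed

definition chosen_ideal :: "'k::field ncpoly set" where
  "chosen_ideal = {x. truncate (chosen_n TYPE('k)) x \<in> hecke_ideal (chosen_l TYPE('k)) (chosen_n TYPE('k)) chosen_u}"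

lemma chosen_ideal:
  fixes x y :: "'k::field ncpoly"
  shows "0 \<in> (chosen_ideal :: 'k ncpoly set)" "1 \<notin> (chosen_ideal :: 'k ncpoly set)"
    and "x \<in> chosen_ideal \<Longrightarrow> y \<in> chosen_ideal \<Longrightarrow> x + y \<in> chosen_ideal" "x \<in> chosen_ideal \<Longrightarrow> - x \<in> chosen_ideal"
    and "x \<in> chosen_ideal \<Longrightarrow> z * x \<in> chosen_ideal" "x \<in> chosen_ideal \<Longrightarrow> x * z \<in> chosen_ideal"
  using one_notin_hecke_ideal[OF chosen_params(1,2)[where 'k = 'k]]
  unfolding chosen_ideal_def
  by (auto intro: hecke_ideal_0 hecke_ideal_add hecke_ideal_uminus hecke_ideal_mult_left hecke_ideal_mult_right
      truncate_in_free chosen_params(2))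

lemma chosen_ideal_cong:
  assumes "x - x' \<in> chosen_ideal" "y - y' \<in> chosen_ideal"
  shows "x + y - (x' + y') \<in> chosen_ideal" "x - y - (x' - y') \<in> chosen_ideal" "x * y - x' * y' \<in> chosen_ideal"
proof -
  show "x + y - (x' + y') \<in> chosen_ideal" using chosen_ideal(3)[OF assms] by (simp add: algebra_simps)
  show "x - y - (x' - y') \<in> chosen_ideal"
    using chosen_ideal(3)[OF assms(1) chosen_ideal(4)[OF assms(2)]] by (simp add: algebra_simps)
  show "x * y - x' * y' \<in> chosen_ideal"
    using chosen_ideal(3)[OF chosen_ideal(6)[OF assms(1), of y] chosen_ideal(5)[OF assms(2), of x']] by (simp add: algebra_simps)
qed

lemma chosen_ideal_cong_uminus: "x - x' \<in> chosen_ideal \<Longrightarrow> - x - - x' \<in> chosen_ideal"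
  using chosen_ideal(4)[of "x - x'"] by simp

quotient_type (overloaded) 'k hecke_alg = "'k::field ncpoly" / "\<lambda>x y. x - y \<in> chosen_ideal"
proof (rule equivpI)
  show "reflp (\<lambda>x (y :: 'k ncpoly). x - y \<in> chosen_ideal)" by (simp add: reflp_def chosen_ideal(1))
  show "symp (\<lambda>x (y :: 'k ncpoly). x - y \<in> chosen_ideal)"
  proof (rule sympI)
    fix x y :: "'k ncpoly" assume "x - y \<in> chosen_ideal"
    from chosen_ideal(4)[OF this] show "y - x \<in> chosen_ideal" by simp
  qed
  show "transp (\<lambda>x (y :: 'k ncpoly). x - y \<in> chosen_ideal)"
  proof (rule transpI)
    fix x y z :: "'k ncpoly" assume "x - y \<in> chosen_ideal" "y - z \<in> chosen_ideal"
    from chosen_ideal(3)[OF this] show "x - z \<in> chosen_ideal" by simp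
  qed
qed

instantiation hecke_alg :: (field) ring_1
begin

lift_definition zero_hecke_alg :: "'a hecke_alg" is 0 .
lift_definition one_hecke_alg :: "'a hecke_alg" is 1 .
lift_definition plus_hecke_alg :: "'a hecke_alg \<Rightarrow> 'a hecke_alg \<Rightarrow> 'a hecke_alg" is "(+)"
  by (rule chosen_ideal_cong(1))
lift_definition minus_hecke_alg :: "'a hecke_alg \<Rightarrow> 'a hecke_alg \<Rightarrow> 'a hecke_alg" is "(-)"
  by (rule chosen_ideal_cong(2))
lift_definition uminus_hecke_alg :: "'a hecke_alg \<Rightarrow> 'a hecke_alg" is uminus
  by (rule chosen_ideal_cong_uminus)
lift_definition times_hecke_alg :: "'a hecke_alg \<Rightarrow> 'a hecke_alg \<Rightarrow> 'a hecke_alg" is "(*)"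
  by (rule chosen_ideal_cong(3))

instance
proof
  fix a b c :: "'a hecke_alg"
  show "a * b * c = a * (b * c)" "1 * a = a" "a * 1 = a" "a + b + c = a + (b + c)" "a + b = b + a" "0 + a = a"
    "- a + a = 0" "a - b = a + - b" "(a + b) * c = a * c + b * c" "a * (b + c) = a * b + a * c"
    by (transfer, simp add: algebra_simps chosen_ideal(1))+
  show "(0 :: 'a hecke_alg) \<noteq> 1"
    by transfer (use chosen_ideal(2) chosen_ideal(4)[of "- 1"] in auto)
qed

end

abbreviation cls :: "'k::field ncpoly \<Rightarrow> 'k hecke_alg" where "cls \<equiv> abs_hecke_alg"

lemma cls_simps:
  "cls (x + y) = cls x + cls y" "cls (x * y) = cls x * cls y" "cls (x - y) = cls x - cls y"
  "cls (- x) = - cls x" "cls 0 = 0" "cls 1 = 1"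
  by (simp_all add: plus_hecke_alg.abs_eq times_hecke_alg.abs_eq minus_hecke_alg.abs_eq
      uminus_hecke_alg.abs_eq zero_hecke_alg.abs_eq one_hecke_alg.abs_eq)

lemma cls_prod_list: "cls (prod_list xs) = prod_list (map cls xs)"
  by (induction xs) (simp_all add: cls_simps)

lemma cls_sum: "cls (sum f A) = (\<Sum>x\<in>A. cls (f x))"
  by (induction A rule: infinite_finite_induct) (simp_all add: cls_simps)

lemma cls_power: "cls (x ^ k) = cls x ^ k"
  by (induction k) (simp_all add: cls_simps)

lemma cls_eq_iff: "cls x = cls y \<longleftrightarrow> x - y \<in> chosen_ideal"
  by (rule hecke_alg.abs_eq_iff)

lemma cls_relator:
  assumes "x - y \<in> relators (chosen_l TYPE('k)) (chosen_n TYPE('k)) chosen_u"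
  shows "cls x = cls (y :: 'k::field ncpoly)"
proof -
  have "x - y \<in> hecke_ideal (chosen_l TYPE('k)) (chosen_n TYPE('k)) chosen_u"
    using relators_hecke_ideal[OF chosen_params(2)] assms by blast
  moreover from this have "x - y \<in> free_elts (chosen_n TYPE('k))" by (rule hecke_ideal_subset[OF chosen_params(2)])
  ultimately show ?thesis unfolding cls_eq_iff chosen_ideal_def by (simp add: truncate_free del: truncate_hom)
qed

lemma hecke_separated_cls:
  "hecke_separated (chosen_l TYPE('k::field)) (chosen_n TYPE('k)) (chosen_u :: nat \<Rightarrow> 'k)
     (\<lambda>a. cls (scal a)) (\<lambda>i. cls (sg i)) (\<lambda>k. cls (Lg k))"
proof -
  let ?l = "chosen_l TYPE('k)" and ?n = "chosen_n TYPE('k)" and ?u = "chosen_u :: nat \<Rightarrow> 'k"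
  interpret sc: scalars "scal :: 'k \<Rightarrow> 'k ncpoly" by (rule scalars_scal)
  note rel = cls_relator[unfolded relators_def]
  show ?thesis
  proof unfold_locales
    fix a b :: 'k and x :: "'k hecke_alg"
    show "cls (scal (a + b)) = cls (scal a) + cls (scal b)" by (simp add: sc.sc_add cls_simps)
    show "cls (scal (a * b)) = cls (scal a) * cls (scal b)" by (simp add: sc.sc_mult cls_simps)
    show "cls (scal 1) = (1 :: 'k hecke_alg)" by (simp add: sc.sc_1 cls_simps)
    show "cls (scal a) * x = x * cls (scal a)"
      by (induction x rule: hecke_alg.abs_induct) (simp add: cls_simps(2)[symmetric] sc.sc_central)
    show "separated ?l ?n ?u" by (rule chosen_params)
    have "cls (\<Prod>j\<leftarrow>[1..<Suc ?l]. (Lg 1 - scal (?u j))) = cls 0"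
      by (rule rel) (simp del: upt_Suc)
    then show "(\<Prod>j\<leftarrow>[1..<Suc ?l]. cls (Lg 1) - cls (scal (?u j))) = 0"
      by (simp add: cls_prod_list cls_simps comp_def del: upt_Suc)
  next
    fix i assume i: "1 \<le> i" "i < ?n"
    have "cls (sg i * sg i) = (cls 1 :: 'k hecke_alg)" by (rule rel) (use i in blast)
    then show "cls (sg i) * cls (sg i) = (1 :: 'k hecke_alg)" by (simp add: cls_simps)
    have "cls (Lg (i + 1)) = (cls (sg i * Lg i * sg i + sg i) :: 'k hecke_alg)" by (rule rel) (use i in blast)
    then show "cls (Lg (i + 1)) = cls (sg i) * cls (Lg i) * cls (sg i) + (cls (sg i) :: 'k hecke_alg)"
      by (simp only: cls_simps)
    {
      fix j assume "1 \<le> j" "j < ?n" "\<bar>int i - int j\<bar> > 1"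
      then have "cls (sg i * sg j) = (cls (sg j * sg i) :: 'k hecke_alg)" by (intro rel) (use i in blast)
      then show "cls (sg i) * cls (sg j) = (cls (sg j) * cls (sg i) :: 'k hecke_alg)" by (simp only: cls_simps)
    next
      fix k assume "1 \<le> k" "k \<le> ?n" "k \<noteq> i" "k \<noteq> i + 1"
      then have "cls (sg i * Lg k) = (cls (Lg k * sg i) :: 'k hecke_alg)" by (intro rel) (use i in blast)
      then show "cls (sg i) * cls (Lg k) = (cls (Lg k) * cls (sg i) :: 'k hecke_alg)" by (simp only: cls_simps)
    }
  next
    fix i assume "1 \<le> i" "i + 1 < ?n"
    then have "cls (sg i * sg (i + 1) * sg i) = (cls (sg (i + 1) * sg i * sg (i + 1)) :: 'k hecke_alg)" by (intro rel) blast
    then show "cls (sg i) * cls (sg (i + 1)) * cls (sg i) =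
        (cls (sg (i + 1)) * cls (sg i) * cls (sg (i + 1)) :: 'k hecke_alg)"
      by (simp only: cls_simps)
  next
    fix i k assume "1 \<le> i" "i \<le> ?n" "1 \<le> k" "k \<le> ?n"
    then have "cls (Lg i * Lg k) = (cls (Lg k * Lg i) :: 'k hecke_alg)" by (intro rel) blast
    then show "cls (Lg i) * cls (Lg k) = (cls (Lg k) * cls (Lg i) :: 'k hecke_alg)" by (simp only: cls_simps)
  qed
qed

lemma cls_perm_elt: "cls (perm_elt n w) = gen_perm (\<lambda>i. cls (sg i)) n w"
  by (simp add: perm_elt_def gen_perm_def cls_prod_list comp_def)

lemma cls_F_elt: "cls (F_elt l n u t) = gen_F (\<lambda>a. cls (scal a)) (\<lambda>k. cls (Lg k)) l n u t"
  by (simp add: F_elt_def gen_F_def set_prod_def cls_prod_list cls_simps comp_def del: upt_Suc)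

lemma cls_m_elt:
  "cls (m_elt l n u lam a b) = gen_m (\<lambda>a. cls (scal a)) (\<lambda>i. cls (sg i)) (\<lambda>k. cls (Lg k)) l n u lam a b"
  by (simp add: m_elt_def gen_m_def gen_X_def gen_U_def cls_prod_list cls_simps cls_sum cls_perm_elt comp_def
      del: upt_Suc)

lemma cls_n_elt:
  "cls (n_elt l n u lam a b) = gen_n (\<lambda>a. cls (scal a)) (\<lambda>i. cls (sg i)) (\<lambda>k. cls (Lg k)) l n u lam a b"
  by (simp add: n_elt_def n_low_def gen_n_def gen_n_low_def cls_prod_list cls_simps cls_sum cls_power cls_perm_elt
      comp_def del: upt_Suc)

lemma dual_basis_relation:
  fixes u :: "nat \<Rightarrow> 'k::field"
  assumes "l \<ge> 1" "n \<ge> 1" "separated l n u"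
  shows "dual_basis_relation l n u"
proof (rule chosen_params(4)[OF _ assms])
  let ?l = "chosen_l TYPE('k)" and ?n = "chosen_n TYPE('k)" and ?u = "chosen_u :: nat \<Rightarrow> 'k"
  interpret hecke_separated ?l ?n ?u "\<lambda>a. cls (scal a)" "\<lambda>i. cls (sg i)" "\<lambda>k. cls (Lg k)"
    by (rule hecke_separated_cls)
  show "dual_basis_relation ?l ?n ?u"
    unfolding dual_basis_relation_def
  proof (intro allI impI)
    fix lam a b
    assume m: "multipartition ?l ?n lam" and a: "std_tab ?l ?n (diagram lam) a" and b: "std_tab ?l ?n (diagram lam) b"
    let ?c = "(- 1) ^ (perm_length ?n (d_perm ?n (conj_mpart ?l lam) (conj_tab ?l a))
          + perm_length ?n (d_perm ?n (conj_mpart ?l lam) (conj_tab ?l b))) *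
        (r'_coeff ?l ?n ?u (conj_tab ?l a) * r'_coeff ?l ?n ?u (conj_tab ?l b) /
         (r_coeff ?l ?n ?u (tab_lower ?l lam) * r'_coeff ?l ?n ?u (tab_upper (conj_mpart ?l lam))))"
    let ?g = "F_elt ?l ?n ?u a * n_elt ?l ?n ?u lam a b * F_elt ?l ?n ?u b"
    let ?f = "F_elt ?l ?n ?u a * m_elt ?l ?n ?u lam a b * F_elt ?l ?n ?u b"
    have "cls ?g = cls (scal ?c * ?f)"
      using dual_seminormal_basis[OF m a b]
      unfolding cls_simps(2) cls_F_elt cls_m_elt cls_n_elt r'_coeff_def .
    \<comment> \<open>An equation in the quotient type speaks of the truncated polynomial; for a
      polynomial of the free algebra truncation changes nothing.\<close>
    then have "truncate ?n (?g - scal ?c * ?f) \<in> hecke_ideal ?l ?n ?u" unfolding cls_eq_iff chosen_ideal_def by blast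
    moreover have "?g - scal ?c * ?f \<in> free_elts ?n"
      by (intro free_elts_diff free_elts_mult free_elts_scal free_elts_F_elt free_elts_n_elt free_elts_m_elt m a b)
    ultimately show "?g - scal ?c * ?f \<in> hecke_ideal ?l ?n ?u" using truncate_free by metis
  qed
qed

theorem theorem1p4:
  fixes u :: "nat \<Rightarrow> 'k::field" and l n :: nat and lam :: mpart and s t :: tableau
  assumes "l \<ge> 1" and "n \<ge> 1"
    and "semisimple_ring (hecke l n u)"
    and "multipartition l n lam"
    and "s \<in> Std n lam" and "t \<in> Std n lam"
  shows "\<exists>a. a \<noteq> 0 \<and>
    g_basis l n u lam s t = hecke_smult l n u a (f_basis l n u lam s t) \<and>
    a = (- 1) powi (- int (perm_length n (d_perm n (conj_mpart l lam) (conj_tab l s)))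
                    - int (perm_length n (d_perm n (conj_mpart l lam) (conj_tab l t)))) *
        (r_coeff l n u (tab_lower l lam) * r'_coeff l n u (tab_upper (conj_mpart l lam)) /
         (r_coeff l n u s * r_coeff l n u t)) \<and>
    a = (- 1) ^ (perm_length n (d_perm n (conj_mpart l lam) (conj_tab l s))
                 + perm_length n (d_perm n (conj_mpart l lam) (conj_tab l t))) *
        (r'_coeff l n u (conj_tab l s) * r'_coeff l n u (conj_tab l t) /
         (r_coeff l n u (tab_lower l lam) * r'_coeff l n u (tab_upper (conj_mpart l lam))))"
proof -
  have S: "separated l n u" by (rule semisimple_separated) fact+
  have s: "std_tab l n (diagram lam) s" and t: "std_tab l n (diagram lam) t"
    using assms(5,6) unfolding Std_iff_std_tab[OF assms(4)] .
  define p where "p = perm_length n (d_perm n (conj_mpart l lam) (conj_tab l s))"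
  define q where "q = perm_length n (d_perm n (conj_mpart l lam) (conj_tab l t))"
  \<comment> \<open>The second formula is taken as the definition;
    \<open>coefficient_identity\<close> yields the first and shows that the value is not
    zero.\<close>
  define a where "a = (- 1) ^ (p + q) * (r'_coeff l n u (conj_tab l s) * r'_coeff l n u (conj_tab l t) /
         (r_coeff l n u (tab_lower l lam) * r'_coeff l n u (tab_upper (conj_mpart l lam))))"
  let ?g = "F_elt l n u s * n_elt l n u lam s t * F_elt l n u t"
  let ?f = "F_elt l n u s * m_elt l n u lam s t * F_elt l n u t"
  have f: "?f \<in> free_elts n"
    by (intro free_elts_mult free_elts_F_elt free_elts_m_elt[OF assms(4) s t])
  have "?g - scal a * ?f \<in> hecke_ideal l n u"
    using dual_basis_relation[OF assms(1,2) S] assms(4) s t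
    unfolding dual_basis_relation_def a_def p_def q_def by blast
  then have "g_basis l n u lam s t = proj l n u (scal a * ?f)"
    unfolding g_basis_def by (simp only: proj_eq_iff[OF assms(2)])
  also have "\<dots> = hecke_smult l n u a (f_basis l n u lam s t)"
    unfolding f_basis_def hecke_smult_def by (rule hecke_mult[symmetric]) (use assms(2) f in auto)
  finally have gf: "g_basis l n u lam s t = hecke_smult l n u a (f_basis l n u lam s t)" .
  note id = coefficient_identity[OF S assms(4) s t, folded r'_coeff_def]
  have "a \<noteq> 0" unfolding a_def using id(2) by simp
  moreover have "(- 1) powi (- int p - int q) = ((- 1) ^ (p + q) :: 'k)"
    by (simp add: power_int_diff power_int_minus power_add divide_inverse power_inverse[symmetric])
  then have "a = (- 1) powi (- int p - int q) *
      (r_coeff l n u (tab_lower l lam) * r'_coeff l n u (tab_upper (conj_mpart l lam)) /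
         (r_coeff l n u s * r_coeff l n u t))"
    unfolding a_def id(1) by simp
  ultimately show ?thesis using gf a_def unfolding p_def q_def by blast
qed

end
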